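(* The following data define a 2-category $\mathbf{D}$, and $\mathbf{D}$ is isomorphic, as a 2-category, to $\mathbf{Cat}\text{-}\mathbf{Multicat}^{\mathbf{ps}}$. The objects of $\mathbf{D}$ are the $\mathbf{Cat}$-multicategories; for $\mathbf{Cat}$-multicategories $\mathcal{M},\mathcal{N}$ the category of morphisms is $$\mathbf{D}(\mathcal{M},\mathcal{N})=\mathbf{Cat}\text{-}\mathbf{Multicat}(\mathcal{M}\times E\Sigma_*,\mathcal{N})$$ (so vertical composition of 2-cells is that of $\mathbf{Cat}\text{-}\mathbf{Multicat}$). For symmetric $\mathbf{Cat}$-multifunctors $F\colon\mathcal{M}\times E\Sigma_*\to\mathcal{N}$ and $G\colon\mathcal{N}\times E\Sigma_*\to\mathcal{Q}$, the composite of $F$ and $G$ in $\mathbf{D}$ is the composite $$\mathcal{M}\times E\Sigma_*\xrightarrow{1\times\Delta}\mathcal{M}\times E\Sigma_*\times E\Sigma_*\xrightarrow{F\times1}\mathcal{N}\times E\Sigma_*\xrightarrow{G}\mathcal{Q}$$ in $\mathbf{Cat}\text{-}\mathbf{Multicat}$, where $\Delta\colon E\Sigma_*\to E\Sigma_*\times E\Sigma_*$ is the diagonal. For symmetric $\mathbf{Cat}$-multifunctors $F,J\colon\mathcal{M}\times E\Sigma_*\to\mathcal{N}$ and $G,K\colon\mathcal{N}\times E\Sigma_*\to\mathcal{Q}$ and $\mathbf{Cat}$-multinatural transformations $\theta\colon F\to J$, $\zeta\colon G\to K$, the horizontal composite of $\theta$ and $\zeta$ in $\mathbf{D}$ is the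 pasting (horizontal composite in $\mathbf{Cat}\text{-}\mathbf{Multicat}$) $\zeta*(\theta\times1)*1_{1\times\Delta}$.
   Context: **Permutations.** $\Sigma_n$ is the symmetric group, with $\sigma\tau=\sigma\circ\tau$. For a sequence $\langle a\rangle=\langle a_1,\dots,a_n\rangle$ put $\langle a\rangle\sigma=\langle a_{\sigma(1)},\dots,a_{\sigma(n)}\rangle$. For $\sigma\in\Sigma_n$ and $\tau_i\in\Sigma_{k_i}$, $\sigma\langle\tau_1,\dots,\tau_n\rangle\in\Sigma_{k_1+\cdots+k_n}$ permutes the $n$ blocks of lengths $k_1,\dots,k_n$ according to $\sigma$ and each block according to $\tau_i$: it sends the $p$-th element of the $i$-th block (block lengths $k_1,\dots,k_n$) to the $\tau_i(p)$-th element of the $\sigma(i)$-th block (block lengths $k_{\sigma^{-1}(1)},\dots,k_{\sigma^{-1}(n)}$). **$\mathbf{Cat}$-multicategories** ($\mathbf{Cat}$ has the monoidal structure given by products). A $\mathbf{Cat}$-multicategory $\mathcal{M}$ has: a class of objects $\mathrm{Ob}(\mathcal{M})$; for all $n\ge 0$, $\langle a\rangle\in \mathrm{Ob}(\mathcal{M})^n$, $b\in\mathrm{Ob}(\mathcal{M})$ a category $\mathcal{M}(\langle a\rangle;b)$, whose objects $f\colon\langle a\rangle\to b$ are called ($n$-ary) 1-cells and whose morphisms are called ($n$-ary) 2-cells; for $\sigma\in\Sigma_n$ an isomorphism of categories $\mathcal{M}(\langle a\rangle;b)\to\mathcal{M}(\langle a\rangle\sigma;b)$, $f\mapsto f\sigma$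 (and similarly on 2-cells); units $1_a\in\mathcal{M}(a;a)$; and composition functors $\gamma\colon\mathcal{M}(\langle b\rangle;c)\times\prod_{j=1}^n\mathcal{M}(\langle a_j\rangle;b_j)\to\mathcal{M}(\langle a_1\rangle,\dots,\langle a_n\rangle;c)$, where $\langle a_j\rangle$ has length $k_j\ge 0$ and the inputs are concatenated. These satisfy: $(f\sigma)\tau=f(\sigma\tau)$ and $f\,\mathrm{id}_n=f$; $\gamma$ is associative and unital; top equivariance $\gamma(f\sigma;\langle g_{\sigma(j)}\rangle)=\gamma(f;\langle g_j\rangle)\,\sigma\langle\mathrm{id}_{k_{\sigma(1)}},\dots,\mathrm{id}_{k_{\sigma(n)}}\rangle$; bottom equivariance $\gamma(f;\langle g_j\tau_j\rangle)=\gamma(f;\langle g_j\rangle)\,\mathrm{id}_n\langle\tau_1,\dots,\tau_n\rangle$ for $\tau_j\in\Sigma_{k_j}$ (all axioms on both 1-cells and 2-cells). A $\mathbf{Cat}$-operad is a $\mathbf{Cat}$-multicategory with one object $*$. **Symmetric $\mathbf{Cat}$-multifunctors.** A symmetric $\mathbf{Cat}$-multifunctor $F\colon\mathcal{M}\to\mathcal{N}$ is a function on objects together with functors $F\colon\mathcal{M}(\langle a\rangle;b)\to\mathcal{N}(\langle Fa\rangle;Fb)$ strictly preserving units, $\gamma$ and the symmetric group action. Composition is the evident one. **Pseudo symmetric $\mathbf{Cat}$-multifunctors.** A pseudo symmetric $\mathbf{Cat}$-multifunctor $F\colon\mathcal{M}\to\mathcal{N}$ is a function on objects together with functors $F\colon\mathcal{M}(\langle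 a\rangle;b)\to\mathcal{N}(\langle Fa\rangle;Fb)$ strictly preserving units and $\gamma$, and, for each $\sigma\in\Sigma_n$, $\langle a\rangle\in\mathrm{Ob}(\mathcal{M})^n$, $b\in\mathrm{Ob}(\mathcal{M})$, a natural isomorphism with components $F_{\sigma;f}\colon F(f\sigma)\to F(f)\sigma$ for $f\colon\langle a\rangle\to b$, such that: (1) $F_{\mathrm{id}_n;f}=1_{Ff}$; (2) $F_{\sigma\tau;f}=(F_{\sigma;f})\tau\circ F_{\tau;f\sigma}$; (3) $F_{\sigma\langle\mathrm{id}_{k_{\sigma(1)}},\dots,\mathrm{id}_{k_{\sigma(n)}}\rangle;\,\gamma(f;\langle g_j\rangle)}=\gamma(F_{\sigma;f};\langle 1_{Fg_{\sigma(j)}}\rangle_{j=1}^n)$ for $f\colon\langle b\rangle\to c$, $g_j\colon\langle a_j\rangle\to b_j$, where $k_j$ is the length of $\langle a_j\rangle$; (4) $F_{\mathrm{id}_n\langle\tau_1,\dots,\tau_n\rangle;\,\gamma(f;\langle g_j\rangle)}=\gamma(1_{Ff};\langle F_{\tau_j;g_j}\rangle)$ for $\tau_j\in\Sigma_{k_j}$. The composite $GF$ is given by composition on objects and component functors, with $(GF)_{\sigma;f}=G_{\sigma;Ff}\circ G(F_{\sigma;f})$. **Transformations.** For symmetric $F,G\colon\mathcal{M}\to\mathcal{N}$, a $\mathbf{Cat}$-multinatural transformation $\theta\colon F\Rightarrow G$ consists of 1-cells $\theta_a\colon Fa\to Ga$ in $\mathcal{N}$ for $a\in\mathrm{Ob}(\mathcal{M})$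 such that $\gamma(Gf;\langle\theta_{a_j}\rangle)=\gamma(\theta_b;Ff)$ for all 1-cells $f\colon\langle a\rangle\to b$ and $\gamma(G\alpha;\langle1_{\theta_{a_j}}\rangle)=\gamma(1_{\theta_b};F\alpha)$ for all 2-cells $\alpha$ of $\mathcal{M}(\langle a\rangle;b)$. For pseudo symmetric $F,G$, a pseudo symmetric $\mathbf{Cat}$-multinatural transformation is such data satisfying the same two conditions and, in addition, $\gamma(1_{\theta_b};F_{\sigma;f})=\gamma(G_{\sigma;f};\langle1_{\theta_{a_{\sigma(j)}}}\rangle)$ for all $f\colon\langle a\rangle\to b$ and $\sigma\in\Sigma_n$. In both cases vertical composition is $(\zeta\theta)_a=\gamma(\zeta_a;\theta_a)$, and for $\theta\colon F\Rightarrow G\colon\mathcal{M}\to\mathcal{N}$ and $\zeta\colon F'\Rightarrow G'\colon\mathcal{N}\to\mathcal{Q}$ horizontal composition is $(\zeta*\theta)_a=\gamma(\zeta_{Ga};F'\theta_a)$. **2-categories.** $\mathbf{Cat}\text{-}\mathbf{Multicat}$ has $\mathbf{Cat}$-multicategories as 0-cells, symmetric $\mathbf{Cat}$-multifunctors as 1-cells and $\mathbf{Cat}$-multinatural transformations as 2-cells. $\mathbf{Cat}\text{-}\mathbf{Multicat}^{\mathbf{ps}}$ has the same 0-cells, pseudo symmetric $\mathbf{Cat}$-multifunctors as 1-cells and pseudo symmetric $\mathbf{Cat}$-multinatural transformations as 2-cells. **$E\Sigma_*$ and products.** $E\Sigma_*$ (the Barratt–Eccles operad) is the $\mathbf{Cat}$-operad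 whose $n$-th category $E\Sigma_n$ has object set $\Sigma_n$ and exactly one morphism between any two objects; on objects the right $\Sigma_n$-action is right multiplication, $\gamma(\sigma;\langle\rho_i\rangle)=\sigma\langle\rho_1,\dots,\rho_n\rangle$, and the unit is $\mathrm{id}_1$. The product $\mathcal{M}\times\mathcal{N}$ of $\mathbf{Cat}$-multicategories has objects $\mathrm{Ob}(\mathcal{M})\times\mathrm{Ob}(\mathcal{N})$, hom categories $(\mathcal{M}\times\mathcal{N})(\langle(a,c)\rangle;(b,d))=\mathcal{M}(\langle a\rangle;b)\times\mathcal{N}(\langle c\rangle;d)$, and units, symmetric group action and $\gamma$ defined componentwise; products of symmetric $\mathbf{Cat}$-multifunctors and of $\mathbf{Cat}$-multinatural transformations are componentwise, and $\theta\times1$ denotes the product of $\theta$ with the identity transformation of $1_{E\Sigma_*}$. (Identity 1-cells of $\mathbf{D}$ are not specified separately; they are uniquely determined by the composition.) *)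

theory Defs
  imports "HOL-Combinatorics.Permutations" "HOL-Library.FuncSet"
begin

section \<open>Categories, functors and 2-categories\<close>

record ('x, 'y) cat =
  Ob :: "'x set"
  Ar :: "'y set"
  Dom :: "'y \<Rightarrow> 'x"
  Cod :: "'y \<Rightarrow> 'x"
  Idn :: "'x \<Rightarrow> 'y"
  Cmp :: "'y \<Rightarrow> 'y \<Rightarrow> 'y"  \<comment> \<open>\<open>Cmp C g f\<close> is \<open>g \<circ> f\<close>\<close>

locale category =
  fixes C :: "('x, 'y) cat"
  assumes Dom_Ob: "f \<in> Ar C \<Longrightarrow> Dom C f \<in> Ob C"
    and Cod_Ob: "f \<in> Ar C \<Longrightarrow> Cod C f \<in> Ob C"
    and Idn_Ar: "x \<in> Ob C \<Longrightarrow> Idn C x \<in> Ar C"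
    and Dom_Idn: "x \<in> Ob C \<Longrightarrow> Dom C (Idn C x) = x"
    and Cod_Idn: "x \<in> Ob C \<Longrightarrow> Cod C (Idn C x) = x"
    and Cmp_Ar: "\<lbrakk>f \<in> Ar C; g \<in> Ar C; Dom C g = Cod C f\<rbrakk> \<Longrightarrow> Cmp C g f \<in> Ar C"
    and Dom_Cmp: "\<lbrakk>f \<in> Ar C; g \<in> Ar C; Dom C g = Cod C f\<rbrakk> \<Longrightarrow> Dom C (Cmp C g f) = Dom C f"
    and Cod_Cmp: "\<lbrakk>f \<in> Ar C; g \<in> Ar C; Dom C g = Cod C f\<rbrakk> \<Longrightarrow> Cod C (Cmp C g f) = Cod C g"
    and Cmp_Idn_left: "f \<in> Ar C \<Longrightarrow> Cmp C (Idn C (Cod C f)) f = f"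
    and Cmp_Idn_right: "f \<in> Ar C \<Longrightarrow> Cmp C f (Idn C (Dom C f)) = f"
    and Cmp_assoc: "\<lbrakk>f \<in> Ar C; g \<in> Ar C; h \<in> Ar C; Dom C g = Cod C f; Dom C h = Cod C g\<rbrakk>
        \<Longrightarrow> Cmp C h (Cmp C g f) = Cmp C (Cmp C h g) f"

locale cat_functor = C: category C + D: category D
  for C :: "('x, 'y) cat" and D :: "('u, 'v) cat" +
  fixes Fo :: "'x \<Rightarrow> 'u" and Fa :: "'y \<Rightarrow> 'v"
  assumes Fo_Ob: "x \<in> Ob C \<Longrightarrow> Fo x \<in> Ob D"
    and Fa_Ar: "f \<in> Ar C \<Longrightarrow> Fa f \<in> Ar D"
    and Dom_Fa: "f \<in> Ar C \<Longrightarrow> Dom D (Fa f) = Fo (Dom C f)"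
    and Cod_Fa: "f \<in> Ar C \<Longrightarrow> Cod D (Fa f) = Fo (Cod C f)"
    and Fa_Idn: "x \<in> Ob C \<Longrightarrow> Fa (Idn C x) = Idn D (Fo x)"
    and Fa_Cmp: "\<lbrakk>f \<in> Ar C; g \<in> Ar C; Dom C g = Cod C f\<rbrakk>
        \<Longrightarrow> Fa (Cmp C g f) = Cmp D (Fa g) (Fa f)"

locale iso_functor = cat_functor C D Fo Fa
  for C :: "('x, 'y) cat" and D :: "('u, 'v) cat" and Fo Fa +
  assumes bij_Fo: "bij_betw Fo (Ob C) (Ob D)"
    and bij_Fa: "bij_betw Fa (Ar C) (Ar D)"

definition iso_ar :: "('x, 'y) cat \<Rightarrow> 'y \<Rightarrow> bool" where
  "iso_ar C f \<longleftrightarrow> f \<in> Ar C \<and>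
     (\<exists>g\<in>Ar C. Dom C g = Cod C f \<and> Cod C g = Dom C f \<and>
        Cmp C g f = Idn C (Dom C f) \<and> Cmp C f g = Idn C (Cod C f))"

locale natural_iso = F: cat_functor C D Fo Fa + G: cat_functor C D Go Ga
  for C :: "('x, 'y) cat" and D :: "('u, 'v) cat" and Fo Fa Go Ga +
  fixes \<eta> :: "'x \<Rightarrow> 'v"
  assumes iso_component: "x \<in> Ob C \<Longrightarrow> iso_ar D (\<eta> x)"
    and Dom_component: "x \<in> Ob C \<Longrightarrow> Dom D (\<eta> x) = Fo x"
    and Cod_component: "x \<in> Ob C \<Longrightarrow> Cod D (\<eta> x) = Go x"
    and naturality: "f \<in> Ar C \<Longrightarrow> Cmp D (\<eta> (Cod C f)) (Fa f) = Cmp D (Ga f) (\<eta> (Dom C f))"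

definition prod_cat :: "('x, 'y) cat \<Rightarrow> ('u, 'v) cat \<Rightarrow> ('x \<times> 'u, 'y \<times> 'v) cat" where
  "prod_cat C D =
     \<lparr>Ob = Ob C \<times> Ob D,
      Ar = Ar C \<times> Ar D,
      Dom = map_prod (Dom C) (Dom D),
      Cod = map_prod (Cod C) (Cod D),
      Idn = map_prod (Idn C) (Idn D),
      Cmp = (\<lambda>(g, g') (f, f'). (Cmp C g f, Cmp D g' f'))\<rparr>"

definition list_cat :: "('x, 'y) cat list \<Rightarrow> ('x list, 'y list) cat" where
  "list_cat Cs =
     \<lparr>Ob = {xs. list_all2 (\<lambda>x C. x \<in> Ob C) xs Cs},
      Ar = {fs. list_all2 (\<lambda>f C. f \<in> Ar C) fs Cs},
      Dom = map2 Dom Cs,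
      Cod = map2 Cod Cs,
      Idn = map2 Idn Cs,
      Cmp = (\<lambda>gs fs. map2 (\<lambda>C (g, f). Cmp C g f) Cs (zip gs fs))\<rparr>"

text \<open>A (strict) 2-category is a category enriched in categories; the hom categories are indexed
  by pairs of 0-cells and need not be disjoint, so compositions carry the 0-cells as arguments.\<close>

record ('o, 'f, 'a) two_cat =
  Ob0 :: "'o set"
  HomC :: "'o \<Rightarrow> 'o \<Rightarrow> ('f, 'a) cat"
  Id1 :: "'o \<Rightarrow> 'f"
  Comp1 :: "'o \<Rightarrow> 'o \<Rightarrow> 'o \<Rightarrow> 'f \<Rightarrow> 'f \<Rightarrow> 'f"
  Comp2 :: "'o \<Rightarrow> 'o \<Rightarrow> 'o \<Rightarrow> 'a \<Rightarrow> 'a \<Rightarrow> 'a"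

locale two_category =
  fixes C :: "('o, 'f, 'a) two_cat"
  assumes hom_category: "\<lbrakk>A \<in> Ob0 C; B \<in> Ob0 C\<rbrakk> \<Longrightarrow> category (HomC C A B)"
    and Id1_Ob: "A \<in> Ob0 C \<Longrightarrow> Id1 C A \<in> Ob (HomC C A A)"
    and comp_functor: "\<lbrakk>A \<in> Ob0 C; B \<in> Ob0 C; E \<in> Ob0 C\<rbrakk> \<Longrightarrow>
      cat_functor (prod_cat (HomC C B E) (HomC C A B)) (HomC C A E)
        (\<lambda>(g, f). Comp1 C A B E g f) (\<lambda>(\<beta>, \<alpha>). Comp2 C A B E \<beta> \<alpha>)"
    and Comp1_assoc: "\<lbrakk>A \<in> Ob0 C; B \<in> Ob0 C; E \<in> Ob0 C; H \<in> Ob0 C;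
        f \<in> Ob (HomC C A B); g \<in> Ob (HomC C B E); h \<in> Ob (HomC C E H)\<rbrakk> \<Longrightarrow>
      Comp1 C A E H h (Comp1 C A B E g f) = Comp1 C A B H (Comp1 C B E H h g) f"
    and Comp2_assoc: "\<lbrakk>A \<in> Ob0 C; B \<in> Ob0 C; E \<in> Ob0 C; H \<in> Ob0 C;
        \<alpha> \<in> Ar (HomC C A B); \<beta> \<in> Ar (HomC C B E); \<delta> \<in> Ar (HomC C E H)\<rbrakk> \<Longrightarrow>
      Comp2 C A E H \<delta> (Comp2 C A B E \<beta> \<alpha>) = Comp2 C A B H (Comp2 C B E H \<delta> \<beta>) \<alpha>"
    and Comp1_Id1_left: "\<lbrakk>A \<in> Ob0 C; B \<in> Ob0 C; f \<in> Ob (HomC C A B)\<rbrakk> \<Longrightarrow>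
      Comp1 C A B B (Id1 C B) f = f"
    and Comp1_Id1_right: "\<lbrakk>A \<in> Ob0 C; B \<in> Ob0 C; f \<in> Ob (HomC C A B)\<rbrakk> \<Longrightarrow>
      Comp1 C A A B f (Id1 C A) = f"
    and Comp2_Id1_left: "\<lbrakk>A \<in> Ob0 C; B \<in> Ob0 C; \<alpha> \<in> Ar (HomC C A B)\<rbrakk> \<Longrightarrow>
      Comp2 C A B B (Idn (HomC C B B) (Id1 C B)) \<alpha> = \<alpha>"
    and Comp2_Id1_right: "\<lbrakk>A \<in> Ob0 C; B \<in> Ob0 C; \<alpha> \<in> Ar (HomC C A B)\<rbrakk> \<Longrightarrow>
      Comp2 C A A B \<alpha> (Idn (HomC C A A) (Id1 C A)) = \<alpha>"

locale two_functor = C: two_category C + D: two_category D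
  for C :: "('o, 'f, 'a) two_cat" and D :: "('p, 'g, 'b) two_cat" +
  fixes P0 :: "'o \<Rightarrow> 'p"
    and P1 :: "'o \<Rightarrow> 'o \<Rightarrow> 'f \<Rightarrow> 'g"
    and P2 :: "'o \<Rightarrow> 'o \<Rightarrow> 'a \<Rightarrow> 'b"
  assumes P0_Ob0: "A \<in> Ob0 C \<Longrightarrow> P0 A \<in> Ob0 D"
    and hom_functor: "\<lbrakk>A \<in> Ob0 C; B \<in> Ob0 C\<rbrakk> \<Longrightarrow>
      cat_functor (HomC C A B) (HomC D (P0 A) (P0 B)) (P1 A B) (P2 A B)"
    and P1_Id1: "A \<in> Ob0 C \<Longrightarrow> P1 A A (Id1 C A) = Id1 D (P0 A)"
    and P1_Comp1: "\<lbrakk>A \<in> Ob0 C; B \<in> Ob0 C; E \<in> Ob0 C;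
        f \<in> Ob (HomC C A B); g \<in> Ob (HomC C B E)\<rbrakk> \<Longrightarrow>
      P1 A E (Comp1 C A B E g f) = Comp1 D (P0 A) (P0 B) (P0 E) (P1 B E g) (P1 A B f)"
    and P2_Comp2: "\<lbrakk>A \<in> Ob0 C; B \<in> Ob0 C; E \<in> Ob0 C;
        \<alpha> \<in> Ar (HomC C A B); \<beta> \<in> Ar (HomC C B E)\<rbrakk> \<Longrightarrow>
      P2 A E (Comp2 C A B E \<beta> \<alpha>) = Comp2 D (P0 A) (P0 B) (P0 E) (P2 B E \<beta>) (P2 A B \<alpha>)"

locale iso_two_functor = two_functor C D P0 P1 P2
  for C :: "('o, 'f, 'a) two_cat" and D :: "('p, 'g, 'b) two_cat" and P0 P1 P2 +
  assumes bij_P0: "bij_betw P0 (Ob0 C) (Ob0 D)"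
    and hom_iso: "\<lbrakk>A \<in> Ob0 C; B \<in> Ob0 C\<rbrakk> \<Longrightarrow>
      iso_functor (HomC C A B) (HomC D (P0 A) (P0 B)) (P1 A B) (P2 A B)"

definition isomorphic_two_cats :: "('o, 'f, 'a) two_cat \<Rightarrow> ('p, 'g, 'b) two_cat \<Rightarrow> bool" where
  "isomorphic_two_cats C D \<longleftrightarrow> (\<exists>P0 P1 P2. iso_two_functor C D P0 P1 P2)"


section \<open>Block permutations\<close>

text \<open>An element of \<open>\<Sigma>\<^sub>n\<close> is a function \<open>\<sigma>\<close> with \<open>\<sigma> permutes {..<n}\<close>, so indices start at 0, and
  the sequence written \<open>\<langle>a\<rangle>\<sigma>\<close> is \<open>permute_list \<sigma> a\<close>.\<close>

definition block_start :: "nat list \<Rightarrow> nat \<Rightarrow> nat" where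
  "block_start ks i = sum_list (take i ks)"

definition block_index :: "nat list \<Rightarrow> nat \<Rightarrow> nat" where
  "block_index ks m = (LEAST i. m < block_start ks (Suc i))"

definition block_pos :: "nat list \<Rightarrow> nat \<Rightarrow> nat" where
  "block_pos ks m = m - block_start ks (block_index ks m)"

text \<open>\<open>block_perm \<sigma> ks \<tau>s\<close> is \<open>\<sigma>\<langle>\<tau>\<^sub>1,\<dots>,\<tau>\<^sub>n\<rangle>\<close> where \<open>\<tau>\<^sub>i \<in> \<Sigma>\<^bsub>k\<^sub>i\<^esub>\<close>. The lengths \<open>ks\<close> are those of the blocks in
  the source; they have to be given since a permuting function does not determine its degree.\<close>

definition block_perm :: "(nat \<Rightarrow> nat) \<Rightarrow> nat list \<Rightarrow> (nat \<Rightarrow> nat) list \<Rightarrow> nat \<Rightarrow> nat" where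
  "block_perm \<sigma> ks \<tau>s m =
     (if m < sum_list ks
      then block_start (permute_list (inv \<sigma>) ks) (\<sigma> (block_index ks m))
             + (\<tau>s ! block_index ks m) (block_pos ks m)
      else m)"


section \<open>Cat-multicategories\<close>

text \<open>All hom categories are kept in one category \<open>cells\<close> (their disjoint union): every 1-cell has
  a well-defined input sequence \<open>src\<close> and output \<open>tgt\<close>, and \<open>mhom M as b\<close> recovers the category
  \<open>M(\<langle>a\<rangle>;b)\<close>.\<close>

record ('o, 'f, 'a) mcat =
  objs :: "'o set"
  cells :: "('f, 'a) cat"
  src :: "'f \<Rightarrow> 'o list"
  tgt :: "'f \<Rightarrow> 'o"
  act1 :: "'f \<Rightarrow> (nat \<Rightarrow> nat) \<Rightarrow> 'f"
  act2 :: "'a \<Rightarrow> (nat \<Rightarrow> nat) \<Rightarrow> 'a"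
  munit :: "'o \<Rightarrow> 'f"
  gam1 :: "'f \<Rightarrow> 'f list \<Rightarrow> 'f"
  gam2 :: "'a \<Rightarrow> 'a list \<Rightarrow> 'a"

abbreviation cells1 :: "('o, 'f, 'a) mcat \<Rightarrow> 'f set" where
  "cells1 M \<equiv> Ob (cells M)"

abbreviation cells2 :: "('o, 'f, 'a) mcat \<Rightarrow> 'a set" where
  "cells2 M \<equiv> Ar (cells M)"

abbreviation arity :: "('o, 'f, 'a) mcat \<Rightarrow> 'f \<Rightarrow> nat" where
  "arity M f \<equiv> length (src M f)"

abbreviation src2 :: "('o, 'f, 'a) mcat \<Rightarrow> 'a \<Rightarrow> 'o list" where
  "src2 M \<alpha> \<equiv> src M (Dom (cells M) \<alpha>)"

abbreviation tgt2 :: "('o, 'f, 'a) mcat \<Rightarrow> 'a \<Rightarrow> 'o" where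
  "tgt2 M \<alpha> \<equiv> tgt M (Dom (cells M) \<alpha>)"

definition mhom :: "('o, 'f, 'a) mcat \<Rightarrow> 'o list \<Rightarrow> 'o \<Rightarrow> ('f, 'a) cat" where
  "mhom M as b =
     (cells M)\<lparr>Ob := {f \<in> cells1 M. src M f = as \<and> tgt M f = b},
               Ar := {\<alpha> \<in> cells2 M. src2 M \<alpha> = as \<and> tgt2 M \<alpha> = b}\<rparr>"

definition composable1 :: "('o, 'f, 'a) mcat \<Rightarrow> 'f \<Rightarrow> 'f list \<Rightarrow> bool" where
  "composable1 M f gs \<longleftrightarrow> f \<in> cells1 M \<and> set gs \<subseteq> cells1 M \<and> map (tgt M) gs = src M f"

definition composable2 :: "('o, 'f, 'a) mcat \<Rightarrow> 'a \<Rightarrow> 'a list \<Rightarrow> bool" where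
  "composable2 M \<alpha> \<beta>s \<longleftrightarrow> \<alpha> \<in> cells2 M \<and> set \<beta>s \<subseteq> cells2 M \<and> map (tgt2 M) \<beta>s = src2 M \<alpha>"

text \<open>The permutations \<open>\<sigma>\<langle>id,\<dots>,id\<rangle>\<close> and \<open>id\<langle>\<tau>\<^sub>1,\<dots>,\<tau>\<^sub>n\<rangle>\<close> of the equivariance axioms, where
  \<open>ks\<close> is the list of arities of the \<open>g\<^sub>j\<close>. For the former, the \<open>i\<close>-th source block has length
  \<open>k\<^bsub>\<sigma>(i)\<^esub>\<close>.\<close>

definition top_perm :: "(nat \<Rightarrow> nat) \<Rightarrow> nat list \<Rightarrow> nat \<Rightarrow> nat" where
  "top_perm \<sigma> ks = block_perm \<sigma> (permute_list \<sigma> ks) (replicate (length ks) id)"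

definition bottom_perm :: "nat list \<Rightarrow> (nat \<Rightarrow> nat) list \<Rightarrow> nat \<Rightarrow> nat" where
  "bottom_perm ks \<tau>s = block_perm id ks \<tau>s"

locale cat_multicategory =
  fixes M :: "('o, 'f, 'a) mcat"
  assumes cells_category: "category (cells M)"
    and src_objs: "f \<in> cells1 M \<Longrightarrow> src M f \<in> lists (objs M)"
    and tgt_objs: "f \<in> cells1 M \<Longrightarrow> tgt M f \<in> objs M"
    and src_Cod: "\<alpha> \<in> cells2 M \<Longrightarrow> src M (Cod (cells M) \<alpha>) = src M (Dom (cells M) \<alpha>)"
    and tgt_Cod: "\<alpha> \<in> cells2 M \<Longrightarrow> tgt M (Cod (cells M) \<alpha>) = tgt M (Dom (cells M) \<alpha>)"
    \<comment> \<open>symmetric group action\<close>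
    and act_iso: "\<lbrakk>as \<in> lists (objs M); b \<in> objs M; \<sigma> permutes {..<length as}\<rbrakk> \<Longrightarrow>
      iso_functor (mhom M as b) (mhom M (permute_list \<sigma> as) b)
        (\<lambda>f. act1 M f \<sigma>) (\<lambda>\<alpha>. act2 M \<alpha> \<sigma>)"
    and act1_act1: "\<lbrakk>f \<in> cells1 M; \<sigma> permutes {..<arity M f}; \<tau> permutes {..<arity M f}\<rbrakk> \<Longrightarrow>
      act1 M (act1 M f \<sigma>) \<tau> = act1 M f (\<sigma> \<circ> \<tau>)"
    and act2_act2: "\<lbrakk>\<alpha> \<in> cells2 M; \<sigma> permutes {..<length (src2 M \<alpha>)};
        \<tau> permutes {..<length (src2 M \<alpha>)}\<rbrakk> \<Longrightarrow>
      act2 M (act2 M \<alpha> \<sigma>) \<tau> = act2 M \<alpha> (\<sigma> \<circ> \<tau>)"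
    and act1_id: "f \<in> cells1 M \<Longrightarrow> act1 M f id = f"
    and act2_id: "\<alpha> \<in> cells2 M \<Longrightarrow> act2 M \<alpha> id = \<alpha>"
    \<comment> \<open>units and composition\<close>
    and munit_hom: "a \<in> objs M \<Longrightarrow> munit M a \<in> Ob (mhom M [a] a)"
    and gam_functor: "\<lbrakk>bs \<in> lists (objs M); c \<in> objs M; ass \<in> lists (lists (objs M));
        length ass = length bs\<rbrakk> \<Longrightarrow>
      cat_functor (prod_cat (mhom M bs c) (list_cat (map2 (mhom M) ass bs)))
        (mhom M (concat ass) c) (\<lambda>(f, gs). gam1 M f gs) (\<lambda>(\<alpha>, \<beta>s). gam2 M \<alpha> \<beta>s)"
    and gam1_munit_left: "f \<in> cells1 M \<Longrightarrow> gam1 M (munit M (tgt M f)) [f] = f"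
    and gam1_munit_right: "f \<in> cells1 M \<Longrightarrow> gam1 M f (map (munit M) (src M f)) = f"
    and gam2_munit_left: "\<alpha> \<in> cells2 M \<Longrightarrow>
      gam2 M (Idn (cells M) (munit M (tgt2 M \<alpha>))) [\<alpha>] = \<alpha>"
    and gam2_munit_right: "\<alpha> \<in> cells2 M \<Longrightarrow>
      gam2 M \<alpha> (map (\<lambda>a. Idn (cells M) (munit M a)) (src2 M \<alpha>)) = \<alpha>"
    and gam1_assoc: "\<lbrakk>composable1 M f gs; list_all2 (composable1 M) gs hss\<rbrakk> \<Longrightarrow>
      gam1 M (gam1 M f gs) (concat hss) = gam1 M f (map2 (gam1 M) gs hss)"
    and gam2_assoc: "\<lbrakk>composable2 M \<alpha> \<beta>s; list_all2 (composable2 M) \<beta>s \<delta>ss\<rbrakk> \<Longrightarrow>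
      gam2 M (gam2 M \<alpha> \<beta>s) (concat \<delta>ss) = gam2 M \<alpha> (map2 (gam2 M) \<beta>s \<delta>ss)"
    \<comment> \<open>equivariance\<close>
    and top_equivariance1: "\<lbrakk>composable1 M f gs; \<sigma> permutes {..<arity M f}\<rbrakk> \<Longrightarrow>
      gam1 M (act1 M f \<sigma>) (permute_list \<sigma> gs) =
        act1 M (gam1 M f gs) (top_perm \<sigma> (map (arity M) gs))"
    and top_equivariance2: "\<lbrakk>composable2 M \<alpha> \<beta>s; \<sigma> permutes {..<length (src2 M \<alpha>)}\<rbrakk> \<Longrightarrow>
      gam2 M (act2 M \<alpha> \<sigma>) (permute_list \<sigma> \<beta>s) =
        act2 M (gam2 M \<alpha> \<beta>s) (top_perm \<sigma> (map (\<lambda>\<beta>. length (src2 M \<beta>)) \<beta>s))"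
    and bottom_equivariance1: "\<lbrakk>composable1 M f gs;
        list_all2 (\<lambda>g \<tau>. \<tau> permutes {..<arity M g}) gs \<tau>s\<rbrakk> \<Longrightarrow>
      gam1 M f (map2 (act1 M) gs \<tau>s) = act1 M (gam1 M f gs) (bottom_perm (map (arity M) gs) \<tau>s)"
    and bottom_equivariance2: "\<lbrakk>composable2 M \<alpha> \<beta>s;
        list_all2 (\<lambda>\<beta> \<tau>. \<tau> permutes {..<length (src2 M \<beta>)}) \<beta>s \<tau>s\<rbrakk> \<Longrightarrow>
      gam2 M \<alpha> (map2 (act2 M) \<beta>s \<tau>s) =
        act2 M (gam2 M \<alpha> \<beta>s) (bottom_perm (map (\<lambda>\<beta>. length (src2 M \<beta>)) \<beta>s) \<tau>s)"


section \<open>Multifunctors\<close>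

text \<open>Multifunctors and transformations are required to be \<open>undefined\<close> off the carriers, so that
  HOL equality of their data is equality in the mathematical sense.\<close>

record ('o, 'f, 'a, 'p, 'g, 'b) mfun =
  fob :: "'o \<Rightarrow> 'p"
  fun1 :: "'f \<Rightarrow> 'g"
  fun2 :: "'a \<Rightarrow> 'b"

record ('o, 'f, 'a, 'p, 'g, 'b) psmfun = "('o, 'f, 'a, 'p, 'g, 'b) mfun" +
  psym :: "(nat \<Rightarrow> nat) \<Rightarrow> 'f \<Rightarrow> 'b"  \<comment> \<open>\<open>psym F \<sigma> f\<close> is \<open>F\<^bsub>\<sigma>;f\<^esub>\<close>\<close>

text \<open>The part of the definition common to symmetric and pseudo symmetric multifunctors.\<close>

locale multifunctor = M: cat_multicategory M + N: cat_multicategory N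
  for M :: "('o, 'f, 'a) mcat" and N :: "('p, 'g, 'b) mcat" +
  fixes F :: "('o, 'f, 'a, 'p, 'g, 'b, 'z) mfun_scheme"
  assumes fob_ext: "fob F \<in> extensional (objs M)"
    and fun1_ext: "fun1 F \<in> extensional (cells1 M)"
    and fun2_ext: "fun2 F \<in> extensional (cells2 M)"
    and fob_objs: "a \<in> objs M \<Longrightarrow> fob F a \<in> objs N"
    and hom_functor: "\<lbrakk>as \<in> lists (objs M); b \<in> objs M\<rbrakk> \<Longrightarrow>
      cat_functor (mhom M as b) (mhom N (map (fob F) as) (fob F b)) (fun1 F) (fun2 F)"
    and fun1_munit: "a \<in> objs M \<Longrightarrow> fun1 F (munit M a) = munit N (fob F a)"
    and fun1_gam1: "composable1 M f gs \<Longrightarrow>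
      fun1 F (gam1 M f gs) = gam1 N (fun1 F f) (map (fun1 F) gs)"
    and fun2_gam2: "composable2 M \<alpha> \<beta>s \<Longrightarrow>
      fun2 F (gam2 M \<alpha> \<beta>s) = gam2 N (fun2 F \<alpha>) (map (fun2 F) \<beta>s)"

locale symmetric_multifunctor = multifunctor M N F
  for M :: "('o, 'f, 'a) mcat" and N :: "('p, 'g, 'b) mcat"
    and F :: "('o, 'f, 'a, 'p, 'g, 'b) mfun" +
  assumes fun1_act1: "\<lbrakk>f \<in> cells1 M; \<sigma> permutes {..<arity M f}\<rbrakk> \<Longrightarrow>
      fun1 F (act1 M f \<sigma>) = act1 N (fun1 F f) \<sigma>"
    and fun2_act2: "\<lbrakk>\<alpha> \<in> cells2 M; \<sigma> permutes {..<length (src2 M \<alpha>)}\<rbrakk> \<Longrightarrow>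
      fun2 F (act2 M \<alpha> \<sigma>) = act2 N (fun2 F \<alpha>) \<sigma>"

locale pseudo_symmetric_multifunctor = multifunctor M N F
  for M :: "('o, 'f, 'a) mcat" and N :: "('p, 'g, 'b) mcat"
    and F :: "('o, 'f, 'a, 'p, 'g, 'b) psmfun" +
  assumes psym_ext: "\<not> (f \<in> cells1 M \<and> \<sigma> permutes {..<arity M f}) \<Longrightarrow> psym F \<sigma> f = undefined"
    and psym_natural: "\<lbrakk>as \<in> lists (objs M); b \<in> objs M; \<sigma> permutes {..<length as}\<rbrakk> \<Longrightarrow>
      natural_iso (mhom M as b) (mhom N (permute_list \<sigma> (map (fob F) as)) (fob F b))
        (\<lambda>f. fun1 F (act1 M f \<sigma>)) (\<lambda>\<alpha>. fun2 F (act2 M \<alpha> \<sigma>))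
        (\<lambda>f. act1 N (fun1 F f) \<sigma>) (\<lambda>\<alpha>. act2 N (fun2 F \<alpha>) \<sigma>)
        (psym F \<sigma>)"
    and psym_id: "f \<in> cells1 M \<Longrightarrow> psym F id f = Idn (cells N) (fun1 F f)"
    and psym_comp: "\<lbrakk>f \<in> cells1 M; \<sigma> permutes {..<arity M f}; \<tau> permutes {..<arity M f}\<rbrakk> \<Longrightarrow>
      psym F (\<sigma> \<circ> \<tau>) f = Cmp (cells N) (act2 N (psym F \<sigma> f) \<tau>) (psym F \<tau> (act1 M f \<sigma>))"
    and psym_top: "\<lbrakk>composable1 M f gs; \<sigma> permutes {..<arity M f}\<rbrakk> \<Longrightarrow>
      psym F (top_perm \<sigma> (map (arity M) gs)) (gam1 M f gs) =
        gam2 N (psym F \<sigma> f) (map (\<lambda>g. Idn (cells N) (fun1 F g)) (permute_list \<sigma> gs))"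
    and psym_bottom: "\<lbrakk>composable1 M f gs;
        list_all2 (\<lambda>g \<tau>. \<tau> permutes {..<arity M g}) gs \<tau>s\<rbrakk> \<Longrightarrow>
      psym F (bottom_perm (map (arity M) gs) \<tau>s) (gam1 M f gs) =
        gam2 N (Idn (cells N) (fun1 F f)) (map2 (psym F) \<tau>s gs)"

definition mfun_id :: "('o, 'f, 'a) mcat \<Rightarrow> ('o, 'f, 'a, 'o, 'f, 'a) mfun" where
  "mfun_id M =
     \<lparr>fob = restrict id (objs M), fun1 = restrict id (cells1 M), fun2 = restrict id (cells2 M)\<rparr>"

text \<open>Composites take the source multicategory (and \<open>psmfun_comp\<close> also the target) as an argument.\<close>

definition mfun_comp :: "('o, 'f, 'a) mcat \<Rightarrow>
    ('p, 'g, 'b, 'q, 'h, 'c) mfun \<Rightarrow> ('o, 'f, 'a, 'p, 'g, 'b) mfun \<Rightarrow>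
    ('o, 'f, 'a, 'q, 'h, 'c) mfun" where
  "mfun_comp M G F =
     \<lparr>fob = compose (objs M) (fob G) (fob F),
      fun1 = compose (cells1 M) (fun1 G) (fun1 F),
      fun2 = compose (cells2 M) (fun2 G) (fun2 F)\<rparr>"

definition psmfun_id :: "('o, 'f, 'a) mcat \<Rightarrow> ('o, 'f, 'a, 'o, 'f, 'a) psmfun" where
  "psmfun_id M =
     \<lparr>fob = restrict id (objs M), fun1 = restrict id (cells1 M), fun2 = restrict id (cells2 M),
      psym = (\<lambda>\<sigma>. \<lambda>f \<in> {f \<in> cells1 M. \<sigma> permutes {..<arity M f}}. Idn (cells M) (act1 M f \<sigma>))\<rparr>"

definition psmfun_comp :: "('o, 'f, 'a) mcat \<Rightarrow> ('q, 'h, 'c) mcat \<Rightarrow>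
    ('p, 'g, 'b, 'q, 'h, 'c) psmfun \<Rightarrow> ('o, 'f, 'a, 'p, 'g, 'b) psmfun \<Rightarrow>
    ('o, 'f, 'a, 'q, 'h, 'c) psmfun" where
  "psmfun_comp M Q G F =
     \<lparr>fob = compose (objs M) (fob G) (fob F),
      fun1 = compose (cells1 M) (fun1 G) (fun1 F),
      fun2 = compose (cells2 M) (fun2 G) (fun2 F),
      psym = (\<lambda>\<sigma>. \<lambda>f \<in> {f \<in> cells1 M. \<sigma> permutes {..<arity M f}}.
        Cmp (cells Q) (psym G \<sigma> (fun1 F f)) (fun2 G (psym F \<sigma> f)))\<rparr>"


section \<open>Multinatural transformations\<close>

text \<open>\<open>'F\<close> is the type of symmetric or of pseudo symmetric multifunctors.\<close>

record ('F, 'o, 'g) mtrans =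
  tdom :: 'F
  tcod :: 'F
  tcmp :: "'o \<Rightarrow> 'g"

definition multinatural :: "('o, 'f, 'a) mcat \<Rightarrow> ('p, 'g, 'b) mcat \<Rightarrow>
    ('o, 'f, 'a, 'p, 'g, 'b, 'z) mfun_scheme \<Rightarrow> ('o, 'f, 'a, 'p, 'g, 'b, 'z) mfun_scheme \<Rightarrow>
    ('o \<Rightarrow> 'g) \<Rightarrow> bool" where
  "multinatural M N F G \<theta> \<longleftrightarrow>
     \<theta> \<in> extensional (objs M) \<and>
     (\<forall>a\<in>objs M. \<theta> a \<in> Ob (mhom N [fob F a] (fob G a))) \<and>
     (\<forall>f\<in>cells1 M. gam1 N (fun1 G f) (map \<theta> (src M f)) = gam1 N (\<theta> (tgt M f)) [fun1 F f]) \<and>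
     (\<forall>\<alpha>\<in>cells2 M. gam2 N (fun2 G \<alpha>) (map (\<lambda>a. Idn (cells N) (\<theta> a)) (src2 M \<alpha>)) =
        gam2 N (Idn (cells N) (\<theta> (tgt2 M \<alpha>))) [fun2 F \<alpha>])"

definition sym_trans :: "('o, 'f, 'a) mcat \<Rightarrow> ('p, 'g, 'b) mcat \<Rightarrow>
    (('o, 'f, 'a, 'p, 'g, 'b) mfun, 'o, 'g) mtrans \<Rightarrow> bool" where
  "sym_trans M N \<theta> \<longleftrightarrow>
     symmetric_multifunctor M N (tdom \<theta>) \<and> symmetric_multifunctor M N (tcod \<theta>) \<and>
     multinatural M N (tdom \<theta>) (tcod \<theta>) (tcmp \<theta>)"

definition pseudo_sym_trans :: "('o, 'f, 'a) mcat \<Rightarrow> ('p, 'g, 'b) mcat \<Rightarrow>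
    (('o, 'f, 'a, 'p, 'g, 'b) psmfun, 'o, 'g) mtrans \<Rightarrow> bool" where
  "pseudo_sym_trans M N \<theta> \<longleftrightarrow>
     pseudo_symmetric_multifunctor M N (tdom \<theta>) \<and>
     pseudo_symmetric_multifunctor M N (tcod \<theta>) \<and>
     multinatural M N (tdom \<theta>) (tcod \<theta>) (tcmp \<theta>) \<and>
     (\<forall>f\<in>cells1 M. \<forall>\<sigma>. \<sigma> permutes {..<arity M f} \<longrightarrow>
        gam2 N (Idn (cells N) (tcmp \<theta> (tgt M f))) [psym (tdom \<theta>) \<sigma> f] =
        gam2 N (psym (tcod \<theta>) \<sigma> f)
          (map (\<lambda>a. Idn (cells N) (tcmp \<theta> a)) (permute_list \<sigma> (src M f))))"

definition trans_id :: "('o, 'f, 'a) mcat \<Rightarrow> ('p, 'g, 'b) mcat \<Rightarrow>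
    ('o, 'f, 'a, 'p, 'g, 'b, 'z) mfun_scheme \<Rightarrow>
    (('o, 'f, 'a, 'p, 'g, 'b, 'z) mfun_scheme, 'o, 'g) mtrans" where
  "trans_id M N F = \<lparr>tdom = F, tcod = F, tcmp = (\<lambda>a\<in>objs M. munit N (fob F a))\<rparr>"

definition trans_vcomp :: "('o, 'f, 'a) mcat \<Rightarrow> ('p, 'g, 'b) mcat \<Rightarrow>
    ('F, 'o, 'g) mtrans \<Rightarrow> ('F, 'o, 'g) mtrans \<Rightarrow> ('F, 'o, 'g) mtrans" where
  "trans_vcomp M N \<zeta> \<theta> =
     \<lparr>tdom = tdom \<theta>, tcod = tcod \<zeta>, tcmp = (\<lambda>a\<in>objs M. gam1 N (tcmp \<zeta> a) [tcmp \<theta> a])\<rparr>"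

definition hcomp_cmp :: "('o, 'f, 'a) mcat \<Rightarrow> ('q, 'h, 'c) mcat \<Rightarrow>
    (('p, 'g, 'b, 'q, 'h, 'c, 'z) mfun_scheme, 'p, 'h) mtrans \<Rightarrow>
    (('o, 'f, 'a, 'p, 'g, 'b, 'y) mfun_scheme, 'o, 'g) mtrans \<Rightarrow> 'o \<Rightarrow> 'h" where
  "hcomp_cmp M Q \<zeta> \<theta> =
     (\<lambda>a\<in>objs M. gam1 Q (tcmp \<zeta> (fob (tcod \<theta>) a)) [fun1 (tdom \<zeta>) (tcmp \<theta> a)])"

definition sym_hcomp :: "('o, 'f, 'a) mcat \<Rightarrow> ('q, 'h, 'c) mcat \<Rightarrow>
    (('p, 'g, 'b, 'q, 'h, 'c) mfun, 'p, 'h) mtrans \<Rightarrow>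
    (('o, 'f, 'a, 'p, 'g, 'b) mfun, 'o, 'g) mtrans \<Rightarrow>
    (('o, 'f, 'a, 'q, 'h, 'c) mfun, 'o, 'h) mtrans" where
  "sym_hcomp M Q \<zeta> \<theta> =
     \<lparr>tdom = mfun_comp M (tdom \<zeta>) (tdom \<theta>), tcod = mfun_comp M (tcod \<zeta>) (tcod \<theta>),
      tcmp = hcomp_cmp M Q \<zeta> \<theta>\<rparr>"

definition pseudo_sym_hcomp :: "('o, 'f, 'a) mcat \<Rightarrow> ('q, 'h, 'c) mcat \<Rightarrow>
    (('p, 'g, 'b, 'q, 'h, 'c) psmfun, 'p, 'h) mtrans \<Rightarrow>
    (('o, 'f, 'a, 'p, 'g, 'b) psmfun, 'o, 'g) mtrans \<Rightarrow>
    (('o, 'f, 'a, 'q, 'h, 'c) psmfun, 'o, 'h) mtrans" where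
  "pseudo_sym_hcomp M Q \<zeta> \<theta> =
     \<lparr>tdom = psmfun_comp M Q (tdom \<zeta>) (tdom \<theta>), tcod = psmfun_comp M Q (tcod \<zeta>) (tcod \<theta>),
      tcmp = hcomp_cmp M Q \<zeta> \<theta>\<rparr>"


section \<open>Hom categories, and the 2-category of pseudo symmetric multifunctors\<close>

text \<open>The operations of Cat-Multicat are polymorphic: source and target of a 1-cell may have
  different carrier types, which is needed for 1-cells out of \<open>M \<times> E\<Sigma>\<^sub>*\<close>. The 2-categories below
  have as 0-cells all multicategories over one (arbitrary) choice of carrier types.\<close>

definition multicat_hom :: "('o, 'f, 'a) mcat \<Rightarrow> ('p, 'g, 'b) mcat \<Rightarrow>
    (('o, 'f, 'a, 'p, 'g, 'b) mfun, (('o, 'f, 'a, 'p, 'g, 'b) mfun, 'o, 'g) mtrans) cat" where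
  "multicat_hom M N =
     \<lparr>Ob = {F. symmetric_multifunctor M N F}, Ar = {\<theta>. sym_trans M N \<theta>},
      Dom = tdom, Cod = tcod, Idn = trans_id M N, Cmp = trans_vcomp M N\<rparr>"

definition multicat_ps_hom :: "('o, 'f, 'a) mcat \<Rightarrow> ('p, 'g, 'b) mcat \<Rightarrow>
    (('o, 'f, 'a, 'p, 'g, 'b) psmfun, (('o, 'f, 'a, 'p, 'g, 'b) psmfun, 'o, 'g) mtrans) cat" where
  "multicat_ps_hom M N =
     \<lparr>Ob = {F. pseudo_symmetric_multifunctor M N F}, Ar = {\<theta>. pseudo_sym_trans M N \<theta>},
      Dom = tdom, Cod = tcod, Idn = trans_id M N, Cmp = trans_vcomp M N\<rparr>"

definition multicat_ps :: "(('o, 'f, 'a) mcat, ('o, 'f, 'a, 'o, 'f, 'a) psmfun,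
    (('o, 'f, 'a, 'o, 'f, 'a) psmfun, 'o, 'f) mtrans) two_cat" where
  "multicat_ps =
     \<lparr>Ob0 = {M. cat_multicategory M},
      HomC = multicat_ps_hom,
      Id1 = psmfun_id,
      Comp1 = (\<lambda>M N Q. psmfun_comp M Q),
      Comp2 = (\<lambda>M N Q. pseudo_sym_hcomp M Q)\<rparr>"


section \<open>Products and the Barratt-Eccles operad\<close>

definition mprod :: "('o, 'f, 'a) mcat \<Rightarrow> ('p, 'g, 'b) mcat \<Rightarrow>
    ('o \<times> 'p, 'f \<times> 'g, 'a \<times> 'b) mcat" where
  "mprod M N =
     \<lparr>objs = objs M \<times> objs N,
      cells = (prod_cat (cells M) (cells N))
        \<lparr>Ob := {(f, g) \<in> cells1 M \<times> cells1 N. arity M f = arity N g},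
         Ar := {(\<alpha>, \<beta>) \<in> cells2 M \<times> cells2 N. length (src2 M \<alpha>) = length (src2 N \<beta>)}\<rparr>,
      src = (\<lambda>(f, g). zip (src M f) (src N g)),
      tgt = map_prod (tgt M) (tgt N),
      act1 = (\<lambda>(f, g) \<sigma>. (act1 M f \<sigma>, act1 N g \<sigma>)),
      act2 = (\<lambda>(\<alpha>, \<beta>) \<sigma>. (act2 M \<alpha> \<sigma>, act2 N \<beta> \<sigma>)),
      munit = map_prod (munit M) (munit N),
      gam1 = (\<lambda>(f, g) hs. (gam1 M f (map fst hs), gam1 N g (map snd hs))),
      gam2 = (\<lambda>(\<alpha>, \<beta>) \<delta>s. (gam2 M \<alpha> (map fst \<delta>s), gam2 N \<beta> (map snd \<delta>s)))\<rparr>"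

definition mfun_prod :: "('o, 'f, 'a) mcat \<Rightarrow> ('p, 'g, 'b) mcat \<Rightarrow>
    ('o, 'f, 'a, 'o1, 'f1, 'a1) mfun \<Rightarrow> ('p, 'g, 'b, 'p1, 'g1, 'b1) mfun \<Rightarrow>
    ('o \<times> 'p, 'f \<times> 'g, 'a \<times> 'b, 'o1 \<times> 'p1, 'f1 \<times> 'g1, 'a1 \<times> 'b1) mfun" where
  "mfun_prod M N F G =
     \<lparr>fob = restrict (map_prod (fob F) (fob G)) (objs (mprod M N)),
      fun1 = restrict (map_prod (fun1 F) (fun1 G)) (cells1 (mprod M N)),
      fun2 = restrict (map_prod (fun2 F) (fun2 G)) (cells2 (mprod M N))\<rparr>"

definition trans_prod :: "('o, 'f, 'a) mcat \<Rightarrow> ('p, 'g, 'b) mcat \<Rightarrow>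
    (('o, 'f, 'a, 'o1, 'f1, 'a1) mfun, 'o, 'f1) mtrans \<Rightarrow>
    (('p, 'g, 'b, 'p1, 'g1, 'b1) mfun, 'p, 'g1) mtrans \<Rightarrow>
    (('o \<times> 'p, 'f \<times> 'g, 'a \<times> 'b, 'o1 \<times> 'p1, 'f1 \<times> 'g1, 'a1 \<times> 'b1) mfun,
      'o \<times> 'p, 'f1 \<times> 'g1) mtrans" where
  "trans_prod M N \<theta> \<zeta> =
     \<lparr>tdom = mfun_prod M N (tdom \<theta>) (tdom \<zeta>), tcod = mfun_prod M N (tcod \<theta>) (tcod \<zeta>),
      tcmp = restrict (map_prod (tcmp \<theta>) (tcmp \<zeta>)) (objs (mprod M N))\<rparr>"

definition mfun_diag :: "('o, 'f, 'a) mcat \<Rightarrow>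
    ('o, 'f, 'a, 'o \<times> 'o, 'f \<times> 'f, 'a \<times> 'a) mfun" where
  "mfun_diag M =
     \<lparr>fob = (\<lambda>a\<in>objs M. (a, a)), fun1 = (\<lambda>f\<in>cells1 M. (f, f)), fun2 = (\<lambda>\<alpha>\<in>cells2 M. (\<alpha>, \<alpha>))\<rparr>"

text \<open>The identification of \<open>L \<times> (M \<times> N)\<close> with \<open>(L \<times> M) \<times> N\<close>.\<close>

definition mfun_assoc :: "('o, 'f, 'a) mcat \<Rightarrow> ('p, 'g, 'b) mcat \<Rightarrow> ('q, 'h, 'c) mcat \<Rightarrow>
    ('o \<times> 'p \<times> 'q, 'f \<times> 'g \<times> 'h, 'a \<times> 'b \<times> 'c,
     ('o \<times> 'p) \<times> 'q, ('f \<times> 'g) \<times> 'h, ('a \<times> 'b) \<times> 'c) mfun" where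
  "mfun_assoc L M N =
     \<lparr>fob = (\<lambda>(a, b, c)\<in>objs (mprod L (mprod M N)). ((a, b), c)),
      fun1 = (\<lambda>(f, g, h)\<in>cells1 (mprod L (mprod M N)). ((f, g), h)),
      fun2 = (\<lambda>(\<alpha>, \<beta>, \<delta>)\<in>cells2 (mprod L (mprod M N)). ((\<alpha>, \<beta>), \<delta>))\<rparr>"

text \<open>A 1-cell of \<open>E\<Sigma>\<^sub>*\<close> is a permutation together with its degree; a 2-cell is the pair of its
  source and target.\<close>

type_synonym deg_perm = "nat \<times> (nat \<Rightarrow> nat)"

definition be_act :: "deg_perm \<Rightarrow> (nat \<Rightarrow> nat) \<Rightarrow> deg_perm" where
  "be_act = (\<lambda>(n, \<sigma>) \<tau>. (n, \<sigma> \<circ> \<tau>))"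

definition be_gam :: "deg_perm \<Rightarrow> deg_perm list \<Rightarrow> deg_perm" where
  "be_gam = (\<lambda>(n, \<sigma>) \<rho>s. (sum_list (map fst \<rho>s), block_perm \<sigma> (map fst \<rho>s) (map snd \<rho>s)))"

definition barratt_eccles :: "(unit, deg_perm, deg_perm \<times> deg_perm) mcat" where
  "barratt_eccles =
     \<lparr>objs = UNIV,
      cells =
        \<lparr>Ob = {(n, \<sigma>). \<sigma> permutes {..<n}},
         Ar = {((n, \<sigma>), (m, \<tau>)). n = m \<and> \<sigma> permutes {..<n} \<and> \<tau> permutes {..<m}},
         Dom = fst, Cod = snd,
         Idn = (\<lambda>x. (x, x)),
         Cmp = (\<lambda>\<beta> \<alpha>. (fst \<alpha>, snd \<beta>))\<rparr>,
      src = (\<lambda>(n, \<sigma>). replicate n ()),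
      tgt = (\<lambda>_. ()),
      act1 = be_act,
      act2 = (\<lambda>(x, y) \<tau>. (be_act x \<tau>, be_act y \<tau>)),
      munit = (\<lambda>_. (1, id)),
      gam1 = be_gam,
      gam2 = (\<lambda>(x, y) \<beta>s. (be_gam x (map fst \<beta>s), be_gam y (map snd \<beta>s)))\<rparr>"


section \<open>The 2-category D\<close>

abbreviation timesE :: "('o, 'f, 'a) mcat \<Rightarrow>
    ('o \<times> unit, 'f \<times> deg_perm, 'a \<times> deg_perm \<times> deg_perm) mcat" where
  "timesE M \<equiv> mprod M barratt_eccles"

text \<open>\<open>1 \<times> \<Delta>\<close> followed by the reassociation of the triple product.\<close>

definition one_times_diag :: "('o, 'f, 'a) mcat \<Rightarrow>
    ('o \<times> unit, 'f \<times> deg_perm, 'a \<times> deg_perm \<times> deg_perm,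
     ('o \<times> unit) \<times> unit, ('f \<times> deg_perm) \<times> deg_perm,
     ('a \<times> deg_perm \<times> deg_perm) \<times> deg_perm \<times> deg_perm) mfun" where
  "one_times_diag M =
     mfun_comp (timesE M) (mfun_assoc M barratt_eccles barratt_eccles)
       (mfun_prod M barratt_eccles (mfun_id M) (mfun_diag barratt_eccles))"

type_synonym ('o, 'f, 'a) d_mfun =
  "('o \<times> unit, 'f \<times> deg_perm, 'a \<times> deg_perm \<times> deg_perm, 'o, 'f, 'a) mfun"

type_synonym ('o, 'f, 'a) d_mtrans =
  "(('o, 'f, 'a) d_mfun, 'o \<times> unit, 'f) mtrans"

definition d_comp1 :: "('o, 'f, 'a) mcat \<Rightarrow> ('o, 'f, 'a) mcat \<Rightarrow> ('o, 'f, 'a) mcat \<Rightarrow>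
    ('o, 'f, 'a) d_mfun \<Rightarrow> ('o, 'f, 'a) d_mfun \<Rightarrow> ('o, 'f, 'a) d_mfun" where
  "d_comp1 M N Q G F =
     mfun_comp (timesE M) G
       (mfun_comp (timesE M) (mfun_prod (timesE M) barratt_eccles F (mfun_id barratt_eccles))
         (one_times_diag M))"

definition d_comp2 :: "('o, 'f, 'a) mcat \<Rightarrow> ('o, 'f, 'a) mcat \<Rightarrow> ('o, 'f, 'a) mcat \<Rightarrow>
    ('o, 'f, 'a) d_mtrans \<Rightarrow> ('o, 'f, 'a) d_mtrans \<Rightarrow> ('o, 'f, 'a) d_mtrans" where
  "d_comp2 M N Q \<zeta> \<theta> =
     sym_hcomp (timesE M) Q \<zeta>
       (sym_hcomp (timesE M) (timesE N)
         (trans_prod (timesE M) barratt_eccles \<theta>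
           (trans_id barratt_eccles barratt_eccles (mfun_id barratt_eccles)))
         (trans_id (timesE M) (mprod (timesE M) barratt_eccles) (one_times_diag M)))"

text \<open>The identity 1-cells of \<open>D\<close> are a parameter: they are determined by the composition.\<close>

definition d_two_cat :: "(('o, 'f, 'a) mcat \<Rightarrow> ('o, 'f, 'a) d_mfun) \<Rightarrow>
    (('o, 'f, 'a) mcat, ('o, 'f, 'a) d_mfun, ('o, 'f, 'a) d_mtrans) two_cat" where
  "d_two_cat I =
     \<lparr>Ob0 = {M. cat_multicategory M},
      HomC = (\<lambda>M N. multicat_hom (timesE M) N),
      Id1 = I,
      Comp1 = d_comp1,
      Comp2 = d_comp2\<rparr>"

end

theory Submission
  imports Defs
begin

text \<open>Since \<open>E\<Sigma>\<^sub>n\<close> has exactly one 2-cell between any two objects, a symmetric multifunctor \<open>F\<close> on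
  \<open>M \<times> E\<Sigma>\<^sub>*\<close> is determined by its restriction to the identity permutations together with the
  isomorphisms \<open>F(1, id \<rightarrow> \<sigma>): F(f\<sigma>, id) \<rightarrow> F(f\<sigma>, \<sigma>) = F(f, id)\<sigma>\<close>, and these satisfy precisely the
  axioms of a pseudo symmetry. Conversely a pseudo symmetric \<open>F\<close> extends to \<open>(f, \<sigma>) \<mapsto> F(f\<sigma>\<^sup>-\<^sup>1)\<sigma>\<close>, which the
  pseudo symmetry isomorphisms identify with \<open>F f\<close>. \<open>D\<close> is the coKleisli 2-category of the comonad
  \<open>- \<times> E\<Sigma>\<^sub>*\<close>, so it is a 2-category for formal reasons; the bijections above respect all compositions,
  and the 2-category structure of pseudo symmetric multifunctors is obtained by transport.\<close>

section \<open>Block permutations\<close>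

text \<open>The delicate point is that the extension of a pseudo symmetric \<open>F\<close>
  preserves \<gamma>. In E\<Sigma> the operation \<gamma> yields
  \<sigma>\<langle>\<tau>_1,...,\<tau>_n\<rangle>, which moves blocks and the entries inside them at
  once, whereas \<open>psym_top\<close> and \<open>psym_bottom\<close> each handle only one of these
  motions. The factorisation \<sigma>\<langle>\<tau>\<rangle> = \<sigma>\<langle>id\<rangle> \<circ>
  id\<langle>\<tau>\<rangle> together with \<open>psym_comp\<close> joins them
  (\<open>twist_iso_gam1\<close>). From there on the formula for the extension on 2-cells is hardly
  used: its value over \<open>\<alpha>\<close> is the only 2-cell closing a square whose sides are
  the twist isomorphisms, so every law follows by pasting squares and cancelling an isomorphism. For
  transformations, the extra pseudo symmetric condition is naturality at the 2-cells
  \<open>(1, id \<rightarrow> \<sigma>)\<close>. An isomorphism of 2-categories, not an equivalence,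
  is claimed. Hence the two translations have to be inverse on the nose, and all equalities are
  equalities of records that also fix values off the carriers. That the product with E\<Sigma> is a
  multicategory has to be proved as well; its core is the calculus of block permutations.\<close>

lemma permute_list_inv [simp]:
  assumes "\<sigma> permutes {..<length xs}"
  shows "permute_list \<sigma> (permute_list (inv \<sigma>) xs) = xs"
    and "permute_list (inv \<sigma>) (permute_list \<sigma> xs) = xs"
proof -
  note inv = permutes_inv[OF assms]
  show "permute_list \<sigma> (permute_list (inv \<sigma>) xs) = xs"
    using permute_list_compose[OF assms, of "inv \<sigma>"] permutes_inv_o[OF assms] by simp
  show "permute_list (inv \<sigma>) (permute_list \<sigma> xs) = xs"
    using permute_list_compose[OF inv, of \<sigma>] permutes_inv_o[OF assms] by simp
qed

lemma permutes_nat_less: "\<sigma> permutes {..<n} \<Longrightarrow> \<sigma> i < n \<longleftrightarrow> i < n"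
  using permutes_in_image[of \<sigma> "{..<n}" i] by simp

lemma permute_list_replicate: "\<sigma> permutes {..<n} \<Longrightarrow> permute_list \<sigma> (replicate n x) = replicate n x"
  by (auto intro!: nth_equalityI simp: permute_list_def permutes_nat_less)

lemma sum_list_permute_list [simp]:
  fixes ks :: "nat list"
  assumes "\<sigma> permutes {..<length ks}"
  shows "sum_list (permute_list \<sigma> ks) = sum_list ks"
  using assms by (metis mset_permute_list sum_mset_sum_list)

section \<open>Positions in a sequence of blocks\<close>

lemma block_start_0 [simp]: "block_start ks 0 = 0"
  by (simp add: block_start_def)

lemma block_start_Suc: "i < length ks \<Longrightarrow> block_start ks (Suc i) = block_start ks i + ks ! i"
  by (simp add: block_start_def take_Suc_conv_app_nth)

lemma block_start_mono: "i \<le> j \<Longrightarrow> block_start ks i \<le> block_start ks j"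
  unfolding block_start_def by (metis le_add1 le_add_diff_inverse sum_list_append take_add)

lemma block_start_length: "block_start ks (length ks) = sum_list ks"
  by (simp add: block_start_def)

lemma block_start_le: "i < length ks \<Longrightarrow> block_start ks i + ks ! i \<le> sum_list ks"
  by (metis Suc_leI block_start_Suc block_start_length block_start_mono)

lemma block_pair_less: "\<lbrakk>i < length ks; p < ks ! i\<rbrakk> \<Longrightarrow> block_start ks i + p < sum_list ks"
  using block_start_le[of i ks] by linarith

text \<open>Empty blocks make several blocks start at the same position; the strict bound
  \<open>p < ks ! i\<close> singles out the right one. A smaller index fails because starts are
  monotone.\<close>

lemma block_index_pair:
  assumes "i < length ks" "p < ks ! i"
  shows "block_index ks (block_start ks i + p) = i"
  unfolding block_index_def
proof (rule Least_equality)
  show "block_start ks i + p < block_start ks (Suc i)"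
    using assms by (simp add: block_start_Suc)
next
  fix j assume j: "block_start ks i + p < block_start ks (Suc j)"
  show "i \<le> j"
  proof (rule ccontr)
    assume "\<not> i \<le> j"
    then have "block_start ks (Suc j) \<le> block_start ks i" by (intro block_start_mono) simp
    with j show False by simp
  qed
qed

lemma block_pos_pair: "\<lbrakk>i < length ks; p < ks ! i\<rbrakk> \<Longrightarrow> block_pos ks (block_start ks i + p) = p"
  by (simp add: block_pos_def block_index_pair)

text \<open>Together with \<open>block_index_pair\<close> this identifies positions below the total
  length with pairs of a block and an offset. All identities of block permutations are checked on
  such pairs.\<close>

lemma block_pair_cases:
  assumes "m < sum_list ks"
  obtains i p where "i < length ks" "p < ks ! i" "m = block_start ks i + p"
proof -
  define i where "i = block_index ks m"
  \<comment> \<open>By monotonicity the start with index \<open>Suc (length ks)\<close> is at least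
    the total length, so the least index exists.\<close>
  have ex: "\<exists>i. m < block_start ks (Suc i)"
    using assms block_start_mono[of "length ks" "Suc (length ks)" ks] block_start_length[of ks]
    by (intro exI[of _ "length ks"]) simp
  have lt: "m < block_start ks (Suc i)"
    unfolding i_def block_index_def by (rule LeastI_ex[OF ex])
  have ge: "block_start ks i \<le> m"
  proof (cases i)
    case (Suc j)
    then have "\<not> m < block_start ks (Suc j)"
      unfolding i_def block_index_def by (metis lessI not_less_Least)
    then show ?thesis using Suc by simp
  qed simp
  have il: "i < length ks"
  proof (rule ccontr)
    assume "\<not> i < length ks"
    then have "block_start ks (length ks) \<le> block_start ks i" by (intro block_start_mono) simp
    with ge assms show False by (simp add: block_start_length)
  qed
  show thesis
    using that[of i "m - block_start ks i"] il lt ge by (simp add: block_start_Suc)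
qed

lemma block_perm_pair:
  assumes "i < length ks" "p < ks ! i"
  shows "block_perm \<sigma> ks \<tau>s (block_start ks i + p) =
    block_start (permute_list (inv \<sigma>) ks) (\<sigma> i) + (\<tau>s ! i) p"
  using assms by (simp add: block_perm_def block_index_pair block_pos_pair block_pair_less)

lemma block_perm_outside: "\<not> m < sum_list ks \<Longrightarrow> block_perm \<sigma> ks \<tau>s m = m"
  by (simp add: block_perm_def)

section \<open>Identities between block permutations\<close>

lemma block_funs_eqI:
  assumes "\<And>i p. \<lbrakk>i < length ks; p < ks ! i\<rbrakk> \<Longrightarrow> f (block_start ks i + p) = g (block_start ks i + p)"
    and "\<And>m. \<not> m < sum_list ks \<Longrightarrow> f m = g m"
  shows "f = g"
proof
  fix m
  show "f m = g m"
    by (cases "m < sum_list ks") (auto elim!: block_pair_cases simp: assms)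
qed

text \<open>Offset \<open>p\<close> of block \<open>i\<close> goes to offset
  \<open>(\<tau>s ! i) p\<close> of block \<open>\<sigma> i\<close>, where it meets the entry of
  \<open>\<rho>s\<close> with index \<open>\<sigma> i\<close>. The blocks that the second
  permutation starts from are the target blocks of the first, which explains the lengths
  \<open>permute_list (inv \<sigma>) ks\<close>. Inverses and both equivariance laws of E\<Sigma>
  are instances.\<close>

lemma block_perm_comp:
  assumes \<sigma>: "\<sigma> permutes {..<length ks}" and \<pi>: "\<pi> permutes {..<length ks}"
    and l: "length \<tau>s = length ks" "length \<rho>s = length ks"
    and \<tau>: "list_all2 (\<lambda>\<tau> k. \<tau> permutes {..<k}) \<tau>s ks"
  shows "block_perm \<pi> (permute_list (inv \<sigma>) ks) \<rho>s \<circ> block_perm \<sigma> ks \<tau>s =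
    block_perm (\<pi> \<circ> \<sigma>) ks (map2 (\<circ>) (permute_list \<sigma> \<rho>s) \<tau>s)"
    (is "?l = ?r")
proof (rule block_funs_eqI)
  note inv = permutes_inv[OF \<sigma>]
  fix i p assume i: "i < length ks" and p: "p < ks ! i"
  have si: "\<sigma> i < length ks" using \<sigma> i by (simp add: permutes_nat_less)
  have k: "permute_list (inv \<sigma>) ks ! \<sigma> i = ks ! i"
    using inv si i by (simp add: permute_list_nth permutes_inverses[OF \<sigma>])
  have "\<tau>s ! i permutes {..<ks ! i}" using \<tau> i l by (auto simp: list_all2_conv_all_nth)
  then have tp: "(\<tau>s ! i) p < ks ! i" using p by (simp add: permutes_nat_less)
  have "?l (block_start ks i + p) =
    block_start (permute_list (inv \<pi>) (permute_list (inv \<sigma>) ks)) (\<pi> (\<sigma> i)) + (\<rho>s ! \<sigma> i) ((\<tau>s ! i) p)"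
    using i p si tp k by (simp add: block_perm_pair)
  \<comment> \<open>The action on sequences is from the right, so the two rearrangements of the
    lengths combine to the inverse of the composite.\<close>
  also have "permute_list (inv \<pi>) (permute_list (inv \<sigma>) ks) = permute_list (inv (\<pi> \<circ> \<sigma>)) ks"
    using permutes_inv[OF \<pi>] permutes_bij[OF \<pi>] permutes_bij[OF \<sigma>]
    by (simp add: permute_list_compose o_inv_distrib)
  also have "block_start (permute_list (inv (\<pi> \<circ> \<sigma>)) ks) (\<pi> (\<sigma> i)) + (\<rho>s ! \<sigma> i) ((\<tau>s ! i) p) =
    ?r (block_start ks i + p)"
    using i p l \<sigma> by (simp add: block_perm_pair permute_list_nth)
  finally show "?l (block_start ks i + p) = ?r (block_start ks i + p)" .
next
  fix m assume "\<not> m < sum_list ks"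
  then show "?l m = ?r m" using permutes_inv[OF \<sigma>] by (simp add: block_perm_outside)
qed

lemma block_perm_id:
  assumes "length \<tau>s = length ks" "\<And>\<tau>. \<tau> \<in> set \<tau>s \<Longrightarrow> \<tau> = id"
  shows "block_perm id ks \<tau>s = id"
proof (rule block_funs_eqI[of ks])
  fix i p assume i: "i < length ks" "p < ks ! i"
  then have "\<tau>s ! i = id" using assms by simp
  with i show "block_perm id ks \<tau>s (block_start ks i + p) = id (block_start ks i + p)"
    by (simp add: block_perm_pair)
qed (simp add: block_perm_outside)

lemma permutes_if_inverse:
  assumes "f \<circ> g = id" "g \<circ> f = id" "\<And>m. m \<notin> S \<Longrightarrow> f m = m"
  shows "f permutes S"
  using assms unfolding permutes_def by (metis comp_apply id_apply)

text \<open>The inverse is again a block permutation, namely that of \<open>inv \<sigma>\<close>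
  with the inverses of the \<open>\<tau>s\<close>; both composites collapse by
  \<open>block_perm_comp\<close>.\<close>

lemma block_perm_permutes:
  assumes \<sigma>: "\<sigma> permutes {..<length ks}"
    and \<tau>: "list_all2 (\<lambda>\<tau> k. \<tau> permutes {..<k}) \<tau>s ks"
  shows "block_perm \<sigma> ks \<tau>s permutes {..<sum_list ks}"
proof (rule permutes_if_inverse)
  have l: "length \<tau>s = length ks" using \<tau> by (rule list_all2_lengthD)
  note inv = permutes_inv[OF \<sigma>]
  \<comment> \<open>The inverse starts from the target blocks. Block \<open>j\<close> there came
    from block \<open>inv \<sigma> j\<close>, hence both lists are reindexed.\<close>
  let ?ts = "permute_list (inv \<sigma>) (map inv \<tau>s)" and ?ks = "permute_list (inv \<sigma>) ks"
  let ?g = "block_perm (inv \<sigma>) ?ks ?ts"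
  have inv': "inv \<sigma> permutes {..<length ?ks}" using inv by simp
  have bij: "bij (\<tau>s ! i)" if "i < length ks" for i
    using \<tau> that by (auto simp: list_all2_conv_all_nth permutes_bij)
  have "?g \<circ> block_perm \<sigma> ks \<tau>s =
      block_perm (inv \<sigma> \<circ> \<sigma>) ks (map2 (\<circ>) (permute_list \<sigma> ?ts) \<tau>s)"
    by (rule block_perm_comp) (use \<sigma> \<tau> l inv in auto)
  also have "\<dots> = id"
    unfolding permutes_inv_o(2)[OF \<sigma>]
    by (rule block_perm_id) (use l \<sigma> bij in \<open>auto simp: set_zip bij_is_inj\<close>)
  finally show "?g \<circ> block_perm \<sigma> ks \<tau>s = id" .
  have \<tau>': "list_all2 (\<lambda>\<tau> k. \<tau> permutes {..<k}) ?ts ?ks"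
    using \<tau> inv l by (simp add: list_all2_permute_list_iff list_all2_map1)
      (auto simp: list_all2_conv_all_nth permutes_inv)
  have "block_perm \<sigma> (permute_list (inv (inv \<sigma>)) ?ks) \<tau>s \<circ> ?g =
      block_perm (\<sigma> \<circ> inv \<sigma>) ?ks (map2 (\<circ>) (permute_list (inv \<sigma>) \<tau>s) ?ts)"
    by (rule block_perm_comp) (use \<sigma> \<tau>' l inv in auto)
  also have "permute_list (inv (inv \<sigma>)) ?ks = ks"
    using \<sigma> by (simp add: inv_inv_eq permutes_bij)
  also have "block_perm (\<sigma> \<circ> inv \<sigma>) ?ks (map2 (\<circ>) (permute_list (inv \<sigma>) \<tau>s) ?ts) = id"
    unfolding permutes_inv_o(1)[OF \<sigma>]
  proof (rule block_perm_id)
    fix f assume "f \<in> set (map2 (\<circ>) (permute_list (inv \<sigma>) \<tau>s) ?ts)"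
    then obtain i where i: "i < length ks" "f = (\<tau>s ! inv \<sigma> i) \<circ> inv (\<tau>s ! inv \<sigma> i)"
      using l inv by (auto simp: set_zip permute_list_nth permutes_nat_less)
    then show "f = id" using bij[of "inv \<sigma> i"] inv
      by (simp add: permutes_nat_less surj_iff[symmetric] bij_is_surj)
  qed (use l in simp)
  finally show "block_perm \<sigma> ks \<tau>s \<circ> ?g = id" .
qed (simp add: block_perm_outside)

lemma block_start_replicate_1: "i \<le> n \<Longrightarrow> block_start (replicate n (Suc 0)) i = i"
  by (simp add: block_start_def min_absorb1 sum_list_replicate)

text \<open>A block of length one starts at its own index and has only the offset 0. This is the
  right unit law of E\<Sigma>; it is used again when the unary components of a transformation are
  permuted.\<close>

lemma block_perm_singletons:
  assumes "\<sigma> permutes {..<n}"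
  shows "block_perm \<sigma> (replicate n (Suc 0)) (replicate n id) = \<sigma>"
proof (rule block_funs_eqI)
  fix i p assume i: "i < length (replicate n (Suc 0))" "p < replicate n (Suc 0) ! i"
  then show "block_perm \<sigma> (replicate n (Suc 0)) (replicate n id)
      (block_start (replicate n (Suc 0)) i + p) = \<sigma> (block_start (replicate n (Suc 0)) i + p)"
    using permutes_nat_less[OF assms, of i]
    by (subst block_perm_pair)
      (simp_all add: permute_list_replicate permutes_inv[OF assms] block_start_replicate_1)
next
  fix m assume "\<not> m < sum_list (replicate n (Suc 0))"
  then show "block_perm \<sigma> (replicate n (Suc 0)) (replicate n id) m = \<sigma> m"
    using assms by (simp add: block_perm_outside sum_list_replicate permutes_not_in)
qed

lemma block_perm_single:
  assumes "\<tau> permutes {..<k}"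
  shows "block_perm id [k] [\<tau>] = \<tau>"
proof (rule block_funs_eqI)
  fix i p assume "i < length [k]" "p < [k] ! i"
  then show "block_perm id [k] [\<tau>] (block_start [k] i + p) = \<tau> (block_start [k] i + p)"
    by (subst block_perm_pair) auto
qed (use assms in \<open>simp add: block_perm_outside permutes_not_in\<close>)

section \<open>Block permutations of concatenated lists, and associativity\<close>

lemma concat_nth_block:
  assumes "i < length xss" "j < length (xss ! i)"
  shows "concat xss ! (block_start (map length xss) i + j) = xss ! i ! j"
  using assms
proof (induction xss arbitrary: i)
  case (Cons xs xss)
  then show ?case by (cases i) (auto simp: block_start_def nth_append)
qed simp

text \<open>Here the list of lengths is itself divided into blocks. An inner block starts at the
  start of its outer block plus its start inside it; this compares the two ways of reading a
  three-level address.\<close>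

lemma block_start_concat:
  assumes "i < length xss" "j \<le> length (xss ! i)"
  shows "block_start (concat xss) (block_start (map length xss) i + j) =
    block_start (map sum_list xss) i + block_start (xss ! i) j"
  using assms
proof (induction xss arbitrary: i)
  case (Cons xs xss)
  then show ?case by (cases i) (auto simp: block_start_def)
qed simp

text \<open>At offset \<open>q\<close> of block \<open>i\<close> both sides read the entry
  \<open>(\<tau>s ! i) q\<close> of \<open>xss ! i\<close>. In \<open>block_perm_assoc\<close> it is
  applied to lists of block lengths, to find the target blocks of a permutation of blocks of
  blocks.\<close>

lemma permute_list_block_perm:
  assumes \<sigma>: "\<sigma> permutes {..<length xss}"
    and \<tau>: "list_all2 (\<lambda>\<tau> xs. \<tau> permutes {..<length xs}) \<tau>s xss"
  shows "permute_list (block_perm \<sigma> (map length xss) \<tau>s) (concat (permute_list (inv \<sigma>) xss)) =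
    concat (map2 permute_list \<tau>s xss)"
proof -
  let ?p = "block_perm \<sigma> (map length xss) \<tau>s" and ?xs = "permute_list (inv \<sigma>) xss"
  note inv = permutes_inv[OF \<sigma>]
  have l: "length \<tau>s = length xss" using \<tau> by (rule list_all2_lengthD)
  have "length (concat ?xs) = sum_list (permute_list (inv \<sigma>) (map length xss))"
    by (simp only: length_concat permute_list_map[OF inv])
  also have "\<dots> = sum_list (map length xss)"
    by (rule sum_list_permute_list) (use inv in simp)
  finally have len: "length (concat ?xs) = sum_list (map length xss)" .
  have p: "?p permutes {..<length (concat ?xs)}"
    unfolding len by (rule block_perm_permutes) (use \<sigma> \<tau> in \<open>auto simp: list_all2_conv_all_nth\<close>)
  have ml: "map length (map2 permute_list \<tau>s xss) = map length xss"
    using l by (auto intro!: nth_equalityI)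
  show ?thesis
  proof (rule nth_equalityI)
    show "length (permute_list ?p (concat ?xs)) = length (concat (map2 permute_list \<tau>s xss))"
        unfolding length_permute_list len by (simp only: length_concat ml)
    fix m assume "m < length (permute_list ?p (concat ?xs))"
    then have m: "m < sum_list (map length xss)" unfolding length_permute_list len .
    from m obtain i q where i: "i < length xss" and q: "q < length (xss ! i)"
      and mi: "m = block_start (map length xss) i + q"
      by (auto elim!: block_pair_cases)
    have t: "\<tau>s ! i permutes {..<length (xss ! i)}"
      using \<tau> i by (auto simp: list_all2_conv_all_nth)
    have si: "\<sigma> i < length xss" using \<sigma> i by (simp add: permutes_nat_less)
    have x: "?xs ! \<sigma> i = xss ! i"
      using inv si by (simp add: permute_list_nth permutes_inverses[OF \<sigma>])
    have "permute_list ?p (concat ?xs) ! m = concat ?xs ! ?p m"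
      using p m by (simp only: permute_list_nth len)
    also have "\<dots> = concat ?xs ! (block_start (map length ?xs) (\<sigma> i) + (\<tau>s ! i) q)"
      unfolding mi using i q inv by (simp add: block_perm_pair permute_list_map)
    also have "\<dots> = xss ! i ! (\<tau>s ! i) q"
      using si t q by (simp add: concat_nth_block x permutes_nat_less)
    also have "\<dots> = map2 permute_list \<tau>s xss ! i ! q"
      using i l q t by (simp add: permute_list_nth)
    also have "\<dots> = concat (map2 permute_list \<tau>s xss) ! m"
      using concat_nth_block[of i "map2 permute_list \<tau>s xss" q] i l q
      unfolding ml mi[symmetric] by simp
    finally show "permute_list ?p (concat ?xs) ! m = concat (map2 permute_list \<tau>s xss) ! m" .
  qed
qed

text \<open>Associativity of \<gamma> in E\<Sigma>. A position has an address made of an outer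
  block, an inner block and an offset; on both sides \<sigma>, the \<rho>s and the \<tau>s act on
  these three coordinates in turn. What needs proof is that the target positions of the two sides
  are counted over the same arrangement of lengths.\<close>

lemma block_perm_assoc:
  assumes \<sigma>: "\<sigma> permutes {..<length lss}"
    and \<rho>: "list_all2 (\<lambda>\<rho> ls. \<rho> permutes {..<length ls}) \<rho>s lss"
    and \<tau>: "list_all2 (\<lambda>\<tau>s ls. length \<tau>s = length ls) \<tau>ss lss"
  shows "block_perm (block_perm \<sigma> (map length lss) \<rho>s) (concat lss) (concat \<tau>ss) =
    block_perm \<sigma> (map sum_list lss) (map2 (\<lambda>\<rho> (ls, \<tau>s). block_perm \<rho> ls \<tau>s) \<rho>s (zip lss \<tau>ss))"
    (is "?l = ?r")
proof (rule block_funs_eqI)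
  have sum: "sum_list (concat lss) = sum_list (map sum_list lss)"
    by (induction lss) auto
  fix i q assume "i < length (map sum_list lss)" and q: "q < map sum_list lss ! i"
  then have i: "i < length lss" by simp
  from q i have "q < sum_list (lss ! i)" by simp
  then obtain j p where j: "j < length (lss ! i)" and p: "p < lss ! i ! j"
    and qj: "q = block_start (lss ! i) j + p"
    by (rule block_pair_cases)
  let ?P = "block_perm \<sigma> (map length lss) \<rho>s"
  define m where "m = block_start (map length lss) i + j"
  have m: "m < length (concat lss)"
    unfolding m_def length_concat by (rule block_pair_less) (use i j in auto)
  have cm: "concat lss ! m = lss ! i ! j" unfolding m_def using i j by (rule concat_nth_block)
  have l: "length \<rho>s = length lss" "length \<tau>ss = length lss" "length (\<tau>ss ! i) = length (lss ! i)"
    using \<rho> \<tau> i by (auto simp: list_all2_conv_all_nth)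
  have "map length \<tau>ss = map length lss"
    using \<tau> by (auto intro!: nth_equalityI simp: list_all2_conv_all_nth)
  then have ct: "concat \<tau>ss ! m = \<tau>ss ! i ! j"
    using concat_nth_block[of i \<tau>ss j] i j l unfolding m_def by simp
  have "lss ! i ! j = concat lss ! m" by (rule cm[symmetric])
  have bs: "block_start (map sum_list lss) i + q = block_start (concat lss) m + p"
    using i j unfolding qj m_def by (simp add: block_start_concat)
  have si: "\<sigma> i < length lss" using \<sigma> i by (simp add: permutes_nat_less)
  have ri: "\<rho>s ! i permutes {..<length (lss ! i)}" using \<rho> i by (auto simp: list_all2_conv_all_nth)
  then have rj: "(\<rho>s ! i) j < length (lss ! i)" using j by (simp add: permutes_nat_less)
  note inv = permutes_inv[OF \<sigma>]
  \<comment> \<open>The lengths in target order: \<open>?ls\<close> rearranges them inside each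
    outer block, \<open>?xs\<close> then rearranges the outer blocks. By
    \<open>permute_list_block_perm\<close> the concatenation of \<open>?xs\<close> is what
    \<open>inv ?P\<close> makes of the source lengths.\<close>
  let ?ls = "map2 (\<lambda>\<rho> ls. permute_list (inv \<rho>) ls) \<rho>s lss"
  let ?xs = "permute_list (inv \<sigma>) ?ls"
  have invl: "inv \<sigma> permutes {..<length ?ls}" using inv l by simp
  have inv\<rho>: "inv (\<rho>s ! k) permutes {..<length (lss ! k)}" if "k < length lss" for k
    using \<rho> that by (auto simp: list_all2_conv_all_nth intro: permutes_inv)
  have mls: "map length ?ls = map length lss" "map sum_list ?ls = map sum_list lss"
    using l inv\<rho> by (auto intro!: nth_equalityI)
  have "permute_list ?P (concat ?xs) = concat (map2 permute_list \<rho>s ?ls)"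
    using permute_list_block_perm[of \<sigma> ?ls \<rho>s] \<sigma> \<rho> l
    unfolding mls by (auto simp: list_all2_conv_all_nth)
  also have "map2 permute_list \<rho>s ?ls = lss"
    using l \<rho> by (auto intro!: nth_equalityI simp: list_all2_conv_all_nth)
  finally have pl: "permute_list ?P (concat ?xs) = concat lss" .
  have P: "?P permutes {..<length (concat lss)}"
    unfolding length_concat
    by (rule block_perm_permutes) (use \<sigma> \<rho> in \<open>auto simp: list_all2_conv_all_nth\<close>)
  have lx: "length (concat ?xs) = length (concat lss)" using pl by (metis length_permute_list)
  have pl': "permute_list (inv ?P) (concat lss) = concat ?xs"
    using pl P lx by (metis permute_list_inv(2))
  have xsi: "?xs ! \<sigma> i = permute_list (inv (\<rho>s ! i)) (lss ! i)"
    using inv si i l by (simp add: permute_list_nth permutes_inverses[OF \<sigma>])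
  have mlx: "map length ?xs = permute_list (inv \<sigma>) (map length lss)"
    by (simp only: permute_list_map[OF invl, symmetric] mls)
  have Pm: "?P m = block_start (map length ?xs) (\<sigma> i) + (\<rho>s ! i) j"
    unfolding m_def mlx using i j by (simp add: block_perm_pair)
  have "?l (block_start (concat lss) m + p) = block_start (concat ?xs) (?P m) + (\<tau>ss ! i ! j) p"
    using m p by (simp add: block_perm_pair cm ct pl')
  also have "block_start (concat ?xs) (?P m) = block_start (map sum_list ?xs) (\<sigma> i) +
      block_start (?xs ! \<sigma> i) ((\<rho>s ! i) j)"
    unfolding Pm by (rule block_start_concat) (use si l xsi rj in auto)
  also have "map sum_list ?xs = permute_list (inv \<sigma>) (map sum_list lss)"
    unfolding permute_list_map[OF invl, symmetric] mls ..
  also have "block_start (permute_list (inv \<sigma>) (map sum_list lss)) (\<sigma> i) +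
      block_start (?xs ! \<sigma> i) ((\<rho>s ! i) j) + (\<tau>ss ! i ! j) p =
      block_start (permute_list (inv \<sigma>) (map sum_list lss)) (\<sigma> i) +
      block_perm (\<rho>s ! i) (lss ! i) (\<tau>ss ! i) q"
    unfolding qj xsi using j p by (simp add: block_perm_pair)
  also have "\<dots> = ?r (block_start (map sum_list lss) i + q)"
    using i q l by (simp add: block_perm_pair)
  finally show "?l (block_start (map sum_list lss) i + q) = ?r (block_start (map sum_list lss) i + q)"
    unfolding bs .
next
  fix m assume "\<not> m < sum_list (map sum_list lss)"
  moreover have "sum_list (concat lss) = sum_list (map sum_list lss)"
    by (induction lss) auto
  ultimately show "?l m = ?r m" by (simp add: block_perm_outside)
qed

section \<open>Categories\<close>

text \<open>Composing with an inverse of \<open>e\<close> recovers \<open>x\<close> and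
  \<open>y\<close>. Equations about twisted 2-cells are reduced by it to equations after
  precomposition with a twist isomorphism.\<close>

lemma (in category) iso_ar_cancel_right:
  assumes "iso_ar C e" "x \<in> Ar C" "y \<in> Ar C" "Dom C x = Cod C e" "Dom C y = Cod C e"
    and "Cmp C x e = Cmp C y e"
  shows "x = y"
proof -
  obtain g where g: "e \<in> Ar C" "g \<in> Ar C" "Dom C g = Cod C e" "Cod C g = Dom C e"
      "Cmp C e g = Idn C (Cod C e)"
    using assms(1) unfolding iso_ar_def by blast
  have "z = Cmp C (Cmp C z e) g" if "z \<in> Ar C" "Dom C z = Cod C e" for z
    using that g Cmp_assoc[of g e z] Cmp_Idn_right[of z] by simp
  then show ?thesis using assms by metis
qed

lemma (in cat_functor) iso_ar_Fa:
  assumes "iso_ar C f"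
  shows "iso_ar D (Fa f)"
proof -
  obtain g where g: "f \<in> Ar C" "g \<in> Ar C" "Dom C g = Cod C f" "Cod C g = Dom C f"
      "Cmp C g f = Idn C (Dom C f)" "Cmp C f g = Idn C (Cod C f)"
    using assms unfolding iso_ar_def by blast
  show ?thesis
    unfolding iso_ar_def
    using g Fa_Cmp[of f g] Fa_Cmp[of g f]
    by (auto intro!: bexI[of _ "Fa g"] simp: Fa_Ar Dom_Fa Cod_Fa Fa_Idn C.Dom_Ob C.Cod_Ob)
qed

lemma prod_cat_simps [simp]:
  "Ob (prod_cat C D) = Ob C \<times> Ob D"
  "Ar (prod_cat C D) = Ar C \<times> Ar D"
  "Dom (prod_cat C D) (f, g) = (Dom C f, Dom D g)"
  "Cod (prod_cat C D) (f, g) = (Cod C f, Cod D g)"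
  "Idn (prod_cat C D) (x, y) = (Idn C x, Idn D y)"
  "Cmp (prod_cat C D) (f, g) (f', g') = (Cmp C f f', Cmp D g g')"
  by (simp_all add: prod_cat_def)

lemma category_prod_cat:
  assumes "category C" "category D"
  shows "category (prod_cat C D)"
proof -
  interpret C: category C by fact
  interpret D: category D by fact
  show ?thesis
    by unfold_locales
      (auto simp: C.Dom_Ob C.Cod_Ob C.Idn_Ar C.Dom_Idn C.Cod_Idn C.Cmp_Ar C.Dom_Cmp C.Cod_Cmp
        C.Cmp_Idn_left C.Cmp_Idn_right C.Cmp_assoc D.Dom_Ob D.Cod_Ob D.Idn_Ar D.Dom_Idn D.Cod_Idn
        D.Cmp_Ar D.Dom_Cmp D.Cod_Cmp D.Cmp_Idn_left D.Cmp_Idn_right D.Cmp_assoc)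
qed

lemma category_list_cat:
  assumes "\<And>C. C \<in> set Cs \<Longrightarrow> category C"
  shows "category (list_cat Cs)"
proof -
  have c: "category (Cs ! i)" if "i < length Cs" for i using assms that by simp
  have nth: "map2 h Cs xs ! i = h (Cs ! i) (xs ! i)" if "i < length Cs" "length xs = length Cs"
    for h :: "('a, 'b) cat \<Rightarrow> 'c \<Rightarrow> 'd" and xs i using that by simp
  have eq: "xs ! i = ys ! i" if "xs = ys" for xs ys :: "'b list" and i using that by simp
  show ?thesis
    by unfold_locales
      (auto simp: list_cat_def list_all2_conv_all_nth list_eq_iff_nth_eq c category.Dom_Ob
        category.Cod_Ob category.Idn_Ar category.Dom_Idn category.Cod_Idn category.Cmp_Ar
        category.Dom_Cmp category.Cod_Cmp category.Cmp_Idn_left category.Cmp_Idn_right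
        category.Cmp_assoc)
qed

section \<open>Cat-multicategories\<close>

lemma mhom_simps [simp]:
  "Ob (mhom M as b) = {f \<in> cells1 M. src M f = as \<and> tgt M f = b}"
  "Ar (mhom M as b) = {\<alpha> \<in> cells2 M. src2 M \<alpha> = as \<and> tgt2 M \<alpha> = b}"
  "Dom (mhom M as b) = Dom (cells M)"
  "Cod (mhom M as b) = Cod (cells M)"
  "Idn (mhom M as b) = Idn (cells M)"
  "Cmp (mhom M as b) = Cmp (cells M)"
  by (simp_all add: mhom_def)

text \<open>The axiom \<open>gam_functor\<close> speaks of a product of hom categories. Reading its
  objects and arrows as lists of cells with prescribed inputs and outputs allows later arguments to
  use \<open>composable1\<close> and \<open>composable2\<close> alone.\<close>

lemma list_cat_mhom:
  assumes "length ass = length bs"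
  shows "Ob (list_cat (map2 (mhom M) ass bs)) =
      {gs. set gs \<subseteq> cells1 M \<and> map (src M) gs = ass \<and> map (tgt M) gs = bs}"
    and "Ar (list_cat (map2 (mhom M) ass bs)) =
      {\<beta>s. set \<beta>s \<subseteq> cells2 M \<and> map (src2 M) \<beta>s = ass \<and> map (tgt2 M) \<beta>s = bs}"
    and "length \<beta>s = length bs \<Longrightarrow>
      Dom (list_cat (map2 (mhom M) ass bs)) \<beta>s = map (Dom (cells M)) \<beta>s"
    and "length \<beta>s = length bs \<Longrightarrow>
      Cod (list_cat (map2 (mhom M) ass bs)) \<beta>s = map (Cod (cells M)) \<beta>s"
    and "length gs = length bs \<Longrightarrow>
      Idn (list_cat (map2 (mhom M) ass bs)) gs = map (Idn (cells M)) gs"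
    and "\<lbrakk>length \<beta>s = length bs; length \<alpha>s = length bs\<rbrakk> \<Longrightarrow>
      Cmp (list_cat (map2 (mhom M) ass bs)) \<beta>s \<alpha>s = map2 (Cmp (cells M)) \<beta>s \<alpha>s"
proof -
  have "list_all2 (\<lambda>f C. f \<in> Ob C) gs (map2 (mhom M) ass bs) \<longleftrightarrow>
      set gs \<subseteq> cells1 M \<and> map (src M) gs = ass \<and> map (tgt M) gs = bs" for gs
    using assms by (induction ass bs arbitrary: gs rule: list_induct2) (auto simp: list_all2_Cons2)
  then show "Ob (list_cat (map2 (mhom M) ass bs)) =
      {gs. set gs \<subseteq> cells1 M \<and> map (src M) gs = ass \<and> map (tgt M) gs = bs}"
    by (simp add: list_cat_def)
  have "list_all2 (\<lambda>\<beta> C. \<beta> \<in> Ar C) \<beta>s (map2 (mhom M) ass bs) \<longleftrightarrow>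
      set \<beta>s \<subseteq> cells2 M \<and> map (src2 M) \<beta>s = ass \<and> map (tgt2 M) \<beta>s = bs" for \<beta>s
    using assms by (induction ass bs arbitrary: \<beta>s rule: list_induct2) (auto simp: list_all2_Cons2)
  then show "Ar (list_cat (map2 (mhom M) ass bs)) =
      {\<beta>s. set \<beta>s \<subseteq> cells2 M \<and> map (src2 M) \<beta>s = ass \<and> map (tgt2 M) \<beta>s = bs}"
    by (simp add: list_cat_def)
qed (use assms in \<open>auto simp: list_cat_def list_eq_iff_nth_eq\<close>)

lemma composable1D:
  assumes "composable1 M f gs"
  shows "f \<in> cells1 M" "set gs \<subseteq> cells1 M" "map (tgt M) gs = src M f" "length gs = arity M f"
  using assms unfolding composable1_def by (auto intro: map_eq_imp_length_eq[of "tgt M" _ id])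

lemma composable2D:
  assumes "composable2 M \<alpha> \<beta>s"
  shows "\<alpha> \<in> cells2 M" "set \<beta>s \<subseteq> cells2 M" "map (tgt2 M) \<beta>s = src2 M \<alpha>"
    "length \<beta>s = length (src2 M \<alpha>)"
  using assms unfolding composable2_def by (auto intro: map_eq_imp_length_eq[of "tgt2 M" _ id])

text \<open>Stated for a bare category \<open>C\<close> so that it also serves in
  \<open>cat_multicategoryI\<close>, before \<open>M\<close> is known to be a multicategory.\<close>

lemma (in category) category_mhom:
  assumes "cells M = C"
    and "\<And>\<alpha>. \<alpha> \<in> Ar C \<Longrightarrow> src M (Cod C \<alpha>) = src M (Dom C \<alpha>)"
    and "\<And>\<alpha>. \<alpha> \<in> Ar C \<Longrightarrow> tgt M (Cod C \<alpha>) = tgt M (Dom C \<alpha>)"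
  shows "category (mhom M as b)"
  by unfold_locales
    (auto simp: assms Dom_Ob Cod_Ob Idn_Ar Dom_Idn Cod_Idn Cmp_Ar Dom_Cmp Cod_Cmp Cmp_Idn_left
      Cmp_Idn_right Cmp_assoc)

sublocale cat_multicategory \<subseteq> cells: category "cells M"
  by (rule cells_category)

section \<open>Consequences of the axioms for single cells\<close>

context cat_multicategory
begin

lemma mhom_category: "category (mhom M as b)"
  by (rule cells.category_mhom) (auto simp: src_Cod tgt_Cod)

lemma src_in_objs: "\<lbrakk>f \<in> cells1 M; a \<in> set (src M f)\<rbrakk> \<Longrightarrow> a \<in> objs M"
  using src_objs by auto

lemma srcs_lists: "set gs \<subseteq> cells1 M \<Longrightarrow> map (src M) gs \<in> lists (lists (objs M))"
  using src_objs by (induction gs) auto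

lemma srcs2_lists: "set \<beta>s \<subseteq> cells2 M \<Longrightarrow> map (src2 M) \<beta>s \<in> lists (lists (objs M))"
  using src_objs cells.Dom_Ob by (induction \<beta>s) auto

lemma act1_cell:
  assumes "f \<in> cells1 M" "\<sigma> permutes {..<arity M f}"
  shows act1_cells1: "act1 M f \<sigma> \<in> cells1 M"
    and src_act1: "src M (act1 M f \<sigma>) = permute_list \<sigma> (src M f)"
    and tgt_act1: "tgt M (act1 M f \<sigma>) = tgt M f"
proof -
  interpret iso_functor "mhom M (src M f) (tgt M f)" "mhom M (permute_list \<sigma> (src M f)) (tgt M f)"
    "\<lambda>f. act1 M f \<sigma>" "\<lambda>\<alpha>. act2 M \<alpha> \<sigma>"
    by (rule act_iso) (use assms src_objs tgt_objs in auto)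
  show "act1 M f \<sigma> \<in> cells1 M" "src M (act1 M f \<sigma>) = permute_list \<sigma> (src M f)"
    "tgt M (act1 M f \<sigma>) = tgt M f"
    using Fo_Ob[of f] assms by auto
qed

lemma act2_cell:
  assumes "\<alpha> \<in> cells2 M" "\<sigma> permutes {..<length (src2 M \<alpha>)}"
  shows act2_cells2: "act2 M \<alpha> \<sigma> \<in> cells2 M"
    and Dom_act2: "Dom (cells M) (act2 M \<alpha> \<sigma>) = act1 M (Dom (cells M) \<alpha>) \<sigma>"
    and Cod_act2: "Cod (cells M) (act2 M \<alpha> \<sigma>) = act1 M (Cod (cells M) \<alpha>) \<sigma>"
    and act2_Cmp: "\<lbrakk>\<beta> \<in> cells2 M; Dom (cells M) \<beta> = Cod (cells M) \<alpha>\<rbrakk> \<Longrightarrow>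
      act2 M (Cmp (cells M) \<beta> \<alpha>) \<sigma> = Cmp (cells M) (act2 M \<beta> \<sigma>) (act2 M \<alpha> \<sigma>)"
proof -
  interpret iso_functor "mhom M (src2 M \<alpha>) (tgt2 M \<alpha>)"
    "mhom M (permute_list \<sigma> (src2 M \<alpha>)) (tgt2 M \<alpha>)" "\<lambda>f. act1 M f \<sigma>" "\<lambda>\<alpha>. act2 M \<alpha> \<sigma>"
    by (rule act_iso) (use assms src_objs tgt_objs cells.Dom_Ob in auto)
  show "act2 M \<alpha> \<sigma> \<in> cells2 M" "Dom (cells M) (act2 M \<alpha> \<sigma>) = act1 M (Dom (cells M) \<alpha>) \<sigma>"
    "Cod (cells M) (act2 M \<alpha> \<sigma>) = act1 M (Cod (cells M) \<alpha>) \<sigma>"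
    using Fa_Ar[of \<alpha>] Dom_Fa[of \<alpha>] Cod_Fa[of \<alpha>] assms by auto
  show "act2 M (Cmp (cells M) \<beta> \<alpha>) \<sigma> = Cmp (cells M) (act2 M \<beta> \<sigma>) (act2 M \<alpha> \<sigma>)"
    if "\<beta> \<in> cells2 M" "Dom (cells M) \<beta> = Cod (cells M) \<alpha>"
    using Fa_Cmp[of \<alpha> \<beta>] assms that by (simp add: src_Cod tgt_Cod)
qed

lemma act2_Idn:
  assumes "f \<in> cells1 M" "\<sigma> permutes {..<arity M f}"
  shows "act2 M (Idn (cells M) f) \<sigma> = Idn (cells M) (act1 M f \<sigma>)"
proof -
  interpret iso_functor "mhom M (src M f) (tgt M f)" "mhom M (permute_list \<sigma> (src M f)) (tgt M f)"
    "\<lambda>f. act1 M f \<sigma>" "\<lambda>\<alpha>. act2 M \<alpha> \<sigma>"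
    by (rule act_iso) (use assms src_objs tgt_objs in auto)
  show ?thesis using Fa_Idn[of f] assms by simp
qed

lemma act1_inv [simp]:
  assumes "f \<in> cells1 M" "\<sigma> permutes {..<arity M f}"
  shows "act1 M (act1 M f (inv \<sigma>)) \<sigma> = f" "act1 M (act1 M f \<sigma>) (inv \<sigma>) = f"
  using assms act1_act1[of f "inv \<sigma>" \<sigma>] act1_act1[of f \<sigma> "inv \<sigma>"] permutes_inv[OF assms(2)]
    permutes_inv_o[OF assms(2)] by (simp_all add: act1_id)

lemma act2_inv [simp]:
  assumes "\<alpha> \<in> cells2 M" "\<sigma> permutes {..<length (src2 M \<alpha>)}"
  shows "act2 M (act2 M \<alpha> (inv \<sigma>)) \<sigma> = \<alpha>" "act2 M (act2 M \<alpha> \<sigma>) (inv \<sigma>) = \<alpha>"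
  using assms act2_act2[of \<alpha> "inv \<sigma>" \<sigma>] act2_act2[of \<alpha> \<sigma> "inv \<sigma>"] permutes_inv[OF assms(2)]
    permutes_inv_o[OF assms(2)] by (simp_all add: act2_id)

lemma munit_cell:
  assumes "a \<in> objs M"
  shows "munit M a \<in> cells1 M" "src M (munit M a) = [a]" "tgt M (munit M a) = a"
  using munit_hom[OF assms] by auto

lemma gam1_cell:
  assumes "composable1 M f gs"
  shows gam1_cells1: "gam1 M f gs \<in> cells1 M"
    and src_gam1: "src M (gam1 M f gs) = concat (map (src M) gs)"
    and tgt_gam1: "tgt M (gam1 M f gs) = tgt M f"
    and gam2_Idn: "gam2 M (Idn (cells M) f) (map (Idn (cells M)) gs) = Idn (cells M) (gam1 M f gs)"
proof -
  note c = composable1D[OF assms]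
  have len: "length (map (src M) gs) = length (src M f)" using c by simp
  interpret cat_functor "prod_cat (mhom M (src M f) (tgt M f))
      (list_cat (map2 (mhom M) (map (src M) gs) (src M f)))"
    "mhom M (concat (map (src M) gs)) (tgt M f)" "\<lambda>(f, gs). gam1 M f gs" "\<lambda>(\<alpha>, \<beta>s). gam2 M \<alpha> \<beta>s"
    by (rule gam_functor) (use c src_objs tgt_objs srcs_lists in auto)
  show "gam1 M f gs \<in> cells1 M" "src M (gam1 M f gs) = concat (map (src M) gs)"
    "tgt M (gam1 M f gs) = tgt M f"
    "gam2 M (Idn (cells M) f) (map (Idn (cells M)) gs) = Idn (cells M) (gam1 M f gs)"
    using Fo_Ob[of "(f, gs)"] Fa_Idn[of "(f, gs)"] c by (auto simp: list_cat_mhom[OF len])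
qed

lemma gam2_cell:
  assumes "composable2 M \<alpha> \<beta>s"
  shows gam2_cells2: "gam2 M \<alpha> \<beta>s \<in> cells2 M"
    and Dom_gam2: "Dom (cells M) (gam2 M \<alpha> \<beta>s) = gam1 M (Dom (cells M) \<alpha>) (map (Dom (cells M)) \<beta>s)"
    and Cod_gam2: "Cod (cells M) (gam2 M \<alpha> \<beta>s) = gam1 M (Cod (cells M) \<alpha>) (map (Cod (cells M)) \<beta>s)"
    and gam2_Cmp: "\<lbrakk>composable2 M \<alpha>' \<beta>s'; Dom (cells M) \<alpha>' = Cod (cells M) \<alpha>;
        map (Dom (cells M)) \<beta>s' = map (Cod (cells M)) \<beta>s\<rbrakk> \<Longrightarrow>
      gam2 M (Cmp (cells M) \<alpha>' \<alpha>) (map2 (Cmp (cells M)) \<beta>s' \<beta>s) =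
        Cmp (cells M) (gam2 M \<alpha>' \<beta>s') (gam2 M \<alpha> \<beta>s)"
proof -
  note c = composable2D[OF assms]
  have len: "length (map (src2 M) \<beta>s) = length (src2 M \<alpha>)" using c by simp
  interpret cat_functor "prod_cat (mhom M (src2 M \<alpha>) (tgt2 M \<alpha>))
      (list_cat (map2 (mhom M) (map (src2 M) \<beta>s) (src2 M \<alpha>)))"
    "mhom M (concat (map (src2 M) \<beta>s)) (tgt2 M \<alpha>)" "\<lambda>(f, gs). gam1 M f gs" "\<lambda>(\<alpha>, \<beta>s). gam2 M \<alpha> \<beta>s"
    by (rule gam_functor) (use c src_objs tgt_objs cells.Dom_Ob srcs2_lists in auto)
  show "gam2 M \<alpha> \<beta>s \<in> cells2 M"
    "Dom (cells M) (gam2 M \<alpha> \<beta>s) = gam1 M (Dom (cells M) \<alpha>) (map (Dom (cells M)) \<beta>s)"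
    "Cod (cells M) (gam2 M \<alpha> \<beta>s) = gam1 M (Cod (cells M) \<alpha>) (map (Cod (cells M)) \<beta>s)"
    using Fa_Ar[of "(\<alpha>, \<beta>s)"] Dom_Fa[of "(\<alpha>, \<beta>s)"] Cod_Fa[of "(\<alpha>, \<beta>s)"] c
    by (auto simp: list_cat_mhom[OF len])
  assume c': "composable2 M \<alpha>' \<beta>s'" and d: "Dom (cells M) \<alpha>' = Cod (cells M) \<alpha>"
    "map (Dom (cells M)) \<beta>s' = map (Cod (cells M)) \<beta>s"
  note c'' = composable2D[OF c']
  have l': "length \<beta>s' = length \<beta>s" using d(2) by (rule map_eq_imp_length_eq)
  \<comment> \<open>With \<open>h\<close> instantiated to \<open>src M\<close> and
    \<open>tgt M\<close>, this places the primed 2-cells in the same hom categories as the unprimed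
    ones.\<close>
  have m: "map (\<lambda>\<beta>. h (Dom (cells M) \<beta>)) \<beta>s' = map (\<lambda>\<beta>. h (Cod (cells M) \<beta>)) \<beta>s"
    for h :: "'f \<Rightarrow> 'z"
    using arg_cong[OF d(2), of "map h"] by (simp add: o_def)
  have m2: "map (\<lambda>\<beta>. src M (Cod (cells M) \<beta>)) \<beta>s = map (src2 M) \<beta>s"
    "map (\<lambda>\<beta>. tgt M (Cod (cells M) \<beta>)) \<beta>s = map (tgt2 M) \<beta>s"
    using c(2) by (auto simp: src_Cod tgt_Cod)
  show "gam2 M (Cmp (cells M) \<alpha>' \<alpha>) (map2 (Cmp (cells M)) \<beta>s' \<beta>s) =
      Cmp (cells M) (gam2 M \<alpha>' \<beta>s') (gam2 M \<alpha> \<beta>s)"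
    using Fa_Cmp[of "(\<alpha>, \<beta>s)" "(\<alpha>', \<beta>s')"] c c'' d l' m[of "src M"] m[of "tgt M"]
    by (simp add: list_cat_mhom[OF len] src_Cod tgt_Cod m2)
qed

lemma composable2_Dom:
  assumes "composable2 M \<alpha> \<beta>s"
  shows "composable1 M (Dom (cells M) \<alpha>) (map (Dom (cells M)) \<beta>s)"
  using composable2D[OF assms] by (auto simp: composable1_def cells.Dom_Ob subset_eq comp_def)

lemma composable2_Cod:
  assumes "composable2 M \<alpha> \<beta>s"
  shows "composable1 M (Cod (cells M) \<alpha>) (map (Cod (cells M)) \<beta>s)"
proof -
  note c = composable2D[OF assms]
  have "map (\<lambda>\<beta>. tgt M (Cod (cells M) \<beta>)) \<beta>s = map (tgt2 M) \<beta>s"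
    using c(2) by (auto simp: tgt_Cod)
  then show ?thesis using c by (auto simp: composable1_def cells.Cod_Ob subset_eq src_Cod o_def)
qed

lemma composable2_Idn:
  "composable1 M f gs \<Longrightarrow> composable2 M (Idn (cells M) f) (map (Idn (cells M)) gs)"
  unfolding composable1_def composable2_def
  by (auto simp: cells.Idn_Ar cells.Dom_Idn subset_eq list_eq_iff_nth_eq)

lemma src2_gam2: "composable2 M \<alpha> \<beta>s \<Longrightarrow> src2 M (gam2 M \<alpha> \<beta>s) = concat (map (src2 M) \<beta>s)"
  using src_gam1[OF composable2_Dom] by (simp add: Dom_gam2 o_def)

end

text \<open>A presentation by conditions on single cells, easier to check for E\<Sigma> and for
  products. Bijectivity of the action need not be supplied: acting with \<open>inv \<sigma>\<close>
  gives the inverse, by the laws for composites and identities.\<close>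

lemma cat_multicategoryI:
  fixes M :: "('o, 'f, 'a) mcat"
  assumes "category (cells M)"
    and src_objs: "\<And>f. f \<in> cells1 M \<Longrightarrow> src M f \<in> lists (objs M)"
    and tgt_objs: "\<And>f. f \<in> cells1 M \<Longrightarrow> tgt M f \<in> objs M"
    and src_Cod: "\<And>\<alpha>. \<alpha> \<in> cells2 M \<Longrightarrow> src M (Cod (cells M) \<alpha>) = src M (Dom (cells M) \<alpha>)"
    and tgt_Cod: "\<And>\<alpha>. \<alpha> \<in> cells2 M \<Longrightarrow> tgt M (Cod (cells M) \<alpha>) = tgt M (Dom (cells M) \<alpha>)"
    and act1: "\<And>f \<sigma>. \<lbrakk>f \<in> cells1 M; \<sigma> permutes {..<arity M f}\<rbrakk> \<Longrightarrow>
      act1 M f \<sigma> \<in> cells1 M \<and> src M (act1 M f \<sigma>) = permute_list \<sigma> (src M f) \<and>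
      tgt M (act1 M f \<sigma>) = tgt M f"
    and act2: "\<And>\<alpha> \<sigma>. \<lbrakk>\<alpha> \<in> cells2 M; \<sigma> permutes {..<length (src2 M \<alpha>)}\<rbrakk> \<Longrightarrow>
      act2 M \<alpha> \<sigma> \<in> cells2 M \<and> Dom (cells M) (act2 M \<alpha> \<sigma>) = act1 M (Dom (cells M) \<alpha>) \<sigma> \<and>
      Cod (cells M) (act2 M \<alpha> \<sigma>) = act1 M (Cod (cells M) \<alpha>) \<sigma>"
    and act2_Idn: "\<And>f \<sigma>. \<lbrakk>f \<in> cells1 M; \<sigma> permutes {..<arity M f}\<rbrakk> \<Longrightarrow>
      act2 M (Idn (cells M) f) \<sigma> = Idn (cells M) (act1 M f \<sigma>)"
    and act2_Cmp: "\<And>\<alpha> \<beta> \<sigma>. \<lbrakk>\<alpha> \<in> cells2 M; \<beta> \<in> cells2 M; Dom (cells M) \<beta> = Cod (cells M) \<alpha>;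
        \<sigma> permutes {..<length (src2 M \<alpha>)}\<rbrakk> \<Longrightarrow>
      act2 M (Cmp (cells M) \<beta> \<alpha>) \<sigma> = Cmp (cells M) (act2 M \<beta> \<sigma>) (act2 M \<alpha> \<sigma>)"
    and act1_act1: "\<And>f \<sigma> \<tau>. \<lbrakk>f \<in> cells1 M; \<sigma> permutes {..<arity M f}; \<tau> permutes {..<arity M f}\<rbrakk> \<Longrightarrow>
      act1 M (act1 M f \<sigma>) \<tau> = act1 M f (\<sigma> \<circ> \<tau>)"
    and act2_act2: "\<And>\<alpha> \<sigma> \<tau>. \<lbrakk>\<alpha> \<in> cells2 M; \<sigma> permutes {..<length (src2 M \<alpha>)};
        \<tau> permutes {..<length (src2 M \<alpha>)}\<rbrakk> \<Longrightarrow>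
      act2 M (act2 M \<alpha> \<sigma>) \<tau> = act2 M \<alpha> (\<sigma> \<circ> \<tau>)"
    and act1_id: "\<And>f. f \<in> cells1 M \<Longrightarrow> act1 M f id = f"
    and act2_id: "\<And>\<alpha>. \<alpha> \<in> cells2 M \<Longrightarrow> act2 M \<alpha> id = \<alpha>"
    and munit: "\<And>a. a \<in> objs M \<Longrightarrow>
      munit M a \<in> cells1 M \<and> src M (munit M a) = [a] \<and> tgt M (munit M a) = a"
    and gam1: "\<And>f gs. composable1 M f gs \<Longrightarrow>
      gam1 M f gs \<in> cells1 M \<and> src M (gam1 M f gs) = concat (map (src M) gs) \<and>
      tgt M (gam1 M f gs) = tgt M f"
    and gam2: "\<And>\<alpha> \<beta>s. composable2 M \<alpha> \<beta>s \<Longrightarrow>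
      gam2 M \<alpha> \<beta>s \<in> cells2 M \<and>
      Dom (cells M) (gam2 M \<alpha> \<beta>s) = gam1 M (Dom (cells M) \<alpha>) (map (Dom (cells M)) \<beta>s) \<and>
      Cod (cells M) (gam2 M \<alpha> \<beta>s) = gam1 M (Cod (cells M) \<alpha>) (map (Cod (cells M)) \<beta>s)"
    and gam2_Idn: "\<And>f gs. composable1 M f gs \<Longrightarrow>
      gam2 M (Idn (cells M) f) (map (Idn (cells M)) gs) = Idn (cells M) (gam1 M f gs)"
    and gam2_Cmp: "\<And>\<alpha> \<beta>s \<alpha>' \<beta>s'. \<lbrakk>composable2 M \<alpha> \<beta>s; composable2 M \<alpha>' \<beta>s';
        Dom (cells M) \<alpha>' = Cod (cells M) \<alpha>; map (Dom (cells M)) \<beta>s' = map (Cod (cells M)) \<beta>s\<rbrakk> \<Longrightarrow>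
      gam2 M (Cmp (cells M) \<alpha>' \<alpha>) (map2 (Cmp (cells M)) \<beta>s' \<beta>s) =
        Cmp (cells M) (gam2 M \<alpha>' \<beta>s') (gam2 M \<alpha> \<beta>s)"
    and "\<And>f. f \<in> cells1 M \<Longrightarrow> gam1 M (munit M (tgt M f)) [f] = f"
    and "\<And>f. f \<in> cells1 M \<Longrightarrow> gam1 M f (map (munit M) (src M f)) = f"
    and "\<And>\<alpha>. \<alpha> \<in> cells2 M \<Longrightarrow> gam2 M (Idn (cells M) (munit M (tgt2 M \<alpha>))) [\<alpha>] = \<alpha>"
    and "\<And>\<alpha>. \<alpha> \<in> cells2 M \<Longrightarrow>
      gam2 M \<alpha> (map (\<lambda>a. Idn (cells M) (munit M a)) (src2 M \<alpha>)) = \<alpha>"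
    and "\<And>f gs hss. \<lbrakk>composable1 M f gs; list_all2 (composable1 M) gs hss\<rbrakk> \<Longrightarrow>
      gam1 M (gam1 M f gs) (concat hss) = gam1 M f (map2 (gam1 M) gs hss)"
    and "\<And>\<alpha> \<beta>s \<delta>ss. \<lbrakk>composable2 M \<alpha> \<beta>s; list_all2 (composable2 M) \<beta>s \<delta>ss\<rbrakk> \<Longrightarrow>
      gam2 M (gam2 M \<alpha> \<beta>s) (concat \<delta>ss) = gam2 M \<alpha> (map2 (gam2 M) \<beta>s \<delta>ss)"
    and "\<And>f gs \<sigma>. \<lbrakk>composable1 M f gs; \<sigma> permutes {..<arity M f}\<rbrakk> \<Longrightarrow>
      gam1 M (act1 M f \<sigma>) (permute_list \<sigma> gs) =
        act1 M (gam1 M f gs) (top_perm \<sigma> (map (arity M) gs))"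
    and "\<And>\<alpha> \<beta>s \<sigma>. \<lbrakk>composable2 M \<alpha> \<beta>s; \<sigma> permutes {..<length (src2 M \<alpha>)}\<rbrakk> \<Longrightarrow>
      gam2 M (act2 M \<alpha> \<sigma>) (permute_list \<sigma> \<beta>s) =
        act2 M (gam2 M \<alpha> \<beta>s) (top_perm \<sigma> (map (\<lambda>\<beta>. length (src2 M \<beta>)) \<beta>s))"
    and "\<And>f gs \<tau>s. \<lbrakk>composable1 M f gs;
        list_all2 (\<lambda>g \<tau>. \<tau> permutes {..<arity M g}) gs \<tau>s\<rbrakk> \<Longrightarrow>
      gam1 M f (map2 (act1 M) gs \<tau>s) = act1 M (gam1 M f gs) (bottom_perm (map (arity M) gs) \<tau>s)"
    and "\<And>\<alpha> \<beta>s \<tau>s. \<lbrakk>composable2 M \<alpha> \<beta>s;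
        list_all2 (\<lambda>\<beta> \<tau>. \<tau> permutes {..<length (src2 M \<beta>)}) \<beta>s \<tau>s\<rbrakk> \<Longrightarrow>
      gam2 M \<alpha> (map2 (act2 M) \<beta>s \<tau>s) =
        act2 M (gam2 M \<alpha> \<beta>s) (bottom_perm (map (\<lambda>\<beta>. length (src2 M \<beta>)) \<beta>s) \<tau>s)"
  shows "cat_multicategory M"
proof -
  interpret cells: category "cells M" by fact
  have hom: "category (mhom M as b)" for as b
    by (rule cells.category_mhom) (auto simp: src_Cod tgt_Cod)
  have act: "cat_functor (mhom M as b) (mhom M (permute_list \<sigma> as) b)
        (\<lambda>f. act1 M f \<sigma>) (\<lambda>\<alpha>. act2 M \<alpha> \<sigma>)" if "\<sigma> permutes {..<length as}" for as b \<sigma>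
    by (intro cat_functor.intro cat_functor_axioms.intro hom)
      (use that act1 act2 in \<open>auto simp: act2_Idn act2_Cmp cells.Dom_Ob\<close>)
  have act_iso: "iso_functor (mhom M as b) (mhom M (permute_list \<sigma> as) b)
        (\<lambda>f. act1 M f \<sigma>) (\<lambda>\<alpha>. act2 M \<alpha> \<sigma>)" if p: "\<sigma> permutes {..<length as}" for as b \<sigma>
  proof (intro iso_functor.intro iso_functor_axioms.intro act p)
    note pi = permutes_inv[OF p] and po = permutes_inv_o[OF p] and pl = permute_list_inv[OF p]
    show "bij_betw (\<lambda>f. act1 M f \<sigma>) (Ob (mhom M as b)) (Ob (mhom M (permute_list \<sigma> as) b))"
      by (rule bij_betw_byWitness[where f' = "\<lambda>f. act1 M f (inv \<sigma>)"])
        (use p pi po pl in \<open>auto simp: act1 act1_act1 act1_id\<close>)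
    show "bij_betw (\<lambda>\<alpha>. act2 M \<alpha> \<sigma>) (Ar (mhom M as b)) (Ar (mhom M (permute_list \<sigma> as) b))"
      by (rule bij_betw_byWitness[where f' = "\<lambda>f. act2 M f (inv \<sigma>)"])
        (use p pi po pl in \<open>auto simp: act1 act2 act2_act2 act2_id cells.Dom_Ob\<close>)
  qed
  have gam: "cat_functor (prod_cat (mhom M bs c) (list_cat (map2 (mhom M) ass bs)))
        (mhom M (concat ass) c) (\<lambda>(f, gs). gam1 M f gs) (\<lambda>(\<alpha>, \<beta>s). gam2 M \<alpha> \<beta>s)"
    if l: "length ass = length bs" for ass bs c
  proof -
    note lc = list_cat_mhom[OF l]
    let ?C = "prod_cat (mhom M bs c) (list_cat (map2 (mhom M) ass bs))"
    \<comment> \<open>An object of the product category determines \<open>ass\<close>,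
      \<open>bs\<close> and \<open>c\<close>, so the assumptions about composable cells cover all
      cases of the functor.\<close>
    have 1: "composable1 M f gs \<and> length gs = length bs \<and> ass = map (src M) gs \<and> bs = src M f \<and> c = tgt M f"
      if "(f, gs) \<in> Ob ?C" for f gs
      using that l by (auto simp: composable1_def lc)
    have 2: "composable2 M f gs \<and> length gs = length bs \<and> ass = map (src2 M) gs \<and> bs = src2 M f \<and>
        c = tgt2 M f" if "(f, gs) \<in> Ar ?C" for f gs
      using that l by (auto simp: composable2_def lc)
    have 3: "composable1 M (Dom (cells M) f) (map (Dom (cells M)) gs)" if "composable2 M f gs" for f gs
      using composable2D[OF that] by (auto simp: composable1_def cells.Dom_Ob subset_eq comp_def)
    show ?thesis
    proof (intro cat_functor.intro cat_functor_axioms.intro category_prod_cat hom category_list_cat)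
    fix x :: "'f \<times> 'f list"
    obtain f gs where x: "x = (f, gs)" by (cases x)
    {
      assume "x \<in> Ob ?C"
      with x have c: "composable1 M f gs" "length gs = length bs" "ass = map (src M) gs" "bs = src M f"
        "c = tgt M f" using 1 by blast+
      show "(case x of (f, gs) \<Rightarrow> gam1 M f gs) \<in> Ob (mhom M (concat ass) c)"
        using c gam1[OF c(1)] x by simp
      show "(case Idn ?C x of (f, gs) \<Rightarrow> gam2 M f gs) =
          Idn (mhom M (concat ass) c) (case x of (f, gs) \<Rightarrow> gam1 M f gs)"
        using c(2) gam2_Idn[OF c(1)] x by (simp add: lc)
    }
  next
    fix x :: "'a \<times> 'a list"
    obtain \<alpha> \<beta>s where x: "x = (\<alpha>, \<beta>s)" by (cases x)
    {
      assume "x \<in> Ar ?C"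
      with x have c: "composable2 M \<alpha> \<beta>s" "length \<beta>s = length bs" "ass = map (src2 M) \<beta>s"
        "bs = src2 M \<alpha>" "c = tgt2 M \<alpha>" using 2 by blast+
      note g = gam2[OF c(1)] gam1[OF 3[OF c(1)]]
      show "(case x of (\<alpha>, \<beta>s) \<Rightarrow> gam2 M \<alpha> \<beta>s) \<in> Ar (mhom M (concat ass) c)"
        using g c x by (simp add: o_def)
      show "Dom (mhom M (concat ass) c) (case x of (f, gs) \<Rightarrow> gam2 M f gs) =
          (case Dom ?C x of (f, gs) \<Rightarrow> gam1 M f gs)"
        using g c(2) x by (simp add: lc)
      show "Cod (mhom M (concat ass) c) (case x of (f, gs) \<Rightarrow> gam2 M f gs) =
          (case Cod ?C x of (f, gs) \<Rightarrow> gam1 M f gs)"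
        using g c(2) x by (simp add: lc)
    }
  next
    show "(case Cmp ?C y x of (f, gs) \<Rightarrow> gam2 M f gs) =
        Cmp (mhom M (concat ass) c) (case y of (f, gs) \<Rightarrow> gam2 M f gs) (case x of (f, gs) \<Rightarrow> gam2 M f gs)"
      if "x \<in> Ar ?C" "y \<in> Ar ?C" "Dom ?C y = Cod ?C x" for x y
    proof -
      obtain \<alpha> \<beta>s \<alpha>' \<beta>s' where xy: "x = (\<alpha>, \<beta>s)" "y = (\<alpha>', \<beta>s')" by (cases x, cases y)
      have c: "composable2 M \<alpha> \<beta>s" "composable2 M \<alpha>' \<beta>s'" "length \<beta>s = length bs"
        "length \<beta>s' = length bs" using 2 that xy by blast+
      have "Dom (cells M) \<alpha>' = Cod (cells M) \<alpha>" "map (Dom (cells M)) \<beta>s' = map (Cod (cells M)) \<beta>s"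
        using that(3) c(3,4) by (simp_all add: xy lc)
      then show ?thesis using gam2_Cmp[OF c(1,2)] c(3,4) by (simp add: xy lc)
    qed
  qed (auto simp: hom)
  qed
  show ?thesis
    by (rule cat_multicategory.intro) (use assms act_iso gam in auto)
qed

text \<open>\<open>top_perm\<close> expects the arities in the order before \<sigma> acts, whereas
  \<open>block_perm\<close> expects the lengths of its own source blocks; the reindexing by
  \<open>inv \<sigma>\<close> converts between the two conventions.\<close>

lemma top_perm_eq:
  assumes "\<sigma> permutes {..<length ks}"
  shows "top_perm \<sigma> (permute_list (inv \<sigma>) ks) = block_perm \<sigma> ks (replicate (length ks) id)"
  using assms by (simp add: top_perm_def)

lemma top_perm_permutes:
  assumes "\<sigma> permutes {..<length ks}"
  shows "top_perm \<sigma> ks permutes {..<sum_list ks}"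
proof -
  have "top_perm \<sigma> ks permutes {..<sum_list (permute_list \<sigma> ks)}"
    unfolding top_perm_def using assms
    by (intro block_perm_permutes) (auto simp: list_all2_conv_all_nth permutes_id)
  then show ?thesis using assms by simp
qed

lemma bottom_perm_permutes:
  "list_all2 (\<lambda>\<tau> k. \<tau> permutes {..<k}) \<tau>s ks \<Longrightarrow> bottom_perm ks \<tau>s permutes {..<sum_list ks}"
  unfolding bottom_perm_def by (rule block_perm_permutes) (simp_all add: permutes_id)

text \<open>A block permutation first permutes inside the blocks and then moves whole blocks.
  Through this factorisation top and bottom equivariance combine in \<open>gam1_act1\<close>, and
  \<open>psym_top\<close> and \<open>psym_bottom\<close> combine in
  \<open>twist_iso_gam1\<close>.\<close>

lemma top_perm_bottom_perm:
  assumes \<sigma>: "\<sigma> permutes {..<length ks}"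
    and \<tau>: "list_all2 (\<lambda>\<tau> k. \<tau> permutes {..<k}) \<tau>s ks"
  shows "top_perm \<sigma> (permute_list (inv \<sigma>) ks) \<circ> bottom_perm ks \<tau>s = block_perm \<sigma> ks \<tau>s"
proof -
  have l: "length \<tau>s = length ks" using \<tau> by (rule list_all2_lengthD)
  have "block_perm \<sigma> (permute_list (inv id) ks) (replicate (length ks) id) \<circ> block_perm id ks \<tau>s =
      block_perm (\<sigma> \<circ> id) ks (map2 (\<circ>) (permute_list id (replicate (length ks) id)) \<tau>s)"
    by (rule block_perm_comp) (use \<sigma> \<tau> l in \<open>simp_all add: permutes_id\<close>)
  moreover have "map2 (\<circ>) (replicate (length ks) id) \<tau>s = \<tau>s"
    using l by (auto intro!: nth_equalityI)
  ultimately show ?thesis by (simp add: top_perm_eq[OF \<sigma>] bottom_perm_def)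
qed

lemma top_perm_singletons: "\<sigma> permutes {..<n} \<Longrightarrow> top_perm \<sigma> (replicate n (Suc 0)) = \<sigma>"
  by (simp add: top_perm_def permute_list_replicate block_perm_singletons)

lemma bottom_perm_single: "\<tau> permutes {..<k} \<Longrightarrow> bottom_perm [k] [\<tau>] = \<tau>"
  by (simp add: bottom_perm_def block_perm_single)

context cat_multicategory
begin

lemma composable1_act1:
  assumes c: "composable1 M f (permute_list (inv \<sigma>) gs)" and \<sigma>: "\<sigma> permutes {..<arity M f}"
  shows "composable1 M (act1 M f \<sigma>) gs"
proof -
  note c' = composable1D[OF c]
  have \<sigma>': "\<sigma> permutes {..<length gs}" using c' \<sigma> by simp
  have "map (tgt M) gs = permute_list \<sigma> (permute_list (inv \<sigma>) (map (tgt M) gs))"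
    using \<sigma>' by simp
  also have "permute_list (inv \<sigma>) (map (tgt M) gs) = src M f"
    using c'(3) permute_list_map[OF permutes_inv[OF \<sigma>'], of "tgt M"] by simp
  finally show ?thesis
    using c' \<sigma> permutes_inv[OF \<sigma>'] unfolding composable1_def
    by (simp add: act1_cell)
qed

lemma composable1_map2_act1:
  assumes "composable1 M f gs" "list_all2 (\<lambda>g \<tau>. \<tau> permutes {..<arity M g}) gs \<tau>s"
  shows "composable1 M f (map2 (act1 M) gs \<tau>s)"
proof -
  note c = composable1D[OF assms(1)]
  have n: "gs ! i \<in> cells1 M" "\<tau>s ! i permutes {..<arity M (gs ! i)}" if "i < length gs" for i
    using that c(2) assms(2) by (auto simp: list_all2_conv_all_nth)
  have l: "length \<tau>s = length gs" using assms(2) by (simp add: list_all2_lengthD)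
  have "map (tgt M) (map2 (act1 M) gs \<tau>s) = map (tgt M) gs"
    using n l by (auto intro!: nth_equalityI simp: tgt_act1)
  then show ?thesis
    using c n l unfolding composable1_def by (auto simp: set_zip act1_cells1)
qed

text \<open>Both equivariance axioms in one formula: the \<tau>s are pulled out by bottom
  equivariance, then \<sigma> by top equivariance, and the two resulting permutations multiply to a
  single block permutation.\<close>

lemma gam1_act1:
  assumes c: "composable1 M f (permute_list (inv \<sigma>) gs)" and \<sigma>: "\<sigma> permutes {..<arity M f}"
    and \<tau>: "list_all2 (\<lambda>g \<tau>. \<tau> permutes {..<arity M g}) gs \<tau>s"
  shows "gam1 M (act1 M f \<sigma>) (map2 (act1 M) gs \<tau>s) =
    act1 M (gam1 M f (permute_list (inv \<sigma>) gs)) (block_perm \<sigma> (map (arity M) gs) \<tau>s)"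
proof -
  let ?gs = "permute_list (inv \<sigma>) gs" and ?ks = "map (arity M) gs"
  have l: "length gs = arity M f" using composable1D(4)[OF c] by simp
  have \<sigma>': "\<sigma> permutes {..<length gs}" using \<sigma> l by simp
  have ks: "map (arity M) ?gs = permute_list (inv \<sigma>) ?ks"
    by (rule permute_list_map[OF permutes_inv[OF \<sigma>'], symmetric])
  have \<tau>': "list_all2 (\<lambda>\<tau> k. \<tau> permutes {..<k}) \<tau>s ?ks"
    using \<tau> by (auto simp: list_all2_conv_all_nth)
  have ar: "arity M (gam1 M f ?gs) = sum_list ?ks"
    using sum_list_permute_list[of "inv \<sigma>" ?ks] permutes_inv[OF \<sigma>']
    by (simp only: src_gam1[OF c] length_concat map_map o_def)
      (simp add: ks[unfolded o_def])
  have "gam1 M (act1 M f \<sigma>) (map2 (act1 M) gs \<tau>s) =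
      act1 M (gam1 M (act1 M f \<sigma>) gs) (bottom_perm ?ks \<tau>s)"
    by (rule bottom_equivariance1[OF composable1_act1[OF c \<sigma>] \<tau>])
  also have "gam1 M (act1 M f \<sigma>) gs = act1 M (gam1 M f ?gs) (top_perm \<sigma> (map (arity M) ?gs))"
    using top_equivariance1[OF c \<sigma>] \<sigma>' by simp
  also have "act1 M \<dots> (bottom_perm ?ks \<tau>s) =
      act1 M (gam1 M f ?gs) (top_perm \<sigma> (map (arity M) ?gs) \<circ> bottom_perm ?ks \<tau>s)"
    by (rule act1_act1[OF gam1_cells1[OF c]])
      (use top_perm_permutes[of \<sigma> "permute_list (inv \<sigma>) ?ks"] permutes_inv[OF \<sigma>'] \<sigma>'
        bottom_perm_permutes[OF \<tau>'] in \<open>simp_all only: ar ks\<close>, simp_all)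
  also have "top_perm \<sigma> (map (arity M) ?gs) \<circ> bottom_perm ?ks \<tau>s = block_perm \<sigma> ?ks \<tau>s"
    unfolding ks by (rule top_perm_bottom_perm[OF _ \<tau>']) (use \<sigma>' in simp)
  finally show ?thesis .
qed

end

section \<open>The Barratt-Eccles operad\<close>

lemma unit_list_eq_iff: "(xs :: unit list) = ys \<longleftrightarrow> length xs = length ys"
  by (auto simp: list_eq_iff_nth_eq)

lemma barratt_eccles_simps [simp]:
  "objs barratt_eccles = UNIV"
  "x \<in> cells1 barratt_eccles \<longleftrightarrow> snd x permutes {..<fst x}"
  "\<alpha> \<in> cells2 barratt_eccles \<longleftrightarrow>
    fst (fst \<alpha>) = fst (snd \<alpha>) \<and> snd (fst \<alpha>) permutes {..<fst (fst \<alpha>)} \<and>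
    snd (snd \<alpha>) permutes {..<fst (fst \<alpha>)}"
  "Dom (cells barratt_eccles) = fst"
  "Cod (cells barratt_eccles) = snd"
  "Idn (cells barratt_eccles) x = (x, x)"
  "Cmp (cells barratt_eccles) \<beta> \<alpha> = (fst \<alpha>, snd \<beta>)"
  "src barratt_eccles x = replicate (fst x) ()"
  "tgt barratt_eccles x = ()"
  "act1 barratt_eccles = be_act"
  "act2 barratt_eccles \<alpha> \<tau> = (be_act (fst \<alpha>) \<tau>, be_act (snd \<alpha>) \<tau>)"
  "munit barratt_eccles a = (1, id)"
  "gam1 barratt_eccles = be_gam"
  "gam2 barratt_eccles \<alpha> \<beta>s = (be_gam (fst \<alpha>) (map fst \<beta>s), be_gam (snd \<alpha>) (map snd \<beta>s))"
  by (auto simp: barratt_eccles_def case_prod_beta)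

lemma be_act_simps [simp]: "fst (be_act x \<tau>) = fst x" "snd (be_act x \<tau>) = snd x \<circ> \<tau>"
  by (simp_all add: be_act_def case_prod_beta)

lemma be_gam_simps [simp]:
  "fst (be_gam x ys) = sum_list (map fst ys)"
  "snd (be_gam x ys) = block_perm (snd x) (map fst ys) (map snd ys)"
  by (simp_all add: be_gam_def case_prod_beta)

lemma be_gam_permutes:
  assumes "snd x permutes {..<length ys}" "\<And>y. y \<in> set ys \<Longrightarrow> snd y permutes {..<fst y}"
  shows "snd (be_gam x ys) permutes {..<fst (be_gam x ys)}"
  using assms by (auto intro!: block_perm_permutes simp: list_all2_conv_all_nth)

lemma be_gam_munit_left: "snd x permutes {..<fst x} \<Longrightarrow> be_gam (1, id) [x] = x"
  by (simp add: prod_eq_iff block_perm_single)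

lemma be_gam_munit_right:
  assumes "snd x permutes {..<fst x}"
  shows "be_gam x (replicate (fst x) (Suc 0, id)) = x"
  using assms by (simp add: prod_eq_iff block_perm_singletons sum_list_replicate)

text \<open>On permutations this is \<open>block_perm_assoc\<close>; on degrees it says that a sum
  may be formed blockwise.\<close>

lemma be_gam_assoc:
  assumes "snd x permutes {..<length ys}" "\<And>y. y \<in> set ys \<Longrightarrow> snd y permutes {..<fst y}"
    and l: "list_all2 (\<lambda>y zs. fst y = length zs) ys zss"
  shows "be_gam (be_gam x ys) (concat zss) = be_gam x (map2 be_gam ys zss)"
proof -
  let ?lss = "map (map fst) zss" and ?\<tau>ss = "map (map snd) zss"
  have len: "length zss = length ys" using l by (simp add: list_all2_lengthD)
  have p: "snd (ys ! i) permutes {..<fst (ys ! i)}" if "i < length ys" for i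
    using assms(2) that by simp
  have 1: "map length ?lss = map fst ys"
    using l by (auto intro!: nth_equalityI simp: list_all2_conv_all_nth)
  have 2: "map fst (map2 be_gam ys zss) = map sum_list ?lss"
    using len by (auto intro!: nth_equalityI)
  have 3: "map snd (map2 be_gam ys zss) =
      map2 (\<lambda>\<rho> (ls, \<tau>s). block_perm \<rho> ls \<tau>s) (map snd ys) (zip ?lss ?\<tau>ss)"
    using len by (auto intro!: nth_equalityI)
  have 4: "sum_list (concat ?lss) = sum_list (map sum_list ?lss)"
    by (induction zss) auto
  have 5: "block_perm (block_perm (snd x) (map length ?lss) (map snd ys)) (concat ?lss) (concat ?\<tau>ss) =
      block_perm (snd x) (map sum_list ?lss)
        (map2 (\<lambda>\<rho> (ls, \<tau>s). block_perm \<rho> ls \<tau>s) (map snd ys) (zip ?lss ?\<tau>ss))"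
    by (rule block_perm_assoc) (use assms(1) p len l in \<open>auto simp: list_all2_conv_all_nth\<close>)
  show ?thesis
    unfolding prod_eq_iff be_gam_simps 2 3 map_concat 4 5[symmetric] 1 by simp
qed

text \<open>Both equivariance laws of E\<Sigma> are instances of \<open>block_perm_comp\<close>.
  Here the factor acting first is \<sigma> with identities on the blocks; for bottom equivariance it
  is the identity with the \<tau>s on the blocks.\<close>

lemma be_gam_top:
  assumes "snd x permutes {..<length ys}" "\<sigma> permutes {..<length ys}"
  shows "be_gam (be_act x \<sigma>) (permute_list \<sigma> ys) = be_act (be_gam x ys) (top_perm \<sigma> (map fst ys))"
proof -
  let ?ks = "map fst ys"
  have k: "\<sigma> permutes {..<length ?ks}" using assms by simp
  have "block_perm (snd x) (permute_list (inv \<sigma>) (permute_list \<sigma> ?ks)) (map snd ys) \<circ>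
      block_perm \<sigma> (permute_list \<sigma> ?ks) (replicate (length ys) id) =
      block_perm (snd x \<circ> \<sigma>) (permute_list \<sigma> ?ks)
        (map2 (\<circ>) (permute_list \<sigma> (map snd ys)) (replicate (length ys) id))"
    by (rule block_perm_comp) (use assms in \<open>auto simp: list_all2_conv_all_nth permutes_id\<close>)
  moreover have "map2 (\<circ>) (permute_list \<sigma> (map snd ys)) (replicate (length ys) id) =
      permute_list \<sigma> (map snd ys)"
    by (auto intro!: nth_equalityI)
  moreover have "sum_list (map fst (permute_list \<sigma> ys)) = sum_list ?ks"
    using sum_list_permute_list[OF k] by (simp only: permute_list_map[OF assms(2)])
  ultimately show ?thesis
    using k assms(2)
    by (simp add: prod_eq_iff top_perm_def permute_list_map[OF assms(2), symmetric])
qed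

lemma be_gam_bottom:
  assumes "snd x permutes {..<length ys}"
    and "list_all2 (\<lambda>y \<tau>. \<tau> permutes {..<fst y}) ys \<tau>s"
  shows "be_gam x (map2 be_act ys \<tau>s) = be_act (be_gam x ys) (bottom_perm (map fst ys) \<tau>s)"
proof -
  have l: "length \<tau>s = length ys" using assms(2) by (simp add: list_all2_lengthD)
  have "block_perm (snd x) (permute_list (inv id) (map fst ys)) (map snd ys) \<circ>
      block_perm id (map fst ys) \<tau>s =
      block_perm (snd x \<circ> id) (map fst ys) (map2 (\<circ>) (permute_list id (map snd ys)) \<tau>s)"
    by (rule block_perm_comp)
      (use assms l in \<open>auto simp: permutes_id list_all2_conv_all_nth\<close>)
  moreover have "map fst (map2 be_act ys \<tau>s) = map fst ys"
    using l by (auto intro!: nth_equalityI)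
  moreover have "map snd (map2 be_act ys \<tau>s) = map2 (\<circ>) (map snd ys) \<tau>s"
    using l by (auto intro!: nth_equalityI)
  ultimately show ?thesis by (simp add: prod_eq_iff bottom_perm_def)
qed

text \<open>With a single object, matching inputs and outputs only means having the right number of
  inputs.\<close>

lemma composable_barratt_eccles:
  "composable1 barratt_eccles x ys \<longleftrightarrow>
    snd x permutes {..<fst x} \<and> (\<forall>y\<in>set ys. snd y permutes {..<fst y}) \<and> length ys = fst x"
  "composable2 barratt_eccles \<alpha> \<beta>s \<longleftrightarrow>
    \<alpha> \<in> cells2 barratt_eccles \<and> set \<beta>s \<subseteq> cells2 barratt_eccles \<and> length \<beta>s = fst (fst \<alpha>)"
  by (auto simp: composable1_def composable2_def unit_list_eq_iff subset_eq)

text \<open>A 2-cell is the pair of its ends, so each law for 2-cells is the law for 1-cells applied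
  once to the sources and once to the targets.\<close>

lemma cat_multicategory_barratt_eccles: "cat_multicategory barratt_eccles"
proof (rule cat_multicategoryI)
  let ?E = barratt_eccles
  show "category (cells ?E)"
    by unfold_locales auto
  have eq12: "map (\<lambda>\<beta>. fst (fst \<beta>)) \<beta>s = map (\<lambda>\<beta>. fst (snd \<beta>)) \<beta>s"
    if "set \<beta>s \<subseteq> cells2 ?E" for \<beta>s using that by auto
  have la: "list_all2 (\<lambda>y zs. fst y = length zs) (map fst \<beta>s) (map (map fst) \<delta>ss)"
    "list_all2 (\<lambda>y zs. fst y = length zs) (map snd \<beta>s) (map (map snd) \<delta>ss)"
    if "list_all2 (composable2 ?E) \<beta>s \<delta>ss" for \<beta>s \<delta>ss
    using that by (auto simp: list_all2_conv_all_nth composable_barratt_eccles)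
  \<comment> \<open>Taking ends commutes with the operations; \<open>h\<close> stands for either end
    so that one proof serves both.\<close>
  have map2': "map h (map2 (gam2 ?E) \<beta>s \<delta>ss) = map2 be_gam (map h \<beta>s) (map (map h) \<delta>ss)"
    if "h = fst \<or> h = snd" for h \<beta>s \<delta>ss
    using that by (auto intro!: nth_equalityI)
  have map2'': "map h (map2 (act2 ?E) \<beta>s \<tau>s) = map2 be_act (map h \<beta>s) \<tau>s"
    if "h = fst \<or> h = snd" for h \<beta>s \<tau>s
    using that by (auto intro!: nth_equalityI)
  {
    fix f gs assume c: "composable1 ?E f gs"
    then show "gam1 ?E f gs \<in> cells1 ?E \<and>
        src ?E (gam1 ?E f gs) = concat (map (src ?E) gs) \<and>
        tgt ?E (gam1 ?E f gs) = tgt ?E f"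
      using be_gam_permutes[of f gs]
      by (simp add: composable_barratt_eccles unit_list_eq_iff length_concat o_def)
    show "gam2 ?E (Idn (cells ?E) f) (map (Idn (cells ?E)) gs) =
        Idn (cells ?E) (gam1 ?E f gs)"
      by (simp add: o_def)
    fix hss assume "list_all2 (composable1 ?E) gs hss"
    then show "gam1 ?E (gam1 ?E f gs) (concat hss) =
        gam1 ?E f (map2 (gam1 ?E) gs hss)"
      using c be_gam_assoc[of f gs hss]
      by (simp add: composable_barratt_eccles list_all2_conv_all_nth)
  next
    fix f gs \<sigma> assume c: "composable1 ?E f gs" and
      \<sigma>: "\<sigma> permutes {..<arity ?E f}"
    then show "gam1 ?E (act1 ?E f \<sigma>) (permute_list \<sigma> gs) =
        act1 ?E (gam1 ?E f gs) (top_perm \<sigma> (map (arity ?E) gs))"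
      using be_gam_top[of f gs \<sigma>] by (simp add: composable_barratt_eccles)
  next
    fix f gs \<tau>s assume c: "composable1 ?E f gs" and
      \<tau>: "list_all2 (\<lambda>g \<tau>. \<tau> permutes {..<arity ?E g}) gs \<tau>s"
    then show "gam1 ?E f (map2 (act1 ?E) gs \<tau>s) =
        act1 ?E (gam1 ?E f gs) (bottom_perm (map (arity ?E) gs) \<tau>s)"
      using be_gam_bottom[of f gs \<tau>s] by (simp add: composable_barratt_eccles)
  next
    fix \<alpha> \<beta>s assume c: "composable2 ?E \<alpha> \<beta>s"
    then have c1: "snd (fst \<alpha>) permutes {..<length (map fst \<beta>s)}"
      "snd (snd \<alpha>) permutes {..<length (map snd \<beta>s)}"
      "\<And>y. y \<in> set (map fst \<beta>s) \<Longrightarrow> snd y permutes {..<fst y}"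
      "\<And>y. y \<in> set (map snd \<beta>s) \<Longrightarrow> snd y permutes {..<fst y}"
      by (auto simp: composable_barratt_eccles subset_eq)
    have m: "map (\<lambda>\<beta>. fst (fst \<beta>)) \<beta>s = map (\<lambda>\<beta>. fst (snd \<beta>)) \<beta>s"
      using c eq12 by (auto simp: composable_barratt_eccles)
    show "gam2 ?E \<alpha> \<beta>s \<in> cells2 ?E \<and>
        Dom (cells ?E) (gam2 ?E \<alpha> \<beta>s) =
          gam1 ?E (Dom (cells ?E) \<alpha>) (map (Dom (cells ?E)) \<beta>s) \<and>
        Cod (cells ?E) (gam2 ?E \<alpha> \<beta>s) =
          gam1 ?E (Cod (cells ?E) \<alpha>) (map (Cod (cells ?E)) \<beta>s)"
      using be_gam_permutes[OF c1(1,3)] be_gam_permutes[OF c1(2,4)] by (simp add: o_def m)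
    show "gam2 ?E (gam2 ?E \<alpha> \<beta>s) (concat \<delta>ss) =
        gam2 ?E \<alpha> (map2 (gam2 ?E) \<beta>s \<delta>ss)"
      if "list_all2 (composable2 ?E) \<beta>s \<delta>ss" for \<delta>ss
      using be_gam_assoc[OF c1(1,3) la(1)[OF that]] be_gam_assoc[OF c1(2,4) la(2)[OF that]]
        map2'[of fst \<beta>s \<delta>ss] map2'[of snd \<beta>s \<delta>ss]
      by (simp add: map_concat del: map_map)
    show "gam2 ?E (act2 ?E \<alpha> \<sigma>) (permute_list \<sigma> \<beta>s) =
        act2 ?E (gam2 ?E \<alpha> \<beta>s)
          (top_perm \<sigma> (map (\<lambda>\<beta>. length (src2 ?E \<beta>)) \<beta>s))"
      if \<sigma>: "\<sigma> permutes {..<length (src2 ?E \<alpha>)}" for \<sigma>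
    proof -
      have \<sigma>': "\<sigma> permutes {..<length \<beta>s}" using \<sigma> c by (simp add: composable_barratt_eccles)
      show ?thesis
        using be_gam_top[OF c1(1), of \<sigma>] be_gam_top[OF c1(2), of \<sigma>] \<sigma>'
        by (simp add: permute_list_map o_def m)
    qed
    show "gam2 ?E \<alpha> (map2 (act2 ?E) \<beta>s \<tau>s) =
        act2 ?E (gam2 ?E \<alpha> \<beta>s)
          (bottom_perm (map (\<lambda>\<beta>. length (src2 ?E \<beta>)) \<beta>s) \<tau>s)"
      if "list_all2 (\<lambda>\<beta> \<tau>. \<tau> permutes {..<length (src2 ?E \<beta>)}) \<beta>s \<tau>s" for \<tau>s
    proof -
      have "list_all2 (\<lambda>y \<tau>. \<tau> permutes {..<fst y}) (map fst \<beta>s) \<tau>s"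
        "list_all2 (\<lambda>y \<tau>. \<tau> permutes {..<fst y}) (map snd \<beta>s) \<tau>s"
        using that c by (auto simp: list_all2_conv_all_nth composable_barratt_eccles subset_eq)
      then show ?thesis
        using be_gam_bottom[OF c1(1), of \<tau>s] be_gam_bottom[OF c1(2), of \<tau>s]
          map2''[of fst \<beta>s \<tau>s] map2''[of snd \<beta>s \<tau>s]
        by (simp add: o_def m)
    qed
  next
    fix \<alpha> \<beta>s \<alpha>' \<beta>s' assume "composable2 ?E \<alpha> \<beta>s" "composable2 ?E \<alpha>' \<beta>s'"
      "Dom (cells ?E) \<alpha>' = Cod (cells ?E) \<alpha>"
      "map (Dom (cells ?E)) \<beta>s' = map (Cod (cells ?E)) \<beta>s"
    then have l: "length \<beta>s' = length \<beta>s" by (metis length_map)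
    then have "map fst (map2 (Cmp (cells ?E)) \<beta>s' \<beta>s) = map fst \<beta>s"
      "map snd (map2 (Cmp (cells ?E)) \<beta>s' \<beta>s) = map snd \<beta>s'"
      by (auto intro!: nth_equalityI)
    then show "gam2 ?E (Cmp (cells ?E) \<alpha>' \<alpha>) (map2 (Cmp (cells ?E)) \<beta>s' \<beta>s) =
        Cmp (cells ?E) (gam2 ?E \<alpha>' \<beta>s') (gam2 ?E \<alpha> \<beta>s)"
      by (simp del: map_map)
  }
qed (auto simp: unit_list_eq_iff prod_eq_iff permutes_compose permutes_id o_assoc
    be_gam_munit_left be_gam_munit_right block_perm_single block_perm_singletons map_replicate
    sum_list_replicate)

section \<open>Products of multicategories\<close>

text \<open>The operations are described through their projections. Under \<open>prod_eq_iff\<close>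
  every law of the product then splits into the laws of the two factors.\<close>

lemma mprod_simps [simp]:
  "objs (mprod M N) = objs M \<times> objs N"
  "x \<in> cells1 (mprod M N) \<longleftrightarrow> fst x \<in> cells1 M \<and> snd x \<in> cells1 N \<and> arity M (fst x) = arity N (snd x)"
  "\<alpha> \<in> cells2 (mprod M N) \<longleftrightarrow> fst \<alpha> \<in> cells2 M \<and> snd \<alpha> \<in> cells2 N \<and>
    length (src2 M (fst \<alpha>)) = length (src2 N (snd \<alpha>))"
  "fst (Dom (cells (mprod M N)) \<alpha>) = Dom (cells M) (fst \<alpha>)"
  "snd (Dom (cells (mprod M N)) \<alpha>) = Dom (cells N) (snd \<alpha>)"
  "fst (Cod (cells (mprod M N)) \<alpha>) = Cod (cells M) (fst \<alpha>)"
  "snd (Cod (cells (mprod M N)) \<alpha>) = Cod (cells N) (snd \<alpha>)"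
  "fst (Idn (cells (mprod M N)) x) = Idn (cells M) (fst x)"
  "snd (Idn (cells (mprod M N)) x) = Idn (cells N) (snd x)"
  "fst (Cmp (cells (mprod M N)) \<beta> \<alpha>) = Cmp (cells M) (fst \<beta>) (fst \<alpha>)"
  "snd (Cmp (cells (mprod M N)) \<beta> \<alpha>) = Cmp (cells N) (snd \<beta>) (snd \<alpha>)"
  "src (mprod M N) x = zip (src M (fst x)) (src N (snd x))"
  "fst (tgt (mprod M N) x) = tgt M (fst x)"
  "snd (tgt (mprod M N) x) = tgt N (snd x)"
  "fst (act1 (mprod M N) x \<sigma>) = act1 M (fst x) \<sigma>"
  "snd (act1 (mprod M N) x \<sigma>) = act1 N (snd x) \<sigma>"
  "fst (act2 (mprod M N) \<alpha> \<sigma>) = act2 M (fst \<alpha>) \<sigma>"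
  "snd (act2 (mprod M N) \<alpha> \<sigma>) = act2 N (snd \<alpha>) \<sigma>"
  "fst (munit (mprod M N) a) = munit M (fst a)"
  "snd (munit (mprod M N) a) = munit N (snd a)"
  "fst (gam1 (mprod M N) x ys) = gam1 M (fst x) (map fst ys)"
  "snd (gam1 (mprod M N) x ys) = gam1 N (snd x) (map snd ys)"
  "fst (gam2 (mprod M N) \<alpha> \<beta>s) = gam2 M (fst \<alpha>) (map fst \<beta>s)"
  "snd (gam2 (mprod M N) \<alpha> \<beta>s) = gam2 N (snd \<alpha>) (map snd \<beta>s)"
  by (auto simp: mprod_def prod_cat_def case_prod_beta)

lemma map_zip_fst: "length xs = length ys \<Longrightarrow> map (\<lambda>x. h (fst x)) (zip xs ys) = map h xs"
  by (auto intro!: nth_equalityI)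

lemma map_zip_snd: "length xs = length ys \<Longrightarrow> map (\<lambda>x. h (snd x)) (zip xs ys) = map h ys"
  by (auto intro!: nth_equalityI)

text \<open>Equal lengths are required block by block: equal total lengths alone would not keep the
  two concatenations aligned.\<close>

lemma concat_map_zip:
  assumes "\<forall>h\<in>set hs. length (u h) = length (v h)"
  shows "concat (map (\<lambda>h. zip (u h) (v h)) hs) = zip (concat (map u hs)) (concat (map v hs))"
  using assms by (induction hs) auto

lemma length_concat_eq:
  "\<forall>h\<in>set hs. length (u h) = length (v h) \<Longrightarrow> length (concat (map u hs)) = length (concat (map v hs))"
  by (induction hs) auto

lemma map_map2:
  assumes "\<And>x y. p (h x y) = h' (q x) (r y)"
  shows "map p (map2 h xs ys) = map2 h' (map q xs) (map r ys)"
  by (auto intro!: nth_equalityI simp: assms)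

lemma mprod_composable1:
  assumes "composable1 (mprod M N) x ys"
  shows "composable1 M (fst x) (map fst ys)" "composable1 N (snd x) (map snd ys)"
    "arity M (fst x) = arity N (snd x)"
    "\<forall>y\<in>set ys. arity M (fst y) = arity N (snd y)"
proof -
  have c: "map (tgt (mprod M N)) ys = zip (src M (fst x)) (src N (snd x))"
    and x: "fst x \<in> cells1 M" "snd x \<in> cells1 N" "arity M (fst x) = arity N (snd x)"
    and ys: "\<forall>y\<in>set ys. fst y \<in> cells1 M \<and> snd y \<in> cells1 N \<and> arity M (fst y) = arity N (snd y)"
    using composable1D[OF assms] by (auto simp: subset_eq)
  show "composable1 M (fst x) (map fst ys)" "composable1 N (snd x) (map snd ys)"
    using x ys arg_cong[OF c, of "map fst"] arg_cong[OF c, of "map snd"]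
    by (auto simp: composable1_def o_def)
qed (use composable1D[OF assms] in \<open>auto simp: subset_eq\<close>)

lemma mprod_composable2:
  assumes "composable2 (mprod M N) \<alpha> \<beta>s"
  shows "composable2 M (fst \<alpha>) (map fst \<beta>s)" "composable2 N (snd \<alpha>) (map snd \<beta>s)"
    "length (src2 M (fst \<alpha>)) = length (src2 N (snd \<alpha>))"
    "\<forall>\<beta>\<in>set \<beta>s. length (src2 M (fst \<beta>)) = length (src2 N (snd \<beta>))"
proof -
  have c: "map (tgt2 (mprod M N)) \<beta>s = zip (src2 M (fst \<alpha>)) (src2 N (snd \<alpha>))"
    and x: "fst \<alpha> \<in> cells2 M" "snd \<alpha> \<in> cells2 N" "length (src2 M (fst \<alpha>)) = length (src2 N (snd \<alpha>))"
    and ys: "\<forall>\<beta>\<in>set \<beta>s. fst \<beta> \<in> cells2 M \<and> snd \<beta> \<in> cells2 N \<and>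
      length (src2 M (fst \<beta>)) = length (src2 N (snd \<beta>))"
    using composable2D[OF assms] by (auto simp: subset_eq)
  show "composable2 M (fst \<alpha>) (map fst \<beta>s)" "composable2 N (snd \<alpha>) (map snd \<beta>s)"
    using x ys arg_cong[OF c, of "map fst"] arg_cong[OF c, of "map snd"]
    by (auto simp: composable2_def o_def)
qed (use composable2D[OF assms] in \<open>auto simp: subset_eq\<close>)

lemma cat_multicategory_mprod:
  fixes M :: "('o, 'f, 'a) mcat" and N :: "('p, 'g, 'b) mcat"
  assumes "cat_multicategory M" "cat_multicategory N"
  shows "cat_multicategory (mprod M N)"
proof -
  interpret M: cat_multicategory M by fact
  interpret N: cat_multicategory N by fact
  show ?thesis
  proof (rule cat_multicategoryI)
    let ?P = "mprod M N"
    note cat_simps = M.cells.Dom_Ob M.cells.Cod_Ob M.cells.Idn_Ar M.cells.Dom_Idn M.cells.Cod_Idn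
      M.cells.Cmp_Ar M.cells.Dom_Cmp M.cells.Cod_Cmp M.cells.Cmp_Idn_left M.cells.Cmp_Idn_right
      M.cells.Cmp_assoc N.cells.Dom_Ob N.cells.Cod_Ob N.cells.Idn_Ar N.cells.Dom_Idn N.cells.Cod_Idn
      N.cells.Cmp_Ar N.cells.Dom_Cmp N.cells.Cod_Cmp N.cells.Cmp_Idn_left N.cells.Cmp_Idn_right
      N.cells.Cmp_assoc
    show "category (cells ?P)"
      by unfold_locales (auto simp: prod_eq_iff cat_simps M.src_Cod N.src_Cod)
    {
      fix f assume f: "f \<in> cells1 ?P"
      show "src ?P f \<in> lists (objs ?P)"
        using f M.src_in_objs N.src_in_objs by (auto dest: set_zip_leftD set_zip_rightD)
      show "tgt ?P f \<in> objs ?P"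
        using f M.tgt_objs[of "fst f"] N.tgt_objs[of "snd f"] by (simp add: mem_Times_iff)
      show "act1 ?P f id = f"
        using f by (simp add: prod_eq_iff M.act1_id N.act1_id)
      show "gam1 ?P (munit ?P (tgt ?P f)) [f] = f"
        using f by (simp add: prod_eq_iff M.gam1_munit_left N.gam1_munit_left)
      show "gam1 ?P f (map (munit ?P) (src ?P f)) = f"
        using f by (simp add: prod_eq_iff o_def map_zip_fst[where h = "munit M"]
            map_zip_snd[where h = "munit N"] M.gam1_munit_right N.gam1_munit_right)
      fix \<sigma> assume \<sigma>: "\<sigma> permutes {..<arity ?P f}"
      show "act1 ?P f \<sigma> \<in> cells1 ?P \<and>
          src ?P (act1 ?P f \<sigma>) = permute_list \<sigma> (src ?P f) \<and>
          tgt ?P (act1 ?P f \<sigma>) = tgt ?P f"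
        using f \<sigma> by (simp add: prod_eq_iff M.act1_cell N.act1_cell permute_list_zip)
      show "act2 ?P (Idn (cells ?P) f) \<sigma> =
          Idn (cells ?P) (act1 ?P f \<sigma>)"
        using f \<sigma> by (simp add: prod_eq_iff M.act2_Idn N.act2_Idn)
      fix \<tau> assume \<tau>: "\<tau> permutes {..<arity ?P f}"
      show "act1 ?P (act1 ?P f \<sigma>) \<tau> = act1 ?P f (\<sigma> \<circ> \<tau>)"
        using f \<sigma> \<tau> by (simp add: prod_eq_iff M.act1_act1 N.act1_act1)
    next
      fix \<alpha> assume \<alpha>: "\<alpha> \<in> cells2 ?P"
      show "src ?P (Cod (cells ?P) \<alpha>) = src2 ?P \<alpha>"
        using \<alpha> by (simp add: M.src_Cod N.src_Cod)
      show "tgt ?P (Cod (cells ?P) \<alpha>) = tgt2 ?P \<alpha>"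
        using \<alpha> by (simp add: prod_eq_iff M.tgt_Cod N.tgt_Cod)
      show "act2 ?P \<alpha> id = \<alpha>"
        using \<alpha> by (simp add: prod_eq_iff M.act2_id N.act2_id)
      show "gam2 ?P (Idn (cells ?P) (munit ?P (tgt2 ?P \<alpha>))) [\<alpha>] = \<alpha>"
        using \<alpha> by (simp add: prod_eq_iff M.gam2_munit_left N.gam2_munit_left)
      show "gam2 ?P \<alpha>
          (map (\<lambda>a. Idn (cells ?P) (munit ?P a)) (src2 ?P \<alpha>)) = \<alpha>"
        using \<alpha> by (simp add: prod_eq_iff o_def map_zip_fst[where h = "\<lambda>a. Idn (cells M) (munit M a)"]
            map_zip_snd[where h = "\<lambda>a. Idn (cells N) (munit N a)"] M.gam2_munit_right
            N.gam2_munit_right)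
      fix \<sigma> assume \<sigma>: "\<sigma> permutes {..<length (src2 ?P \<alpha>)}"
      show "act2 ?P \<alpha> \<sigma> \<in> cells2 ?P \<and>
          Dom (cells ?P) (act2 ?P \<alpha> \<sigma>) =
            act1 ?P (Dom (cells ?P) \<alpha>) \<sigma> \<and>
          Cod (cells ?P) (act2 ?P \<alpha> \<sigma>) =
            act1 ?P (Cod (cells ?P) \<alpha>) \<sigma>"
        using \<alpha> \<sigma> by (simp add: prod_eq_iff M.act2_cell N.act2_cell M.act1_cell N.act1_cell cat_simps)
      {
        fix \<beta> assume "\<beta> \<in> cells2 ?P" "Dom (cells ?P) \<beta> = Cod (cells ?P) \<alpha>"
        then show "act2 ?P (Cmp (cells ?P) \<beta> \<alpha>) \<sigma> =
            Cmp (cells ?P) (act2 ?P \<beta> \<sigma>) (act2 ?P \<alpha> \<sigma>)"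
          using \<alpha> \<sigma> by (simp add: prod_eq_iff M.act2_Cmp N.act2_Cmp)
      }
      fix \<tau> assume \<tau>: "\<tau> permutes {..<length (src2 ?P \<alpha>)}"
      show "act2 ?P (act2 ?P \<alpha> \<sigma>) \<tau> = act2 ?P \<alpha> (\<sigma> \<circ> \<tau>)"
        using \<alpha> \<sigma> \<tau> by (simp add: prod_eq_iff M.act2_act2 N.act2_act2)
    next
      fix a assume "a \<in> objs ?P"
      then show "munit ?P a \<in> cells1 ?P \<and> src ?P (munit ?P a) = [a] \<and>
          tgt ?P (munit ?P a) = a"
        by (auto simp: prod_eq_iff M.munit_cell N.munit_cell)
    next
      fix f gs assume c: "composable1 ?P f gs"
      note c' = mprod_composable1[OF c]
      \<comment> \<open>The two components of a cell have the same arity, so one and the same block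
        permutation occurs in the equivariance laws of both factors.\<close>
      have ar: "map (arity ?P) gs = map (arity M) (map fst gs)"
        "map (arity ?P) gs = map (arity N) (map snd gs)"
        using c'(4) by auto
      have src_map: "map (src ?P) gs = map (\<lambda>h. zip (src M (fst h)) (src N (snd h))) gs"
        by simp
      show "gam1 ?P f gs \<in> cells1 ?P \<and>
          src ?P (gam1 ?P f gs) = concat (map (src ?P) gs) \<and>
          tgt ?P (gam1 ?P f gs) = tgt ?P f"
        using c' length_concat_eq[OF c'(4)]
        by (simp add: prod_eq_iff M.gam1_cell N.gam1_cell o_def src_map concat_map_zip[OF c'(4)])
      show "gam2 ?P (Idn (cells ?P) f) (map (Idn (cells ?P)) gs) =
          Idn (cells ?P) (gam1 ?P f gs)"
        using M.gam2_Idn[OF c'(1)] N.gam2_Idn[OF c'(2)] by (simp add: prod_eq_iff o_def)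
      show "gam1 ?P (act1 ?P f \<sigma>) (permute_list \<sigma> gs) =
          act1 ?P (gam1 ?P f gs) (top_perm \<sigma> (map (arity ?P) gs))"
        if \<sigma>: "\<sigma> permutes {..<arity ?P f}" for \<sigma>
      proof -
        have "\<sigma> permutes {..<length gs}" "\<sigma> permutes {..<arity M (fst f)}" "\<sigma> permutes {..<arity N (snd f)}"
          using \<sigma> c'(3) composable1D(4)[OF c'(1)] by simp_all
        then show ?thesis
          using M.top_equivariance1[OF c'(1), of \<sigma>] N.top_equivariance1[OF c'(2), of \<sigma>]
          unfolding prod_eq_iff by (simp only: mprod_simps(15,16,21,22) ar[symmetric] permute_list_map)
      qed
      {
        fix hss assume "list_all2 (composable1 ?P) gs hss"
        then have "list_all2 (composable1 M) (map fst gs) (map (map fst) hss)"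
          "list_all2 (composable1 N) (map snd gs) (map (map snd) hss)"
          by (auto simp: list_all2_conv_all_nth mprod_composable1)
        then show "gam1 ?P (gam1 ?P f gs) (concat hss) =
            gam1 ?P f (map2 (gam1 ?P) gs hss)"
          using M.gam1_assoc[OF c'(1)] N.gam1_assoc[OF c'(2)]
          by (simp add: prod_eq_iff map_concat del: map_map add:
              map_map2[where h = "gam1 ?P" and p = fst and h' = "gam1 M" and q = fst and r = "map fst"]
              map_map2[where h = "gam1 ?P" and p = snd and h' = "gam1 N" and q = snd and r = "map snd"])
      }
      fix \<tau>s assume "list_all2 (\<lambda>g \<tau>. \<tau> permutes {..<arity ?P g}) gs \<tau>s"
      then have "list_all2 (\<lambda>g \<tau>. \<tau> permutes {..<arity M g}) (map fst gs) \<tau>s"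
        "list_all2 (\<lambda>g \<tau>. \<tau> permutes {..<arity N g}) (map snd gs) \<tau>s"
        using c'(4) by (auto simp: list_all2_conv_all_nth)
      then show "gam1 ?P f (map2 (act1 ?P) gs \<tau>s) =
          act1 ?P (gam1 ?P f gs) (bottom_perm (map (arity ?P) gs) \<tau>s)"
        using M.bottom_equivariance1[OF c'(1), of \<tau>s] N.bottom_equivariance1[OF c'(2), of \<tau>s]
          map_map2[of fst "act1 ?P" "act1 M" fst id gs \<tau>s]
          map_map2[of snd "act1 ?P" "act1 N" snd id gs \<tau>s]
        unfolding prod_eq_iff by (simp only: mprod_simps(15,16,21,22) ar[symmetric] list.map_id id_apply)
    next
      fix \<alpha> \<beta>s assume c: "composable2 ?P \<alpha> \<beta>s"
      note c' = mprod_composable2[OF c]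
      have ar: "map (\<lambda>\<beta>. length (src2 ?P \<beta>)) \<beta>s = map (\<lambda>\<beta>. length (src2 M \<beta>)) (map fst \<beta>s)"
        "map (\<lambda>\<beta>. length (src2 ?P \<beta>)) \<beta>s = map (\<lambda>\<beta>. length (src2 N \<beta>)) (map snd \<beta>s)"
        using c'(4) by auto
      show "gam2 ?P \<alpha> \<beta>s \<in> cells2 ?P \<and>
          Dom (cells ?P) (gam2 ?P \<alpha> \<beta>s) =
            gam1 ?P (Dom (cells ?P) \<alpha>) (map (Dom (cells ?P)) \<beta>s) \<and>
          Cod (cells ?P) (gam2 ?P \<alpha> \<beta>s) =
            gam1 ?P (Cod (cells ?P) \<alpha>) (map (Cod (cells ?P)) \<beta>s)"
        using c' length_concat_eq[OF c'(4)] M.src2_gam2[OF c'(1)] N.src2_gam2[OF c'(2)]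
        by (simp add: prod_eq_iff M.gam2_cell N.gam2_cell o_def)
      show "gam2 ?P (act2 ?P \<alpha> \<sigma>) (permute_list \<sigma> \<beta>s) =
          act2 ?P (gam2 ?P \<alpha> \<beta>s)
            (top_perm \<sigma> (map (\<lambda>\<beta>. length (src2 ?P \<beta>)) \<beta>s))"
        if \<sigma>: "\<sigma> permutes {..<length (src2 ?P \<alpha>)}" for \<sigma>
      proof -
        have "\<sigma> permutes {..<length \<beta>s}" "\<sigma> permutes {..<length (src2 M (fst \<alpha>))}"
          "\<sigma> permutes {..<length (src2 N (snd \<alpha>))}"
          using \<sigma> c'(3) composable2D(4)[OF c'(1)] by simp_all
        then show ?thesis
          using M.top_equivariance2[OF c'(1), of \<sigma>] N.top_equivariance2[OF c'(2), of \<sigma>]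
          unfolding prod_eq_iff by (simp only: mprod_simps(17,18,23,24) ar[symmetric] permute_list_map)
      qed
      {
        fix \<delta>ss assume "list_all2 (composable2 ?P) \<beta>s \<delta>ss"
        then have "list_all2 (composable2 M) (map fst \<beta>s) (map (map fst) \<delta>ss)"
          "list_all2 (composable2 N) (map snd \<beta>s) (map (map snd) \<delta>ss)"
          by (auto simp: list_all2_conv_all_nth mprod_composable2)
        then show "gam2 ?P (gam2 ?P \<alpha> \<beta>s) (concat \<delta>ss) =
            gam2 ?P \<alpha> (map2 (gam2 ?P) \<beta>s \<delta>ss)"
          using M.gam2_assoc[OF c'(1)] N.gam2_assoc[OF c'(2)]
          by (simp add: prod_eq_iff map_concat del: map_map add:
              map_map2[where h = "gam2 ?P" and p = fst and h' = "gam2 M" and q = fst and r = "map fst"]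
              map_map2[where h = "gam2 ?P" and p = snd and h' = "gam2 N" and q = snd and r = "map snd"])
      }
      {
        fix \<tau>s assume "list_all2 (\<lambda>\<beta> \<tau>. \<tau> permutes {..<length (src2 ?P \<beta>)}) \<beta>s \<tau>s"
        then have "list_all2 (\<lambda>\<beta> \<tau>. \<tau> permutes {..<length (src2 M \<beta>)}) (map fst \<beta>s) \<tau>s"
          "list_all2 (\<lambda>\<beta> \<tau>. \<tau> permutes {..<length (src2 N \<beta>)}) (map snd \<beta>s) \<tau>s"
          using c'(4) by (auto simp: list_all2_conv_all_nth)
        then show "gam2 ?P \<alpha> (map2 (act2 ?P) \<beta>s \<tau>s) =
            act2 ?P (gam2 ?P \<alpha> \<beta>s)
              (bottom_perm (map (\<lambda>\<beta>. length (src2 ?P \<beta>)) \<beta>s) \<tau>s)"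
          using M.bottom_equivariance2[OF c'(1), of \<tau>s] N.bottom_equivariance2[OF c'(2), of \<tau>s]
            map_map2[of fst "act2 ?P" "act2 M" fst id \<beta>s \<tau>s]
            map_map2[of snd "act2 ?P" "act2 N" snd id \<beta>s \<tau>s]
          unfolding prod_eq_iff by (simp only: mprod_simps(17,18,23,24) ar[symmetric] list.map_id id_apply)
      }
      fix \<alpha>' \<beta>s' assume cc: "composable2 ?P \<alpha>' \<beta>s'"
        and d: "Dom (cells ?P) \<alpha>' = Cod (cells ?P) \<alpha>"
        and e: "map (Dom (cells ?P)) \<beta>s' = map (Cod (cells ?P)) \<beta>s"
      note cc' = mprod_composable2[OF cc]
      have "Dom (cells M) (fst \<alpha>') = Cod (cells M) (fst \<alpha>)" "Dom (cells N) (snd \<alpha>') = Cod (cells N) (snd \<alpha>)"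
        using d by (simp_all add: prod_eq_iff)
      moreover have "map (Dom (cells M)) (map fst \<beta>s') = map (Cod (cells M)) (map fst \<beta>s)"
        "map (Dom (cells N)) (map snd \<beta>s') = map (Cod (cells N)) (map snd \<beta>s)"
        using arg_cong[OF e, of "map fst"] arg_cong[OF e, of "map snd"] by (simp_all add: o_def)
      ultimately show "gam2 ?P (Cmp (cells ?P) \<alpha>' \<alpha>)
            (map2 (Cmp (cells ?P)) \<beta>s' \<beta>s) =
          Cmp (cells ?P) (gam2 ?P \<alpha>' \<beta>s') (gam2 ?P \<alpha> \<beta>s)"
        using M.gam2_Cmp[OF c'(1) cc'(1)] N.gam2_Cmp[OF c'(2) cc'(2)]
        by (simp add: prod_eq_iff del: map_map add:
            map_map2[where h = "Cmp (cells ?P)" and p = fst and h' = "Cmp (cells M)" and q = fst and r = fst]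
            map_map2[where h = "Cmp (cells ?P)" and p = snd and h' = "Cmp (cells N)" and q = snd and r = snd])
    }
  qed
qed

section \<open>Multifunctors\<close>

lemma (in cat_multicategory) composable1_singleton:
  "composable1 M f [g] \<longleftrightarrow> f \<in> cells1 M \<and> g \<in> cells1 M \<and> src M f = [tgt M g]"
  by (auto simp: composable1_def)

lemma (in cat_multicategory) composable2_singleton:
  "composable2 M \<alpha> [\<beta>] \<longleftrightarrow> \<alpha> \<in> cells2 M \<and> \<beta> \<in> cells2 M \<and> src2 M \<alpha> = [tgt2 M \<beta>]"
  by (auto simp: composable2_def)

context cat_multicategory
begin

lemma gam1_assoc_single:
  assumes "composable1 M f [g]" "composable1 M g hs"
  shows "gam1 M (gam1 M f [g]) hs = gam1 M f [gam1 M g hs]"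
  using gam1_assoc[OF assms(1), of "[hs]"] assms(2) by simp

lemma gam2_assoc_single:
  assumes "composable2 M \<alpha> [\<beta>]" "composable2 M \<beta> \<delta>s"
  shows "gam2 M (gam2 M \<alpha> [\<beta>]) \<delta>s = gam2 M \<alpha> [gam2 M \<beta> \<delta>s]"
  using gam2_assoc[OF assms(1), of "[\<delta>s]"] assms(2) by simp

text \<open>The cells \<open>u a\<close> are unary, so the double list of inputs consists of
  singletons and \<open>concat\<close> disappears. This is the form of associativity needed for
  components of transformations.\<close>

lemma gam1_assoc_map:
  assumes "composable1 M f (map u as)" "\<And>a. a \<in> set as \<Longrightarrow> composable1 M (u a) [v a]"
  shows "gam1 M (gam1 M f (map u as)) (map v as) = gam1 M f (map (\<lambda>a. gam1 M (u a) [v a]) as)"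
proof -
  have "list_all2 (composable1 M) (map u as) (map (\<lambda>a. [v a]) as)"
    using assms(2) by (auto simp: list_all2_conv_all_nth)
  moreover have "concat (map (\<lambda>a. [v a]) as) = map v as" by (induction as) auto
  moreover have "map2 (gam1 M) (map u as) (map (\<lambda>a. [v a]) as) = map (\<lambda>a. gam1 M (u a) [v a]) as"
    by (auto intro!: nth_equalityI)
  ultimately show ?thesis using gam1_assoc[OF assms(1)] by metis
qed

lemma gam2_assoc_map:
  assumes "composable2 M \<alpha> (map u as)" "\<And>a. a \<in> set as \<Longrightarrow> composable2 M (u a) [v a]"
  shows "gam2 M (gam2 M \<alpha> (map u as)) (map v as) = gam2 M \<alpha> (map (\<lambda>a. gam2 M (u a) [v a]) as)"
proof -
  have "list_all2 (composable2 M) (map u as) (map (\<lambda>a. [v a]) as)"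
    using assms(2) by (auto simp: list_all2_conv_all_nth)
  moreover have "concat (map (\<lambda>a. [v a]) as) = map v as" by (induction as) auto
  moreover have "map2 (gam2 M) (map u as) (map (\<lambda>a. [v a]) as) = map (\<lambda>a. gam2 M (u a) [v a]) as"
    by (auto intro!: nth_equalityI)
  ultimately show ?thesis using gam2_assoc[OF assms(1)] by metis
qed

end

lemma multifunctorI:
  fixes F :: "('o, 'f, 'a, 'p, 'g, 'b, 'z) mfun_scheme"
  assumes "cat_multicategory M" "cat_multicategory N"
    and "fob F \<in> extensional (objs M)" "fun1 F \<in> extensional (cells1 M)"
      "fun2 F \<in> extensional (cells2 M)"
    and "\<And>a. a \<in> objs M \<Longrightarrow> fob F a \<in> objs N"
    and "\<And>f. f \<in> cells1 M \<Longrightarrow> fun1 F f \<in> cells1 N \<and> src N (fun1 F f) = map (fob F) (src M f) \<and>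
      tgt N (fun1 F f) = fob F (tgt M f)"
    and "\<And>\<alpha>. \<alpha> \<in> cells2 M \<Longrightarrow> fun2 F \<alpha> \<in> cells2 N \<and>
      Dom (cells N) (fun2 F \<alpha>) = fun1 F (Dom (cells M) \<alpha>) \<and>
      Cod (cells N) (fun2 F \<alpha>) = fun1 F (Cod (cells M) \<alpha>)"
    and "\<And>f. f \<in> cells1 M \<Longrightarrow> fun2 F (Idn (cells M) f) = Idn (cells N) (fun1 F f)"
    and "\<And>\<alpha> \<beta>. \<lbrakk>\<alpha> \<in> cells2 M; \<beta> \<in> cells2 M; Dom (cells M) \<beta> = Cod (cells M) \<alpha>\<rbrakk> \<Longrightarrow>
      fun2 F (Cmp (cells M) \<beta> \<alpha>) = Cmp (cells N) (fun2 F \<beta>) (fun2 F \<alpha>)"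
    and "\<And>a. a \<in> objs M \<Longrightarrow> fun1 F (munit M a) = munit N (fob F a)"
    and "\<And>f gs. composable1 M f gs \<Longrightarrow> fun1 F (gam1 M f gs) = gam1 N (fun1 F f) (map (fun1 F) gs)"
    and "\<And>\<alpha> \<beta>s. composable2 M \<alpha> \<beta>s \<Longrightarrow> fun2 F (gam2 M \<alpha> \<beta>s) = gam2 N (fun2 F \<alpha>) (map (fun2 F) \<beta>s)"
  shows "multifunctor M N F"
proof -
  interpret M: cat_multicategory M by fact
  interpret N: cat_multicategory N by fact
  show ?thesis
    by (intro multifunctor.intro multifunctor_axioms.intro assms cat_functor.intro
        cat_functor_axioms.intro M.mhom_category N.mhom_category) (auto simp: assms M.cells.Dom_Ob)
qed

context multifunctor
begin

lemma fun1_cell: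
  assumes "f \<in> cells1 M"
  shows fun1_cells1: "fun1 F f \<in> cells1 N"
    and src_fun1: "src N (fun1 F f) = map (fob F) (src M f)"
    and tgt_fun1: "tgt N (fun1 F f) = fob F (tgt M f)"
    and fun2_Idn: "fun2 F (Idn (cells M) f) = Idn (cells N) (fun1 F f)"
proof -
  interpret cat_functor "mhom M (src M f) (tgt M f)" "mhom N (map (fob F) (src M f)) (fob F (tgt M f))"
    "fun1 F" "fun2 F" by (rule hom_functor) (use assms M.src_objs M.tgt_objs in auto)
  show "fun1 F f \<in> cells1 N" "src N (fun1 F f) = map (fob F) (src M f)"
    "tgt N (fun1 F f) = fob F (tgt M f)" "fun2 F (Idn (cells M) f) = Idn (cells N) (fun1 F f)"
    using Fo_Ob[of f] Fa_Idn[of f] assms by auto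
qed

lemma fun2_cell:
  assumes "\<alpha> \<in> cells2 M"
  shows fun2_cells2: "fun2 F \<alpha> \<in> cells2 N"
    and Dom_fun2: "Dom (cells N) (fun2 F \<alpha>) = fun1 F (Dom (cells M) \<alpha>)"
    and Cod_fun2: "Cod (cells N) (fun2 F \<alpha>) = fun1 F (Cod (cells M) \<alpha>)"
    and fun2_Cmp: "\<lbrakk>\<beta> \<in> cells2 M; Dom (cells M) \<beta> = Cod (cells M) \<alpha>\<rbrakk> \<Longrightarrow>
      fun2 F (Cmp (cells M) \<beta> \<alpha>) = Cmp (cells N) (fun2 F \<beta>) (fun2 F \<alpha>)"
proof -
  interpret cat_functor "mhom M (src2 M \<alpha>) (tgt2 M \<alpha>)" "mhom N (map (fob F) (src2 M \<alpha>)) (fob F (tgt2 M \<alpha>))"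
    "fun1 F" "fun2 F"
    by (rule hom_functor) (use assms M.src_objs M.tgt_objs M.cells.Dom_Ob in auto)
  show "fun2 F \<alpha> \<in> cells2 N" "Dom (cells N) (fun2 F \<alpha>) = fun1 F (Dom (cells M) \<alpha>)"
    "Cod (cells N) (fun2 F \<alpha>) = fun1 F (Cod (cells M) \<alpha>)"
    using Fa_Ar[of \<alpha>] Dom_Fa[of \<alpha>] Cod_Fa[of \<alpha>] assms by auto
  show "fun2 F (Cmp (cells M) \<beta> \<alpha>) = Cmp (cells N) (fun2 F \<beta>) (fun2 F \<alpha>)"
    if "\<beta> \<in> cells2 M" "Dom (cells M) \<beta> = Cod (cells M) \<alpha>"
    using Fa_Cmp[of \<alpha> \<beta>] assms that by (simp add: M.src_Cod M.tgt_Cod)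
qed

lemma composable1_fun1: "composable1 M f gs \<Longrightarrow> composable1 N (fun1 F f) (map (fun1 F) gs)"
  unfolding composable1_def by (auto simp: fun1_cell subset_eq list_eq_iff_nth_eq)

lemma composable2_fun2: "composable2 M \<alpha> \<beta>s \<Longrightarrow> composable2 N (fun2 F \<alpha>) (map (fun2 F) \<beta>s)"
  unfolding composable2_def
  by (auto simp: fun2_cell fun1_cell M.cells.Dom_Ob subset_eq list_eq_iff_nth_eq)

text \<open>The functors on the hom categories assemble to one functor on their union
  \<open>cells M\<close>, and functors preserve isomorphisms.\<close>

lemma iso_ar_fun2: "iso_ar (cells M) \<alpha> \<Longrightarrow> iso_ar (cells N) (fun2 F \<alpha>)"
proof -
  interpret cat_functor "cells M" "cells N" "fun1 F" "fun2 F"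
    by unfold_locales (auto simp: fun1_cell fun2_cell)
  show "iso_ar (cells M) \<alpha> \<Longrightarrow> iso_ar (cells N) (fun2 F \<alpha>)" by (rule iso_ar_Fa)
qed

end

section \<open>Composition of symmetric multifunctors\<close>

lemma mfun_comp_simps [simp]:
  "a \<in> objs M \<Longrightarrow> fob (mfun_comp M G F) a = fob G (fob F a)"
  "f \<in> cells1 M \<Longrightarrow> fun1 (mfun_comp M G F) f = fun1 G (fun1 F f)"
  "\<alpha> \<in> cells2 M \<Longrightarrow> fun2 (mfun_comp M G F) \<alpha> = fun2 G (fun2 F \<alpha>)"
  by (simp_all add: mfun_comp_def compose_def)

lemma mfun_comp_ext:
  "fob (mfun_comp M G F) \<in> extensional (objs M)"
  "fun1 (mfun_comp M G F) \<in> extensional (cells1 M)"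
  "fun2 (mfun_comp M G F) \<in> extensional (cells2 M)"
  by (simp_all add: mfun_comp_def compose_def)

lemma symmetric_multifunctor_comp:
  assumes "symmetric_multifunctor M N F" "symmetric_multifunctor N Q G"
  shows "symmetric_multifunctor M Q (mfun_comp M G F)"
proof -
  interpret F: symmetric_multifunctor M N F by fact
  interpret G: symmetric_multifunctor N Q G by fact
  have "multifunctor M Q (mfun_comp M G F)"
  proof (rule multifunctorI)
    fix f gs assume c: "composable1 M f gs"
    have m: "map (fun1 (mfun_comp M G F)) gs = map (fun1 G) (map (fun1 F) gs)"
      using composable1D[OF c] by auto
    show "fun1 (mfun_comp M G F) (gam1 M f gs) =
        gam1 Q (fun1 (mfun_comp M G F) f) (map (fun1 (mfun_comp M G F)) gs)"
      unfolding m
      using F.fun1_gam1[OF c] G.fun1_gam1[OF F.composable1_fun1[OF c]] composable1D[OF c]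
        F.M.gam1_cells1[OF c] by simp
  next
    fix \<alpha> \<beta>s assume c: "composable2 M \<alpha> \<beta>s"
    have m: "map (fun2 (mfun_comp M G F)) \<beta>s = map (fun2 G) (map (fun2 F) \<beta>s)"
      using composable2D[OF c] by auto
    show "fun2 (mfun_comp M G F) (gam2 M \<alpha> \<beta>s) =
        gam2 Q (fun2 (mfun_comp M G F) \<alpha>) (map (fun2 (mfun_comp M G F)) \<beta>s)"
      unfolding m
      using F.fun2_gam2[OF c] G.fun2_gam2[OF F.composable2_fun2[OF c]] composable2D[OF c]
        F.M.gam2_cells2[OF c] by simp
  next
    fix f assume f: "f \<in> cells1 M"
    have "map (fob G) (map (fob F) (src M f)) = map (fob (mfun_comp M G F)) (src M f)"
      using F.M.src_in_objs[OF f] by simp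
    then show "fun1 (mfun_comp M G F) f \<in> cells1 Q \<and>
        src Q (fun1 (mfun_comp M G F) f) = map (fob (mfun_comp M G F)) (src M f) \<and>
        tgt Q (fun1 (mfun_comp M G F) f) = fob (mfun_comp M G F) (tgt M f)"
      using f F.M.tgt_objs[OF f] by (simp add: F.fun1_cell G.fun1_cell)
  qed (simp_all add: mfun_comp_ext F.M.cat_multicategory_axioms G.N.cat_multicategory_axioms
      F.fob_objs G.fob_objs F.fun1_cell G.fun1_cell F.fun2_cell G.fun2_cell F.M.munit_cell F.fun1_munit
      G.fun1_munit F.M.cells.Idn_Ar F.M.cells.Cmp_Ar F.M.cells.Dom_Ob F.M.cells.Cod_Ob)
  then show ?thesis
    by (intro symmetric_multifunctor.intro symmetric_multifunctor_axioms.intro)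
      (simp_all add: F.M.act1_cell F.M.act2_cell F.fun1_act1 F.fun2_act2 F.fun1_cell F.fun2_cell
        G.fun1_act1 G.fun2_act2 F.M.cells.Dom_Ob)
qed

text \<open>Strict equality of records: \<open>F\<close> has to map into the carriers of
  \<open>M\<close>, because \<open>compose\<close> returns \<open>undefined\<close> outside
  them.\<close>

lemma mfun_comp_assoc:
  assumes "symmetric_multifunctor L M F"
  shows "mfun_comp L (mfun_comp M H G) F = mfun_comp L H (mfun_comp L G F)"
proof -
  interpret symmetric_multifunctor L M F by fact
  show ?thesis
    by (intro mfun.equality) (auto simp: mfun_comp_def compose_def fun_eq_iff fob_objs fun1_cell fun2_cell)
qed

section \<open>Multinatural transformations\<close>

lemma multinaturalD:
  assumes "multinatural M N F G \<theta>"
  shows "\<theta> \<in> extensional (objs M)"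
    and "\<And>a. a \<in> objs M \<Longrightarrow> \<theta> a \<in> cells1 N"
    and "\<And>a. a \<in> objs M \<Longrightarrow> src N (\<theta> a) = [fob F a]"
    and "\<And>a. a \<in> objs M \<Longrightarrow> tgt N (\<theta> a) = fob G a"
    and "\<And>f. f \<in> cells1 M \<Longrightarrow> gam1 N (fun1 G f) (map \<theta> (src M f)) = gam1 N (\<theta> (tgt M f)) [fun1 F f]"
    and "\<And>\<alpha>. \<alpha> \<in> cells2 M \<Longrightarrow> gam2 N (fun2 G \<alpha>) (map (\<lambda>a. Idn (cells N) (\<theta> a)) (src2 M \<alpha>)) =
        gam2 N (Idn (cells N) (\<theta> (tgt2 M \<alpha>))) [fun2 F \<alpha>]"
  using assms unfolding multinatural_def by auto

lemma multinaturalI: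
  assumes "\<theta> \<in> extensional (objs M)"
    and "\<And>a. a \<in> objs M \<Longrightarrow> \<theta> a \<in> cells1 N \<and> src N (\<theta> a) = [fob F a] \<and> tgt N (\<theta> a) = fob G a"
    and "\<And>f. f \<in> cells1 M \<Longrightarrow> gam1 N (fun1 G f) (map \<theta> (src M f)) = gam1 N (\<theta> (tgt M f)) [fun1 F f]"
    and "\<And>\<alpha>. \<alpha> \<in> cells2 M \<Longrightarrow> gam2 N (fun2 G \<alpha>) (map (\<lambda>a. Idn (cells N) (\<theta> a)) (src2 M \<alpha>)) =
        gam2 N (Idn (cells N) (\<theta> (tgt2 M \<alpha>))) [fun2 F \<alpha>]"
  shows "multinatural M N F G \<theta>"
  using assms unfolding multinatural_def by auto

context multifunctor
begin

text \<open>Both sides of each naturality square reduce to the image of the cell, by the right and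
  the left unit law.\<close>

lemma multinatural_id: "multinatural M N F F (\<lambda>a\<in>objs M. munit N (fob F a))"
proof (rule multinaturalI)
  fix f assume f: "f \<in> cells1 M"
  have m: "map (\<lambda>a\<in>objs M. munit N (fob F a)) (src M f) = map (munit N) (src N (fun1 F f))"
    using M.src_in_objs[OF f] by (simp add: src_fun1[OF f])
  show "gam1 N (fun1 F f) (map (\<lambda>a\<in>objs M. munit N (fob F a)) (src M f)) =
      gam1 N ((\<lambda>a\<in>objs M. munit N (fob F a)) (tgt M f)) [fun1 F f]"
    unfolding m
    using N.gam1_munit_left[of "fun1 F f"] N.gam1_munit_right[of "fun1 F f"] M.tgt_objs[OF f]
    by (simp add: fun1_cell f)
next
  fix \<alpha> assume \<alpha>: "\<alpha> \<in> cells2 M"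
  note d = M.cells.Dom_Ob[OF \<alpha>]
  have m: "map (\<lambda>a. Idn (cells N) ((\<lambda>a\<in>objs M. munit N (fob F a)) a)) (src2 M \<alpha>) =
      map (\<lambda>a. Idn (cells N) (munit N a)) (src2 N (fun2 F \<alpha>))"
    using M.src_in_objs[OF d] by (simp add: fun2_cell[OF \<alpha>] src_fun1[OF d])
  show "gam2 N (fun2 F \<alpha>) (map (\<lambda>a. Idn (cells N) ((\<lambda>a\<in>objs M. munit N (fob F a)) a)) (src2 M \<alpha>)) =
      gam2 N (Idn (cells N) ((\<lambda>a\<in>objs M. munit N (fob F a)) (tgt2 M \<alpha>))) [fun2 F \<alpha>]"
    unfolding m
    using N.gam2_munit_left[of "fun2 F \<alpha>"] N.gam2_munit_right[of "fun2 F \<alpha>"] M.tgt_objs[OF d]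
    by (simp add: fun1_cell fun2_cell \<alpha> d)
qed (simp_all add: N.munit_cell fob_objs)

end

lemma (in cat_multicategory) composable2_Idn_map:
  assumes "\<alpha> \<in> cells2 M" "\<And>a. a \<in> set as \<Longrightarrow> u a \<in> cells1 M" "map (\<lambda>a. tgt M (u a)) as = src2 M \<alpha>"
  shows "composable2 M \<alpha> (map (\<lambda>a. Idn (cells M) (u a)) as)"
  using assms unfolding composable2_def
  by (auto simp: cells.Idn_Ar cells.Dom_Idn subset_eq list_eq_iff_nth_eq)

text \<open>Pasting of the naturality squares \<open>\<gamma>(z; u) = \<gamma>(s; y)\<close> and \<open>\<gamma>(y; v) = \<gamma>(t; x)\<close>.\<close>

lemma (in cat_multicategory) paste1:
  assumes c: "composable1 M z (map u as)" "composable1 M y (map v as)" "composable1 M s [y]"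
      "composable1 M t [x]" "composable1 M s [t]"
    and cu: "\<And>a. a \<in> set as \<Longrightarrow> composable1 M (u a) [v a]"
    and e1: "gam1 M z (map u as) = gam1 M s [y]"
    and e2: "gam1 M y (map v as) = gam1 M t [x]"
  shows "gam1 M z (map (\<lambda>a. gam1 M (u a) [v a]) as) = gam1 M (gam1 M s [t]) [x]"
proof -
  have "gam1 M z (map (\<lambda>a. gam1 M (u a) [v a]) as) = gam1 M (gam1 M z (map u as)) (map v as)"
    by (rule gam1_assoc_map[OF c(1) cu, symmetric])
  also have "\<dots> = gam1 M s [gam1 M y (map v as)]"
    unfolding e1 by (rule gam1_assoc_single[OF c(3,2)])
  also have "\<dots> = gam1 M (gam1 M s [t]) [x]"
    unfolding e2 by (rule gam1_assoc_single[OF c(5,4), symmetric])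
  finally show ?thesis .
qed

lemma (in cat_multicategory) paste2:
  assumes c: "composable2 M z (map u as)" "composable2 M y (map v as)" "composable2 M s [y]"
      "composable2 M t [x]" "composable2 M s [t]"
    and cu: "\<And>a. a \<in> set as \<Longrightarrow> composable2 M (u a) [v a]"
    and e1: "gam2 M z (map u as) = gam2 M s [y]"
    and e2: "gam2 M y (map v as) = gam2 M t [x]"
  shows "gam2 M z (map (\<lambda>a. gam2 M (u a) [v a]) as) = gam2 M (gam2 M s [t]) [x]"
proof -
  have "gam2 M z (map (\<lambda>a. gam2 M (u a) [v a]) as) = gam2 M (gam2 M z (map u as)) (map v as)"
    by (rule gam2_assoc_map[OF c(1) cu, symmetric])
  also have "\<dots> = gam2 M s [gam2 M y (map v as)]"
    unfolding e1 by (rule gam2_assoc_single[OF c(3,2)])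
  also have "\<dots> = gam2 M (gam2 M s [t]) [x]"
    unfolding e2 by (rule gam2_assoc_single[OF c(5,4), symmetric])
  finally show ?thesis .
qed

lemma (in cat_multicategory) gam2_Idn_single:
  "composable1 M f [g] \<Longrightarrow> gam2 M (Idn (cells M) f) [Idn (cells M) g] = Idn (cells M) (gam1 M f [g])"
  using gam2_Idn[of f "[g]"] by simp

text \<open>The square of \<zeta> is pasted to the square of \<theta> along the image of the cell
  under \<open>G\<close>.\<close>

lemma multinatural_vcomp:
  assumes "multifunctor M N F" "multifunctor M N G" "multifunctor M N H"
    and \<theta>: "multinatural M N F G \<theta>" and \<zeta>: "multinatural M N G H \<zeta>"
  shows "multinatural M N F H (\<lambda>a\<in>objs M. gam1 N (\<zeta> a) [\<theta> a])"
proof (rule multinaturalI)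
  interpret F: multifunctor M N F by fact
  interpret G: multifunctor M N G by fact
  interpret H: multifunctor M N H by fact
  let ?\<kappa> = "\<lambda>a\<in>objs M. gam1 N (\<zeta> a) [\<theta> a]"
  note t = multinaturalD[OF \<theta>] and z = multinaturalD[OF \<zeta>]
  have c: "composable1 N (\<zeta> a) [\<theta> a]" if "a \<in> objs M" for a
    using that t z by (simp add: F.N.composable1_singleton)
  note simps = F.N.composable1_singleton F.N.composable2_singleton F.fun1_cell G.fun1_cell H.fun1_cell
    F.fun2_cell G.fun2_cell H.fun2_cell t z F.M.tgt_objs F.N.cells.Idn_Ar F.N.cells.Dom_Idn
    F.M.cells.Dom_Ob
  show "?\<kappa> \<in> extensional (objs M)" by simp
  show "?\<kappa> a \<in> cells1 N \<and> src N (?\<kappa> a) = [fob F a] \<and> tgt N (?\<kappa> a) = fob H a" if "a \<in> objs M" for a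
    using that c[OF that] t z by (simp add: F.N.gam1_cell)
  fix f assume f: "f \<in> cells1 M"
  note o = F.M.src_in_objs[OF f]
  have m: "map ?\<kappa> (src M f) = map (\<lambda>a. gam1 N (\<zeta> a) [\<theta> a]) (src M f)" using o by simp
  moreover have "gam1 N (fun1 H f) (map (\<lambda>a. gam1 N (\<zeta> a) [\<theta> a]) (src M f)) =
      gam1 N (gam1 N (\<zeta> (tgt M f)) [\<theta> (tgt M f)]) [fun1 F f]"
    by (rule F.N.paste1[of _ _ _ "fun1 G f"])
      (use f o in \<open>auto simp: simps composable1_def subset_eq\<close>)
  ultimately show "gam1 N (fun1 H f) (map ?\<kappa> (src M f)) = gam1 N (?\<kappa> (tgt M f)) [fun1 F f]"
      unfolding m
    using F.M.tgt_objs[OF f] by simp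
next
  interpret F: multifunctor M N F by fact
  interpret G: multifunctor M N G by fact
  interpret H: multifunctor M N H by fact
  let ?\<kappa> = "\<lambda>a\<in>objs M. gam1 N (\<zeta> a) [\<theta> a]"
  note t = multinaturalD[OF \<theta>] and z = multinaturalD[OF \<zeta>]
  have c: "composable1 N (\<zeta> a) [\<theta> a]" if "a \<in> objs M" for a
    using that t z by (simp add: F.N.composable1_singleton)
  note simps = F.N.composable1_singleton F.N.composable2_singleton F.fun1_cell G.fun1_cell H.fun1_cell
    F.fun2_cell G.fun2_cell H.fun2_cell t z F.M.tgt_objs F.N.cells.Idn_Ar F.N.cells.Dom_Idn
    F.M.cells.Dom_Ob
  fix \<alpha> assume \<alpha>: "\<alpha> \<in> cells2 M"
  let ?f = "Dom (cells M) \<alpha>"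
  note d = F.M.cells.Dom_Ob[OF \<alpha>]
  note o = F.M.src_in_objs[OF d]
  \<comment> \<open>Since \<gamma> preserves identities, the condition on 2-cells takes the same
    shape as that on 1-cells and can be pasted in the same way.\<close>
  have k: "Idn (cells N) (?\<kappa> a) = gam2 N (Idn (cells N) (\<zeta> a)) [Idn (cells N) (\<theta> a)]"
    if "a \<in> objs M" for a using that c[OF that] by (simp add: F.N.gam2_Idn_single)
  have m: "map (\<lambda>a. Idn (cells N) (?\<kappa> a)) (src M ?f) =
      map (\<lambda>a. gam2 N (Idn (cells N) (\<zeta> a)) [Idn (cells N) (\<theta> a)]) (src M ?f)"
    using o k by simp
  moreover have "gam2 N (fun2 H \<alpha>) (map (\<lambda>a. gam2 N (Idn (cells N) (\<zeta> a)) [Idn (cells N) (\<theta> a)]) (src M ?f)) =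
      gam2 N (gam2 N (Idn (cells N) (\<zeta> (tgt M ?f))) [Idn (cells N) (\<theta> (tgt M ?f))]) [fun2 F \<alpha>]"
    by (rule F.N.paste2[of _ _ _ "fun2 G \<alpha>"])
      (use \<alpha> d o in \<open>auto simp: simps intro!: F.N.composable2_Idn_map\<close>)
  ultimately show "gam2 N (fun2 H \<alpha>) (map (\<lambda>a. Idn (cells N) (?\<kappa> a)) (src2 M \<alpha>)) =
      gam2 N (Idn (cells N) (?\<kappa> (tgt2 M \<alpha>))) [fun2 F \<alpha>]"
      unfolding m
    using k[OF F.M.tgt_objs[OF d]] by simp
qed

text \<open>Two squares are pasted: that of \<zeta> at the image of the cell under \<open>J\<close>,
  and the image under \<open>G\<close> of the square of \<theta>. They meet in \<open>G\<close>
  applied to \<open>J\<close> of the cell.\<close>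

lemma multinatural_hcomp:
  assumes "symmetric_multifunctor M N F" "symmetric_multifunctor M N J"
    and "symmetric_multifunctor N Q G" "symmetric_multifunctor N Q K"
    and \<theta>: "multinatural M N F J \<theta>" and \<zeta>: "multinatural N Q G K \<zeta>"
  shows "multinatural M Q (mfun_comp M G F) (mfun_comp M K J)
    (\<lambda>a\<in>objs M. gam1 Q (\<zeta> (fob J a)) [fun1 G (\<theta> a)])" (is "multinatural M Q _ _ ?\<kappa>")
proof -
  interpret F: symmetric_multifunctor M N F by fact
  interpret J: symmetric_multifunctor M N J by fact
  interpret G: symmetric_multifunctor N Q G by fact
  interpret K: symmetric_multifunctor N Q K by fact
  note t = multinaturalD[OF \<theta>] and z = multinaturalD[OF \<zeta>]
  have c: "composable1 Q (\<zeta> (fob J a)) [fun1 G (\<theta> a)]" if "a \<in> objs M" for a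
    using that t z by (simp add: G.N.composable1_singleton J.fob_objs G.fun1_cell)
  note simps = G.N.composable1_singleton G.N.composable2_singleton F.fun1_cell J.fun1_cell G.fun1_cell
    K.fun1_cell F.fun2_cell J.fun2_cell G.fun2_cell K.fun2_cell t(2-4) z(2-4) F.M.tgt_objs
    G.N.cells.Idn_Ar G.N.cells.Dom_Idn F.M.cells.Dom_Ob F.N.cells.Dom_Ob J.fob_objs F.fob_objs
  show ?thesis
  proof (rule multinaturalI)
    show "?\<kappa> \<in> extensional (objs M)" by simp
    show "?\<kappa> a \<in> cells1 Q \<and> src Q (?\<kappa> a) = [fob (mfun_comp M G F) a] \<and>
        tgt Q (?\<kappa> a) = fob (mfun_comp M K J) a" if "a \<in> objs M" for a
      using that c[OF that] by (simp add: G.N.gam1_cell simps)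
  next
    fix f assume f: "f \<in> cells1 M"
    note o = F.M.src_in_objs[OF f]
    have m: "map ?\<kappa> (src M f) = map (\<lambda>a. gam1 Q (\<zeta> (fob J a)) [fun1 G (\<theta> a)]) (src M f)" using o by simp
    moreover have "gam1 Q (fun1 K (fun1 J f)) (map (\<lambda>a. gam1 Q (\<zeta> (fob J a)) [fun1 G (\<theta> a)]) (src M f)) =
        gam1 Q (gam1 Q (\<zeta> (fob J (tgt M f))) [fun1 G (\<theta> (tgt M f))]) [fun1 G (fun1 F f)]"
    proof (rule G.N.paste1[of _ _ _ "fun1 G (fun1 J f)"])
      show "gam1 Q (fun1 K (fun1 J f)) (map (\<lambda>a. \<zeta> (fob J a)) (src M f)) =
          gam1 Q (\<zeta> (fob J (tgt M f))) [fun1 G (fun1 J f)]"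
        using z(5)[OF J.fun1_cells1[OF f]] by (simp add: J.fun1_cell f o_def)
      have "composable1 N (fun1 J f) (map \<theta> (src M f))" "composable1 N (\<theta> (tgt M f)) [fun1 F f]"
        using f o by (auto simp: simps composable1_def subset_eq)
      from G.fun1_gam1[OF this(1)] G.fun1_gam1[OF this(2)]
      show "gam1 Q (fun1 G (fun1 J f)) (map (\<lambda>a. fun1 G (\<theta> a)) (src M f)) =
          gam1 Q (fun1 G (\<theta> (tgt M f))) [fun1 G (fun1 F f)]"
        using t(5)[OF f] by (simp add: o_def)
    qed (use f o in \<open>auto simp: simps composable1_def subset_eq\<close>)
    ultimately show "gam1 Q (fun1 (mfun_comp M K J) f) (map ?\<kappa> (src M f)) =
        gam1 Q (?\<kappa> (tgt M f)) [fun1 (mfun_comp M G F) f]"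
      unfolding m
      using F.M.tgt_objs[OF f] f by simp
  next
    fix \<alpha> assume \<alpha>: "\<alpha> \<in> cells2 M"
    let ?f = "Dom (cells M) \<alpha>" and ?i = "Idn (cells Q)"
    note d = F.M.cells.Dom_Ob[OF \<alpha>]
    note o = F.M.src_in_objs[OF d]
    have k: "?i (?\<kappa> a) = gam2 Q (?i (\<zeta> (fob J a))) [?i (fun1 G (\<theta> a))]"
      if "a \<in> objs M" for a using that c[OF that] by (simp add: G.N.gam2_Idn_single)
    have m: "map (\<lambda>a. ?i (?\<kappa> a)) (src M ?f) =
        map (\<lambda>a. gam2 Q (?i (\<zeta> (fob J a))) [?i (fun1 G (\<theta> a))]) (src M ?f)"
      using o k by simp
    moreover have "gam2 Q (fun2 K (fun2 J \<alpha>))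
          (map (\<lambda>a. gam2 Q (?i (\<zeta> (fob J a))) [?i (fun1 G (\<theta> a))]) (src M ?f)) =
        gam2 Q (gam2 Q (?i (\<zeta> (fob J (tgt M ?f)))) [?i (fun1 G (\<theta> (tgt M ?f)))]) [fun2 G (fun2 F \<alpha>)]"
    proof (rule G.N.paste2[of _ _ _ "fun2 G (fun2 J \<alpha>)"])
      show "gam2 Q (fun2 K (fun2 J \<alpha>)) (map (\<lambda>a. ?i (\<zeta> (fob J a))) (src M ?f)) =
          gam2 Q (?i (\<zeta> (fob J (tgt M ?f)))) [fun2 G (fun2 J \<alpha>)]"
        using z(6)[OF J.fun2_cells2[OF \<alpha>]] by (simp add: J.fun1_cell J.fun2_cell \<alpha> d o_def)
      have A: "composable2 N (fun2 J \<alpha>) (map (\<lambda>a. Idn (cells N) (\<theta> a)) (src M ?f))"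
        using \<alpha> d o by (intro F.N.composable2_Idn_map) (auto simp: simps)
      have B: "composable2 N (Idn (cells N) (\<theta> (tgt M ?f))) [fun2 F \<alpha>]"
        using \<alpha> d o by (auto simp: simps F.N.composable2_singleton F.N.cells.Idn_Ar F.N.cells.Dom_Idn)
      have E: "map (\<lambda>a. ?i (fun1 G (\<theta> a))) (src M ?f) =
          map (fun2 G) (map (\<lambda>a. Idn (cells N) (\<theta> a)) (src M ?f))"
        using o by (simp add: G.fun2_Idn t(2))
      show "gam2 Q (fun2 G (fun2 J \<alpha>)) (map (\<lambda>a. ?i (fun1 G (\<theta> a))) (src M ?f)) =
          gam2 Q (?i (fun1 G (\<theta> (tgt M ?f)))) [fun2 G (fun2 F \<alpha>)]"
        unfolding E G.fun2_gam2[OF A, symmetric] t(6)[OF \<alpha>] G.fun2_gam2[OF B]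
        by (simp add: G.fun2_Idn t(2) F.M.tgt_objs[OF d])
    qed (use \<alpha> d o in \<open>auto simp: simps intro!: G.N.composable2_Idn_map\<close>)
    ultimately show "gam2 Q (fun2 (mfun_comp M K J) \<alpha>) (map (\<lambda>a. ?i (?\<kappa> a)) (src2 M \<alpha>)) =
        gam2 Q (?i (?\<kappa> (tgt2 M \<alpha>))) [fun2 (mfun_comp M G F) \<alpha>]"
      unfolding m
      using k[OF F.M.tgt_objs[OF d]] \<alpha> by simp
  qed
qed

section \<open>Symmetric multifunctors and their transformations\<close>

lemma sym_transD:
  assumes "sym_trans M N \<theta>"
  shows "symmetric_multifunctor M N (tdom \<theta>)" "symmetric_multifunctor M N (tcod \<theta>)"
    "multinatural M N (tdom \<theta>) (tcod \<theta>) (tcmp \<theta>)"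
    "multifunctor M N (tdom \<theta>)" "multifunctor M N (tcod \<theta>)"
  using assms by (auto simp: sym_trans_def symmetric_multifunctor_def)

lemma trans_id_simps [simp]:
  "tdom (trans_id M N F) = F" "tcod (trans_id M N F) = F"
  "a \<in> objs M \<Longrightarrow> tcmp (trans_id M N F) a = munit N (fob F a)"
  "tcmp (trans_id M N F) \<in> extensional (objs M)"
  by (simp_all add: trans_id_def)

lemma trans_vcomp_simps [simp]:
  "tdom (trans_vcomp M N \<zeta> \<theta>) = tdom \<theta>" "tcod (trans_vcomp M N \<zeta> \<theta>) = tcod \<zeta>"
  "a \<in> objs M \<Longrightarrow> tcmp (trans_vcomp M N \<zeta> \<theta>) a = gam1 N (tcmp \<zeta> a) [tcmp \<theta> a]"
  "tcmp (trans_vcomp M N \<zeta> \<theta>) \<in> extensional (objs M)"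
  by (simp_all add: trans_vcomp_def)

lemma sym_hcomp_simps [simp]:
  "tdom (sym_hcomp M Q \<zeta> \<theta>) = mfun_comp M (tdom \<zeta>) (tdom \<theta>)"
  "tcod (sym_hcomp M Q \<zeta> \<theta>) = mfun_comp M (tcod \<zeta>) (tcod \<theta>)"
  "a \<in> objs M \<Longrightarrow> tcmp (sym_hcomp M Q \<zeta> \<theta>) a =
    gam1 Q (tcmp \<zeta> (fob (tcod \<theta>) a)) [fun1 (tdom \<zeta>) (tcmp \<theta> a)]"
  "tcmp (sym_hcomp M Q \<zeta> \<theta>) \<in> extensional (objs M)"
  by (simp_all add: sym_hcomp_def hcomp_cmp_def)

lemma mtrans_eqI:
  fixes \<theta> \<theta>' :: "('F, 'o, 'g) mtrans"
  assumes "tdom \<theta> = tdom \<theta>'" "tcod \<theta> = tcod \<theta>'"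
    and "tcmp \<theta> \<in> extensional A" "tcmp \<theta>' \<in> extensional A"
    and "\<And>a. a \<in> A \<Longrightarrow> tcmp \<theta> a = tcmp \<theta>' a"
  shows "\<theta> = \<theta>'"
  using assms by (intro mtrans.equality) (auto intro: extensionalityI)

lemma mfun_eqI:
  fixes F G :: "('o, 'f, 'a, 'p, 'g, 'b) mfun"
  assumes "fob F \<in> extensional A" "fob G \<in> extensional A" "fun1 F \<in> extensional B"
    "fun1 G \<in> extensional B" "fun2 F \<in> extensional E" "fun2 G \<in> extensional E"
    and "\<And>a. a \<in> A \<Longrightarrow> fob F a = fob G a" "\<And>f. f \<in> B \<Longrightarrow> fun1 F f = fun1 G f"
    and "\<And>\<alpha>. \<alpha> \<in> E \<Longrightarrow> fun2 F \<alpha> = fun2 G \<alpha>"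
  shows "F = G"
  using assms by (intro mfun.equality) (auto intro: extensionalityI)

section \<open>Operations on transformations and their laws\<close>

lemma sym_trans_id: "symmetric_multifunctor M N F \<Longrightarrow> sym_trans M N (trans_id M N F)"
  using multifunctor.multinatural_id[of M N F]
  by (simp add: sym_trans_def trans_id_def symmetric_multifunctor_def)

lemma sym_trans_vcomp:
  assumes "sym_trans M N \<theta>" "sym_trans M N \<zeta>" "tdom \<zeta> = tcod \<theta>"
  shows "sym_trans M N (trans_vcomp M N \<zeta> \<theta>)"
  using multinatural_vcomp[of M N "tdom \<theta>" "tcod \<theta>" "tcod \<zeta>" "tcmp \<theta>" "tcmp \<zeta>"]
    sym_transD[OF assms(1)] sym_transD[OF assms(2)] assms(3)
  by (simp add: sym_trans_def trans_vcomp_def)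

lemma sym_trans_hcomp:
  assumes "sym_trans M N \<theta>" "sym_trans N Q \<zeta>"
  shows "sym_trans M Q (sym_hcomp M Q \<zeta> \<theta>)"
  using sym_transD[OF assms(1)] sym_transD[OF assms(2)]
  by (simp add: sym_trans_def sym_hcomp_def hcomp_cmp_def symmetric_multifunctor_comp
      multinatural_hcomp)

lemma sym_trans_cell:
  assumes "sym_trans M N \<theta>" "a \<in> objs M"
  shows "tcmp \<theta> a \<in> cells1 N" "src N (tcmp \<theta> a) = [fob (tdom \<theta>) a]"
    "tgt N (tcmp \<theta> a) = fob (tcod \<theta>) a"
  using multinaturalD[OF sym_transD(3)[OF assms(1)]] assms(2) by simp_all

lemma sym_trans_ext: "sym_trans M N \<theta> \<Longrightarrow> tcmp \<theta> \<in> extensional (objs M)"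
  using multinaturalD(1) sym_transD(3) by blast

lemma category_multicat_hom:
  assumes "cat_multicategory N"
  shows "category (multicat_hom M N)"
proof -
  interpret N: cat_multicategory N by fact
  show ?thesis
  proof
    fix \<theta> assume "\<theta> \<in> Ar (multicat_hom M N)"
    then have t: "sym_trans M N \<theta>" by (simp add: multicat_hom_def)
    show "Dom (multicat_hom M N) \<theta> \<in> Ob (multicat_hom M N)"
      "Cod (multicat_hom M N) \<theta> \<in> Ob (multicat_hom M N)"
      using sym_transD[OF t] by (simp_all add: multicat_hom_def)
    have "trans_vcomp M N (trans_id M N (tcod \<theta>)) \<theta> = \<theta>"
      by (rule mtrans_eqI[where A = "objs M"])
        (use sym_trans_cell[OF t] sym_trans_ext[OF t] N.gam1_munit_left in \<open>auto, metis\<close>)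
    then show "Cmp (multicat_hom M N) (Idn (multicat_hom M N) (Cod (multicat_hom M N) \<theta>)) \<theta> = \<theta>"
      by (simp add: multicat_hom_def)
    have "gam1 N (tcmp \<theta> a) [munit N (fob (tdom \<theta>) a)] = tcmp \<theta> a" if "a \<in> objs M" for a
      using N.gam1_munit_right[of "tcmp \<theta> a"] sym_trans_cell[OF t that] by simp
    then have "trans_vcomp M N \<theta> (trans_id M N (tdom \<theta>)) = \<theta>"
      by (intro mtrans_eqI[where A = "objs M"]) (use sym_trans_ext[OF t] in auto)
    then show "Cmp (multicat_hom M N) \<theta> (Idn (multicat_hom M N) (Dom (multicat_hom M N) \<theta>)) = \<theta>"
      by (simp add: multicat_hom_def)
  next
    fix \<theta> \<zeta> \<delta>
    assume a: "\<theta> \<in> Ar (multicat_hom M N)" "\<zeta> \<in> Ar (multicat_hom M N)" "\<delta> \<in> Ar (multicat_hom M N)"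
      "Dom (multicat_hom M N) \<zeta> = Cod (multicat_hom M N) \<theta>"
      "Dom (multicat_hom M N) \<delta> = Cod (multicat_hom M N) \<zeta>"
    then have t: "sym_trans M N \<theta>" "sym_trans M N \<zeta>" "sym_trans M N \<delta>"
      and d: "tdom \<zeta> = tcod \<theta>" "tdom \<delta> = tcod \<zeta>"
      by (simp_all add: multicat_hom_def)
    have "gam1 N (tcmp \<delta> a) [gam1 N (tcmp \<zeta> a) [tcmp \<theta> a]] =
        gam1 N (gam1 N (tcmp \<delta> a) [tcmp \<zeta> a]) [tcmp \<theta> a]" if "a \<in> objs M" for a
      by (rule N.gam1_assoc_single[symmetric])
        (use that t d in \<open>simp_all add: N.composable1_singleton sym_trans_cell\<close>)
    then have "trans_vcomp M N \<delta> (trans_vcomp M N \<zeta> \<theta>) = trans_vcomp M N (trans_vcomp M N \<delta> \<zeta>) \<theta>"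
      by (intro mtrans_eqI[where A = "objs M"]) simp_all
    then show "Cmp (multicat_hom M N) \<delta> (Cmp (multicat_hom M N) \<zeta> \<theta>) =
        Cmp (multicat_hom M N) (Cmp (multicat_hom M N) \<delta> \<zeta>) \<theta>"
      by (simp add: multicat_hom_def)
  qed (simp_all add: multicat_hom_def sym_trans_id sym_trans_vcomp)
qed

lemma sym_hcomp_trans_id:
  assumes "symmetric_multifunctor M N F" "symmetric_multifunctor N Q G"
  shows "sym_hcomp M Q (trans_id N Q G) (trans_id M N F) = trans_id M Q (mfun_comp M G F)"
proof -
  interpret F: symmetric_multifunctor M N F by fact
  interpret G: symmetric_multifunctor N Q G by fact
  have "gam1 Q (munit Q b) [munit Q b] = munit Q b" if "b \<in> objs Q" for b
    using G.N.gam1_munit_left[of "munit Q b"] G.N.munit_cell[OF that] by simp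
  then show ?thesis
    by (intro mtrans_eqI[where A = "objs M"]) (simp_all add: F.fob_objs G.fob_objs G.fun1_munit)
qed

text \<open>The interchange law. Beyond associativity and preservation of \<gamma> by
  \<open>tdom \<zeta>\<close> it uses only naturality of \<zeta> at the 1-cell
  \<open>tcmp \<theta>' a\<close>, which moves \<zeta> past that component.\<close>

lemma sym_hcomp_vcomp:
  assumes t: "sym_trans M N \<theta>" "sym_trans M N \<theta>'" "tdom \<theta>' = tcod \<theta>"
    and z: "sym_trans N Q \<zeta>" "sym_trans N Q \<zeta>'" "tdom \<zeta>' = tcod \<zeta>"
  shows "sym_hcomp M Q (trans_vcomp N Q \<zeta>' \<zeta>) (trans_vcomp M N \<theta>' \<theta>) =
    trans_vcomp M Q (sym_hcomp M Q \<zeta>' \<theta>') (sym_hcomp M Q \<zeta> \<theta>)"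
proof (rule mtrans_eqI[where A = "objs M"])
  interpret F: symmetric_multifunctor M N "tdom \<theta>" by (rule sym_transD[OF t(1)])
  interpret J: symmetric_multifunctor M N "tcod \<theta>" by (rule sym_transD[OF t(1)])
  interpret J': symmetric_multifunctor M N "tcod \<theta>'" by (rule sym_transD[OF t(2)])
  interpret G: symmetric_multifunctor N Q "tdom \<zeta>" by (rule sym_transD[OF z(1)])
  interpret K: symmetric_multifunctor N Q "tcod \<zeta>" by (rule sym_transD[OF z(1)])
  fix a assume a: "a \<in> objs M"
  let ?G = "fun1 (tdom \<zeta>)" and ?K = "fun1 (tcod \<zeta>)"
  let ?Ja = "fob (tcod \<theta>) a" and ?J'a = "fob (tcod \<theta>') a"
  let ?t = "tcmp \<theta> a" and ?t' = "tcmp \<theta>' a"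
  note tc = sym_trans_cell[OF t(1) a] sym_trans_cell[OF t(2) a]
  have Ja: "?Ja \<in> objs N" "?J'a \<in> objs N" using a by (simp_all add: J.fob_objs J'.fob_objs)
  note zc = sym_trans_cell[OF z(1)] sym_trans_cell[OF z(2)]
  note simps = G.N.composable1_singleton tc zc Ja t(3) z(3) G.fun1_cell K.fun1_cell
  have c: "composable1 N ?t' [?t]" by (simp add: F.N.composable1_singleton tc t(3))
  have nat: "gam1 Q (?K ?t') [tcmp \<zeta> ?Ja] = gam1 Q (tcmp \<zeta> ?J'a) [?G ?t']"
    using multinaturalD(5)[OF sym_transD(3)[OF z(1)], of ?t'] tc t(3) by simp
  let ?p = "?G ?t"
  have "gam1 Q (gam1 Q (tcmp \<zeta>' ?J'a) [tcmp \<zeta> ?J'a]) [?G (gam1 N ?t' [?t])] =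
      gam1 Q (tcmp \<zeta>' ?J'a) [gam1 Q (tcmp \<zeta> ?J'a) [gam1 Q (?G ?t') [?p]]]"
    by (subst G.N.gam1_assoc_single) (simp_all add: simps G.fun1_gam1[OF c] G.N.gam1_cell)
  also have "gam1 Q (tcmp \<zeta> ?J'a) [gam1 Q (?G ?t') [?p]] = gam1 Q (gam1 Q (?K ?t') [tcmp \<zeta> ?Ja]) [?p]"
    unfolding nat by (rule G.N.gam1_assoc_single[symmetric]) (simp_all add: simps)
  also have "\<dots> = gam1 Q (?K ?t') [gam1 Q (tcmp \<zeta> ?Ja) [?p]]"
    by (rule G.N.gam1_assoc_single) (simp_all add: simps)
  also have "gam1 Q (tcmp \<zeta>' ?J'a) [\<dots>] =
      gam1 Q (gam1 Q (tcmp \<zeta>' ?J'a) [?K ?t']) [gam1 Q (tcmp \<zeta> ?Ja) [?p]]"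
    by (rule G.N.gam1_assoc_single[symmetric]) (simp_all add: simps G.N.gam1_cell)
  finally show "tcmp (sym_hcomp M Q (trans_vcomp N Q \<zeta>' \<zeta>) (trans_vcomp M N \<theta>' \<theta>)) a =
      tcmp (trans_vcomp M Q (sym_hcomp M Q \<zeta>' \<theta>') (sym_hcomp M Q \<zeta> \<theta>)) a"
    using a Ja z(3) by simp
qed simp_all

text \<open>Both components compose the same three 1-cells, once \<open>tdom \<delta>\<close> has
  been distributed over the composite inside; the rest is associativity of \<gamma>.\<close>

lemma sym_hcomp_assoc:
  assumes t: "sym_trans L M \<theta>" and z: "sym_trans M N \<zeta>" and d: "sym_trans N Q \<delta>"
  shows "sym_hcomp L Q \<delta> (sym_hcomp L N \<zeta> \<theta>) = sym_hcomp L Q (sym_hcomp M Q \<delta> \<zeta>) \<theta>"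
proof (rule mtrans_eqI[where A = "objs L"])
  interpret J: symmetric_multifunctor L M "tcod \<theta>" by (rule sym_transD[OF t])
  interpret G: symmetric_multifunctor M N "tdom \<zeta>" by (rule sym_transD[OF z])
  interpret K: symmetric_multifunctor M N "tcod \<zeta>" by (rule sym_transD[OF z])
  interpret D: symmetric_multifunctor N Q "tdom \<delta>" by (rule sym_transD[OF d])
  fix a assume a: "a \<in> objs L"
  note tc = sym_trans_cell[OF t a] and zc = sym_trans_cell[OF z] and dc = sym_trans_cell[OF d]
  have Ja: "fob (tcod \<theta>) a \<in> objs M" using a by (rule J.fob_objs)
  have c: "composable1 N (tcmp \<zeta> (fob (tcod \<theta>) a)) [fun1 (tdom \<zeta>) (tcmp \<theta> a)]"
    by (simp add: G.N.composable1_singleton tc zc Ja G.fun1_cell)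
  show "tcmp (sym_hcomp L Q \<delta> (sym_hcomp L N \<zeta> \<theta>)) a = tcmp (sym_hcomp L Q (sym_hcomp M Q \<delta> \<zeta>) \<theta>) a"
    using a Ja tc D.fun1_gam1[OF c] D.composable1_fun1[OF c]
      D.N.gam1_assoc_single[of "tcmp \<delta> (fob (tcod \<zeta>) (fob (tcod \<theta>) a))"
        "fun1 (tdom \<delta>) (tcmp \<zeta> (fob (tcod \<theta>) a))"
        "[fun1 (tdom \<delta>) (fun1 (tdom \<zeta>) (tcmp \<theta> a))]"]
    by (simp add: D.N.composable1_singleton dc zc K.fob_objs D.fun1_cell)
qed (simp_all add: mfun_comp_assoc[OF sym_transD(1)[OF t]] mfun_comp_assoc[OF sym_transD(2)[OF t]])

section \<open>The 2-category D\<close>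

lemma cat_multicategory_timesE: "cat_multicategory M \<Longrightarrow> cat_multicategory (timesE M)"
  by (simp add: cat_multicategory_mprod cat_multicategory_barratt_eccles)

text \<open>\<open>lift_mfun M F\<close> is \<open>(F \<times> 1)(1 \<times> \<Delta>)\<close>, the coKleisli lift of \<open>F\<close>.\<close>

definition lift_mfun :: "('o, 'f, 'a) mcat \<Rightarrow>
    ('o \<times> unit, 'f \<times> deg_perm, 'a \<times> deg_perm \<times> deg_perm, 'p, 'g, 'b) mfun \<Rightarrow>
    ('o \<times> unit, 'f \<times> deg_perm, 'a \<times> deg_perm \<times> deg_perm,
     'p \<times> unit, 'g \<times> deg_perm, 'b \<times> deg_perm \<times> deg_perm) mfun" where
  "lift_mfun M F =
     \<lparr>fob = (\<lambda>x\<in>objs (timesE M). (fob F x, ())),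
      fun1 = (\<lambda>x\<in>cells1 (timesE M). (fun1 F x, snd x)),
      fun2 = (\<lambda>x\<in>cells2 (timesE M). (fun2 F x, snd x))\<rparr>"

text \<open>The corresponding lift of a 2-cell: \<open>\<theta> \<times> 1\<close> whiskered with
  \<open>1 \<times> \<Delta>\<close>. The second entry \<open>(1, id)\<close> of a component is the
  unit of the operad.\<close>

definition lift_trans :: "('o, 'f, 'a) mcat \<Rightarrow>
    (('o \<times> unit, 'f \<times> deg_perm, 'a \<times> deg_perm \<times> deg_perm, 'p, 'g, 'b) mfun, 'o \<times> unit, 'g) mtrans \<Rightarrow>
    (('o \<times> unit, 'f \<times> deg_perm, 'a \<times> deg_perm \<times> deg_perm,
      'p \<times> unit, 'g \<times> deg_perm, 'b \<times> deg_perm \<times> deg_perm) mfun, 'o \<times> unit, 'g \<times> deg_perm) mtrans" where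
  "lift_trans M \<theta> =
     \<lparr>tdom = lift_mfun M (tdom \<theta>), tcod = lift_mfun M (tcod \<theta>),
      tcmp = (\<lambda>x\<in>objs (timesE M). (tcmp \<theta> x, (1, id)))\<rparr>"

text \<open>Membership in the carriers of \<open>timesE M\<close> stays folded in these rules.
  Simplification would split it into conditions on components, so below the rules are mostly
  instantiated explicitly with such a membership fact.\<close>

lemma lift_mfun_simps [simp]:
  "x \<in> objs (timesE M) \<Longrightarrow> fob (lift_mfun M F) x = (fob F x, ())"
  "f \<in> cells1 (timesE M) \<Longrightarrow> fun1 (lift_mfun M F) f = (fun1 F f, snd f)"
  "\<alpha> \<in> cells2 (timesE M) \<Longrightarrow> fun2 (lift_mfun M F) \<alpha> = (fun2 F \<alpha>, snd \<alpha>)"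
  "fob (lift_mfun M F) \<in> extensional (objs (timesE M))"
  "fun1 (lift_mfun M F) \<in> extensional (cells1 (timesE M))"
  "fun2 (lift_mfun M F) \<in> extensional (cells2 (timesE M))"
  by (simp_all add: lift_mfun_def del: mprod_simps barratt_eccles_simps)

lemma lift_trans_simps [simp]:
  "tdom (lift_trans M \<theta>) = lift_mfun M (tdom \<theta>)" "tcod (lift_trans M \<theta>) = lift_mfun M (tcod \<theta>)"
  "x \<in> objs (timesE M) \<Longrightarrow> tcmp (lift_trans M \<theta>) x = (tcmp \<theta> x, (1, id))"
  "tcmp (lift_trans M \<theta>) \<in> extensional (objs (timesE M))"
  by (simp_all add: lift_trans_def del: mprod_simps barratt_eccles_simps)

lemma zip_units: "length xs = n \<Longrightarrow> zip xs (replicate n ()) = map (\<lambda>x. (x, ())) xs"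
  by (auto intro!: nth_equalityI)

text \<open>The lift pairs \<open>F\<close> with the projection to E\<Sigma>, and both respect all
  operations. The pair lies in the product because \<open>F\<close> preserves arities, so the degree
  of the second entry still fits.\<close>

lemma symmetric_lift_mfun:
  assumes "cat_multicategory M" "symmetric_multifunctor (timesE M) N F"
  shows "symmetric_multifunctor (timesE M) (timesE N) (lift_mfun M F)"
proof -
  interpret F: symmetric_multifunctor "timesE M" N F by fact
  interpret M: cat_multicategory M by fact
  interpret E: cat_multicategory barratt_eccles by (rule cat_multicategory_barratt_eccles)
  interpret T: cat_multicategory "timesE N"
    by (rule cat_multicategory_timesE[OF F.N.cat_multicategory_axioms])
  let ?L = "lift_mfun M F"
  have "multifunctor (timesE M) (timesE N) ?L"
  proof (rule multifunctorI)
    fix f assume f: "f \<in> cells1 (timesE M)"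
    have "map (fob ?L) (src (timesE M) f) = map (\<lambda>x. (fob F x, ())) (src (timesE M) f)"
      by (rule map_cong[OF refl lift_mfun_simps(1)]) (rule F.M.src_in_objs[OF f])
    then have "zip (map (fob F) (src (timesE M) f)) (src barratt_eccles (snd f)) =
        map (fob ?L) (src (timesE M) f)"
      using f by (simp add: zip_units)
    then show "fun1 ?L f \<in> cells1 (timesE N) \<and> src (timesE N) (fun1 ?L f) = map (fob ?L) (src (timesE M) f) \<and>
        tgt (timesE N) (fun1 ?L f) = fob ?L (tgt (timesE M) f)"
      unfolding lift_mfun_simps(2)[OF f] lift_mfun_simps(1)[OF F.M.tgt_objs[OF f]]
      using F.fun1_cell[OF f] f by (simp add: prod_eq_iff)
    show "fun2 ?L (Idn (cells (timesE M)) f) = Idn (cells (timesE N)) (fun1 ?L f)"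
      unfolding lift_mfun_simps(2)[OF f] lift_mfun_simps(3)[OF F.M.cells.Idn_Ar[OF f]]
      using F.fun2_Idn[OF f] by (simp add: prod_eq_iff)
  next
    fix \<alpha> assume \<alpha>: "\<alpha> \<in> cells2 (timesE M)"
    show "fun2 ?L \<alpha> \<in> cells2 (timesE N) \<and>
        Dom (cells (timesE N)) (fun2 ?L \<alpha>) = fun1 ?L (Dom (cells (timesE M)) \<alpha>) \<and>
        Cod (cells (timesE N)) (fun2 ?L \<alpha>) = fun1 ?L (Cod (cells (timesE M)) \<alpha>)"
      unfolding lift_mfun_simps(3)[OF \<alpha>] lift_mfun_simps(2)[OF F.M.cells.Dom_Ob[OF \<alpha>]]
        lift_mfun_simps(2)[OF F.M.cells.Cod_Ob[OF \<alpha>]]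
      using F.fun2_cell(1-3)[OF \<alpha>] F.src_fun1[OF F.M.cells.Dom_Ob[OF \<alpha>]] \<alpha>
      by (auto simp: prod_eq_iff)
    fix \<beta> assume \<beta>: "\<beta> \<in> cells2 (timesE M)" "Dom (cells (timesE M)) \<beta> = Cod (cells (timesE M)) \<alpha>"
    show "fun2 ?L (Cmp (cells (timesE M)) \<beta> \<alpha>) = Cmp (cells (timesE N)) (fun2 ?L \<beta>) (fun2 ?L \<alpha>)"
      unfolding lift_mfun_simps(3)[OF \<alpha>] lift_mfun_simps(3)[OF \<beta>(1)]
        lift_mfun_simps(3)[OF F.M.cells.Cmp_Ar[OF \<alpha> \<beta>]]
      using F.fun2_Cmp[OF \<alpha> \<beta>] by (simp add: prod_eq_iff)
  next
    fix a assume a: "a \<in> objs (timesE M)"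
    show "fun1 ?L (munit (timesE M) a) = munit (timesE N) (fob ?L a)"
      unfolding lift_mfun_simps(1)[OF a] lift_mfun_simps(2)[OF F.M.munit_cell(1)[OF a]]
      using F.fun1_munit[OF a] by (simp add: prod_eq_iff)
    show "fob ?L a \<in> objs (timesE N)"
      using F.fob_objs[OF a] a by simp
  next
    fix f gs assume c: "composable1 (timesE M) f gs"
    note c' = composable1D[OF c]
    have m: "map (fun1 ?L) gs = map (\<lambda>g. (fun1 F g, snd g)) gs"
      using lift_mfun_simps(2)[of _ M F] c'(2) by auto
    show "fun1 ?L (gam1 (timesE M) f gs) = gam1 (timesE N) (fun1 ?L f) (map (fun1 ?L) gs)"
      unfolding lift_mfun_simps(2)[OF c'(1)] lift_mfun_simps(2)[OF F.M.gam1_cells1[OF c]] m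
      using F.fun1_gam1[OF c] by (simp add: prod_eq_iff o_def)
  next
    fix f gs assume c: "composable2 (timesE M) f gs"
    note c' = composable2D[OF c]
    have m: "map (fun2 ?L) gs = map (\<lambda>g. (fun2 F g, snd g)) gs"
      using lift_mfun_simps(3)[of _ M F] c'(2) by auto
    show "fun2 ?L (gam2 (timesE M) f gs) = gam2 (timesE N) (fun2 ?L f) (map (fun2 ?L) gs)"
      unfolding lift_mfun_simps(3)[OF c'(1)] lift_mfun_simps(3)[OF F.M.gam2_cells2[OF c]] m
      using F.fun2_gam2[OF c] by (simp add: prod_eq_iff o_def)
  qed (fact F.M.cat_multicategory_axioms T.cat_multicategory_axioms lift_mfun_simps)+
  then show ?thesis
  proof (intro symmetric_multifunctor.intro symmetric_multifunctor_axioms.intro)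
    fix f \<sigma> assume f: "f \<in> cells1 (timesE M)" and \<sigma>: "\<sigma> permutes {..<arity (timesE M) f}"
    show "fun1 ?L (act1 (timesE M) f \<sigma>) = act1 (timesE N) (fun1 ?L f) \<sigma>"
      unfolding lift_mfun_simps(2)[OF f] lift_mfun_simps(2)[OF F.M.act1_cells1[OF f \<sigma>]]
      using F.fun1_act1[OF f \<sigma>] by (simp add: prod_eq_iff)
  next
    fix f \<sigma> assume f: "f \<in> cells2 (timesE M)" and \<sigma>: "\<sigma> permutes {..<length (src2 (timesE M) f)}"
    show "fun2 ?L (act2 (timesE M) f \<sigma>) = act2 (timesE N) (fun2 ?L f) \<sigma>"
      unfolding lift_mfun_simps(3)[OF f] lift_mfun_simps(3)[OF F.M.act2_cells2[OF f \<sigma>]]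
      using F.fun2_act2[OF f \<sigma>] by (simp add: prod_eq_iff)
  qed
qed

text \<open>The first entry of each naturality condition is that of \<theta>. In the second entry
  all components are operad units, and the condition reduces to the two unit laws of
  E\<Sigma>.\<close>

lemma sym_trans_lift:
  assumes "cat_multicategory M" "sym_trans (timesE M) N \<theta>"
  shows "sym_trans (timesE M) (timesE N) (lift_trans M \<theta>)"
proof -
  note t = sym_transD[OF assms(2)]
  interpret F: symmetric_multifunctor "timesE M" N "tdom \<theta>" by fact
  interpret J: symmetric_multifunctor "timesE M" N "tcod \<theta>" by fact
  note L = symmetric_lift_mfun[OF assms(1) t(1)] symmetric_lift_mfun[OF assms(1) t(2)]
  let ?t = "tcmp (lift_trans M \<theta>)"
  have "multinatural (timesE M) (timesE N) (lift_mfun M (tdom \<theta>)) (lift_mfun M (tcod \<theta>)) ?t"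
  proof (rule multinaturalI)
    fix a assume a: "a \<in> objs (timesE M)"
    show "?t a \<in> cells1 (timesE N) \<and> src (timesE N) (?t a) = [fob (lift_mfun M (tdom \<theta>)) a] \<and>
        tgt (timesE N) (?t a) = fob (lift_mfun M (tcod \<theta>)) a"
      unfolding lift_mfun_simps(1)[OF a] lift_trans_simps(3)[OF a]
      using sym_trans_cell[OF assms(2) a] by (simp add: prod_eq_iff permutes_id)
  next
    fix f assume f: "f \<in> cells1 (timesE M)"
    have m: "map ?t (src (timesE M) f) = map (\<lambda>x. (tcmp \<theta> x, 1, id)) (src (timesE M) f)"
      using lift_trans_simps(3)[of _ M] F.M.src_in_objs[OF f] by simp
    have l: "length (src (timesE M) f) = fst (snd f)" using f by simp
    have "map (\<lambda>x. (1, id) :: deg_perm) (src (timesE M) f) = replicate (fst (snd f)) (Suc 0, id)"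
      unfolding map_replicate_const l by simp
    then show "gam1 (timesE N) (fun1 (lift_mfun M (tcod \<theta>)) f) (map ?t (src (timesE M) f)) =
        gam1 (timesE N) (?t (tgt (timesE M) f)) [fun1 (lift_mfun M (tdom \<theta>)) f]"
      unfolding lift_mfun_simps(2)[OF f] lift_trans_simps(3)[OF F.M.tgt_objs[OF f]] m
      using multinaturalD(5)[OF t(3) f] be_gam_munit_left[of "snd f"] be_gam_munit_right[of "snd f"] f
      by (simp add: prod_eq_iff o_def del: be_gam_simps)
  next
    fix \<alpha> assume \<alpha>: "\<alpha> \<in> cells2 (timesE M)"
    let ?f = "Dom (cells (timesE M)) \<alpha>"
    note f = F.M.cells.Dom_Ob[OF \<alpha>]
    have m: "map (\<lambda>a. Idn (cells (timesE N)) (?t a)) (src (timesE M) ?f) =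
        map (\<lambda>x. (Idn (cells N) (tcmp \<theta> x), (1, id), (1, id))) (src (timesE M) ?f)"
      using lift_trans_simps(3)[of _ M] F.M.src_in_objs[OF f] by (simp add: prod_eq_iff)
    have l: "length (src (timesE M) ?f) = fst (fst (snd \<alpha>))" using \<alpha> by simp
    have "map (\<lambda>x. (1, id) :: deg_perm) (src (timesE M) ?f) = replicate (fst (fst (snd \<alpha>))) (Suc 0, id)"
      unfolding map_replicate_const l by simp
    then show "gam2 (timesE N) (fun2 (lift_mfun M (tcod \<theta>)) \<alpha>)
          (map (\<lambda>a. Idn (cells (timesE N)) (?t a)) (src2 (timesE M) \<alpha>)) =
        gam2 (timesE N) (Idn (cells (timesE N)) (?t (tgt2 (timesE M) \<alpha>))) [fun2 (lift_mfun M (tdom \<theta>)) \<alpha>]"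
      unfolding lift_mfun_simps(3)[OF \<alpha>] lift_trans_simps(3)[OF F.M.tgt_objs[OF f]] m
      using multinaturalD(6)[OF t(3) \<alpha>] be_gam_munit_left[of "fst (snd \<alpha>)"]
        be_gam_munit_right[of "fst (snd \<alpha>)"] be_gam_munit_left[of "snd (snd \<alpha>)"]
        be_gam_munit_right[of "snd (snd \<alpha>)"] \<alpha>
      by (auto simp add: prod_eq_iff o_def del: be_gam_simps)
  qed (rule lift_trans_simps)
  then show ?thesis using L by (simp add: sym_trans_def)
qed

text \<open>The coKleisli form of the composition: \<open>1 \<times> \<Delta>\<close> with the
  reassociation sends a cell \<open>x\<close> to \<open>(x, snd x)\<close>, after which
  \<open>F\<close> acts on the first entry only.\<close>

lemma d_comp1_eq: "d_comp1 M N Q G F = mfun_comp (timesE M) G (lift_mfun M F)"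
proof (rule mfun_eqI)
  let ?E = barratt_eccles
  let ?D = "one_times_diag M" and ?P = "mfun_prod (timesE M) ?E F (mfun_id ?E)"
  {
    fix a assume a: "a \<in> objs (timesE M)"
    have "fob ?D a = (a, ())"
      using a by (auto simp: one_times_diag_def mfun_comp_def mfun_assoc_def mfun_prod_def mfun_id_def
          mfun_diag_def compose_def)
    then have "fob (mfun_comp (timesE M) ?P ?D) a = (fob F a, ())"
      unfolding mfun_comp_simps(1)[OF a] using a
      by (simp add: mfun_prod_def mfun_id_def)
    then show "fob (d_comp1 M N Q G F) a = fob (mfun_comp (timesE M) G (lift_mfun M F)) a"
      unfolding d_comp1_def mfun_comp_simps(1)[OF a] lift_mfun_simps(1)[OF a] by simp
  next
    fix f assume f: "f \<in> cells1 (timesE M)"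
    have "fun1 ?D f = (f, snd f)"
      using f by (auto simp: one_times_diag_def mfun_comp_def mfun_assoc_def mfun_prod_def mfun_id_def
          mfun_diag_def compose_def case_prod_beta prod_eq_iff)
    then have "fun1 (mfun_comp (timesE M) ?P ?D) f = (fun1 F f, snd f)"
      unfolding mfun_comp_simps(2)[OF f] using f
      by (simp add: mfun_prod_def mfun_id_def)
    then show "fun1 (d_comp1 M N Q G F) f = fun1 (mfun_comp (timesE M) G (lift_mfun M F)) f"
      unfolding d_comp1_def mfun_comp_simps(2)[OF f] lift_mfun_simps(2)[OF f] by simp
  next
    fix f assume f: "f \<in> cells2 (timesE M)"
    have "fun2 ?D f = (f, snd f)"
      using f by (auto simp: one_times_diag_def mfun_comp_def mfun_assoc_def mfun_prod_def mfun_id_def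
          mfun_diag_def compose_def case_prod_beta prod_eq_iff)
    then have "fun2 (mfun_comp (timesE M) ?P ?D) f = (fun2 F f, snd f)"
      unfolding mfun_comp_simps(3)[OF f] using f
      by (auto simp: mfun_prod_def mfun_id_def)
    then show "fun2 (d_comp1 M N Q G F) f = fun2 (mfun_comp (timesE M) G (lift_mfun M F)) f"
      unfolding d_comp1_def mfun_comp_simps(3)[OF f] lift_mfun_simps(3)[OF f] by simp
  }
qed (simp_all only: d_comp1_def mfun_comp_ext)

text \<open>Whiskering with \<open>1 \<times> \<Delta>\<close> composes each component with the
  image of a unit 1-cell. That image is again a unit and vanishes by the unit laws of
  \<open>N\<close> and E\<Sigma>.\<close>

lemma d_comp2_eq:
  assumes "cat_multicategory M" "sym_trans (timesE M) N \<theta>"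
  shows "d_comp2 M N Q \<zeta> \<theta> = sym_hcomp (timesE M) Q \<zeta> (lift_trans M \<theta>)"
proof (rule mtrans_eqI)
  interpret F: symmetric_multifunctor "timesE M" N "tdom \<theta>" by (rule sym_transD[OF assms(2)])
  let ?E = barratt_eccles
  let ?D = "one_times_diag M"
  let ?T = "trans_prod (timesE M) ?E \<theta> (trans_id ?E ?E (mfun_id ?E))"
  show "tdom (d_comp2 M N Q \<zeta> \<theta>) = tdom (sym_hcomp (timesE M) Q \<zeta> (lift_trans M \<theta>))"
    using d_comp1_eq[of M N Q "tdom \<zeta>" "tdom \<theta>"]
    by (simp add: d_comp2_def d_comp1_def trans_prod_def)
  show "tcod (d_comp2 M N Q \<zeta> \<theta>) = tcod (sym_hcomp (timesE M) Q \<zeta> (lift_trans M \<theta>))"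
    using d_comp1_eq[of M N Q "tcod \<zeta>" "tcod \<theta>"]
    by (simp add: d_comp2_def d_comp1_def trans_prod_def)
  fix a assume a: "a \<in> objs (timesE M)"
  have Da: "fob ?D a = (a, ())"
    using a by (auto simp: one_times_diag_def mfun_comp_def mfun_assoc_def mfun_prod_def mfun_id_def
        mfun_diag_def compose_def)
  have u: "munit (timesE M) a \<in> cells1 (timesE M)" by (rule F.M.munit_cell(1)[OF a])
  have "munit (mprod (timesE M) ?E) (a, ()) = (munit (timesE M) a, (1, id))"
    by (simp add: prod_eq_iff)
  moreover have "(munit (timesE M) a, (1, id)) \<in> cells1 (mprod (timesE M) ?E)"
    using u F.M.munit_cell(2)[OF a] by (simp add: permutes_id)
  \<comment> \<open>The inserted image of a unit, computed from preservation of units by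
    \<open>tdom \<theta>\<close>.\<close>
  ultimately have 1: "fun1 (tdom ?T) (munit (mprod (timesE M) ?E) (fob ?D a)) = (munit N (fob (tdom \<theta>) a), (1, id))"
    by (simp add: Da trans_prod_def mfun_prod_def mfun_id_def permutes_id F.fun1_munit[OF a]
        del: mprod_simps)
  have 2: "tcmp ?T (fob ?D a) = (tcmp \<theta> a, (1, id))"
    using a by (simp add: Da trans_prod_def trans_id_def mfun_id_def)
  have 3: "gam1 N (tcmp \<theta> a) [munit N (fob (tdom \<theta>) a)] = tcmp \<theta> a"
    using F.N.gam1_munit_right[of "tcmp \<theta> a"] sym_trans_cell[OF assms(2) a] by simp
  have 4: "be_gam (1, id) [(1, id)] = (1, id)"
    by (rule be_gam_munit_left) (simp add: permutes_id)
  let ?I = "sym_hcomp (timesE M) (timesE N) ?T (trans_id (timesE M) (mprod (timesE M) ?E) ?D)"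
  have "tcmp ?I a = gam1 (timesE N) (tcmp \<theta> a, (1, id)) [(munit N (fob (tdom \<theta>) a), (1, id))]"
    unfolding sym_hcomp_simps(3)[OF a] trans_id_simps(2) trans_id_simps(3)[OF a] 1 2 ..
  also have "\<dots> = (tcmp \<theta> a, (1, id))"
    using 3 4 by (simp add: prod_eq_iff del: be_gam_simps)
  finally have 5: "tcmp ?I a = (tcmp \<theta> a, (1, id))" .
  have 6: "fob (tcod ?I) a = (fob (tcod \<theta>) a, ())"
    unfolding sym_hcomp_simps(2) trans_id_simps(2) mfun_comp_simps(1)[OF a] Da
    using a by (simp add: trans_prod_def mfun_prod_def mfun_id_def)
  show "tcmp (d_comp2 M N Q \<zeta> \<theta>) a = tcmp (sym_hcomp (timesE M) Q \<zeta> (lift_trans M \<theta>)) a"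
    unfolding d_comp2_def sym_hcomp_simps(3)[OF a, of Q \<zeta>] 5 6 lift_trans_simps(2) lift_trans_simps(3)[OF a]
      lift_mfun_simps(1)[OF a] ..
qed (simp_all only: d_comp2_def sym_hcomp_simps)

text \<open>The counit of the comonad \<open>- \<times> E\<Sigma>\<close>: projection away from
  E\<Sigma>. It serves as the identity 1-cell.\<close>

definition d_id :: "('o, 'f, 'a) mcat \<Rightarrow> ('o, 'f, 'a) d_mfun" where
  "d_id M =
     \<lparr>fob = restrict fst (objs (timesE M)), fun1 = restrict fst (cells1 (timesE M)),
      fun2 = restrict fst (cells2 (timesE M))\<rparr>"

lemma d_id_simps [simp]:
  "x \<in> objs (timesE M) \<Longrightarrow> fob (d_id M) x = fst x"
  "f \<in> cells1 (timesE M) \<Longrightarrow> fun1 (d_id M) f = fst f"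
  "\<alpha> \<in> cells2 (timesE M) \<Longrightarrow> fun2 (d_id M) \<alpha> = fst \<alpha>"
  "fob (d_id M) \<in> extensional (objs (timesE M))"
  "fun1 (d_id M) \<in> extensional (cells1 (timesE M))"
  "fun2 (d_id M) \<in> extensional (cells2 (timesE M))"
  by (simp_all add: d_id_def del: mprod_simps barratt_eccles_simps)

lemma mfun_id_simps [simp]:
  "a \<in> objs M \<Longrightarrow> fob (mfun_id M) a = a"
  "f \<in> cells1 M \<Longrightarrow> fun1 (mfun_id M) f = f"
  "\<alpha> \<in> cells2 M \<Longrightarrow> fun2 (mfun_id M) \<alpha> = \<alpha>"
  "fob (mfun_id M) \<in> extensional (objs M)"
  "fun1 (mfun_id M) \<in> extensional (cells1 M)"
  "fun2 (mfun_id M) \<in> extensional (cells2 M)"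
  by (simp_all add: mfun_id_def)

lemma symmetric_d_id:
  assumes "cat_multicategory M"
  shows "symmetric_multifunctor (timesE M) M (d_id M)"
proof -
  interpret M: cat_multicategory M by fact
  interpret T: cat_multicategory "timesE M" by (rule cat_multicategory_timesE[OF assms])
  have "multifunctor (timesE M) M (d_id M)"
  proof (rule multifunctorI)
    fix f assume f: "f \<in> cells1 (timesE M)"
    have m: "map (fob (d_id M)) (src (timesE M) f) = map fst (src (timesE M) f)"
      by (rule map_cong[OF refl d_id_simps(1)]) (rule T.src_in_objs[OF f])
    show "fun1 (d_id M) f \<in> cells1 M \<and> src M (fun1 (d_id M) f) = map (fob (d_id M)) (src (timesE M) f) \<and>
        tgt M (fun1 (d_id M) f) = fob (d_id M) (tgt (timesE M) f)"
      unfolding d_id_simps(2)[OF f] d_id_simps(1)[OF T.tgt_objs[OF f]] m using f by simp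
    show "fun2 (d_id M) (Idn (cells (timesE M)) f) = Idn (cells M) (fun1 (d_id M) f)"
      unfolding d_id_simps(2)[OF f] d_id_simps(3)[OF T.cells.Idn_Ar[OF f]] by simp
  next
    fix \<alpha> assume \<alpha>: "\<alpha> \<in> cells2 (timesE M)"
    show "fun2 (d_id M) \<alpha> \<in> cells2 M \<and>
        Dom (cells M) (fun2 (d_id M) \<alpha>) = fun1 (d_id M) (Dom (cells (timesE M)) \<alpha>) \<and>
        Cod (cells M) (fun2 (d_id M) \<alpha>) = fun1 (d_id M) (Cod (cells (timesE M)) \<alpha>)"
      unfolding d_id_simps(3)[OF \<alpha>] d_id_simps(2)[OF T.cells.Dom_Ob[OF \<alpha>]]
        d_id_simps(2)[OF T.cells.Cod_Ob[OF \<alpha>]]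
      using \<alpha> by simp
    fix \<beta> assume \<beta>: "\<beta> \<in> cells2 (timesE M)" "Dom (cells (timesE M)) \<beta> = Cod (cells (timesE M)) \<alpha>"
    show "fun2 (d_id M) (Cmp (cells (timesE M)) \<beta> \<alpha>) = Cmp (cells M) (fun2 (d_id M) \<beta>) (fun2 (d_id M) \<alpha>)"
      unfolding d_id_simps(3)[OF \<alpha>] d_id_simps(3)[OF \<beta>(1)] d_id_simps(3)[OF T.cells.Cmp_Ar[OF \<alpha> \<beta>]]
      by simp
  next
    fix a assume a: "a \<in> objs (timesE M)"
    show "fun1 (d_id M) (munit (timesE M) a) = munit M (fob (d_id M) a)"
      unfolding d_id_simps(1)[OF a] d_id_simps(2)[OF T.munit_cell(1)[OF a]] by simp
    show "fob (d_id M) a \<in> objs M" unfolding d_id_simps(1)[OF a] using a by auto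
  next
    fix f gs assume c: "composable1 (timesE M) f gs"
    note c' = composable1D[OF c]
    have m: "map (fun1 (d_id M)) gs = map fst gs"
      by (rule map_cong[OF refl d_id_simps(2)]) (use c'(2) in blast)
    show "fun1 (d_id M) (gam1 (timesE M) f gs) = gam1 M (fun1 (d_id M) f) (map (fun1 (d_id M)) gs)"
      unfolding d_id_simps(2)[OF c'(1)] d_id_simps(2)[OF T.gam1_cells1[OF c]] m by simp
  next
    fix f gs assume c: "composable2 (timesE M) f gs"
    note c' = composable2D[OF c]
    have m: "map (fun2 (d_id M)) gs = map fst gs"
      by (rule map_cong[OF refl d_id_simps(3)]) (use c'(2) in blast)
    show "fun2 (d_id M) (gam2 (timesE M) f gs) = gam2 M (fun2 (d_id M) f) (map (fun2 (d_id M)) gs)"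
      unfolding d_id_simps(3)[OF c'(1)] d_id_simps(3)[OF T.gam2_cells2[OF c]] m by simp
  qed (fact assms T.cat_multicategory_axioms d_id_simps)+
  then show ?thesis
  proof (intro symmetric_multifunctor.intro symmetric_multifunctor_axioms.intro)
    fix f \<sigma> assume f: "f \<in> cells1 (timesE M)" and \<sigma>: "\<sigma> permutes {..<arity (timesE M) f}"
    show "fun1 (d_id M) (act1 (timesE M) f \<sigma>) = act1 M (fun1 (d_id M) f) \<sigma>"
      unfolding d_id_simps(2)[OF f] d_id_simps(2)[OF T.act1_cells1[OF f \<sigma>]] by simp
  next
    fix f \<sigma> assume f: "f \<in> cells2 (timesE M)" and \<sigma>: "\<sigma> permutes {..<length (src2 (timesE M) f)}"
    show "fun2 (d_id M) (act2 (timesE M) f \<sigma>) = act2 M (fun2 (d_id M) f) \<sigma>"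
      unfolding d_id_simps(3)[OF f] d_id_simps(3)[OF T.act2_cells2[OF f \<sigma>]] by simp
  qed
qed

text \<open>The first of the three laws of a coKleisli extension, along with
  \<open>d_id_lift_mfun\<close> and \<open>lift_mfun_comp\<close>. They provide the right unit, the
  left unit and the associativity of composition in \<open>D\<close>.\<close>

lemma lift_mfun_d_id: "lift_mfun M (d_id M) = mfun_id (timesE M)"
proof (rule mfun_eqI)
  show "fob (lift_mfun M (d_id M)) a = fob (mfun_id (timesE M)) a" if "a \<in> objs (timesE M)" for a
    unfolding lift_mfun_simps(1)[OF that] mfun_id_simps(1)[OF that] d_id_simps(1)[OF that]
    by (simp add: prod_eq_iff)
  show "fun1 (lift_mfun M (d_id M)) a = fun1 (mfun_id (timesE M)) a" if "a \<in> cells1 (timesE M)" for a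
    unfolding lift_mfun_simps(2)[OF that] mfun_id_simps(2)[OF that] d_id_simps(2)[OF that] by simp
  show "fun2 (lift_mfun M (d_id M)) a = fun2 (mfun_id (timesE M)) a" if "a \<in> cells2 (timesE M)" for a
    unfolding lift_mfun_simps(3)[OF that] mfun_id_simps(3)[OF that] d_id_simps(3)[OF that] by simp
qed (fact lift_mfun_simps mfun_id_simps)+

lemma (in symmetric_multifunctor) mfun_comp_mfun_id: "mfun_comp M F (mfun_id M) = F"
  by (rule mfun_eqI[where A = "objs M" and B = "cells1 M" and E = "cells2 M"])
    (simp_all add: mfun_comp_ext fob_ext fun1_ext fun2_ext)

lemma d_id_lift_mfun:
  assumes "cat_multicategory M" "symmetric_multifunctor (timesE M) N F"
  shows "mfun_comp (timesE M) (d_id N) (lift_mfun M F) = F"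
proof -
  interpret F: symmetric_multifunctor "timesE M" N F by fact
  interpret L: symmetric_multifunctor "timesE M" "timesE N" "lift_mfun M F"
    by (rule symmetric_lift_mfun[OF assms])
  show ?thesis
  proof (rule mfun_eqI)
    show "fob (mfun_comp (timesE M) (d_id N) (lift_mfun M F)) a = fob F a" if "a \<in> objs (timesE M)" for a
      unfolding mfun_comp_simps(1)[OF that] d_id_simps(1)[OF L.fob_objs[OF that]]
      unfolding lift_mfun_simps(1)[OF that] by simp
    show "fun1 (mfun_comp (timesE M) (d_id N) (lift_mfun M F)) a = fun1 F a" if "a \<in> cells1 (timesE M)" for a
      unfolding mfun_comp_simps(2)[OF that] d_id_simps(2)[OF L.fun1_cells1[OF that]]
      unfolding lift_mfun_simps(2)[OF that] by simp
    show "fun2 (mfun_comp (timesE M) (d_id N) (lift_mfun M F)) a = fun2 F a" if "a \<in> cells2 (timesE M)" for a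
      unfolding mfun_comp_simps(3)[OF that] d_id_simps(3)[OF L.fun2_cells2[OF that]]
      unfolding lift_mfun_simps(3)[OF that] by simp
  qed (fact mfun_comp_ext F.fob_ext F.fun1_ext F.fun2_ext)+
qed

lemma lift_mfun_comp:
  assumes "cat_multicategory M" "symmetric_multifunctor (timesE M) N F"
  shows "lift_mfun M (mfun_comp (timesE M) G (lift_mfun M F)) =
    mfun_comp (timesE M) (lift_mfun N G) (lift_mfun M F)"
proof -
  interpret L: symmetric_multifunctor "timesE M" "timesE N" "lift_mfun M F"
    by (rule symmetric_lift_mfun[OF assms])
  show ?thesis
  proof (rule mfun_eqI)
    show "fob (lift_mfun M (mfun_comp (timesE M) G (lift_mfun M F))) a =
        fob (mfun_comp (timesE M) (lift_mfun N G) (lift_mfun M F)) a" if "a \<in> objs (timesE M)" for a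
      unfolding mfun_comp_simps(1)[OF that] lift_mfun_simps(1)[OF L.fob_objs[OF that]]
      unfolding lift_mfun_simps(1)[OF that] mfun_comp_simps(1)[OF that] ..
    show "fun1 (lift_mfun M (mfun_comp (timesE M) G (lift_mfun M F))) a =
        fun1 (mfun_comp (timesE M) (lift_mfun N G) (lift_mfun M F)) a" if "a \<in> cells1 (timesE M)" for a
      unfolding mfun_comp_simps(2)[OF that] lift_mfun_simps(2)[OF L.fun1_cells1[OF that]]
      unfolding lift_mfun_simps(2)[OF that] mfun_comp_simps(2)[OF that] by simp
    show "fun2 (lift_mfun M (mfun_comp (timesE M) G (lift_mfun M F))) a =
        fun2 (mfun_comp (timesE M) (lift_mfun N G) (lift_mfun M F)) a" if "a \<in> cells2 (timesE M)" for a
      unfolding mfun_comp_simps(3)[OF that] lift_mfun_simps(3)[OF L.fun2_cells2[OF that]]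
      unfolding lift_mfun_simps(3)[OF that] mfun_comp_simps(3)[OF that] by simp
  qed (fact mfun_comp_ext lift_mfun_simps)+
qed

lemma be_gam_unit: "be_gam (1, id) [(1, id)] = (1, id)"
  by (rule be_gam_munit_left) (simp add: permutes_id)

lemma gam1_timesE_unit: "gam1 (timesE N) (f, (1, id)) [(g, (1, id))] = (gam1 N f [g], (1, id))"
  using be_gam_unit by (simp add: prod_eq_iff del: be_gam_simps)

text \<open>Lifting is compatible with the operations on 2-cells too: products of operad units are
  operad units, so the second entry stays \<open>(1, id)\<close>.\<close>

lemma lift_trans_id:
  "lift_trans M (trans_id (timesE M) N F) = trans_id (timesE M) (timesE N) (lift_mfun M F)"
proof (rule mtrans_eqI)
  fix a assume a: "a \<in> objs (timesE M)"
  show "tcmp (lift_trans M (trans_id (timesE M) N F)) a = tcmp (trans_id (timesE M) (timesE N) (lift_mfun M F)) a"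
    unfolding lift_trans_simps(3)[OF a] trans_id_simps(3)[OF a] lift_mfun_simps(1)[OF a]
    by (simp add: prod_eq_iff)
qed (simp_all only: lift_trans_simps trans_id_simps)

lemma lift_trans_vcomp:
  "lift_trans M (trans_vcomp (timesE M) N \<zeta> \<theta>) =
    trans_vcomp (timesE M) (timesE N) (lift_trans M \<zeta>) (lift_trans M \<theta>)"
proof (rule mtrans_eqI)
  fix a assume a: "a \<in> objs (timesE M)"
  show "tcmp (lift_trans M (trans_vcomp (timesE M) N \<zeta> \<theta>)) a =
      tcmp (trans_vcomp (timesE M) (timesE N) (lift_trans M \<zeta>) (lift_trans M \<theta>)) a"
    unfolding lift_trans_simps(3)[OF a] trans_vcomp_simps(3)[OF a] gam1_timesE_unit ..
qed (simp_all only: lift_trans_simps trans_vcomp_simps)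

lemma lift_trans_hcomp:
  assumes "cat_multicategory M" and t: "sym_trans (timesE M) N \<theta>"
  shows "lift_trans M (sym_hcomp (timesE M) Q \<zeta> (lift_trans M \<theta>)) =
    sym_hcomp (timesE M) (timesE Q) (lift_trans N \<zeta>) (lift_trans M \<theta>)"
proof (rule mtrans_eqI)
  note l = sym_trans_lift[OF assms]
  fix a assume a: "a \<in> objs (timesE M)"
  interpret J: symmetric_multifunctor "timesE M" "timesE N" "tcod (lift_trans M \<theta>)"
    by (rule sym_transD[OF l])
  have c: "tcmp (lift_trans M \<theta>) a \<in> cells1 (timesE N)" by (rule sym_trans_cell[OF l a])
  have s: "snd (tcmp (lift_trans M \<theta>) a) = (1, id)" unfolding lift_trans_simps(3)[OF a] by simp
  show "tcmp (lift_trans M (sym_hcomp (timesE M) Q \<zeta> (lift_trans M \<theta>))) a =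
      tcmp (sym_hcomp (timesE M) (timesE Q) (lift_trans N \<zeta>) (lift_trans M \<theta>)) a"
    unfolding lift_trans_simps(3)[OF a, of "sym_hcomp (timesE M) Q \<zeta> (lift_trans M \<theta>)"]
      sym_hcomp_simps(3)[OF a] lift_trans_simps(1)[of N]
      lift_mfun_simps(2)[OF c] lift_trans_simps(3)[OF J.fob_objs[OF a]] s gam1_timesE_unit ..
qed (simp_all only: lift_trans_simps sym_hcomp_simps lift_mfun_comp[OF assms(1) sym_transD(1)[OF t]]
    lift_mfun_comp[OF assms(1) sym_transD(2)[OF t]])

lemma multicat_hom_simps:
  "Ob (multicat_hom M N) = {F. symmetric_multifunctor M N F}"
  "Ar (multicat_hom M N) = {\<theta>. sym_trans M N \<theta>}" "Dom (multicat_hom M N) = tdom"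
  "Cod (multicat_hom M N) = tcod" "Idn (multicat_hom M N) = trans_id M N"
  "Cmp (multicat_hom M N) = trans_vcomp M N"
  by (simp_all add: multicat_hom_def)

text \<open>In coKleisli form every axiom becomes a law of composition of multifunctors and
  transformations, applied to lifts.\<close>

lemma two_category_D: "two_category (d_two_cat (d_id :: ('o, 'f, 'a) mcat \<Rightarrow> _))"
proof (rule two_category.intro)
  let ?D = "d_two_cat (d_id :: ('o, 'f, 'a) mcat \<Rightarrow> _)"
  have simps: "Ob0 ?D = {M. cat_multicategory M}" "HomC ?D M N = multicat_hom (timesE M) N"
    "Id1 ?D = d_id" "Comp1 ?D = d_comp1" "Comp2 ?D = d_comp2"
    for M N :: "('o, 'f, 'a) mcat"
    by (simp_all add: d_two_cat_def)
  note simps = simps multicat_hom_simps mem_Collect_eq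
  fix A B E H :: "('o, 'f, 'a) mcat"
  assume "A \<in> Ob0 ?D"
  then have A: "cat_multicategory A" by (simp only: simps)
  show "Id1 ?D A \<in> Ob (HomC ?D A A)"
    unfolding simps by (rule symmetric_d_id[OF A])
  assume "B \<in> Ob0 ?D"
  then have B: "cat_multicategory B" by (simp only: simps)
  show "category (HomC ?D A B)"
    unfolding simps by (rule category_multicat_hom[OF B])
  {
    fix f assume "f \<in> Ob (HomC ?D A B)"
    then have f: "symmetric_multifunctor (timesE A) B f" unfolding simps .
    show "Comp1 ?D A B B (Id1 ?D B) f = f"
      unfolding simps d_comp1_eq by (rule d_id_lift_mfun[OF A f])
    show "Comp1 ?D A A B f (Id1 ?D A) = f"
      unfolding simps d_comp1_eq lift_mfun_d_id by (rule symmetric_multifunctor.mfun_comp_mfun_id[OF f])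
  next
    fix \<alpha> assume "\<alpha> \<in> Ar (HomC ?D A B)"
    then have \<alpha>: "sym_trans (timesE A) B \<alpha>" unfolding simps .
    interpret F: symmetric_multifunctor "timesE A" B "tdom \<alpha>" by (rule sym_transD[OF \<alpha>])
    interpret J: symmetric_multifunctor "timesE A" B "tcod \<alpha>" by (rule sym_transD[OF \<alpha>])
    note l = sym_trans_lift[OF A \<alpha>]
    interpret L: symmetric_multifunctor "timesE A" "timesE B" "tcod (lift_trans A \<alpha>)"
      by (rule sym_transD[OF l])
    show "Comp2 ?D A B B (Idn (HomC ?D B B) (Id1 ?D B)) \<alpha> = \<alpha>"
      unfolding simps d_comp2_eq[OF A \<alpha>]
    proof (rule mtrans_eqI)
      fix a assume a: "a \<in> objs (timesE A)"
      have "fob (d_id B) (fob (tcod (lift_trans A \<alpha>)) a) = fob (tcod \<alpha>) a"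
        unfolding d_id_simps(1)[OF L.fob_objs[OF a]]
        unfolding lift_trans_simps(2) lift_mfun_simps(1)[OF a] by simp
      moreover have "fun1 (d_id B) (tcmp (lift_trans A \<alpha>) a) = tcmp \<alpha> a"
        unfolding d_id_simps(2)[OF sym_trans_cell(1)[OF l a]]
        unfolding lift_trans_simps(3)[OF a] by simp
      ultimately show "tcmp (sym_hcomp (timesE A) B (trans_id (timesE B) B (d_id B)) (lift_trans A \<alpha>)) a = tcmp \<alpha> a"
        unfolding sym_hcomp_simps(3)[OF a] trans_id_simps(1) trans_id_simps(3)[OF L.fob_objs[OF a]]
        using F.N.gam1_munit_left[of "tcmp \<alpha> a"] sym_trans_cell[OF \<alpha> a] by simp
    qed (simp_all only: sym_hcomp_simps trans_id_simps lift_trans_simps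
        d_id_lift_mfun[OF A sym_transD(1)[OF \<alpha>]] d_id_lift_mfun[OF A sym_transD(2)[OF \<alpha>]]
        sym_trans_ext[OF \<alpha>])
    show "Comp2 ?D A A B \<alpha> (Idn (HomC ?D A A) (Id1 ?D A)) = \<alpha>"
      unfolding simps d_comp2_eq[OF A sym_trans_id[OF symmetric_d_id[OF A]]] lift_trans_id lift_mfun_d_id
    proof (rule mtrans_eqI)
      fix a assume a: "a \<in> objs (timesE A)"
      show "tcmp (sym_hcomp (timesE A) B \<alpha> (trans_id (timesE A) (timesE A) (mfun_id (timesE A)))) a = tcmp \<alpha> a"
        unfolding sym_hcomp_simps(3)[OF a] trans_id_simps(2) trans_id_simps(3)[OF a] mfun_id_simps(1)[OF a]
          F.fun1_munit[OF a]
        using F.N.gam1_munit_right[of "tcmp \<alpha> a"] sym_trans_cell[OF \<alpha> a] by simp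
    qed (simp_all only: sym_hcomp_simps trans_id_simps F.mfun_comp_mfun_id J.mfun_comp_mfun_id
        sym_trans_ext[OF \<alpha>])
  }
  assume "E \<in> Ob0 ?D"
  then have E: "cat_multicategory E" by (simp only: simps)
  {
    show "cat_functor (prod_cat (HomC ?D B E) (HomC ?D A B)) (HomC ?D A E)
        (\<lambda>(g, f). Comp1 ?D A B E g f) (\<lambda>(\<beta>, \<alpha>). Comp2 ?D A B E \<beta> \<alpha>)"
      unfolding simps
    proof (intro cat_functor.intro cat_functor_axioms.intro category_prod_cat category_multicat_hom B E)
      fix x assume "x \<in> Ob (prod_cat (multicat_hom (timesE B) E) (multicat_hom (timesE A) B))"
      then obtain g f where x: "x = (g, f)" and g: "symmetric_multifunctor (timesE B) E g"
        and f: "symmetric_multifunctor (timesE A) B f"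
        unfolding prod_cat_simps simps by blast
      note l = symmetric_lift_mfun[OF A f]
      show "(case x of (g, f) \<Rightarrow> d_comp1 A B E g f) \<in> Ob (multicat_hom (timesE A) E)"
        unfolding x prod.case simps d_comp1_eq by (rule symmetric_multifunctor_comp[OF l g])
      show "(case Idn (prod_cat (multicat_hom (timesE B) E) (multicat_hom (timesE A) B)) x of
          (\<beta>, \<alpha>) \<Rightarrow> d_comp2 A B E \<beta> \<alpha>) =
          Idn (multicat_hom (timesE A) E) (case x of (g, f) \<Rightarrow> d_comp1 A B E g f)"
        unfolding x prod.case prod_cat_simps simps d_comp1_eq d_comp2_eq[OF A sym_trans_id[OF f]] lift_trans_id
        by (rule sym_hcomp_trans_id[OF l g])
    next
      fix x assume "x \<in> Ar (prod_cat (multicat_hom (timesE B) E) (multicat_hom (timesE A) B))"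
      then obtain g f where x: "x = (g, f)" and g: "sym_trans (timesE B) E g"
        and f: "sym_trans (timesE A) B f"
        unfolding prod_cat_simps simps by blast
      note l = sym_trans_lift[OF A f]
      show "(case x of (g, f) \<Rightarrow> d_comp2 A B E g f) \<in> Ar (multicat_hom (timesE A) E)"
        unfolding x prod.case simps d_comp2_eq[OF A f] by (rule sym_trans_hcomp[OF l g])
      show "Dom (multicat_hom (timesE A) E) (case x of (\<beta>, \<alpha>) \<Rightarrow> d_comp2 A B E \<beta> \<alpha>) =
          (case Dom (prod_cat (multicat_hom (timesE B) E) (multicat_hom (timesE A) B)) x of
            (g, f) \<Rightarrow> d_comp1 A B E g f)"
        unfolding x prod.case prod_cat_simps simps d_comp2_eq[OF A f] d_comp1_eq
          sym_hcomp_simps lift_trans_simps ..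
      show "Cod (multicat_hom (timesE A) E) (case x of (\<beta>, \<alpha>) \<Rightarrow> d_comp2 A B E \<beta> \<alpha>) =
          (case Cod (prod_cat (multicat_hom (timesE B) E) (multicat_hom (timesE A) B)) x of
            (g, f) \<Rightarrow> d_comp1 A B E g f)"
        unfolding x prod.case prod_cat_simps simps d_comp2_eq[OF A f] d_comp1_eq
          sym_hcomp_simps lift_trans_simps ..
      fix y assume "y \<in> Ar (prod_cat (multicat_hom (timesE B) E) (multicat_hom (timesE A) B))"
        and d: "Dom (prod_cat (multicat_hom (timesE B) E) (multicat_hom (timesE A) B)) y =
          Cod (prod_cat (multicat_hom (timesE B) E) (multicat_hom (timesE A) B)) x"
      then obtain g' f' where y: "y = (g', f')" and g': "sym_trans (timesE B) E g'"
        and f': "sym_trans (timesE A) B f'"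
        unfolding prod_cat_simps simps by blast
      have d': "tdom g' = tcod g" "tdom f' = tcod f" using d unfolding x y prod_cat_simps simps by blast+
      note l' = sym_trans_lift[OF A f']
      show "(case Cmp (prod_cat (multicat_hom (timesE B) E) (multicat_hom (timesE A) B)) y x of
            (\<beta>, \<alpha>) \<Rightarrow> d_comp2 A B E \<beta> \<alpha>) =
          Cmp (multicat_hom (timesE A) E) (case y of (\<beta>, \<alpha>) \<Rightarrow> d_comp2 A B E \<beta> \<alpha>)
            (case x of (\<beta>, \<alpha>) \<Rightarrow> d_comp2 A B E \<beta> \<alpha>)"
        unfolding x y prod.case prod_cat_simps simps d_comp2_eq[OF A f] d_comp2_eq[OF A f']
          d_comp2_eq[OF A sym_trans_vcomp[OF f f' d'(2)]] lift_trans_vcomp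
        by (rule sym_hcomp_vcomp[OF l l' _ g g' d'(1)]) (simp only: lift_trans_simps d')
    qed
  }
  assume "H \<in> Ob0 ?D"
  then have H: "cat_multicategory H" by (simp only: simps)
  {
    fix f g h assume "f \<in> Ob (HomC ?D A B)" "g \<in> Ob (HomC ?D B E)" "h \<in> Ob (HomC ?D E H)"
    then have f: "symmetric_multifunctor (timesE A) B f" and g: "symmetric_multifunctor (timesE B) E g"
      and h: "symmetric_multifunctor (timesE E) H h" unfolding simps .
    show "Comp1 ?D A E H h (Comp1 ?D A B E g f) = Comp1 ?D A B H (Comp1 ?D B E H h g) f"
      unfolding simps d_comp1_eq lift_mfun_comp[OF A f]
      by (rule mfun_comp_assoc[OF symmetric_lift_mfun[OF A f], symmetric])
  next
    fix f g h assume "f \<in> Ar (HomC ?D A B)" "g \<in> Ar (HomC ?D B E)" "h \<in> Ar (HomC ?D E H)"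
    then have f: "sym_trans (timesE A) B f" and g: "sym_trans (timesE B) E g"
      and h: "sym_trans (timesE E) H h" unfolding simps .
    note lf = sym_trans_lift[OF A f] and lg = sym_trans_lift[OF B g]
    show "Comp2 ?D A E H h (Comp2 ?D A B E g f) = Comp2 ?D A B H (Comp2 ?D B E H h g) f"
      unfolding simps d_comp2_eq[OF A f] d_comp2_eq[OF B g] d_comp2_eq[OF A sym_trans_hcomp[OF lf g]]
        lift_trans_hcomp[OF A f]
      by (rule sym_hcomp_assoc[OF lf lg h])
  }
qed

section \<open>Pseudo symmetric multifunctors\<close>

text \<open>An inverse has the same inputs and output as the 2-cell, so it lies in the same hom
  category.\<close>

lemma (in cat_multicategory) iso_ar_mhom:
  assumes "iso_ar (cells M) \<alpha>" "src2 M \<alpha> = as" "tgt2 M \<alpha> = b"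
  shows "iso_ar (mhom M as b) \<alpha>"
  using assms unfolding iso_ar_def by (auto simp: src_Cod tgt_Cod)

text \<open>Replaces the natural isomorphism between hom functors by its components and squares;
  functoriality of the two sides is a consequence of the axioms for the action and for
  \<open>F\<close>.\<close>

lemma pseudo_symmetric_multifunctorI:
  fixes F :: "('o, 'f, 'a, 'p, 'g, 'b) psmfun"
  assumes "multifunctor M N F"
    and ext: "\<And>f \<sigma>. \<not> (f \<in> cells1 M \<and> \<sigma> permutes {..<arity M f}) \<Longrightarrow> psym F \<sigma> f = undefined"
    and psym: "\<And>f \<sigma>. \<lbrakk>f \<in> cells1 M; \<sigma> permutes {..<arity M f}\<rbrakk> \<Longrightarrow>
      iso_ar (cells N) (psym F \<sigma> f) \<and> Dom (cells N) (psym F \<sigma> f) = fun1 F (act1 M f \<sigma>) \<and>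
      Cod (cells N) (psym F \<sigma> f) = act1 N (fun1 F f) \<sigma>"
    and nat: "\<And>\<alpha> \<sigma>. \<lbrakk>\<alpha> \<in> cells2 M; \<sigma> permutes {..<length (src2 M \<alpha>)}\<rbrakk> \<Longrightarrow>
      Cmp (cells N) (psym F \<sigma> (Cod (cells M) \<alpha>)) (fun2 F (act2 M \<alpha> \<sigma>)) =
      Cmp (cells N) (act2 N (fun2 F \<alpha>) \<sigma>) (psym F \<sigma> (Dom (cells M) \<alpha>))"
    and "\<And>f. f \<in> cells1 M \<Longrightarrow> psym F id f = Idn (cells N) (fun1 F f)"
    and "\<And>f \<sigma> \<tau>. \<lbrakk>f \<in> cells1 M; \<sigma> permutes {..<arity M f}; \<tau> permutes {..<arity M f}\<rbrakk> \<Longrightarrow>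
      psym F (\<sigma> \<circ> \<tau>) f = Cmp (cells N) (act2 N (psym F \<sigma> f) \<tau>) (psym F \<tau> (act1 M f \<sigma>))"
    and "\<And>f gs \<sigma>. \<lbrakk>composable1 M f gs; \<sigma> permutes {..<arity M f}\<rbrakk> \<Longrightarrow>
      psym F (top_perm \<sigma> (map (arity M) gs)) (gam1 M f gs) =
        gam2 N (psym F \<sigma> f) (map (\<lambda>g. Idn (cells N) (fun1 F g)) (permute_list \<sigma> gs))"
    and "\<And>f gs \<tau>s. \<lbrakk>composable1 M f gs; list_all2 (\<lambda>g \<tau>. \<tau> permutes {..<arity M g}) gs \<tau>s\<rbrakk> \<Longrightarrow>
      psym F (bottom_perm (map (arity M) gs) \<tau>s) (gam1 M f gs) =
        gam2 N (Idn (cells N) (fun1 F f)) (map2 (psym F) \<tau>s gs)"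
  shows "pseudo_symmetric_multifunctor M N F"
proof -
  interpret multifunctor M N F by fact
  have "natural_iso (mhom M as b) (mhom N (permute_list \<sigma> (map (fob F) as)) (fob F b))
        (\<lambda>f. fun1 F (act1 M f \<sigma>)) (\<lambda>\<alpha>. fun2 F (act2 M \<alpha> \<sigma>))
        (\<lambda>f. act1 N (fun1 F f) \<sigma>) (\<lambda>\<alpha>. act2 N (fun2 F \<alpha>) \<sigma>) (psym F \<sigma>)"
    if \<sigma>: "\<sigma> permutes {..<length as}" for as b \<sigma>
  proof (intro natural_iso.intro natural_iso_axioms.intro cat_functor.intro cat_functor_axioms.intro
      M.mhom_category N.mhom_category)
    fix f assume f: "f \<in> Ob (mhom M as b)"
    then have \<sigma>': "\<sigma> permutes {..<arity M f}" using \<sigma> by simp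
    note p = psym[OF _ \<sigma>']
    show "iso_ar (mhom N (permute_list \<sigma> (map (fob F) as)) (fob F b)) (psym F \<sigma> f)"
      by (rule N.iso_ar_mhom)
        (use p f \<sigma>' in \<open>auto simp: fun1_cell M.act1_cell permute_list_map\<close>)
  qed (use \<sigma> psym nat in \<open>auto simp: fun1_cell fun2_cell M.act1_cell N.act1_cell M.act2_cell N.act2_cell
      permute_list_map M.cells.Dom_Ob M.cells.Cod_Ob M.act2_Idn N.act2_Idn M.src_Cod\<close>)
  then show ?thesis
    using assms by (intro pseudo_symmetric_multifunctor.intro pseudo_symmetric_multifunctor_axioms.intro)
qed

context pseudo_symmetric_multifunctor
begin

lemma psym_cell:
  assumes f: "f \<in> cells1 M" and \<sigma>: "\<sigma> permutes {..<arity M f}"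
  shows psym_cells2: "psym F \<sigma> f \<in> cells2 N"
    and Dom_psym: "Dom (cells N) (psym F \<sigma> f) = fun1 F (act1 M f \<sigma>)"
    and Cod_psym: "Cod (cells N) (psym F \<sigma> f) = act1 N (fun1 F f) \<sigma>"
proof -
  interpret natural_iso "mhom M (src M f) (tgt M f)"
    "mhom N (permute_list \<sigma> (map (fob F) (src M f))) (fob F (tgt M f))"
    "\<lambda>f. fun1 F (act1 M f \<sigma>)" "\<lambda>\<alpha>. fun2 F (act2 M \<alpha> \<sigma>)"
    "\<lambda>f. act1 N (fun1 F f) \<sigma>" "\<lambda>\<alpha>. act2 N (fun2 F \<alpha>) \<sigma>" "psym F \<sigma>"
    by (rule psym_natural) (use assms M.src_objs M.tgt_objs in auto)
  show "psym F \<sigma> f \<in> cells2 N" "Dom (cells N) (psym F \<sigma> f) = fun1 F (act1 M f \<sigma>)"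
    "Cod (cells N) (psym F \<sigma> f) = act1 N (fun1 F f) \<sigma>"
    using iso_component[of f] Dom_component[of f] Cod_component[of f] f by (auto simp: iso_ar_def)
qed

lemma psym_naturality:
  assumes \<alpha>: "\<alpha> \<in> cells2 M" and \<sigma>: "\<sigma> permutes {..<length (src2 M \<alpha>)}"
  shows "Cmp (cells N) (psym F \<sigma> (Cod (cells M) \<alpha>)) (fun2 F (act2 M \<alpha> \<sigma>)) =
      Cmp (cells N) (act2 N (fun2 F \<alpha>) \<sigma>) (psym F \<sigma> (Dom (cells M) \<alpha>))"
proof -
  interpret natural_iso "mhom M (src2 M \<alpha>) (tgt2 M \<alpha>)"
    "mhom N (permute_list \<sigma> (map (fob F) (src2 M \<alpha>))) (fob F (tgt2 M \<alpha>))"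
    "\<lambda>f. fun1 F (act1 M f \<sigma>)" "\<lambda>\<alpha>. fun2 F (act2 M \<alpha> \<sigma>)"
    "\<lambda>f. act1 N (fun1 F f) \<sigma>" "\<lambda>\<alpha>. act2 N (fun2 F \<alpha>) \<sigma>" "psym F \<sigma>"
    by (rule psym_natural) (use assms M.src_objs M.tgt_objs M.cells.Dom_Ob in auto)
  show ?thesis using naturality[of \<alpha>] \<alpha> by simp
qed

end

section \<open>Cells of the product with the Barratt-Eccles operad\<close>

text \<open>The cell \<open>(f, \<sigma>)\<close>, with the degree that E\<Sigma> has to store
  beside \<sigma> supplied by the arity of \<open>f\<close>. Likewise
  \<open>tcell2 M \<alpha> \<sigma> \<tau>\<close> stands for
  \<open>(\<alpha>, \<sigma> \<rightarrow> \<tau>)\<close>. All cells of \<open>timesE M\<close>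
  have these forms.\<close>

definition tcell1 :: "('o, 'f, 'a) mcat \<Rightarrow> 'f \<Rightarrow> (nat \<Rightarrow> nat) \<Rightarrow> 'f \<times> deg_perm" where
  "tcell1 M f \<sigma> = (f, (arity M f, \<sigma>))"

definition tcell2 :: "('o, 'f, 'a) mcat \<Rightarrow> 'a \<Rightarrow> (nat \<Rightarrow> nat) \<Rightarrow> (nat \<Rightarrow> nat) \<Rightarrow>
    'a \<times> deg_perm \<times> deg_perm" where
  "tcell2 M \<alpha> \<sigma> \<tau> = (\<alpha>, ((length (src2 M \<alpha>), \<sigma>), (length (src2 M \<alpha>), \<tau>)))"

context cat_multicategory
begin

lemma tcell1_cells1 [simp]:
  "\<lbrakk>f \<in> cells1 M; \<sigma> permutes {..<arity M f}\<rbrakk> \<Longrightarrow> tcell1 M f \<sigma> \<in> cells1 (timesE M)"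
  by (simp add: tcell1_def)

lemma cells1_timesE:
  assumes "x \<in> cells1 (timesE M)"
  shows "fst x \<in> cells1 M" "snd (snd x) permutes {..<arity M (fst x)}"
    "x = tcell1 M (fst x) (snd (snd x))"
  using assms by (auto simp: tcell1_def prod_eq_iff)

lemma tcell2_cells2 [simp]:
  "\<lbrakk>\<alpha> \<in> cells2 M; \<sigma> permutes {..<length (src2 M \<alpha>)}; \<tau> permutes {..<length (src2 M \<alpha>)}\<rbrakk> \<Longrightarrow>
    tcell2 M \<alpha> \<sigma> \<tau> \<in> cells2 (timesE M)"
  by (simp add: tcell2_def)

lemma cells2_timesE:
  assumes "x \<in> cells2 (timesE M)"
  shows "fst x \<in> cells2 M" "snd (fst (snd x)) permutes {..<length (src2 M (fst x))}"
    "snd (snd (snd x)) permutes {..<length (src2 M (fst x))}"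
    "x = tcell2 M (fst x) (snd (fst (snd x))) (snd (snd (snd x)))"
  using assms by (auto simp: tcell2_def prod_eq_iff)

lemma src_tcell1 [simp]: "src (timesE M) (tcell1 M f \<sigma>) = map (\<lambda>a. (a, ())) (src M f)"
  by (simp add: tcell1_def zip_units)

lemma tgt_tcell1 [simp]: "tgt (timesE M) (tcell1 M f \<sigma>) = (tgt M f, ())"
  by (simp add: tcell1_def prod_eq_iff)

lemma Dom_tcell2: "Dom (cells (timesE M)) (tcell2 M \<alpha> \<sigma> \<tau>) = tcell1 M (Dom (cells M) \<alpha>) \<sigma>"
  by (simp add: tcell1_def tcell2_def prod_eq_iff)

lemma Cod_tcell2:
  "\<alpha> \<in> cells2 M \<Longrightarrow> Cod (cells (timesE M)) (tcell2 M \<alpha> \<sigma> \<tau>) = tcell1 M (Cod (cells M) \<alpha>) \<tau>"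
  by (simp add: tcell1_def tcell2_def prod_eq_iff src_Cod)

lemma Idn_tcell1:
  "f \<in> cells1 M \<Longrightarrow> Idn (cells (timesE M)) (tcell1 M f \<sigma>) = tcell2 M (Idn (cells M) f) \<sigma> \<sigma>"
  by (simp add: tcell1_def tcell2_def prod_eq_iff cells.Dom_Idn)

lemma Cmp_tcell2:
  "\<lbrakk>\<alpha> \<in> cells2 M; \<beta> \<in> cells2 M; Dom (cells M) \<beta> = Cod (cells M) \<alpha>\<rbrakk> \<Longrightarrow>
    Cmp (cells (timesE M)) (tcell2 M \<beta> \<tau> \<upsilon>) (tcell2 M \<alpha> \<sigma> \<tau>) = tcell2 M (Cmp (cells M) \<beta> \<alpha>) \<sigma> \<upsilon>"
  by (simp add: tcell2_def prod_eq_iff cells.Dom_Cmp src_Cod)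

lemma act1_tcell1:
  "\<lbrakk>f \<in> cells1 M; \<tau> permutes {..<arity M f}\<rbrakk> \<Longrightarrow>
    act1 (timesE M) (tcell1 M f \<sigma>) \<tau> = tcell1 M (act1 M f \<tau>) (\<sigma> \<circ> \<tau>)"
  by (simp add: tcell1_def prod_eq_iff src_act1)

lemma act2_tcell2:
  "\<lbrakk>\<alpha> \<in> cells2 M; \<tau> permutes {..<length (src2 M \<alpha>)}\<rbrakk> \<Longrightarrow>
    act2 (timesE M) (tcell2 M \<alpha> \<sigma> \<sigma>') \<tau> = tcell2 M (act2 M \<alpha> \<tau>) (\<sigma> \<circ> \<tau>) (\<sigma>' \<circ> \<tau>)"
  by (simp add: tcell2_def prod_eq_iff Dom_act2 src_act1 cells.Dom_Ob)

lemma munit_timesE: "a \<in> objs M \<Longrightarrow> munit (timesE M) (a, u) = tcell1 M (munit M a) id"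
  by (simp add: tcell1_def prod_eq_iff munit_cell)

lemma arity_gam1: "composable1 M f gs \<Longrightarrow> arity M (gam1 M f gs) = sum_list (map (arity M) gs)"
  by (simp add: src_gam1 length_concat o_def)

text \<open>The common index list \<open>xs\<close> ties each input to its permutation. It will be
  the list of inputs itself, or a list of inputs zipped with permutations.\<close>

lemma composable1_tcell1:
  assumes "composable1 M f (map g xs)" "\<sigma> permutes {..<arity M f}"
    "\<And>x. x \<in> set xs \<Longrightarrow> t x permutes {..<arity M (g x)}"
  shows "composable1 (timesE M) (tcell1 M f \<sigma>) (map (\<lambda>x. tcell1 M (g x) (t x)) xs)"
proof -
  note c = composable1D[OF assms(1)]
  have "map (\<lambda>x. tgt (timesE M) (tcell1 M (g x) (t x))) xs = map (\<lambda>a. (a, ())) (map (tgt M) (map g xs))"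
    by simp
  also have "\<dots> = map (\<lambda>a. (a, ())) (src M f)" unfolding c(3) ..
  finally have "map (\<lambda>x. tgt (timesE M) (tcell1 M (g x) (t x))) xs = src (timesE M) (tcell1 M f \<sigma>)"
    by (simp only: src_tcell1)
  moreover have "tcell1 M (g x) (t x) \<in> cells1 (timesE M)" if "x \<in> set xs" for x
    using that assms(3) c(2) by (intro tcell1_cells1) auto
  ultimately show ?thesis
    using tcell1_cells1[OF c(1) assms(2)]
    unfolding composable1_def map_map o_def set_map by blast
qed

lemma composable2_tcell2:
  assumes "composable2 M \<alpha> (map \<beta> xs)" "\<sigma> permutes {..<length (src2 M \<alpha>)}"
    "\<sigma>' permutes {..<length (src2 M \<alpha>)}"
    "\<And>x. x \<in> set xs \<Longrightarrow> t x permutes {..<length (src2 M (\<beta> x))}"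
    "\<And>x. x \<in> set xs \<Longrightarrow> t' x permutes {..<length (src2 M (\<beta> x))}"
  shows "composable2 (timesE M) (tcell2 M \<alpha> \<sigma> \<sigma>') (map (\<lambda>x. tcell2 M (\<beta> x) (t x) (t' x)) xs)"
proof -
  note c = composable2D[OF assms(1)]
  have "map (\<lambda>x. tgt2 (timesE M) (tcell2 M (\<beta> x) (t x) (t' x))) xs =
      map (\<lambda>a. (a, ())) (map (tgt2 M) (map \<beta> xs))"
    by (simp add: Dom_tcell2)
  also have "\<dots> = map (\<lambda>a. (a, ())) (src2 M \<alpha>)" unfolding c(3) ..
  finally have "map (\<lambda>x. tgt2 (timesE M) (tcell2 M (\<beta> x) (t x) (t' x))) xs =
      src2 (timesE M) (tcell2 M \<alpha> \<sigma> \<sigma>')"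
    by (simp only: src_tcell1 Dom_tcell2)
  moreover have "tcell2 M (\<beta> x) (t x) (t' x) \<in> cells2 (timesE M)" if "x \<in> set xs" for x
    using that assms(4,5) c(2) by (intro tcell2_cells2) auto
  ultimately show ?thesis
    using tcell2_cells2[OF c(1) assms(2,3)]
    unfolding composable2_def map_map o_def set_map by blast
qed

lemma gam1_tcell1:
  assumes "composable1 M f (map g xs)"
  shows "gam1 (timesE M) (tcell1 M f \<sigma>) (map (\<lambda>x. tcell1 M (g x) (t x)) xs) =
    tcell1 M (gam1 M f (map g xs)) (block_perm \<sigma> (map (\<lambda>x. arity M (g x)) xs) (map t xs))"
  using arity_gam1[OF assms] by (simp add: tcell1_def prod_eq_iff o_def)

lemma gam2_tcell2:
  assumes "composable2 M \<alpha> (map \<beta> xs)"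
  shows "gam2 (timesE M) (tcell2 M \<alpha> \<sigma> \<sigma>') (map (\<lambda>x. tcell2 M (\<beta> x) (t x) (t' x)) xs) =
    tcell2 M (gam2 M \<alpha> (map \<beta> xs)) (block_perm \<sigma> (map (\<lambda>x. length (src2 M (\<beta> x))) xs) (map t xs))
      (block_perm \<sigma>' (map (\<lambda>x. length (src2 M (\<beta> x))) xs) (map t' xs))"
  using arity_gam1[OF composable2_Dom[OF assms]] Dom_gam2[OF assms]
  by (simp add: tcell2_def prod_eq_iff o_def)

text \<open>The inverse runs from \<open>\<tau>\<close> back to \<open>\<sigma>\<close>: any two
  objects of a category \<open>E\<Sigma>\<^sub>n\<close> are isomorphic in a unique way.\<close>

lemma iso_ar_tcell2_Idn:
  assumes "f \<in> cells1 M" "\<sigma> permutes {..<arity M f}" "\<tau> permutes {..<arity M f}"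
  shows "iso_ar (cells (timesE M)) (tcell2 M (Idn (cells M) f) \<sigma> \<tau>)"
proof -
  have i: "Idn (cells M) f \<in> cells2 M" "Dom (cells M) (Idn (cells M) f) = f"
    "Cod (cells M) (Idn (cells M) f) = f" "Cmp (cells M) (Idn (cells M) f) (Idn (cells M) f) = Idn (cells M) f"
    using assms cells.Cmp_Idn_left[of "Idn (cells M) f"]
    by (simp_all add: cells.Idn_Ar cells.Dom_Idn cells.Cod_Idn)
  show ?thesis
    unfolding iso_ar_def
    by (intro conjI bexI[of _ "tcell2 M (Idn (cells M) f) \<tau> \<sigma>"])
      (use i assms in \<open>simp_all add: Dom_tcell2 Cod_tcell2 Cmp_tcell2 Idn_tcell1 del: mprod_simps\<close>)
qed

end

section \<open>From D to pseudo symmetric multifunctors\<close>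

definition to_ps :: "('o, 'f, 'a) mcat \<Rightarrow>
    ('o \<times> unit, 'f \<times> deg_perm, 'a \<times> deg_perm \<times> deg_perm, 'p, 'g, 'b) mfun \<Rightarrow>
    ('o, 'f, 'a, 'p, 'g, 'b) psmfun" where
  "to_ps M F =
     \<lparr>fob = (\<lambda>a\<in>objs M. fob F (a, ())),
      fun1 = (\<lambda>f\<in>cells1 M. fun1 F (tcell1 M f id)),
      fun2 = (\<lambda>\<alpha>\<in>cells2 M. fun2 F (tcell2 M \<alpha> id id)),
      psym = (\<lambda>\<sigma>. \<lambda>f \<in> {f \<in> cells1 M. \<sigma> permutes {..<arity M f}}.
        fun2 F (tcell2 M (Idn (cells M) (act1 M f \<sigma>)) id \<sigma>))\<rparr>"

lemma to_ps_simps [simp]: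
  "a \<in> objs M \<Longrightarrow> fob (to_ps M F) a = fob F (a, ())"
  "f \<in> cells1 M \<Longrightarrow> fun1 (to_ps M F) f = fun1 F (tcell1 M f id)"
  "\<alpha> \<in> cells2 M \<Longrightarrow> fun2 (to_ps M F) \<alpha> = fun2 F (tcell2 M \<alpha> id id)"
  "\<lbrakk>f \<in> cells1 M; \<sigma> permutes {..<arity M f}\<rbrakk> \<Longrightarrow>
    psym (to_ps M F) \<sigma> f = fun2 F (tcell2 M (Idn (cells M) (act1 M f \<sigma>)) id \<sigma>)"
  by (simp_all add: to_ps_def)

lemma to_ps_ext:
  "fob (to_ps M F) \<in> extensional (objs M)"
  "fun1 (to_ps M F) \<in> extensional (cells1 M)"
  "fun2 (to_ps M F) \<in> extensional (cells2 M)"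
  "\<not> (f \<in> cells1 M \<and> \<sigma> permutes {..<arity M f}) \<Longrightarrow> psym (to_ps M F) \<sigma> f = undefined"
  by (auto simp: to_ps_def)

text \<open>Each axiom is the image under \<open>F\<close> of an equation between 2-cells of
  \<open>timesE M\<close>. The E\<Sigma> entries agree as soon as their ends do; the
  \<open>M\<close> entries agree by identity laws or equivariance.\<close>

lemma pseudo_symmetric_to_ps:
  assumes "cat_multicategory M" "symmetric_multifunctor (timesE M) N F"
  shows "pseudo_symmetric_multifunctor M N (to_ps M F)"
proof -
  interpret M: cat_multicategory M by fact
  interpret F: symmetric_multifunctor "timesE M" N F by fact
  let ?F = "to_ps M F"
  note [simp del] = mprod_simps
  note [simp] = permutes_id M.cells.Idn_Ar M.cells.Dom_Idn M.cells.Cod_Idn M.cells.Dom_Ob M.cells.Cod_Ob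
    M.src_Cod M.tgt_Cod M.act1_cell M.Dom_tcell2 M.Cod_tcell2
  \<comment> \<open>Identity permutations are closed under \<gamma>, so the restriction of
    \<open>F\<close> to them preserves \<gamma>.\<close>
  have block_id: "block_perm id ks (map (\<lambda>x. id) xs) = id" if "length ks = length xs"
    for ks and xs :: "'z list"
    by (rule block_perm_id) (use that in auto)
  have m: "multifunctor M N ?F"
  proof (rule multifunctorI)
    fix f assume f: "f \<in> cells1 M"
    have "map (\<lambda>a. fob F (a, ())) (src M f) = map (fob ?F) (src M f)"
      using M.src_in_objs[OF f] by simp
    then show "fun1 ?F f \<in> cells1 N \<and> src N (fun1 ?F f) = map (fob ?F) (src M f) \<and>
        tgt N (fun1 ?F f) = fob ?F (tgt M f)"
      using f by (simp add: F.fun1_cell M.tgt_objs o_def)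
    show "fun2 ?F (Idn (cells M) f) = Idn (cells N) (fun1 ?F f)"
      using f F.fun2_Idn[of "tcell1 M f id"] by (simp add: M.Idn_tcell1)
  next
    fix \<alpha> assume \<alpha>: "\<alpha> \<in> cells2 M"
    show "fun2 ?F \<alpha> \<in> cells2 N \<and> Dom (cells N) (fun2 ?F \<alpha>) = fun1 ?F (Dom (cells M) \<alpha>) \<and>
        Cod (cells N) (fun2 ?F \<alpha>) = fun1 ?F (Cod (cells M) \<alpha>)"
      using \<alpha> by (simp add: F.fun2_cell)
    fix \<beta> assume \<beta>: "\<beta> \<in> cells2 M" "Dom (cells M) \<beta> = Cod (cells M) \<alpha>"
    then show "fun2 ?F (Cmp (cells M) \<beta> \<alpha>) = Cmp (cells N) (fun2 ?F \<beta>) (fun2 ?F \<alpha>)"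
      using \<alpha> F.fun2_Cmp[of "tcell2 M \<alpha> id id" "tcell2 M \<beta> id id"]
      by (simp add: M.Cmp_tcell2 M.cells.Cmp_Ar)
  next
    fix a assume a: "a \<in> objs M"
    show "fun1 ?F (munit M a) = munit N (fob ?F a)"
      using a F.fun1_munit[of "(a, ())"] by (simp add: M.munit_cell M.munit_timesE mprod_simps(1))
    show "fob ?F a \<in> objs N" using a F.fob_objs[of "(a, ())"] by (simp add: mprod_simps(1))
  next
    fix f gs assume c: "composable1 M f gs"
    note c' = composable1D[OF c]
    have cE: "composable1 (timesE M) (tcell1 M f id) (map (\<lambda>g. tcell1 M g id) gs)"
      using c M.composable1_tcell1[of f "\<lambda>g. g" gs id "\<lambda>g. id"] by simp
    have m: "map (fun1 ?F) gs = map (fun1 F) (map (\<lambda>g. tcell1 M g id) gs)" using c'(2) by auto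
    show "fun1 ?F (gam1 M f gs) = gam1 N (fun1 ?F f) (map (fun1 ?F) gs)"
      unfolding m
      using F.fun1_gam1[OF cE] c'(1) M.gam1_cells1[OF c] c M.gam1_tcell1[of f "\<lambda>g. g" gs id "\<lambda>g. id"]
      by (simp add: block_id)
  next
    fix \<alpha> \<beta>s assume c: "composable2 M \<alpha> \<beta>s"
    note c' = composable2D[OF c]
    have cE: "composable2 (timesE M) (tcell2 M \<alpha> id id) (map (\<lambda>g. tcell2 M g id id) \<beta>s)"
      using c M.composable2_tcell2[of \<alpha> "\<lambda>g. g" \<beta>s id id "\<lambda>g. id" "\<lambda>g. id"] by simp
    have m: "map (fun2 ?F) \<beta>s = map (fun2 F) (map (\<lambda>g. tcell2 M g id id) \<beta>s)" using c'(2) by auto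
    show "fun2 ?F (gam2 M \<alpha> \<beta>s) = gam2 N (fun2 ?F \<alpha>) (map (fun2 ?F) \<beta>s)"
      unfolding m
      using F.fun2_gam2[OF cE] c'(1) M.gam2_cells2[OF c] c
        M.gam2_tcell2[of \<alpha> "\<lambda>g. g" \<beta>s id id "\<lambda>g. id" "\<lambda>g. id"]
      by (simp add: block_id)
  qed (fact M.cat_multicategory_axioms F.N.cat_multicategory_axioms to_ps_ext)+
  show ?thesis
  proof (rule pseudo_symmetric_multifunctorI[OF m to_ps_ext(4)])
    fix f \<sigma> assume f: "f \<in> cells1 M" and \<sigma>: "\<sigma> permutes {..<arity M f}"
    have c: "tcell2 M (Idn (cells M) (act1 M f \<sigma>)) id \<sigma> \<in> cells2 (timesE M)"
      using f \<sigma> by simp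
    show "iso_ar (cells N) (psym ?F \<sigma> f) \<and> Dom (cells N) (psym ?F \<sigma> f) = fun1 ?F (act1 M f \<sigma>) \<and>
        Cod (cells N) (psym ?F \<sigma> f) = act1 N (fun1 ?F f) \<sigma>"
      using f \<sigma> F.iso_ar_fun2[OF M.iso_ar_tcell2_Idn[of "act1 M f \<sigma>" id \<sigma>]]
      by (simp add: F.fun2_cell F.fun1_act1[symmetric] M.act1_tcell1)
    fix \<tau> assume \<tau>: "\<tau> permutes {..<arity M f}"
    have "psym ?F (\<sigma> \<circ> \<tau>) f = fun2 F (tcell2 M (Idn (cells M) (act1 M (act1 M f \<sigma>) \<tau>)) id (\<sigma> \<circ> \<tau>))"
      using f \<sigma> \<tau> by (simp add: M.act1_act1 permutes_compose)
    \<comment> \<open>Acting with \<tau> turns \<open>id \<rightarrow> \<sigma>\<close> into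
      \<open>\<tau> \<rightarrow> \<sigma> \<circ> \<tau>\<close>, and after
      \<open>id \<rightarrow> \<tau>\<close> this gives
      \<open>id \<rightarrow> \<sigma> \<circ> \<tau>\<close>.\<close>
    also have "\<dots> = Cmp (cells N)
        (fun2 F (act2 (timesE M) (tcell2 M (Idn (cells M) (act1 M f \<sigma>)) id \<sigma>) \<tau>))
        (fun2 F (tcell2 M (Idn (cells M) (act1 M (act1 M f \<sigma>) \<tau>)) id \<tau>))"
      using f \<sigma> \<tau> M.cells.Cmp_Idn_left[of "Idn (cells M) (act1 M (act1 M f \<sigma>) \<tau>)"]
      by (subst F.fun2_Cmp[symmetric])
        (simp_all add: M.act2_tcell2 M.act2_Idn M.Cmp_tcell2 permutes_compose)
    also have "\<dots> = Cmp (cells N) (act2 N (psym ?F \<sigma> f) \<tau>) (psym ?F \<tau> (act1 M f \<sigma>))"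
      using f \<sigma> \<tau> by (simp add: F.fun2_act2)
    finally show "psym ?F (\<sigma> \<circ> \<tau>) f =
        Cmp (cells N) (act2 N (psym ?F \<sigma> f) \<tau>) (psym ?F \<tau> (act1 M f \<sigma>))" .
  next
    fix f assume "f \<in> cells1 M"
    then show "psym ?F id f = Idn (cells N) (fun1 ?F f)"
      using F.fun2_Idn[of "tcell1 M f id"] by (simp add: M.act1_id M.Idn_tcell1)
  next
    fix \<alpha> \<sigma> assume \<alpha>: "\<alpha> \<in> cells2 M" and \<sigma>: "\<sigma> permutes {..<length (src2 M \<alpha>)}"
    note [simp] = M.act2_cell
    \<comment> \<open>Both sides of the naturality square are the image of
      \<open>\<alpha>\<sigma>\<close> over \<open>id \<rightarrow> \<sigma>\<close>; the path
      through \<open>id \<rightarrow> id\<close> is compared with the one through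
      \<open>\<sigma> \<rightarrow> \<sigma>\<close>.\<close>
    have "Cmp (cells N) (psym ?F \<sigma> (Cod (cells M) \<alpha>)) (fun2 ?F (act2 M \<alpha> \<sigma>)) =
        fun2 F (tcell2 M (act2 M \<alpha> \<sigma>) id \<sigma>)"
      using \<alpha> \<sigma> M.cells.Cmp_Idn_left[of "act2 M \<alpha> \<sigma>"]
      by (simp add: F.fun2_Cmp[symmetric] M.Cmp_tcell2)
    also have "\<dots> = Cmp (cells N) (fun2 F (act2 (timesE M) (tcell2 M \<alpha> id id) \<sigma>))
        (psym ?F \<sigma> (Dom (cells M) \<alpha>))"
      using \<alpha> \<sigma> M.cells.Cmp_Idn_right[of "act2 M \<alpha> \<sigma>"]
      by (simp add: F.fun2_Cmp[symmetric] M.Cmp_tcell2 M.act2_tcell2)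
    also have "\<dots> = Cmp (cells N) (act2 N (fun2 ?F \<alpha>) \<sigma>) (psym ?F \<sigma> (Dom (cells M) \<alpha>))"
      using \<alpha> \<sigma> by (simp add: F.fun2_act2)
    finally show "Cmp (cells N) (psym ?F \<sigma> (Cod (cells M) \<alpha>)) (fun2 ?F (act2 M \<alpha> \<sigma>)) =
        Cmp (cells N) (act2 N (fun2 ?F \<alpha>) \<sigma>) (psym ?F \<sigma> (Dom (cells M) \<alpha>))" .
  next
    fix f gs \<sigma> assume c: "composable1 M f gs" and \<sigma>: "\<sigma> permutes {..<arity M f}"
    note c' = composable1D[OF c]
    let ?gs = "permute_list \<sigma> gs" and ?t = "top_perm \<sigma> (map (arity M) gs)"
    have \<sigma>': "\<sigma> permutes {..<length gs}" using \<sigma> c'(4) by simp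
    have cp: "composable1 M (act1 M f \<sigma>) ?gs"
      by (rule M.composable1_act1) (use c \<sigma> \<sigma>' in simp_all)
    \<comment> \<open>So \<gamma> of \<open>id \<rightarrow> \<sigma>\<close> with identities
      \<open>id \<rightarrow> id\<close> in the inputs is exactly \<open>id \<rightarrow> ?t\<close>
      in E\<Sigma>, while top equivariance gives the identity 2-cell in \<open>M\<close>.\<close>
    have t: "?t = block_perm \<sigma> (map (arity M) ?gs) (map (\<lambda>g. id) ?gs)"
      by (simp add: top_perm_def permute_list_map[OF \<sigma>'] map_replicate_const)
    have g: "gam1 M (act1 M f \<sigma>) ?gs = act1 M (gam1 M f gs) ?t"
      by (rule M.top_equivariance1[OF c \<sigma>])
    have tp: "?t permutes {..<arity M (gam1 M f gs)}"
      using top_perm_permutes[of \<sigma> "map (arity M) gs"] \<sigma>' by (simp add: M.arity_gam1[OF c])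
    have c2: "composable2 M (Idn (cells M) (act1 M f \<sigma>)) (map (Idn (cells M)) ?gs)"
      by (rule M.composable2_Idn[OF cp])
    have gc: "g \<in> cells1 M" if "g \<in> set ?gs" for g using that c'(2) \<sigma>' by auto
    have cE: "composable2 (timesE M) (tcell2 M (Idn (cells M) (act1 M f \<sigma>)) id \<sigma>)
        (map (\<lambda>g. tcell2 M (Idn (cells M) g) id id) ?gs)"
      by (rule M.composable2_tcell2[OF c2]) (use c' \<sigma> gc in auto)
    have m: "map (\<lambda>g. Idn (cells N) (fun1 ?F g)) ?gs =
        map (fun2 F) (map (\<lambda>g. tcell2 M (Idn (cells M) g) id id) ?gs)"
      using gc F.fun2_Idn by (auto simp: M.Idn_tcell1[symmetric])
    have "gam2 N (psym ?F \<sigma> f) (map (\<lambda>g. Idn (cells N) (fun1 ?F g)) ?gs) =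
        fun2 F (gam2 (timesE M) (tcell2 M (Idn (cells M) (act1 M f \<sigma>)) id \<sigma>)
          (map (\<lambda>g. tcell2 M (Idn (cells M) g) id id) ?gs))"
      unfolding m using F.fun2_gam2[OF cE] c'(1) \<sigma> by simp
    also have "map (\<lambda>g. length (src2 M (Idn (cells M) g))) ?gs = map (arity M) ?gs"
      using gc by simp
    then have "gam2 (timesE M) (tcell2 M (Idn (cells M) (act1 M f \<sigma>)) id \<sigma>)
          (map (\<lambda>g. tcell2 M (Idn (cells M) g) id id) ?gs) =
        tcell2 M (Idn (cells M) (act1 M (gam1 M f gs) ?t)) id ?t"
      unfolding M.gam2_tcell2[OF c2] M.gam2_Idn[OF cp] g t[symmetric] by (simp only: t block_id length_map)
    finally show "psym ?F ?t (gam1 M f gs) =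
        gam2 N (psym ?F \<sigma> f) (map (\<lambda>g. Idn (cells N) (fun1 ?F g)) ?gs)"
      using M.gam1_cells1[OF c] tp by simp
  next
    fix f gs \<tau>s assume c: "composable1 M f gs"
      and \<tau>: "list_all2 (\<lambda>g \<tau>. \<tau> permutes {..<arity M g}) gs \<tau>s"
    note c' = composable1D[OF c]
    \<comment> \<open>Now each input carries its own \<open>id \<rightarrow> \<tau>\<close>, and
      \<gamma> with \<open>id \<rightarrow> id\<close> outside produces
      \<open>id \<rightarrow> ?t\<close>.\<close>
    let ?xs = "zip gs \<tau>s" and ?t = "bottom_perm (map (arity M) gs) \<tau>s"
    let ?g = "\<lambda>(g, \<tau>). act1 M g \<tau>"
    have l: "length \<tau>s = length gs" using \<tau> by (simp add: list_all2_lengthD)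
    have x: "fst x \<in> cells1 M" "snd x permutes {..<arity M (fst x)}" if "x \<in> set ?xs" for x
      using that \<tau> c'(2) set_zip_leftD[of "fst x" "snd x" gs \<tau>s] by (auto simp: list_all2_iff)
    have cp: "composable1 M f (map ?g ?xs)"
      using M.composable1_map2_act1[OF c \<tau>] .
    have g: "gam1 M f (map ?g ?xs) = act1 M (gam1 M f gs) ?t"
      by (rule M.bottom_equivariance1[OF c \<tau>])
    have tp: "?t permutes {..<arity M (gam1 M f gs)}"
      using bottom_perm_permutes[of \<tau>s "map (arity M) gs"] \<tau>
      by (auto simp: M.arity_gam1[OF c] list_all2_conv_all_nth)
    have c2: "composable2 M (Idn (cells M) f) (map (\<lambda>x. Idn (cells M) (?g x)) ?xs)"
      using M.composable2_Idn[OF cp] by (simp add: o_def)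
    have cE: "composable2 (timesE M) (tcell2 M (Idn (cells M) f) id id)
        (map (\<lambda>x. tcell2 M (Idn (cells M) (?g x)) id (snd x)) ?xs)"
      by (rule M.composable2_tcell2[OF c2]) (use c' x in \<open>auto simp: case_prod_beta\<close>)
    have "map2 (psym ?F) \<tau>s gs = map (\<lambda>x. psym ?F (snd x) (fst x)) ?xs"
      using l by (auto intro!: nth_equalityI)
    also have "\<dots> = map (fun2 F) (map (\<lambda>x. tcell2 M (Idn (cells M) (?g x)) id (snd x)) ?xs)"
      using x by (auto simp: case_prod_beta)
    finally have "gam2 N (Idn (cells N) (fun1 ?F f)) (map2 (psym ?F) \<tau>s gs) =
        fun2 F (gam2 (timesE M) (tcell2 M (Idn (cells M) f) id id)
          (map (\<lambda>x. tcell2 M (Idn (cells M) (?g x)) id (snd x)) ?xs))"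
      using F.fun2_gam2[OF cE] c'(1) F.fun2_Idn[of "tcell1 M f id"] by (simp add: M.Idn_tcell1)
    also have "map (\<lambda>x. length (src2 M (Idn (cells M) (?g x)))) ?xs = map (arity M) gs"
      using c'(2) \<tau> l by (auto intro!: nth_equalityI simp: list_all2_conv_all_nth subset_eq)
    then have "gam2 (timesE M) (tcell2 M (Idn (cells M) f) id id)
          (map (\<lambda>x. tcell2 M (Idn (cells M) (?g x)) id (snd x)) ?xs) =
        tcell2 M (Idn (cells M) (act1 M (gam1 M f gs) ?t)) id ?t"
      unfolding M.gam2_tcell2[OF c2]
      using M.gam2_Idn[OF cp] l by (simp add: g block_id bottom_perm_def o_def)
    finally show "psym ?F ?t (gam1 M f gs) = gam2 N (Idn (cells N) (fun1 ?F f)) (map2 (psym ?F) \<tau>s gs)"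
      using M.gam1_cells1[OF c] tp by simp
  qed
qed

section \<open>From pseudo symmetric multifunctors to D\<close>

text \<open>\<open>twist_iso\<close>, the pseudo symmetry isomorphism at \<open>f\<sigma>\<^sup>-\<^sup>1\<close>, identifies \<open>F f\<close> with \<open>F(f\<sigma>\<^sup>-\<^sup>1)\<sigma>\<close>;
  this dictates the value \<open>twist2\<close> on 2-cells.\<close>

definition twist1 :: "('o, 'f, 'a) mcat \<Rightarrow> ('p, 'g, 'b) mcat \<Rightarrow>
    ('o, 'f, 'a, 'p, 'g, 'b) psmfun \<Rightarrow> 'f \<Rightarrow> (nat \<Rightarrow> nat) \<Rightarrow> 'g" where
  "twist1 M N F f \<sigma> = act1 N (fun1 F (act1 M f (inv \<sigma>))) \<sigma>"

definition twist_iso :: "('o, 'f, 'a) mcat \<Rightarrow>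
    ('o, 'f, 'a, 'p, 'g, 'b) psmfun \<Rightarrow> 'f \<Rightarrow> (nat \<Rightarrow> nat) \<Rightarrow> 'b" where
  "twist_iso M F f \<sigma> = psym F \<sigma> (act1 M f (inv \<sigma>))"

text \<open>The pseudo symmetry isomorphism of \<open>inv \<sigma>\<close> at \<open>f\<close>,
  acted on by \<sigma>, leads from the twisted image of \<open>f\<close> back to \<open>F f\<close>.
  A closed formula keeps \<open>twist2\<close> free of a choice of inverse.\<close>

definition twist_inv :: "('p, 'g, 'b) mcat \<Rightarrow>
    ('o, 'f, 'a, 'p, 'g, 'b) psmfun \<Rightarrow> 'f \<Rightarrow> (nat \<Rightarrow> nat) \<Rightarrow> 'b" where
  "twist_inv N F f \<sigma> = act2 N (psym F (inv \<sigma>) f) \<sigma>"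

definition twist2 :: "('o, 'f, 'a) mcat \<Rightarrow> ('p, 'g, 'b) mcat \<Rightarrow>
    ('o, 'f, 'a, 'p, 'g, 'b) psmfun \<Rightarrow> 'a \<Rightarrow> (nat \<Rightarrow> nat) \<Rightarrow> (nat \<Rightarrow> nat) \<Rightarrow> 'b" where
  "twist2 M N F \<alpha> \<sigma> \<tau> = Cmp (cells N) (twist_iso M F (Cod (cells M) \<alpha>) \<tau>)
     (Cmp (cells N) (fun2 F \<alpha>) (twist_inv N F (Dom (cells M) \<alpha>) \<sigma>))"

section \<open>Twisted cells: ends, invertibility and uniqueness\<close>

context pseudo_symmetric_multifunctor
begin

lemma twist1_cell:
  assumes f: "f \<in> cells1 M" and \<sigma>: "\<sigma> permutes {..<arity M f}"
  shows twist1_cells1: "twist1 M N F f \<sigma> \<in> cells1 N"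
    and src_twist1: "src N (twist1 M N F f \<sigma>) = map (fob F) (src M f)"
    and tgt_twist1: "tgt N (twist1 M N F f \<sigma>) = fob F (tgt M f)"
  using f \<sigma> permutes_inv[OF \<sigma>]
  by (simp_all add: twist1_def M.act1_cell N.act1_cell fun1_cell permute_list_map[symmetric])

lemma twist_iso_cell:
  assumes f: "f \<in> cells1 M" and \<sigma>: "\<sigma> permutes {..<arity M f}"
  shows twist_iso_cells2: "twist_iso M F f \<sigma> \<in> cells2 N"
    and Dom_twist_iso: "Dom (cells N) (twist_iso M F f \<sigma>) = fun1 F f"
    and Cod_twist_iso: "Cod (cells N) (twist_iso M F f \<sigma>) = twist1 M N F f \<sigma>"
  using f \<sigma> permutes_inv[OF \<sigma>] M.act1_cell[OF f permutes_inv[OF \<sigma>]]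
  by (simp_all add: twist_iso_def twist1_def psym_cell)

lemma twist_inv_cell:
  assumes f: "f \<in> cells1 M" and \<sigma>: "\<sigma> permutes {..<arity M f}"
  shows twist_inv_cells2: "twist_inv N F f \<sigma> \<in> cells2 N"
    and Dom_twist_inv: "Dom (cells N) (twist_inv N F f \<sigma>) = twist1 M N F f \<sigma>"
    and Cod_twist_inv: "Cod (cells N) (twist_inv N F f \<sigma>) = fun1 F f"
  using f \<sigma> permutes_inv[OF \<sigma>] M.act1_cell[OF f permutes_inv[OF \<sigma>]] fun1_cell[OF f]
  by (simp_all add: twist_inv_def twist1_def psym_cell N.act2_cell fun1_cell)

text \<open>Both equations are \<open>psym_comp\<close> and \<open>psym_id\<close> for \<sigma> and
  its inverse. The second arises directly at \<open>f\<close>; the first arises at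
  \<open>act1 M f (inv \<sigma>)\<close> and is then moved by the action of \<sigma>.\<close>

lemma twist_inverse:
  assumes f: "f \<in> cells1 M" and \<sigma>: "\<sigma> permutes {..<arity M f}"
  shows "Cmp (cells N) (twist_iso M F f \<sigma>) (twist_inv N F f \<sigma>) = Idn (cells N) (twist1 M N F f \<sigma>)"
    and "Cmp (cells N) (twist_inv N F f \<sigma>) (twist_iso M F f \<sigma>) = Idn (cells N) (fun1 F f)"
proof -
  note inv = permutes_inv[OF \<sigma>]
  let ?f = "act1 M f (inv \<sigma>)"
  note f' = M.act1_cell[OF f inv]
  have \<sigma>': "\<sigma> permutes {..<arity M ?f}" "inv \<sigma> permutes {..<arity M ?f}"
    using f' \<sigma> inv by simp_all
  have "Idn (cells N) (fun1 F ?f) = Cmp (cells N) (act2 N (psym F \<sigma> ?f) (inv \<sigma>)) (psym F (inv \<sigma>) f)"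
    using psym_comp[OF f'(1) \<sigma>'] psym_id[OF f'(1)] permutes_inv_o[OF \<sigma>] f \<sigma> by simp
  then have "Idn (cells N) (act1 N (fun1 F ?f) \<sigma>) =
      act2 N (Cmp (cells N) (act2 N (psym F \<sigma> ?f) (inv \<sigma>)) (psym F (inv \<sigma>) f)) \<sigma>"
    using N.act2_Idn[of "fun1 F ?f" \<sigma>] fun1_cell[OF f'(1)] \<sigma>' by simp
  also have "\<dots> = Cmp (cells N) (act2 N (act2 N (psym F \<sigma> ?f) (inv \<sigma>)) \<sigma>) (act2 N (psym F (inv \<sigma>) f) \<sigma>)"
    using f \<sigma> \<sigma>' inv f' by (intro N.act2_Cmp)
      (simp_all add: psym_cell N.act2_cell fun1_cell N.act1_act1 permutes_inv_o[OF \<sigma>] N.act1_id)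
  also have "act2 N (act2 N (psym F \<sigma> ?f) (inv \<sigma>)) \<sigma> = psym F \<sigma> ?f"
    using f \<sigma> \<sigma>' inv f' by (simp add: psym_cell fun1_cell)
  finally show "Cmp (cells N) (twist_iso M F f \<sigma>) (twist_inv N F f \<sigma>) = Idn (cells N) (twist1 M N F f \<sigma>)"
    by (simp add: twist_iso_def twist_inv_def twist1_def)
  show "Cmp (cells N) (twist_inv N F f \<sigma>) (twist_iso M F f \<sigma>) = Idn (cells N) (fun1 F f)"
    using psym_comp[OF f inv \<sigma>] psym_id[OF f] permutes_inv_o[OF \<sigma>]
    by (simp add: twist_iso_def twist_inv_def)
qed

lemma iso_ar_twist_iso:
  assumes "f \<in> cells1 M" "\<sigma> permutes {..<arity M f}"
  shows "iso_ar (cells N) (twist_iso M F f \<sigma>)"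
  unfolding iso_ar_def
  using assms by (intro conjI bexI[of _ "twist_inv N F f \<sigma>"])
    (simp_all add: twist_iso_cell twist_inv_cell twist_inverse)

lemma twist_iso_id: "f \<in> cells1 M \<Longrightarrow> twist_iso M F f id = Idn (cells N) (fun1 F f)"
  by (simp add: twist_iso_def psym_id M.act1_id)

lemma twist_inv_id: "f \<in> cells1 M \<Longrightarrow> twist_inv N F f id = Idn (cells N) (fun1 F f)"
  by (simp add: twist_inv_def psym_id N.act2_Idn N.act1_id fun1_cell permutes_id)

lemma twist1_id: "f \<in> cells1 M \<Longrightarrow> twist1 M N F f id = fun1 F f"
  by (simp add: twist1_def M.act1_id N.act1_id fun1_cell)

text \<open>\<open>twist2\<close> conjugates \<open>F \<alpha>\<close> by twist isomorphisms, so
  composing with the isomorphism at the source cancels its inverse and leaves a commuting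
  square.\<close>

lemma twist2_cell:
  assumes \<alpha>: "\<alpha> \<in> cells2 M" and \<sigma>: "\<sigma> permutes {..<length (src2 M \<alpha>)}"
    and \<tau>: "\<tau> permutes {..<length (src2 M \<alpha>)}"
  shows twist2_cells2: "twist2 M N F \<alpha> \<sigma> \<tau> \<in> cells2 N"
    and Dom_twist2: "Dom (cells N) (twist2 M N F \<alpha> \<sigma> \<tau>) = twist1 M N F (Dom (cells M) \<alpha>) \<sigma>"
    and Cod_twist2: "Cod (cells N) (twist2 M N F \<alpha> \<sigma> \<tau>) = twist1 M N F (Cod (cells M) \<alpha>) \<tau>"
    and twist2_twist_iso: "Cmp (cells N) (twist2 M N F \<alpha> \<sigma> \<tau>) (twist_iso M F (Dom (cells M) \<alpha>) \<sigma>) =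
      Cmp (cells N) (twist_iso M F (Cod (cells M) \<alpha>) \<tau>) (fun2 F \<alpha>)"
proof -
  let ?f = "Dom (cells M) \<alpha>" and ?g = "Cod (cells M) \<alpha>"
  have f: "?f \<in> cells1 M" "?g \<in> cells1 M" "\<tau> permutes {..<arity M ?g}"
    using \<alpha> \<tau> by (simp_all add: M.cells.Dom_Ob M.cells.Cod_Ob M.src_Cod)
  note simps = twist_iso_cell[OF f(1) \<sigma>] twist_iso_cell[OF f(2,3)] twist_inv_cell[OF f(1) \<sigma>]
    fun2_cell(1-3)[OF \<alpha>]
  let ?i = "twist_inv N F ?f \<sigma>" and ?e = "twist_iso M F ?f \<sigma>" and ?e' = "twist_iso M F ?g \<tau>"
  show "twist2 M N F \<alpha> \<sigma> \<tau> \<in> cells2 N"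
    "Dom (cells N) (twist2 M N F \<alpha> \<sigma> \<tau>) = twist1 M N F ?f \<sigma>"
    "Cod (cells N) (twist2 M N F \<alpha> \<sigma> \<tau>) = twist1 M N F ?g \<tau>"
    by (simp_all add: twist2_def N.cells.Cmp_Ar N.cells.Dom_Cmp N.cells.Cod_Cmp simps)
  have "Cmp (cells N) (twist2 M N F \<alpha> \<sigma> \<tau>) ?e =
      Cmp (cells N) ?e' (Cmp (cells N) (Cmp (cells N) (fun2 F \<alpha>) ?i) ?e)"
    unfolding twist2_def
    by (rule N.cells.Cmp_assoc[symmetric])
      (simp_all add: N.cells.Cmp_Ar N.cells.Dom_Cmp N.cells.Cod_Cmp simps)
  also have "Cmp (cells N) (Cmp (cells N) (fun2 F \<alpha>) ?i) ?e = Cmp (cells N) (fun2 F \<alpha>) (Cmp (cells N) ?i ?e)"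
    by (rule N.cells.Cmp_assoc[symmetric]) (simp_all add: simps)
  also have "\<dots> = fun2 F \<alpha>"
    using N.cells.Cmp_Idn_right[OF simps(10)] by (simp add: twist_inverse[OF f(1) \<sigma>] simps)
  finally show "Cmp (cells N) (twist2 M N F \<alpha> \<sigma> \<tau>) ?e = Cmp (cells N) ?e' (fun2 F \<alpha>)" .
qed

text \<open>The principle behind all laws of \<open>twist2\<close>: a candidate only has to start at
  the right 1-cell and close the square, because the side of the square is invertible.\<close>

lemma twist2_unique:
  assumes \<alpha>: "\<alpha> \<in> cells2 M" and \<sigma>: "\<sigma> permutes {..<length (src2 M \<alpha>)}"
    and \<tau>: "\<tau> permutes {..<length (src2 M \<alpha>)}"
    and y: "y \<in> cells2 N" "Dom (cells N) y = twist1 M N F (Dom (cells M) \<alpha>) \<sigma>"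
      "Cmp (cells N) y (twist_iso M F (Dom (cells M) \<alpha>) \<sigma>) =
        Cmp (cells N) (twist_iso M F (Cod (cells M) \<alpha>) \<tau>) (fun2 F \<alpha>)"
  shows "y = twist2 M N F \<alpha> \<sigma> \<tau>"
proof (rule N.cells.iso_ar_cancel_right)
  note f = M.cells.Dom_Ob[OF \<alpha>]
  show "iso_ar (cells N) (twist_iso M F (Dom (cells M) \<alpha>) \<sigma>)"
    by (rule iso_ar_twist_iso[OF f \<sigma>])
  show "Cmp (cells N) y (twist_iso M F (Dom (cells M) \<alpha>) \<sigma>) =
      Cmp (cells N) (twist2 M N F \<alpha> \<sigma> \<tau>) (twist_iso M F (Dom (cells M) \<alpha>) \<sigma>)"
    unfolding y(3) by (rule twist2_twist_iso[OF \<alpha> \<sigma> \<tau>, symmetric])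
qed (use assms M.cells.Dom_Ob[OF \<alpha>] in \<open>simp_all add: twist2_cell twist_iso_cell\<close>)

text \<open>Undoing \<sigma> \<circ> \<tau> on \<open>f\<close> acted on by \<tau> leaves
  \<open>act1 M f (inv \<sigma>)\<close>. The equation is therefore \<open>psym_comp\<close> at that
  1-cell.\<close>

lemma twist_iso_act1:
  assumes f: "f \<in> cells1 M" and \<sigma>: "\<sigma> permutes {..<arity M f}" and \<tau>: "\<tau> permutes {..<arity M f}"
  shows "twist_iso M F (act1 M f \<tau>) (\<sigma> \<circ> \<tau>) = Cmp (cells N) (act2 N (twist_iso M F f \<sigma>) \<tau>) (psym F \<tau> f)"
proof -
  note inv = permutes_inv[OF \<sigma>] permutes_inv[OF \<tau>]
  have "act1 M (act1 M f \<tau>) (inv (\<sigma> \<circ> \<tau>)) = act1 M (act1 M (act1 M f \<tau>) (inv \<tau>)) (inv \<sigma>)"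
    using f inv M.act1_cell[OF f \<tau>] M.act1_act1[of "act1 M f \<tau>" "inv \<tau>" "inv \<sigma>"]
    by (simp add: o_inv_distrib permutes_bij[OF \<sigma>] permutes_bij[OF \<tau>] del: M.act1_inv)
  then have "act1 M (act1 M f \<tau>) (inv (\<sigma> \<circ> \<tau>)) = act1 M f (inv \<sigma>)" using f \<tau> by simp
  then show ?thesis
    using psym_comp[of "act1 M f (inv \<sigma>)" \<sigma> \<tau>] f \<sigma> \<tau> inv by (simp add: twist_iso_def M.act1_cell)
qed

text \<open>Read off by comparing codomains in \<open>twist_iso_act1\<close>.\<close>

lemma twist1_act1:
  assumes f: "f \<in> cells1 M" and \<sigma>: "\<sigma> permutes {..<arity M f}" and \<tau>: "\<tau> permutes {..<arity M f}"
  shows "twist1 M N F (act1 M f \<tau>) (\<sigma> \<circ> \<tau>) = act1 N (twist1 M N F f \<sigma>) \<tau>"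
  using arg_cong[OF twist_iso_act1[OF assms], of "Cod (cells N)"] assms
    Cod_twist_iso[of "act1 M f \<tau>" "\<sigma> \<circ> \<tau>"]
  by (simp add: N.cells.Cod_Cmp N.act2_cell twist_iso_cell psym_cell fun1_cell M.act1_cell permutes_compose)

text \<open>Let \<open>?h\<close> be \<gamma> of the untwisted cells. By \<open>gam1_act1\<close>,
  acting on \<open>?h\<close> with the block permutation gives back \<gamma> of \<open>f\<close> and
  the \<open>g x\<close>, so the left side is a pseudo symmetry isomorphism at \<open>?h\<close>.
  Factoring the block permutation splits it by \<open>psym_comp\<close> into a part known from
  \<open>psym_top\<close> and a part known from \<open>psym_bottom\<close>; functoriality of
  \<gamma> merges the two.\<close>

lemma twist_iso_gam1:
  assumes c: "composable1 M f (map g xs)" and \<sigma>: "\<sigma> permutes {..<arity M f}"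
    and t: "\<And>x. x \<in> set xs \<Longrightarrow> t x permutes {..<arity M (g x)}"
  shows "twist_iso M F (gam1 M f (map g xs)) (block_perm \<sigma> (map (\<lambda>x. arity M (g x)) xs) (map t xs)) =
    gam2 N (twist_iso M F f \<sigma>) (map (\<lambda>x. twist_iso M F (g x) (t x)) xs)"
proof -
  let ?ks = "map (\<lambda>x. arity M (g x)) xs" and ?ts = "map t xs"
  \<comment> \<open>The cells with \<sigma> and the \<open>t x\<close> undone. Undoing \<sigma> also
    reorders the inputs of \<open>f\<close>, hence \<open>?gs'\<close> in the next line.\<close>
  let ?f = "act1 M f (inv \<sigma>)" and ?gs = "map (\<lambda>x. act1 M (g x) (inv (t x))) xs"
  let ?gs' = "permute_list (inv \<sigma>) ?gs"
  let ?h = "gam1 M ?f ?gs'" and ?p = "block_perm \<sigma> ?ks ?ts"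
  let ?top = "top_perm \<sigma> (map (arity M) ?gs')" and ?bot = "bottom_perm (map (arity M) ?gs) ?ts"
  note c' = composable1D[OF c]
  note inv = permutes_inv[OF \<sigma>]
  have g: "g x \<in> cells1 M" "t x permutes {..<arity M (g x)}" "inv (t x) permutes {..<arity M (g x)}"
    if "x \<in> set xs" for x using that c'(2) t permutes_inv[OF t] by auto
  have l: "length xs = arity M f" using c'(4) by simp
  have \<sigma>x: "\<sigma> permutes {..<length xs}" "inv \<sigma> permutes {..<length xs}" using \<sigma> inv l by simp_all
  have f': "?f \<in> cells1 M" "arity M ?f = arity M f" "act1 M ?f \<sigma> = f"
    using c'(1) \<sigma> inv by (simp_all add: M.act1_cell)
  have \<sigma>f: "\<sigma> permutes {..<arity M ?f}" using \<sigma> f' by simp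
  have ks: "map (arity M) ?gs = ?ks" using g by (simp add: M.act1_cell)
  have "map (tgt M) ?gs = map (tgt M) (map g xs)" using g by (simp add: M.tgt_act1)
  also have "\<dots> = src M f" by (rule c'(3))
  finally have cg: "composable1 M f ?gs"
    unfolding composable1_def using c'(1) g by (auto simp: M.act1_cells1)
  have ch: "composable1 M ?f ?gs'"
  proof -
    have "inv (inv \<sigma>) = \<sigma>" using permutes_bij[OF \<sigma>] by (simp add: inv_inv_eq)
    then show ?thesis using M.composable1_act1[of f "inv \<sigma>" ?gs'] cg inv \<sigma>x by simp
  qed
  have ts: "list_all2 (\<lambda>g \<tau>. \<tau> permutes {..<arity M g}) ?gs ?ts"
    using g by (auto simp: list_all2_map1 list_all2_map2 list.rel_refl_strong M.act1_cell intro!: list.rel_refl_strong)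
  then have ts': "list_all2 (\<lambda>\<tau> k. \<tau> permutes {..<k}) ?ts (map (arity M) ?gs)"
    by (auto simp: list_all2_conv_all_nth)
  have m2: "map2 (act1 M) ?gs ?ts = map g xs"
    using g by (auto intro!: nth_equalityI)
  have \<sigma>k: "\<sigma> permutes {..<length ?ks}" using \<sigma>x by simp
  have pks: "map (arity M) ?gs' = permute_list (inv \<sigma>) (map (arity M) ?gs)"
    by (rule permute_list_map[symmetric]) (use \<sigma>x in simp)
  have ph: "arity M ?h = sum_list (map (arity M) ?gs)"
    unfolding M.arity_gam1[OF ch] pks by (rule sum_list_permute_list) (use \<sigma>x in simp)
  have pt: "?top permutes {..<arity M ?h}"
    using top_perm_permutes[of \<sigma> "map (arity M) ?gs'"] \<sigma>x unfolding M.arity_gam1[OF ch] by simp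
  have pb: "?bot permutes {..<arity M ?h}"
    unfolding ph by (rule bottom_perm_permutes[OF ts'])
  have p: "?p = ?top \<circ> ?bot"
    unfolding pks ks[symmetric] by (rule top_perm_bottom_perm[symmetric, OF _ ts']) (use \<sigma>x in simp)
  have hp: "act1 M ?h ?p = gam1 M f (map g xs)"
    using M.gam1_act1[OF ch \<sigma>f ts] unfolding m2 f'(3) ks by simp
  have pp: "?p permutes {..<arity M ?h}"
    unfolding p by (rule permutes_compose[OF pb pt])
  have ht: "act1 M ?h ?top = gam1 M f ?gs"
    using M.top_equivariance1[OF ch \<sigma>f] \<sigma>x unfolding f'(3) by simp
  have "twist_iso M F (gam1 M f (map g xs)) ?p = psym F (?top \<circ> ?bot) ?h"
    unfolding twist_iso_def hp[symmetric] using M.act1_inv(2)[OF M.gam1_cells1[OF ch] pp] p by simp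
  also have "\<dots> = Cmp (cells N) (act2 N (psym F ?top ?h) ?bot) (psym F ?bot (act1 M ?h ?top))"
    by (rule psym_comp[OF M.gam1_cells1[OF ch] pt pb])
  also have "psym F ?top ?h = gam2 N (psym F \<sigma> ?f) (map (\<lambda>g. Idn (cells N) (fun1 F g)) ?gs)"
    using psym_top[OF ch \<sigma>f] \<sigma>x by simp
  \<comment> \<open>Bottom equivariance passes the permutation on to the inputs, where it turns
    identities of images of untwisted cells into identities of \<open>twist1\<close> cells.\<close>
  also have "act2 N \<dots> ?bot =
      gam2 N (psym F \<sigma> ?f) (map2 (act2 N) (map (\<lambda>g. Idn (cells N) (fun1 F g)) ?gs) ?ts)"
  proof -
    have "composable2 N (psym F \<sigma> ?f) (map (\<lambda>g. Idn (cells N) (fun1 F g)) ?gs)"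
      using N.composable2_Idn[OF composable1_fun1[OF cg]] f' c'(1) \<sigma>f
      by (simp add: composable2_def psym_cell N.cells.Dom_Idn fun1_cell o_def)
    moreover have "list_all2 (\<lambda>\<beta> \<tau>. \<tau> permutes {..<length (src2 N \<beta>)})
        (map (\<lambda>g. Idn (cells N) (fun1 F g)) ?gs) ?ts"
      using g by (auto simp: list_all2_conv_all_nth N.cells.Dom_Idn fun1_cell M.act1_cell)
    moreover have "map (\<lambda>\<beta>. length (src2 N \<beta>)) (map (\<lambda>g. Idn (cells N) (fun1 F g)) ?gs) = map (arity M) ?gs"
      using g by (auto simp: N.cells.Dom_Idn fun1_cell M.act1_cell)
    ultimately show ?thesis by (simp only: N.bottom_equivariance2)
  qed
  also have "map2 (act2 N) (map (\<lambda>g. Idn (cells N) (fun1 F g)) ?gs) ?ts =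
      map (\<lambda>x. Idn (cells N) (twist1 M N F (g x) (t x))) xs"
    using g by (auto intro!: nth_equalityI simp: twist1_def N.act2_Idn fun1_cell M.act1_cell)
  also have "psym F ?bot (act1 M ?h ?top) = gam2 N (Idn (cells N) (fun1 F f)) (map2 (psym F) ?ts ?gs)"
    unfolding ht by (rule psym_bottom[OF cg ts])
  also have "map2 (psym F) ?ts ?gs = map (\<lambda>x. twist_iso M F (g x) (t x)) xs"
    by (auto intro!: nth_equalityI simp: twist_iso_def)
  \<comment> \<open>Interchange for \<gamma>. In every slot one of the two factors is an identity:
    outside the \<open>psym\<close> cell survives, inside the twist isomorphisms do.\<close>
  also have "Cmp (cells N) (gam2 N (psym F \<sigma> ?f) (map (\<lambda>x. Idn (cells N) (twist1 M N F (g x) (t x))) xs))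
      (gam2 N (Idn (cells N) (fun1 F f)) (map (\<lambda>x. twist_iso M F (g x) (t x)) xs)) =
      gam2 N (Cmp (cells N) (psym F \<sigma> ?f) (Idn (cells N) (fun1 F f)))
        (map2 (Cmp (cells N)) (map (\<lambda>x. Idn (cells N) (twist1 M N F (g x) (t x))) xs)
          (map (\<lambda>x. twist_iso M F (g x) (t x)) xs))"
  proof (rule N.gam2_Cmp[symmetric])
    show "composable2 N (Idn (cells N) (fun1 F f)) (map (\<lambda>x. twist_iso M F (g x) (t x)) xs)"
      using c'(1) g arg_cong[OF c'(3), of "map (fob F)"] unfolding composable2_def
      by (auto simp: N.cells.Idn_Ar N.cells.Dom_Idn fun1_cell twist_iso_cell o_def cong: map_cong)
    show "composable2 N (psym F \<sigma> ?f) (map (\<lambda>x. Idn (cells N) (twist1 M N F (g x) (t x))) xs)"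
      using f' c'(1) \<sigma>f g arg_cong[OF c'(3), of "map (fob F)"]
      by (intro N.composable2_Idn_map) (auto simp: psym_cell fun1_cell twist1_cell o_def cong: map_cong)
  qed (use f' \<sigma>f g c'(1) in \<open>auto simp: psym_cell N.cells.Dom_Idn N.cells.Cod_Idn fun1_cell
      twist1_cell twist_iso_cell\<close>)
  also have "Cmp (cells N) (psym F \<sigma> ?f) (Idn (cells N) (fun1 F f)) = psym F \<sigma> ?f"
    using N.cells.Cmp_Idn_right[OF psym_cells2[OF f'(1) \<sigma>f]] f' \<sigma>f by (simp add: psym_cell)
  also have "map2 (Cmp (cells N)) (map (\<lambda>x. Idn (cells N) (twist1 M N F (g x) (t x))) xs)
          (map (\<lambda>x. twist_iso M F (g x) (t x)) xs) = map (\<lambda>x. twist_iso M F (g x) (t x)) xs"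
  proof -
    have "Cmp (cells N) (Idn (cells N) (twist1 M N F (g x) (t x))) (twist_iso M F (g x) (t x)) =
        twist_iso M F (g x) (t x)" if "x \<in> set xs" for x
      using N.cells.Cmp_Idn_left[OF twist_iso_cells2[OF g(1,2)[OF that]]]
      by (simp add: twist_iso_cell[OF g(1,2)[OF that]])
    then show ?thesis by (auto intro!: nth_equalityI)
  qed
  finally show ?thesis by (simp only: twist_iso_def)
qed

lemma composable2_twist_iso:
  assumes c: "composable1 M f (map g xs)" and \<sigma>: "\<sigma> permutes {..<arity M f}"
    and t: "\<And>x. x \<in> set xs \<Longrightarrow> t x permutes {..<arity M (g x)}"
  shows "composable2 N (twist_iso M F f \<sigma>) (map (\<lambda>x. twist_iso M F (g x) (t x)) xs)"
proof -
  note c' = composable1D[OF c]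
  have "g x \<in> cells1 M" if "x \<in> set xs" for x using that c'(2) by auto
  then show ?thesis
    using c'(1) \<sigma> t arg_cong[OF c'(3), of "map (fob F)"] unfolding composable2_def
    by (auto simp: fun1_cell twist_iso_cell o_def cong: map_cong)
qed

lemma composable2_twist2:
  assumes c: "composable2 M \<alpha> (map \<beta> xs)" and \<sigma>: "\<sigma> permutes {..<length (src2 M \<alpha>)}"
    and \<sigma>': "\<sigma>' permutes {..<length (src2 M \<alpha>)}"
    and t: "\<And>x. x \<in> set xs \<Longrightarrow> t x permutes {..<length (src2 M (\<beta> x))}"
    and t': "\<And>x. x \<in> set xs \<Longrightarrow> t' x permutes {..<length (src2 M (\<beta> x))}"
  shows "composable2 N (twist2 M N F \<alpha> \<sigma> \<sigma>') (map (\<lambda>x. twist2 M N F (\<beta> x) (t x) (t' x)) xs)"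
proof -
  note c' = composable2D[OF c]
  have "\<beta> x \<in> cells2 M" if "x \<in> set xs" for x using that c'(2) by auto
  then show ?thesis
    using c'(1) \<sigma> \<sigma>' t t' arg_cong[OF c'(3), of "map (fob F)"] unfolding composable2_def
    by (auto simp: twist2_cell twist1_cell M.cells.Dom_Ob o_def cong: map_cong)
qed

text \<open>The equation of 1-cells compares the codomains of the 2-cells in
  \<open>twist_iso_gam1\<close>.\<close>

lemma twist1_gam1:
  assumes c: "composable1 M f (map g xs)" and \<sigma>: "\<sigma> permutes {..<arity M f}"
    and t: "\<And>x. x \<in> set xs \<Longrightarrow> t x permutes {..<arity M (g x)}"
  shows "block_perm \<sigma> (map (\<lambda>x. arity M (g x)) xs) (map t xs) permutes {..<arity M (gam1 M f (map g xs))}"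
    and "twist1 M N F (gam1 M f (map g xs)) (block_perm \<sigma> (map (\<lambda>x. arity M (g x)) xs) (map t xs)) =
      gam1 N (twist1 M N F f \<sigma>) (map (\<lambda>x. twist1 M N F (g x) (t x)) xs)" (is "?l = ?r")
proof -
  let ?p = "block_perm \<sigma> (map (\<lambda>x. arity M (g x)) xs) (map t xs)"
  note c' = composable1D[OF c]
  have g: "g x \<in> cells1 M" if "x \<in> set xs" for x using that c'(2) by auto
  have "arity M (gam1 M f (map g xs)) = sum_list (map (\<lambda>x. arity M (g x)) xs)"
    using M.arity_gam1[OF c] by (simp add: o_def)
  moreover have "?p permutes {..<sum_list (map (\<lambda>x. arity M (g x)) xs)}"
    by (rule block_perm_permutes) (use \<sigma> t c'(4) in \<open>auto simp: list_all2_conv_all_nth\<close>)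
  ultimately show p: "?p permutes {..<arity M (gam1 M f (map g xs))}" by simp
  have ce: "composable2 N (twist_iso M F f \<sigma>) (map (\<lambda>x. twist_iso M F (g x) (t x)) xs)"
    by (rule composable2_twist_iso[OF assms])
  have "?l = Cod (cells N) (twist_iso M F (gam1 M f (map g xs)) ?p)"
    by (rule Cod_twist_iso[OF M.gam1_cells1[OF c] p, symmetric])
  also have "\<dots> = Cod (cells N) (gam2 N (twist_iso M F f \<sigma>) (map (\<lambda>x. twist_iso M F (g x) (t x)) xs))"
    using twist_iso_gam1[OF c \<sigma> t] by simp
  also have "\<dots> = ?r"
    unfolding N.Cod_gam2[OF ce]
    using c'(1) \<sigma> g t by (simp add: twist_iso_cell o_def cong: map_cong)
  finally show "?l = ?r" .
qed

text \<open>By \<open>twist2_unique\<close> it suffices that the right side closes the square. The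
  squares of \<open>\<alpha>\<close> and of the \<open>\<beta> x\<close> are composed by \<gamma>,
  and \<open>twist_iso_gam1\<close> recognises the sides of the resulting square.\<close>

lemma twist2_gam2:
  assumes c: "composable2 M \<alpha> (map \<beta> xs)" and \<sigma>: "\<sigma> permutes {..<length (src2 M \<alpha>)}"
    and \<sigma>': "\<sigma>' permutes {..<length (src2 M \<alpha>)}"
    and t: "\<And>x. x \<in> set xs \<Longrightarrow> t x permutes {..<length (src2 M (\<beta> x))}"
    and t': "\<And>x. x \<in> set xs \<Longrightarrow> t' x permutes {..<length (src2 M (\<beta> x))}"
  shows "twist2 M N F (gam2 M \<alpha> (map \<beta> xs))
      (block_perm \<sigma> (map (\<lambda>x. length (src2 M (\<beta> x))) xs) (map t xs))
      (block_perm \<sigma>' (map (\<lambda>x. length (src2 M (\<beta> x))) xs) (map t' xs)) =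
    gam2 N (twist2 M N F \<alpha> \<sigma> \<sigma>') (map (\<lambda>x. twist2 M N F (\<beta> x) (t x) (t' x)) xs)"
    (is "twist2 M N F ?a ?p ?p' = ?y")
proof (rule twist2_unique[symmetric])
  note c' = composable2D[OF c]
  have b: "\<beta> x \<in> cells2 M" if "x \<in> set xs" for x using that c'(2) by auto
  let ?D = "\<lambda>x. Dom (cells M) (\<beta> x)" and ?C = "\<lambda>x. Cod (cells M) (\<beta> x)"
  have cD: "composable1 M (Dom (cells M) \<alpha>) (map ?D xs)" and cC: "composable1 M (Cod (cells M) \<alpha>) (map ?C xs)"
    using M.composable2_Dom[OF c] M.composable2_Cod[OF c] by (simp_all add: o_def)
  have \<sigma>C: "\<sigma>' permutes {..<arity M (Cod (cells M) \<alpha>)}"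
    and tC: "\<And>x. x \<in> set xs \<Longrightarrow> t' x permutes {..<arity M (?C x)}"
    using \<sigma>' c'(1) t' b by (simp_all add: M.src_Cod)
  have kC: "map (\<lambda>x. arity M (?C x)) xs = map (\<lambda>x. length (src2 M (\<beta> x))) xs"
    using b by (simp add: M.src_Cod)
  have DC: "Dom (cells M) ?a = gam1 M (Dom (cells M) \<alpha>) (map ?D xs)"
    "Cod (cells M) ?a = gam1 M (Cod (cells M) \<alpha>) (map ?C xs)"
    using M.Dom_gam2[OF c] M.Cod_gam2[OF c] by (simp_all add: o_def)
  have cy: "composable2 N (twist2 M N F \<alpha> \<sigma> \<sigma>') (map (\<lambda>x. twist2 M N F (\<beta> x) (t x) (t' x)) xs)"
    by (rule composable2_twist2[OF assms])
  have cF: "composable2 N (fun2 F \<alpha>) (map (\<lambda>x. fun2 F (\<beta> x)) xs)"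
    using composable2_fun2[OF c] by (simp add: o_def)
  show "?a \<in> cells2 M" by (rule M.gam2_cells2[OF c])
  show "?p permutes {..<length (src2 M ?a)}"
    unfolding DC by (rule twist1_gam1(1)[OF cD \<sigma> t])
  show "?p' permutes {..<length (src2 M ?a)}"
    unfolding DC by (rule twist1_gam1(1)[OF cD \<sigma>' t'])
  show "?y \<in> cells2 N" by (rule N.gam2_cells2[OF cy])
  show "Dom (cells N) ?y = twist1 M N F (Dom (cells M) ?a) ?p"
    unfolding DC N.Dom_gam2[OF cy]
    using twist1_gam1(2)[OF cD \<sigma> t] c'(1) \<sigma> \<sigma>' t t' b by (simp add: twist2_cell o_def cong: map_cong)
  have "Cmp (cells N) ?y (twist_iso M F (Dom (cells M) ?a) ?p) =
      Cmp (cells N) ?y (gam2 N (twist_iso M F (Dom (cells M) \<alpha>) \<sigma>) (map (\<lambda>x. twist_iso M F (?D x) (t x)) xs))"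
    using twist_iso_gam1[OF cD \<sigma> t] unfolding DC by simp
  also have "\<dots> = gam2 N (Cmp (cells N) (twist2 M N F \<alpha> \<sigma> \<sigma>') (twist_iso M F (Dom (cells M) \<alpha>) \<sigma>))
      (map2 (Cmp (cells N)) (map (\<lambda>x. twist2 M N F (\<beta> x) (t x) (t' x)) xs)
        (map (\<lambda>x. twist_iso M F (?D x) (t x)) xs))"
    by (rule N.gam2_Cmp[OF composable2_twist_iso[OF cD \<sigma> t] cy, symmetric])
      (use c'(1) \<sigma> \<sigma>' t t' b in \<open>simp_all add: twist2_cell twist_iso_cell M.cells.Dom_Ob\<close>)
  \<comment> \<open>The squares of the inputs are exchanged first, then that of
    \<open>\<alpha>\<close>; afterwards \<gamma> of the composites is split again.\<close>
  also have "map2 (Cmp (cells N)) (map (\<lambda>x. twist2 M N F (\<beta> x) (t x) (t' x)) xs)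
        (map (\<lambda>x. twist_iso M F (?D x) (t x)) xs) =
      map2 (Cmp (cells N)) (map (\<lambda>x. twist_iso M F (?C x) (t' x)) xs) (map (\<lambda>x. fun2 F (\<beta> x)) xs)"
    using b t t' by (auto intro!: nth_equalityI twist2_twist_iso)
  also have "Cmp (cells N) (twist2 M N F \<alpha> \<sigma> \<sigma>') (twist_iso M F (Dom (cells M) \<alpha>) \<sigma>) =
      Cmp (cells N) (twist_iso M F (Cod (cells M) \<alpha>) \<sigma>') (fun2 F \<alpha>)"
    by (rule twist2_twist_iso[OF c'(1) \<sigma> \<sigma>'])
  also have "gam2 N (Cmp (cells N) (twist_iso M F (Cod (cells M) \<alpha>) \<sigma>') (fun2 F \<alpha>))
      (map2 (Cmp (cells N)) (map (\<lambda>x. twist_iso M F (?C x) (t' x)) xs) (map (\<lambda>x. fun2 F (\<beta> x)) xs)) =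
      Cmp (cells N) (gam2 N (twist_iso M F (Cod (cells M) \<alpha>) \<sigma>') (map (\<lambda>x. twist_iso M F (?C x) (t' x)) xs))
        (gam2 N (fun2 F \<alpha>) (map (\<lambda>x. fun2 F (\<beta> x)) xs))"
    by (rule N.gam2_Cmp[OF cF composable2_twist_iso[OF cC \<sigma>C tC]])
      (use c'(1) \<sigma>C tC b in \<open>simp_all add: fun2_cell twist_iso_cell M.cells.Cod_Ob\<close>)
  also have "\<dots> = Cmp (cells N) (twist_iso M F (Cod (cells M) ?a) ?p') (fun2 F ?a)"
    using twist_iso_gam1[OF cC \<sigma>C tC] fun2_gam2[OF c] unfolding DC kC by (simp add: o_def)
  finally show "Cmp (cells N) ?y (twist_iso M F (Dom (cells M) ?a) ?p) =
      Cmp (cells N) (twist_iso M F (Cod (cells M) ?a) ?p') (fun2 F ?a)" .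
qed

text \<open>The twist isomorphism for \<sigma> \<circ> \<tau> splits into the twist isomorphism for
  \<sigma> acted on by \<tau>, and \<open>psym F \<tau>\<close>. Accordingly the square is pasted
  from the square of \<open>twist2\<close> acted on by \<tau> and the naturality square of
  \<open>psym F \<tau>\<close>.\<close>

lemma twist2_act2:
  assumes \<alpha>: "\<alpha> \<in> cells2 M" and \<sigma>: "\<sigma> permutes {..<length (src2 M \<alpha>)}"
    and \<sigma>': "\<sigma>' permutes {..<length (src2 M \<alpha>)}" and \<tau>: "\<tau> permutes {..<length (src2 M \<alpha>)}"
  shows "twist2 M N F (act2 M \<alpha> \<tau>) (\<sigma> \<circ> \<tau>) (\<sigma>' \<circ> \<tau>) = act2 N (twist2 M N F \<alpha> \<sigma> \<sigma>') \<tau>"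
    (is "_ = ?y")
proof (rule twist2_unique[symmetric])
  let ?f = "Dom (cells M) \<alpha>" and ?g = "Cod (cells M) \<alpha>"
  have f: "?f \<in> cells1 M" "?g \<in> cells1 M" using \<alpha> by (simp_all add: M.cells.Dom_Ob M.cells.Cod_Ob)
  have \<tau>g: "\<tau> permutes {..<arity M ?g}" "\<sigma>' permutes {..<arity M ?g}" using \<tau> \<sigma>' \<alpha> by (simp_all add: M.src_Cod)
  note a = M.act2_cell[OF \<alpha> \<tau>]
  note simps = \<alpha> \<sigma> \<sigma>' \<tau> f \<tau>g twist2_cell twist1_cell twist_iso_cell psym_cell fun1_cell fun2_cell
    N.act2_cell M.act1_cell N.cells.Dom_Cmp N.cells.Cod_Cmp
  show "act2 M \<alpha> \<tau> \<in> cells2 M" by (rule a)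
  show "\<sigma> \<circ> \<tau> permutes {..<length (src2 M (act2 M \<alpha> \<tau>))}" "\<sigma>' \<circ> \<tau> permutes {..<length (src2 M (act2 M \<alpha> \<tau>))}"
    using \<sigma> \<sigma>' \<tau> f by (simp_all add: a M.act1_cell permutes_compose)
  show "?y \<in> cells2 N" by (simp add: simps)
  show "Dom (cells N) ?y = twist1 M N F (Dom (cells M) (act2 M \<alpha> \<tau>)) (\<sigma> \<circ> \<tau>)"
    by (simp add: simps a twist1_act1)
  have "Cmp (cells N) ?y (twist_iso M F (Dom (cells M) (act2 M \<alpha> \<tau>)) (\<sigma> \<circ> \<tau>)) =
      Cmp (cells N) ?y (Cmp (cells N) (act2 N (twist_iso M F ?f \<sigma>) \<tau>) (psym F \<tau> ?f))"
    unfolding a(2) twist_iso_act1[OF f(1) \<sigma> \<tau>] ..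
  also have "\<dots> = Cmp (cells N) (Cmp (cells N) ?y (act2 N (twist_iso M F ?f \<sigma>) \<tau>)) (psym F \<tau> ?f)"
    by (rule N.cells.Cmp_assoc) (simp_all add: simps)
  also have "Cmp (cells N) ?y (act2 N (twist_iso M F ?f \<sigma>) \<tau>) =
      act2 N (Cmp (cells N) (twist2 M N F \<alpha> \<sigma> \<sigma>') (twist_iso M F ?f \<sigma>)) \<tau>"
    by (rule N.act2_Cmp[symmetric]) (simp_all add: simps)
  also have "\<dots> = act2 N (Cmp (cells N) (twist_iso M F ?g \<sigma>') (fun2 F \<alpha>)) \<tau>"
    unfolding twist2_twist_iso[OF \<alpha> \<sigma> \<sigma>'] ..
  also have "\<dots> = Cmp (cells N) (act2 N (twist_iso M F ?g \<sigma>') \<tau>) (act2 N (fun2 F \<alpha>) \<tau>)"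
    by (rule N.act2_Cmp) (simp_all add: simps)
  also have "Cmp (cells N) \<dots> (psym F \<tau> ?f) =
      Cmp (cells N) (act2 N (twist_iso M F ?g \<sigma>') \<tau>) (Cmp (cells N) (act2 N (fun2 F \<alpha>) \<tau>) (psym F \<tau> ?f))"
    by (rule N.cells.Cmp_assoc[symmetric]) (simp_all add: simps)
  also have "\<dots> = Cmp (cells N) (act2 N (twist_iso M F ?g \<sigma>') \<tau>)
      (Cmp (cells N) (psym F \<tau> ?g) (fun2 F (act2 M \<alpha> \<tau>)))"
    unfolding psym_naturality[OF \<alpha> \<tau>] ..
  also have "\<dots> = Cmp (cells N) (Cmp (cells N) (act2 N (twist_iso M F ?g \<sigma>') \<tau>) (psym F \<tau> ?g))
      (fun2 F (act2 M \<alpha> \<tau>))"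
    by (rule N.cells.Cmp_assoc) (simp_all add: simps a)
  also have "Cmp (cells N) (act2 N (twist_iso M F ?g \<sigma>') \<tau>) (psym F \<tau> ?g) =
      twist_iso M F (Cod (cells M) (act2 M \<alpha> \<tau>)) (\<sigma>' \<circ> \<tau>)"
    unfolding a(3) by (rule twist_iso_act1[OF f(2) \<tau>g(2,1), symmetric])
  finally show "Cmp (cells N) ?y (twist_iso M F (Dom (cells M) (act2 M \<alpha> \<tau>)) (\<sigma> \<circ> \<tau>)) =
      Cmp (cells N) (twist_iso M F (Cod (cells M) (act2 M \<alpha> \<tau>)) (\<sigma>' \<circ> \<tau>)) (fun2 F (act2 M \<alpha> \<tau>))" .
qed

lemma twist2_Idn:
  assumes f: "f \<in> cells1 M" and \<sigma>: "\<sigma> permutes {..<arity M f}"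
  shows "twist2 M N F (Idn (cells M) f) \<sigma> \<sigma> = Idn (cells N) (twist1 M N F f \<sigma>)"
  by (rule twist2_unique[symmetric])
    (use f \<sigma> N.cells.Cmp_Idn_left[OF twist_iso_cells2[OF f \<sigma>]]
      N.cells.Cmp_Idn_right[OF twist_iso_cells2[OF f \<sigma>]] in
      \<open>simp_all add: M.cells.Idn_Ar M.cells.Dom_Idn M.cells.Cod_Idn N.cells.Idn_Ar N.cells.Dom_Idn
        twist1_cell twist_iso_cell fun1_cell\<close>)

text \<open>The squares of the two 2-cells share the twist isomorphism for \<tau> at the middle
  1-cell and are pasted along it.\<close>

lemma twist2_Cmp:
  assumes \<alpha>: "\<alpha> \<in> cells2 M" and \<beta>: "\<beta> \<in> cells2 M" "Dom (cells M) \<beta> = Cod (cells M) \<alpha>"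
    and \<sigma>: "\<sigma> permutes {..<length (src2 M \<alpha>)}" "\<tau> permutes {..<length (src2 M \<alpha>)}"
      "\<upsilon> permutes {..<length (src2 M \<alpha>)}"
  shows "twist2 M N F (Cmp (cells M) \<beta> \<alpha>) \<sigma> \<upsilon> = Cmp (cells N) (twist2 M N F \<beta> \<tau> \<upsilon>) (twist2 M N F \<alpha> \<sigma> \<tau>)"
proof (rule twist2_unique[symmetric])
  note d = M.cells.Cmp_Ar[OF \<alpha> \<beta>] M.cells.Dom_Cmp[OF \<alpha> \<beta>] M.cells.Cod_Cmp[OF \<alpha> \<beta>]
  have \<sigma>': "\<tau> permutes {..<length (src2 M \<beta>)}" "\<upsilon> permutes {..<length (src2 M \<beta>)}"
    using \<sigma> \<alpha> \<beta> by (simp_all add: M.src_Cod)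
  note a = twist2_cell[OF \<alpha> \<sigma>(1,2)] and b = twist2_cell[OF \<beta>(1) \<sigma>']
  have f: "Dom (cells M) \<alpha> \<in> cells1 M" "Cod (cells M) \<alpha> \<in> cells1 M" "Cod (cells M) \<beta> \<in> cells1 M"
    "\<upsilon> permutes {..<arity M (Cod (cells M) \<beta>)}" "\<tau> permutes {..<arity M (Cod (cells M) \<alpha>)}"
    using \<alpha> \<beta> \<sigma> by (simp_all add: M.cells.Dom_Ob M.cells.Cod_Ob M.src_Cod)
  note e = twist_iso_cell[OF f(1) \<sigma>(1)] twist_iso_cell[OF f(2,5)] twist_iso_cell[OF f(3,4)]
  note simps = a b d e \<beta>(2) fun2_cell(1-3)[OF \<alpha>] fun2_cell(1-3)[OF \<beta>(1)]
    N.cells.Cmp_Ar N.cells.Dom_Cmp N.cells.Cod_Cmp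
  let ?y = "Cmp (cells N) (twist2 M N F \<beta> \<tau> \<upsilon>) (twist2 M N F \<alpha> \<sigma> \<tau>)"
  have "Cmp (cells N) ?y (twist_iso M F (Dom (cells M) \<alpha>) \<sigma>) =
      Cmp (cells N) (twist2 M N F \<beta> \<tau> \<upsilon>) (Cmp (cells N) (twist2 M N F \<alpha> \<sigma> \<tau>) (twist_iso M F (Dom (cells M) \<alpha>) \<sigma>))"
    by (rule N.cells.Cmp_assoc[symmetric]) (simp_all add: simps)
  also have "\<dots> = Cmp (cells N) (Cmp (cells N) (twist2 M N F \<beta> \<tau> \<upsilon>) (twist_iso M F (Cod (cells M) \<alpha>) \<tau>)) (fun2 F \<alpha>)"
    unfolding a(4) by (rule N.cells.Cmp_assoc) (simp_all add: simps)
  also have "\<dots> = Cmp (cells N) (twist_iso M F (Cod (cells M) \<beta>) \<upsilon>) (Cmp (cells N) (fun2 F \<beta>) (fun2 F \<alpha>))"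
    unfolding b(4)[unfolded \<beta>(2)] by (rule N.cells.Cmp_assoc[symmetric]) (simp_all add: simps)
  finally show "Cmp (cells N) ?y (twist_iso M F (Dom (cells M) (Cmp (cells M) \<beta> \<alpha>)) \<sigma>) =
      Cmp (cells N) (twist_iso M F (Cod (cells M) (Cmp (cells M) \<beta> \<alpha>)) \<upsilon>) (fun2 F (Cmp (cells M) \<beta> \<alpha>))"
    using fun2_Cmp[OF \<alpha> \<beta>] by (simp add: d)
qed (use assms twist2_cell M.cells.Cmp_Ar M.cells.Dom_Cmp N.cells.Cmp_Ar N.cells.Dom_Cmp in
    \<open>simp_all add: M.src_Cod\<close>)

end

definition from_ps :: "('o, 'f, 'a) mcat \<Rightarrow> ('p, 'g, 'b) mcat \<Rightarrow> ('o, 'f, 'a, 'p, 'g, 'b) psmfun \<Rightarrow>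
    ('o \<times> unit, 'f \<times> deg_perm, 'a \<times> deg_perm \<times> deg_perm, 'p, 'g, 'b) mfun" where
  "from_ps M N F =
     \<lparr>fob = (\<lambda>x\<in>objs (timesE M). fob F (fst x)),
      fun1 = (\<lambda>x\<in>cells1 (timesE M). twist1 M N F (fst x) (snd (snd x))),
      fun2 = (\<lambda>x\<in>cells2 (timesE M). twist2 M N F (fst x) (snd (fst (snd x))) (snd (snd (snd x))))\<rparr>"

lemma from_ps_simps:
  "x \<in> objs (timesE M) \<Longrightarrow> fob (from_ps M N F) x = fob F (fst x)"
  "f \<in> cells1 (timesE M) \<Longrightarrow> fun1 (from_ps M N F) f = twist1 M N F (fst f) (snd (snd f))"
  "\<alpha> \<in> cells2 (timesE M) \<Longrightarrow>
    fun2 (from_ps M N F) \<alpha> = twist2 M N F (fst \<alpha>) (snd (fst (snd \<alpha>))) (snd (snd (snd \<alpha>)))"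
  "fob (from_ps M N F) \<in> extensional (objs (timesE M))"
  "fun1 (from_ps M N F) \<in> extensional (cells1 (timesE M))"
  "fun2 (from_ps M N F) \<in> extensional (cells2 (timesE M))"
  by (simp_all add: from_ps_def del: mprod_simps barratt_eccles_simps)

context pseudo_symmetric_multifunctor
begin

lemma symmetric_from_ps: "symmetric_multifunctor (timesE M) N (from_ps M N F)"
proof -
  interpret T: cat_multicategory "timesE M" by (rule cat_multicategory_timesE[OF M.cat_multicategory_axioms])
  let ?F = "from_ps M N F"
  note X1 = M.cells1_timesE and X2 = M.cells2_timesE
  note ps = from_ps_simps[where M = M and N = N and F = F]
  have "multifunctor (timesE M) N ?F"
  proof (rule multifunctorI)
    fix x assume x: "x \<in> cells1 (timesE M)"
    have "src (timesE M) x = map (\<lambda>a. (a, ())) (src M (fst x))"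
      using x by (simp add: zip_units)
    moreover have "map (fob F) (src M (fst x)) = map (fob ?F) (map (\<lambda>a. (a, ())) (src M (fst x)))"
      using M.src_in_objs[OF X1(1)[OF x]] by (simp add: ps(1))
    ultimately show "fun1 ?F x \<in> cells1 N \<and> src N (fun1 ?F x) = map (fob ?F) (src (timesE M) x) \<and>
        tgt N (fun1 ?F x) = fob ?F (tgt (timesE M) x)"
      unfolding ps(2)[OF x] ps(1)[OF T.tgt_objs[OF x]]
      by (simp add: twist1_cell[OF X1(1,2)[OF x]] del: map_map)
    show "fun2 ?F (Idn (cells (timesE M)) x) = Idn (cells N) (fun1 ?F x)"
      unfolding ps(2)[OF x] ps(3)[OF T.cells.Idn_Ar[OF x]]
      by (simp add: twist2_Idn[OF X1(1,2)[OF x]])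
  next
    fix \<alpha> assume \<alpha>: "\<alpha> \<in> cells2 (timesE M)"
    show "fun2 ?F \<alpha> \<in> cells2 N \<and> Dom (cells N) (fun2 ?F \<alpha>) = fun1 ?F (Dom (cells (timesE M)) \<alpha>) \<and>
        Cod (cells N) (fun2 ?F \<alpha>) = fun1 ?F (Cod (cells (timesE M)) \<alpha>)"
      unfolding ps(3)[OF \<alpha>] ps(2)[OF T.cells.Dom_Ob[OF \<alpha>]] ps(2)[OF T.cells.Cod_Ob[OF \<alpha>]]
      by (simp add: twist2_cell[OF X2(1-3)[OF \<alpha>]])
    fix \<beta> assume \<beta>: "\<beta> \<in> cells2 (timesE M)" "Dom (cells (timesE M)) \<beta> = Cod (cells (timesE M)) \<alpha>"
    \<comment> \<open>Composability in the product also matches the permutations in the middle, as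
      \<open>twist2_Cmp\<close> requires.\<close>
    have d: "Dom (cells M) (fst \<beta>) = Cod (cells M) (fst \<alpha>)" "fst (snd \<beta>) = snd (snd \<alpha>)"
      using arg_cong[OF \<beta>(2), of fst] arg_cong[OF \<beta>(2), of snd] by simp_all
    then have "snd (snd (snd \<beta>)) permutes {..<length (src2 M (fst \<alpha>))}"
      using X2(3)[OF \<beta>(1)] X2(1)[OF \<alpha>] by (simp add: M.src_Cod)
    then show "fun2 ?F (Cmp (cells (timesE M)) \<beta> \<alpha>) = Cmp (cells N) (fun2 ?F \<beta>) (fun2 ?F \<alpha>)"
      unfolding ps(3)[OF \<alpha>] ps(3)[OF \<beta>(1)] ps(3)[OF T.cells.Cmp_Ar[OF \<alpha> \<beta>]]
      using twist2_Cmp[OF X2(1)[OF \<alpha>] X2(1)[OF \<beta>(1)] d(1) X2(2,3)[OF \<alpha>]] d(2) by simp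
  next
    fix a assume a: "a \<in> objs (timesE M)"
    then have "fst a \<in> objs M" by auto
    then show "fun1 ?F (munit (timesE M) a) = munit N (fob ?F a)" "fob ?F a \<in> objs N"
      unfolding ps(1)[OF a] ps(2)[OF T.munit_cell(1)[OF a]]
      by (simp_all add: fob_objs twist1_id M.munit_cell fun1_munit)
  next
    fix x ys assume c: "composable1 (timesE M) x ys"
    note c' = composable1D[OF c]
    have y: "fst y \<in> cells1 M \<and> snd (snd y) permutes {..<arity M (fst y)} \<and> fst (snd y) = arity M (fst y)"
      if "y \<in> set ys" for y using X1(1,2)[of y] c'(2) that by auto
    \<comment> \<open>\<gamma> in E\<Sigma> counts with the stored degrees, the twisted cells with
      arities in \<open>M\<close>; on cells of the product they coincide.\<close>
    have k: "map (\<lambda>y. fst (snd y)) ys = map (\<lambda>y. arity M (fst y)) ys" using y by simp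
    have m: "map (fun1 ?F) ys = map (\<lambda>y. twist1 M N F (fst y) (snd (snd y))) ys"
      by (rule map_cong[OF refl ps(2)]) (use c'(2) in blast)
    have "twist1 M N F (gam1 M (fst x) (map fst ys))
        (block_perm (snd (snd x)) (map (\<lambda>y. arity M (fst y)) ys) (map (\<lambda>y. snd (snd y)) ys)) =
      gam1 N (twist1 M N F (fst x) (snd (snd x))) (map (\<lambda>y. twist1 M N F (fst y) (snd (snd y))) ys)"
      by (rule twist1_gam1(2)[OF mprod_composable1(1)[OF c] X1(2)[OF c'(1)]]) (use y in blast)
    then show "fun1 ?F (gam1 (timesE M) x ys) = gam1 N (fun1 ?F x) (map (fun1 ?F) ys)"
      unfolding ps(2)[OF c'(1)] ps(2)[OF T.gam1_cells1[OF c]] m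
      by (simp add: k o_def)
  next
    fix x ys assume c: "composable2 (timesE M) x ys"
    note c' = composable2D[OF c]
    have y: "fst y \<in> cells2 M \<and> snd (fst (snd y)) permutes {..<length (src2 M (fst y))} \<and>
        snd (snd (snd y)) permutes {..<length (src2 M (fst y))} \<and>
        fst (fst (snd y)) = length (src2 M (fst y)) \<and> fst (snd (snd y)) = length (src2 M (fst y))"
      if "y \<in> set ys" for y
    proof -
      have "y \<in> cells2 (timesE M)" using c'(2) that by blast
      then show ?thesis by auto
    qed
    have k: "map (\<lambda>y. fst (fst (snd y))) ys = map (\<lambda>y. length (src2 M (fst y))) ys"
      "map (\<lambda>y. fst (snd (snd y))) ys = map (\<lambda>y. length (src2 M (fst y))) ys" using y by simp_all
    have m: "map (fun2 ?F) ys =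
        map (\<lambda>y. twist2 M N F (fst y) (snd (fst (snd y))) (snd (snd (snd y)))) ys"
      by (rule map_cong[OF refl ps(3)]) (use c'(2) in blast)
    have "twist2 M N F (gam2 M (fst x) (map fst ys))
        (block_perm (snd (fst (snd x))) (map (\<lambda>y. length (src2 M (fst y))) ys) (map (\<lambda>y. snd (fst (snd y))) ys))
        (block_perm (snd (snd (snd x))) (map (\<lambda>y. length (src2 M (fst y))) ys) (map (\<lambda>y. snd (snd (snd y))) ys)) =
      gam2 N (twist2 M N F (fst x) (snd (fst (snd x))) (snd (snd (snd x))))
        (map (\<lambda>y. twist2 M N F (fst y) (snd (fst (snd y))) (snd (snd (snd y)))) ys)"
      by (rule twist2_gam2[OF mprod_composable2(1)[OF c] X2(2,3)[OF c'(1)]]) (use y in blast)+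
    then show "fun2 ?F (gam2 (timesE M) x ys) = gam2 N (fun2 ?F x) (map (fun2 ?F) ys)"
      unfolding ps(3)[OF c'(1)] ps(3)[OF T.gam2_cells2[OF c]] m
      by (simp add: k o_def)
  qed (fact T.cat_multicategory_axioms N.cat_multicategory_axioms from_ps_simps)+
  then show ?thesis
  proof (intro symmetric_multifunctor.intro symmetric_multifunctor_axioms.intro)
    fix x \<tau> assume x: "x \<in> cells1 (timesE M)" and \<tau>: "\<tau> permutes {..<arity (timesE M) x}"
    then have "\<tau> permutes {..<arity M (fst x)}" by simp
    then show "fun1 ?F (act1 (timesE M) x \<tau>) = act1 N (fun1 ?F x) \<tau>"
      unfolding ps(2)[OF x] ps(2)[OF T.act1_cells1[OF x \<tau>]]
      by (simp add: twist1_act1[OF X1(1,2)[OF x]])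
  next
    fix x \<tau> assume x: "x \<in> cells2 (timesE M)" and \<tau>: "\<tau> permutes {..<length (src2 (timesE M) x)}"
    then have "\<tau> permutes {..<length (src2 M (fst x))}" by simp
    then show "fun2 ?F (act2 (timesE M) x \<tau>) = act2 N (fun2 ?F x) \<tau>"
      unfolding ps(3)[OF x] ps(3)[OF T.act2_cells2[OF x \<tau>]]
      by (simp add: twist2_act2[OF X2(1-3)[OF x]])
  qed
qed

text \<open>At the identity permutation the twist isomorphisms are identities, so \<open>F\<close>
  itself is recovered. Over \<open>id \<rightarrow> \<sigma>\<close> only the twist isomorphism at
  \<open>act1 M f \<sigma>\<close> remains, and that is \<open>psym F \<sigma> f\<close>.\<close>

lemma to_ps_from_ps: "to_ps M (from_ps M N F) = F"
proof (rule psmfun.equality)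
  note [simp del] = mprod_simps
  show "fob (to_ps M (from_ps M N F)) = fob F"
    by (rule extensionalityI[OF to_ps_ext(1) fob_ext]) (simp add: from_ps_simps(1) mprod_simps(1))
  show "fun1 (to_ps M (from_ps M N F)) = fun1 F"
    by (rule extensionalityI[OF to_ps_ext(2) fun1_ext])
      (simp add: from_ps_simps(2) permutes_id, simp add: tcell1_def twist1_id)
  have "twist2 M N F \<alpha> id id = fun2 F \<alpha>" if "\<alpha> \<in> cells2 M" for \<alpha>
    using N.cells.Cmp_Idn_left[OF fun2_cells2[OF that]] N.cells.Cmp_Idn_right[OF fun2_cells2[OF that]]
      that fun2_cell(1-3)[OF that]
    by (simp add: twist2_def twist_iso_id twist_inv_id M.cells.Dom_Ob M.cells.Cod_Ob)
  then show "fun2 (to_ps M (from_ps M N F)) = fun2 F"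
    by (intro extensionalityI[OF to_ps_ext(3) fun2_ext])
      (simp add: from_ps_simps(3) permutes_id, simp add: tcell2_def)
  show "psym (to_ps M (from_ps M N F)) = psym F"
  proof (intro ext)
    fix \<sigma> f
    show "psym (to_ps M (from_ps M N F)) \<sigma> f = psym F \<sigma> f"
    proof (cases "f \<in> cells1 M \<and> \<sigma> permutes {..<arity M f}")
      case True
      then have f: "f \<in> cells1 M" and \<sigma>: "\<sigma> permutes {..<arity M f}" by auto
      let ?f = "act1 M f \<sigma>"
      have f': "?f \<in> cells1 M" "\<sigma> permutes {..<arity M ?f}" using f \<sigma> by (simp_all add: M.act1_cell)
      have c: "tcell2 M (Idn (cells M) ?f) id \<sigma> \<in> cells2 (timesE M)"
        using f' by (simp add: M.cells.Idn_Ar M.cells.Dom_Idn permutes_id)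
      have "psym (to_ps M (from_ps M N F)) \<sigma> f = twist2 M N F (Idn (cells M) ?f) id \<sigma>"
        unfolding to_ps_simps(4)[OF f \<sigma>] from_ps_simps(3)[OF c] by (simp add: tcell2_def)
      also have "\<dots> = Cmp (cells N) (twist_iso M F ?f \<sigma>)
          (Cmp (cells N) (Idn (cells N) (fun1 F ?f)) (Idn (cells N) (fun1 F ?f)))"
        using f' by (simp add: twist2_def M.cells.Dom_Idn M.cells.Cod_Idn twist_inv_id fun1_cell)
      also have "\<dots> = twist_iso M F ?f \<sigma>"
        using N.cells.Cmp_Idn_left[of "Idn (cells N) (fun1 F ?f)"]
          N.cells.Cmp_Idn_right[OF twist_iso_cells2[OF f']] f'
        by (simp add: fun1_cell N.cells.Idn_Ar N.cells.Cod_Idn twist_iso_cell)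
      also have "\<dots> = psym F \<sigma> f" using f \<sigma> by (simp add: twist_iso_def)
      finally show ?thesis .
    qed (simp add: psym_ext to_ps_ext(4))
  qed
qed simp

end

text \<open>On 1-cells \<open>(f, \<sigma>)\<close> arises from a cell over the identity permutation
  by acting with \<sigma>, and \<open>F\<close> respects the action. On 2-cells the images under
  \<open>F\<close> close the squares that characterise \<open>twist2\<close>.\<close>

lemma from_ps_to_ps:
  assumes M: "cat_multicategory M" and F: "symmetric_multifunctor (timesE M) N F"
  shows "from_ps M N (to_ps M F) = F"
proof -
  interpret F: symmetric_multifunctor "timesE M" N F by fact
  interpret G: pseudo_symmetric_multifunctor M N "to_ps M F" by (rule pseudo_symmetric_to_ps[OF M F])
  note [simp del] = mprod_simps
  note [simp] = permutes_id G.M.cells.Idn_Ar G.M.cells.Dom_Idn G.M.cells.Cod_Idn G.M.cells.Dom_Ob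
    G.M.cells.Cod_Ob G.M.act1_cell G.M.Dom_tcell2 G.M.Cod_tcell2
  have t1: "twist1 M N (to_ps M F) f \<sigma> = fun1 F (tcell1 M f \<sigma>)"
    if f: "f \<in> cells1 M" and \<sigma>: "\<sigma> permutes {..<arity M f}" for f \<sigma>
  proof -
    have "twist1 M N (to_ps M F) f \<sigma> = fun1 F (act1 (timesE M) (tcell1 M (act1 M f (inv \<sigma>)) id) \<sigma>)"
      using f \<sigma> permutes_inv[OF \<sigma>] by (simp add: twist1_def F.fun1_act1)
    also have "act1 (timesE M) (tcell1 M (act1 M f (inv \<sigma>)) id) \<sigma> = tcell1 M f \<sigma>"
      using f \<sigma> permutes_inv[OF \<sigma>] by (simp add: G.M.act1_tcell1)
    finally show ?thesis .
  qed
  have e: "twist_iso M (to_ps M F) f \<sigma> = fun2 F (tcell2 M (Idn (cells M) f) id \<sigma>)"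
    if f: "f \<in> cells1 M" and \<sigma>: "\<sigma> permutes {..<arity M f}" for f \<sigma>
    using f \<sigma> permutes_inv[OF \<sigma>] by (simp add: twist_iso_def)
  have t2: "fun2 F (tcell2 M \<alpha> \<sigma> \<tau>) = twist2 M N (to_ps M F) \<alpha> \<sigma> \<tau>"
    if \<alpha>: "\<alpha> \<in> cells2 M" and \<sigma>: "\<sigma> permutes {..<length (src2 M \<alpha>)}" and \<tau>: "\<tau> permutes {..<length (src2 M \<alpha>)}"
    for \<alpha> \<sigma> \<tau>
  proof (rule G.twist2_unique[OF \<alpha> \<sigma> \<tau>])
    have \<tau>': "\<tau> permutes {..<arity M (Cod (cells M) \<alpha>)}" using \<tau> \<alpha> by (simp add: G.M.src_Cod)
    show "fun2 F (tcell2 M \<alpha> \<sigma> \<tau>) \<in> cells2 N"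
      "Dom (cells N) (fun2 F (tcell2 M \<alpha> \<sigma> \<tau>)) = twist1 M N (to_ps M F) (Dom (cells M) \<alpha>) \<sigma>"
      using \<alpha> \<sigma> \<tau> by (simp_all add: F.fun2_cell t1)
    \<comment> \<open>Both paths around the square are images of \<open>\<alpha>\<close> over
      \<open>id \<rightarrow> \<tau>\<close>: one composes through \<sigma>, the other through
      \<open>id\<close>.\<close>
    have "Cmp (cells N) (fun2 F (tcell2 M \<alpha> \<sigma> \<tau>)) (twist_iso M (to_ps M F) (Dom (cells M) \<alpha>) \<sigma>) =
        fun2 F (tcell2 M \<alpha> id \<tau>)"
      using \<alpha> \<sigma> \<tau> G.M.cells.Cmp_Idn_right[OF \<alpha>]
      by (simp add: e F.fun2_Cmp[symmetric] G.M.Cmp_tcell2)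
    also have "\<dots> = Cmp (cells N) (twist_iso M (to_ps M F) (Cod (cells M) \<alpha>) \<tau>) (fun2 (to_ps M F) \<alpha>)"
      using \<alpha> \<tau>' G.M.cells.Cmp_Idn_left[OF \<alpha>]
      by (simp add: e F.fun2_Cmp[symmetric] G.M.Cmp_tcell2)
    finally show "Cmp (cells N) (fun2 F (tcell2 M \<alpha> \<sigma> \<tau>)) (twist_iso M (to_ps M F) (Dom (cells M) \<alpha>) \<sigma>) =
        Cmp (cells N) (twist_iso M (to_ps M F) (Cod (cells M) \<alpha>) \<tau>) (fun2 (to_ps M F) \<alpha>)" .
  qed
  show ?thesis
  proof (rule mfun_eqI)
    fix a assume a: "a \<in> objs (timesE M)"
    then show "fob (from_ps M N (to_ps M F)) a = fob F a"
      unfolding from_ps_simps(1)[OF a] by (auto simp: mprod_simps(1))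
  next
    fix f assume f: "f \<in> cells1 (timesE M)"
    show "fun1 (from_ps M N (to_ps M F)) f = fun1 F f"
      unfolding from_ps_simps(2)[OF f] t1[OF G.M.cells1_timesE(1,2)[OF f]]
        G.M.cells1_timesE(3)[OF f, symmetric] ..
  next
    fix f assume f: "f \<in> cells2 (timesE M)"
    show "fun2 (from_ps M N (to_ps M F)) f = fun2 F f"
      unfolding from_ps_simps(3)[OF f] t2[OF G.M.cells2_timesE(1-3)[OF f], symmetric]
        G.M.cells2_timesE(4)[OF f, symmetric] ..
  qed (fact from_ps_simps F.fob_ext F.fun1_ext F.fun2_ext)+
qed

section \<open>Transformations\<close>

lemma pseudo_sym_transD:
  assumes "pseudo_sym_trans M N \<theta>"
  shows "pseudo_symmetric_multifunctor M N (tdom \<theta>)" "pseudo_symmetric_multifunctor M N (tcod \<theta>)"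
    "multinatural M N (tdom \<theta>) (tcod \<theta>) (tcmp \<theta>)"
    "\<And>f \<sigma>. \<lbrakk>f \<in> cells1 M; \<sigma> permutes {..<arity M f}\<rbrakk> \<Longrightarrow>
      gam2 N (Idn (cells N) (tcmp \<theta> (tgt M f))) [psym (tdom \<theta>) \<sigma> f] =
      gam2 N (psym (tcod \<theta>) \<sigma> f)
        (map (\<lambda>a. Idn (cells N) (tcmp \<theta> a)) (permute_list \<sigma> (src M f)))"
  using assms by (auto simp: pseudo_sym_trans_def)

definition to_ps_trans :: "('o, 'f, 'a) mcat \<Rightarrow>
    (('o \<times> unit, 'f \<times> deg_perm, 'a \<times> deg_perm \<times> deg_perm, 'p, 'g, 'b) mfun, 'o \<times> unit, 'g) mtrans \<Rightarrow>
    (('o, 'f, 'a, 'p, 'g, 'b) psmfun, 'o, 'g) mtrans" where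
  "to_ps_trans M \<theta> =
     \<lparr>tdom = to_ps M (tdom \<theta>), tcod = to_ps M (tcod \<theta>), tcmp = (\<lambda>a\<in>objs M. tcmp \<theta> (a, ()))\<rparr>"

definition from_ps_trans :: "('o, 'f, 'a) mcat \<Rightarrow> ('p, 'g, 'b) mcat \<Rightarrow>
    (('o, 'f, 'a, 'p, 'g, 'b) psmfun, 'o, 'g) mtrans \<Rightarrow>
    (('o \<times> unit, 'f \<times> deg_perm, 'a \<times> deg_perm \<times> deg_perm, 'p, 'g, 'b) mfun, 'o \<times> unit, 'g) mtrans" where
  "from_ps_trans M N \<theta> =
     \<lparr>tdom = from_ps M N (tdom \<theta>), tcod = from_ps M N (tcod \<theta>),
      tcmp = (\<lambda>x\<in>objs (timesE M). tcmp \<theta> (fst x))\<rparr>"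

lemma to_ps_trans_simps [simp]:
  "tdom (to_ps_trans M \<theta>) = to_ps M (tdom \<theta>)" "tcod (to_ps_trans M \<theta>) = to_ps M (tcod \<theta>)"
  "a \<in> objs M \<Longrightarrow> tcmp (to_ps_trans M \<theta>) a = tcmp \<theta> (a, ())"
  "tcmp (to_ps_trans M \<theta>) \<in> extensional (objs M)"
  by (simp_all add: to_ps_trans_def)

lemma from_ps_trans_simps:
  "tdom (from_ps_trans M N \<theta>) = from_ps M N (tdom \<theta>)"
  "tcod (from_ps_trans M N \<theta>) = from_ps M N (tcod \<theta>)"
  "x \<in> objs (timesE M) \<Longrightarrow> tcmp (from_ps_trans M N \<theta>) x = tcmp \<theta> (fst x)"
  "tcmp (from_ps_trans M N \<theta>) \<in> extensional (objs (timesE M))"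
  by (simp_all add: from_ps_trans_def del: mprod_simps barratt_eccles_simps)

text \<open>The additional condition is naturality of \<theta> at the 2-cell over
  \<open>id \<rightarrow> \<sigma>\<close> whose first entry is an identity.\<close>

lemma pseudo_sym_to_ps_trans:
  assumes M: "cat_multicategory M" and t: "sym_trans (timesE M) N \<theta>"
  shows "pseudo_sym_trans M N (to_ps_trans M \<theta>)"
proof -
  interpret M: cat_multicategory M by fact
  note t' = sym_transD[OF t]
  interpret F: symmetric_multifunctor "timesE M" N "tdom \<theta>" by (rule t'(1))
  note n = multinaturalD[OF t'(3)]
  note [simp del] = mprod_simps
  note [simp] = mprod_simps(1) permutes_id M.cells.Idn_Ar M.cells.Dom_Idn M.cells.Cod_Idn M.cells.Dom_Ob
    M.act1_cell M.Dom_tcell2 M.tgt_objs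
  let ?t = "tcmp (to_ps_trans M \<theta>)"
  have m: "map ?t as = map (tcmp \<theta>) (map (\<lambda>a. (a, ())) as)"
    "map (\<lambda>a. Idn (cells N) (?t a)) as = map (\<lambda>a. Idn (cells N) (tcmp \<theta> a)) (map (\<lambda>a. (a, ())) as)"
    if "set as \<subseteq> objs M" for as using that by auto
  have s: "set (src M f) \<subseteq> objs M" if "f \<in> cells1 M" for f using M.src_in_objs[OF that] by auto
  have "multinatural M N (to_ps M (tdom \<theta>)) (to_ps M (tcod \<theta>)) ?t"
  proof (rule multinaturalI)
    fix f assume f: "f \<in> cells1 M"
    show "gam1 N (fun1 (to_ps M (tcod \<theta>)) f) (map ?t (src M f)) =
        gam1 N (?t (tgt M f)) [fun1 (to_ps M (tdom \<theta>)) f]"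
      unfolding m[OF s[OF f]] using n(5)[of "tcell1 M f id"] f by simp
  next
    fix \<alpha> assume \<alpha>: "\<alpha> \<in> cells2 M"
    show "gam2 N (fun2 (to_ps M (tcod \<theta>)) \<alpha>) (map (\<lambda>a. Idn (cells N) (?t a)) (src2 M \<alpha>)) =
        gam2 N (Idn (cells N) (?t (tgt2 M \<alpha>))) [fun2 (to_ps M (tdom \<theta>)) \<alpha>]"
      unfolding m[OF s[OF M.cells.Dom_Ob[OF \<alpha>]]] using n(6)[of "tcell2 M \<alpha> id id"] \<alpha> by simp
  qed (simp_all add: n)
  moreover have "gam2 N (Idn (cells N) (?t (tgt M f))) [psym (to_ps M (tdom \<theta>)) \<sigma> f] =
      gam2 N (psym (to_ps M (tcod \<theta>)) \<sigma> f) (map (\<lambda>a. Idn (cells N) (?t a)) (permute_list \<sigma> (src M f)))"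
    if f: "f \<in> cells1 M" and \<sigma>: "\<sigma> permutes {..<arity M f}" for f \<sigma>
  proof -
    have "set (permute_list \<sigma> (src M f)) \<subseteq> objs M" using s[OF f] \<sigma> by simp
    then show ?thesis
      unfolding m[OF \<open>set (permute_list \<sigma> (src M f)) \<subseteq> objs M\<close>]
      using n(6)[of "tcell2 M (Idn (cells M) (act1 M f \<sigma>)) id \<sigma>"] f \<sigma> by simp
  qed
  ultimately show ?thesis
    using pseudo_symmetric_to_ps[OF M t'(1)] pseudo_symmetric_to_ps[OF M t'(2)]
    by (simp add: pseudo_sym_trans_def)
qed

text \<open>Whiskering is functorial: \<gamma> preserves composition, and identities in the inputs
  compose to themselves.\<close>

lemma (in cat_multicategory) gam2_Cmp_Idn_map:
  assumes "composable2 M \<alpha> (map (\<lambda>a. Idn (cells M) (u a)) as)" "\<beta> \<in> cells2 M"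
    "Dom (cells M) \<beta> = Cod (cells M) \<alpha>" "\<And>a. a \<in> set as \<Longrightarrow> u a \<in> cells1 M"
  shows "gam2 M (Cmp (cells M) \<beta> \<alpha>) (map (\<lambda>a. Idn (cells M) (u a)) as) =
    Cmp (cells M) (gam2 M \<beta> (map (\<lambda>a. Idn (cells M) (u a)) as)) (gam2 M \<alpha> (map (\<lambda>a. Idn (cells M) (u a)) as))"
    (is "gam2 M _ ?I = _")
proof -
  have "Cmp (cells M) (Idn (cells M) x) (Idn (cells M) x) = Idn (cells M) x" if "x \<in> cells1 M" for x
    using cells.Cmp_Idn_left[of "Idn (cells M) x"] that by (simp add: cells.Idn_Ar cells.Cod_Idn)
  then have "map2 (Cmp (cells M)) ?I ?I = ?I"
    using assms(4) by (auto intro!: nth_equalityI)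
  moreover have "composable2 M \<beta> ?I"
    using assms by (simp add: composable2_def src_Cod)
  ultimately show ?thesis
    using gam2_Cmp[OF assms(1), of \<beta> ?I] assms(3,4) by (simp add: cells.Dom_Idn cells.Cod_Idn)
qed

lemma (in cat_multicategory) gam2_Idn_Cmp:
  assumes "composable2 M (Idn (cells M) f) [\<alpha>]" "f \<in> cells1 M" "\<beta> \<in> cells2 M"
    "Dom (cells M) \<beta> = Cod (cells M) \<alpha>"
  shows "gam2 M (Idn (cells M) f) [Cmp (cells M) \<beta> \<alpha>] =
    Cmp (cells M) (gam2 M (Idn (cells M) f) [\<beta>]) (gam2 M (Idn (cells M) f) [\<alpha>])"
proof -
  have "composable2 M (Idn (cells M) f) [\<beta>]"
    using assms by (simp add: composable2_def tgt_Cod)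
  then show ?thesis
    using gam2_Cmp[OF assms(1), of "Idn (cells M) f" "[\<beta>]"] assms(2-4)
      cells.Cmp_Idn_left[of "Idn (cells M) f"]
    by (simp add: cells.Idn_Ar cells.Dom_Idn cells.Cod_Idn)
qed

lemma (in cat_multicategory) iso_ar_gam2_Idn:
  assumes c: "composable2 M (Idn (cells M) f) [\<alpha>]" and f: "f \<in> cells1 M" and i: "iso_ar (cells M) \<alpha>"
  shows "iso_ar (cells M) (gam2 M (Idn (cells M) f) [\<alpha>])"
proof -
  obtain \<beta> where \<alpha>: "\<alpha> \<in> cells2 M" and \<beta>: "\<beta> \<in> cells2 M" "Dom (cells M) \<beta> = Cod (cells M) \<alpha>"
      "Cod (cells M) \<beta> = Dom (cells M) \<alpha>"
    and e: "Cmp (cells M) \<beta> \<alpha> = Idn (cells M) (Dom (cells M) \<alpha>)"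
      "Cmp (cells M) \<alpha> \<beta> = Idn (cells M) (Cod (cells M) \<alpha>)"
    using i unfolding iso_ar_def by blast
  have c': "composable2 M (Idn (cells M) f) [\<beta>]"
    using c \<alpha> \<beta> by (simp add: composable2_def tgt_Cod)
  note d = composable2_Dom[OF c] composable2_Cod[OF c]
  show ?thesis
    unfolding iso_ar_def
    using gam2_Idn_Cmp[OF c f \<beta>(1,2)] gam2_Idn_Cmp[OF c' f \<alpha> \<beta>(3)[symmetric]]
      gam2_Idn_single[of f "Dom (cells M) \<alpha>"] gam2_Idn_single[of f "Cod (cells M) \<alpha>"] d f \<beta>
    by (intro conjI bexI[of _ "gam2 M (Idn (cells M) f) [\<beta>]"])
      (simp_all add: gam2_cell[OF c] gam2_cell[OF c'] e cells.Dom_Idn cells.Cod_Idn)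
qed

text \<open>Naturality at \<open>(f, \<sigma>)\<close> follows from naturality at
  \<open>act1 M f (inv \<sigma>)\<close> by equivariance. Naturality at 2-cells follows from that of
  \<theta> at \<open>\<alpha>\<close> and the pseudo symmetric condition, by conjugating with twist
  isomorphisms.\<close>

lemma sym_from_ps_trans:
  assumes t: "pseudo_sym_trans M N \<theta>"
  shows "sym_trans (timesE M) N (from_ps_trans M N \<theta>)"
proof -
  note t' = pseudo_sym_transD[OF t]
  interpret F: pseudo_symmetric_multifunctor M N "tdom \<theta>" by (rule t'(1))
  interpret J: pseudo_symmetric_multifunctor M N "tcod \<theta>" by (rule t'(2))
  interpret T: cat_multicategory "timesE M"
    by (rule cat_multicategory_timesE[OF F.M.cat_multicategory_axioms])
  note n = multinaturalD[OF t'(3)]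
  let ?F = "tdom \<theta>" and ?J = "tcod \<theta>" and ?\<theta> = "tcmp \<theta>" and ?i = "Idn (cells N)"
  let ?t = "tcmp (from_ps_trans M N \<theta>)"
  have nat1: "gam1 N (twist1 M N ?J f \<sigma>) (map ?\<theta> (src M f)) = gam1 N (?\<theta> (tgt M f)) [twist1 M N ?F f \<sigma>]"
    if f: "f \<in> cells1 M" and \<sigma>: "\<sigma> permutes {..<arity M f}" for f \<sigma>
  proof -
    let ?f = "act1 M f (inv \<sigma>)"
    note f' = F.M.act1_cell[OF f permutes_inv[OF \<sigma>]]
    have \<sigma>': "\<sigma> permutes {..<arity M ?f}" using \<sigma> f' by simp
    have s: "src M f = permute_list \<sigma> (src M ?f)" using f' \<sigma> by simp
    have o: "a \<in> objs M" if "a \<in> set (src M ?f)" for a using F.M.src_in_objs[OF f'(1) that] .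
    have cJ: "composable1 N (fun1 ?J ?f) (map ?\<theta> (src M ?f))"
      using o f' n by (auto simp: composable1_def J.fun1_cell)
    have cF: "composable1 N (?\<theta> (tgt M f)) [fun1 ?F ?f]"
      using f f' n F.M.tgt_objs[OF f] by (simp add: composable1_def F.fun1_cell)
    \<comment> \<open>Components are unary, so permuting them as inputs permutes blocks of length
      one and \<open>top_perm\<close> reduces to \<sigma>.\<close>
    have ar: "map (arity N) (map ?\<theta> (src M ?f)) = replicate (arity M f) (Suc 0)"
      using o n(3) f' by (auto intro!: nth_equalityI)
    have "gam1 N (twist1 M N ?J f \<sigma>) (map ?\<theta> (src M f)) =
        gam1 N (act1 N (fun1 ?J ?f) \<sigma>) (permute_list \<sigma> (map ?\<theta> (src M ?f)))"
      unfolding twist1_def s permute_list_map[OF \<sigma>'] ..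
    also have "\<dots> = act1 N (gam1 N (fun1 ?J ?f) (map ?\<theta> (src M ?f))) \<sigma>"
      using F.N.top_equivariance1[OF cJ, of \<sigma>] \<sigma>' unfolding ar top_perm_singletons[OF \<sigma>]
      by (simp add: J.fun1_cell f')
    also have "\<dots> = act1 N (gam1 N (?\<theta> (tgt M f)) [fun1 ?F ?f]) \<sigma>"
      unfolding n(5)[OF f'(1)] f'(3) ..
    also have "\<dots> = gam1 N (?\<theta> (tgt M f)) [twist1 M N ?F f \<sigma>]"
      using F.N.bottom_equivariance1[OF cF, of "[\<sigma>]"] \<sigma> \<sigma>' f' bottom_perm_single[OF \<sigma>']
      by (simp add: F.fun1_cell twist1_def)
    finally show ?thesis .
  qed
  \<comment> \<open>The pseudo symmetric condition at \<open>act1 M f (inv \<sigma>)\<close>; its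
    permuted source list is the source list of \<open>f\<close>.\<close>
  have eq_iso: "gam2 N (?i (?\<theta> (tgt M f))) [twist_iso M ?F f \<sigma>] =
      gam2 N (twist_iso M ?J f \<sigma>) (map (\<lambda>a. ?i (?\<theta> a)) (src M f))"
    if f: "f \<in> cells1 M" and \<sigma>: "\<sigma> permutes {..<arity M f}" for f \<sigma>
    using t'(4)[of "act1 M f (inv \<sigma>)" \<sigma>] F.M.act1_cell[OF f permutes_inv[OF \<sigma>]] \<sigma>
    by (simp add: twist_iso_def)
  have nat2: "gam2 N (twist2 M N ?J \<alpha> \<sigma> \<tau>) (map (\<lambda>a. ?i (?\<theta> a)) (src2 M \<alpha>)) =
      gam2 N (?i (?\<theta> (tgt2 M \<alpha>))) [twist2 M N ?F \<alpha> \<sigma> \<tau>]" (is "?x = ?y")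
    if \<alpha>: "\<alpha> \<in> cells2 M" and \<sigma>: "\<sigma> permutes {..<length (src2 M \<alpha>)}" and \<tau>: "\<tau> permutes {..<length (src2 M \<alpha>)}"
    for \<alpha> \<sigma> \<tau>
  proof -
    let ?f = "Dom (cells M) \<alpha>" and ?g = "Cod (cells M) \<alpha>"
    have f: "?f \<in> cells1 M" "?g \<in> cells1 M" "src M ?g = src M ?f" "tgt M ?g = tgt M ?f"
      using \<alpha> by (simp_all add: F.M.cells.Dom_Ob F.M.cells.Cod_Ob F.M.src_Cod F.M.tgt_Cod)
    have \<tau>': "\<tau> permutes {..<arity M ?g}" using \<tau> f by simp
    have o: "a \<in> objs M" if "a \<in> set (src M ?f)" for a using F.M.src_in_objs[OF f(1) that] .
    have b: "tgt M ?f \<in> objs M" by (rule F.M.tgt_objs[OF f(1)])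
    note F = F.twist2_cell[OF \<alpha> \<sigma> \<tau>] F.twist_iso_cell[OF f(1) \<sigma>] F.twist_iso_cell[OF f(2) \<tau>']
      F.twist1_cell[OF f(1) \<sigma>] F.twist1_cell[OF f(2) \<tau>'] F.fun2_cell(1-3)[OF \<alpha>] F.fun1_cell[OF f(1)] F.fun1_cell[OF f(2)]
    note J = J.twist2_cell[OF \<alpha> \<sigma> \<tau>] J.twist_iso_cell[OF f(1) \<sigma>] J.twist_iso_cell[OF f(2) \<tau>']
      J.twist1_cell[OF f(1) \<sigma>] J.twist1_cell[OF f(2) \<tau>'] J.fun2_cell(1-3)[OF \<alpha>] J.fun1_cell[OF f(1)] J.fun1_cell[OF f(2)]
    let ?I = "map (\<lambda>a. ?i (?\<theta> a)) (src M ?f)" and ?b = "?\<theta> (tgt M ?f)"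
    let ?eF = "twist_iso M ?F ?f \<sigma>" and ?eJ = "twist_iso M ?J ?f \<sigma>"
    let ?eF' = "twist_iso M ?F ?g \<tau>" and ?eJ' = "twist_iso M ?J ?g \<tau>"
    have th: "?\<theta> a \<in> cells1 N" if "a \<in> set (src M ?f)" for a using n(2) o that by blast
    have cI: "composable2 N x ?I" if "x \<in> cells2 N" "src2 N x = map (fob ?J) (src M ?f)" for x
      by (rule F.N.composable2_Idn_map[OF that(1) th]) (use that(2) o n(4) in auto)
    have cb: "composable2 N (?i ?b) [x]" if "x \<in> cells2 N" "tgt2 N x = fob ?F (tgt M ?f)" for x
      using that n(2,3)[OF b] by (simp add: F.N.composable2_singleton F.N.cells.Idn_Ar F.N.cells.Dom_Idn)
    show "?x = ?y"
    \<comment> \<open>Whiskering keeps the twist isomorphism invertible, so it can be cancelled. By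
      \<open>eq_iso\<close> the whiskered isomorphisms of the two functors coincide, and the squares
      of both \<open>twist2\<close> cells reduce the claim to naturality of \<theta> at
      \<open>\<alpha>\<close>.\<close>
    proof (rule F.N.cells.iso_ar_cancel_right)
      show "iso_ar (cells N) (gam2 N (?i ?b) [?eF])"
        by (rule F.N.iso_ar_gam2_Idn[OF cb n(2)[OF b] F.iso_ar_twist_iso[OF f(1) \<sigma>]]) (simp_all add: F)
      note cx = cI[of "twist2 M N ?J \<alpha> \<sigma> \<tau>"] cI[of ?eJ] cI[of "fun2 ?J \<alpha>"]
      note cy = cb[of "twist2 M N ?F \<alpha> \<sigma> \<tau>"] cb[of ?eF] cb[of "fun2 ?F \<alpha>"]
      show "?x \<in> cells2 N" "?y \<in> cells2 N"
        using cx(1) cy(1) by (simp_all add: F J F.N.gam2_cells2)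
      have "Cod (cells N) (gam2 N (?i ?b) [?eF]) = gam1 N ?b [twist1 M N ?F ?f \<sigma>]"
        using cy(2) n(2)[OF b] by (simp add: F F.N.Cod_gam2 F.N.cells.Cod_Idn)
      moreover have "Dom (cells N) ?x = gam1 N (twist1 M N ?J ?f \<sigma>) (map ?\<theta> (src M ?f))"
        using cx(1) th by (simp add: J F.N.Dom_gam2 F.N.cells.Dom_Idn o_def cong: map_cong)
      moreover have "Dom (cells N) ?y = gam1 N ?b [twist1 M N ?F ?f \<sigma>]"
        using cy(1) n(2)[OF b] by (simp add: F F.N.Dom_gam2 F.N.cells.Dom_Idn)
      ultimately show "Dom (cells N) ?x = Cod (cells N) (gam2 N (?i ?b) [?eF])"
        "Dom (cells N) ?y = Cod (cells N) (gam2 N (?i ?b) [?eF])"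
        using nat1[OF f(1) \<sigma>] by simp_all
      have "Cmp (cells N) ?x (gam2 N (?i ?b) [?eF]) = Cmp (cells N) ?x (gam2 N ?eJ ?I)"
        unfolding eq_iso[OF f(1) \<sigma>] ..
      also have "\<dots> = gam2 N (Cmp (cells N) (twist2 M N ?J \<alpha> \<sigma> \<tau>) ?eJ) ?I"
        by (rule F.N.gam2_Cmp_Idn_map[symmetric, OF cx(2) _ _ th]) (simp_all add: J)
      also have "\<dots> = gam2 N (Cmp (cells N) ?eJ' (fun2 ?J \<alpha>)) ?I"
        unfolding J(4) ..
      also have "\<dots> = Cmp (cells N) (gam2 N ?eJ' ?I) (gam2 N (fun2 ?J \<alpha>) ?I)"
        by (rule F.N.gam2_Cmp_Idn_map[OF cx(3) _ _ th]) (simp_all add: J)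
      also have "gam2 N ?eJ' ?I = gam2 N (?i ?b) [?eF']"
        using eq_iso[OF f(2) \<tau>'] unfolding f(3,4) ..
      also have "gam2 N (fun2 ?J \<alpha>) ?I = gam2 N (?i ?b) [fun2 ?F \<alpha>]"
        by (rule n(6)[OF \<alpha>])
      also have "Cmp (cells N) (gam2 N (?i ?b) [?eF']) (gam2 N (?i ?b) [fun2 ?F \<alpha>]) =
          gam2 N (?i ?b) [Cmp (cells N) ?eF' (fun2 ?F \<alpha>)]"
        by (rule F.N.gam2_Idn_Cmp[symmetric, OF cy(3) n(2)[OF b]]) (simp_all add: F)
      also have "\<dots> = gam2 N (?i ?b) [Cmp (cells N) (twist2 M N ?F \<alpha> \<sigma> \<tau>) ?eF]"
        unfolding F(4) ..
      also have "\<dots> = Cmp (cells N) ?y (gam2 N (?i ?b) [?eF])"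
        by (rule F.N.gam2_Idn_Cmp[OF cy(2) n(2)[OF b]]) (simp_all add: F)
      finally show "Cmp (cells N) ?x (gam2 N (?i ?b) [?eF]) = Cmp (cells N) ?y (gam2 N (?i ?b) [?eF])" .
    qed
  qed
  have "multinatural (timesE M) N (from_ps M N ?F) (from_ps M N ?J) ?t"
  proof (rule multinaturalI)
    show "?t \<in> extensional (objs (timesE M))" by (rule from_ps_trans_simps)
  next
    fix a assume a: "a \<in> objs (timesE M)"
    then have "fst a \<in> objs M" by auto
    then show "?t a \<in> cells1 N \<and> src N (?t a) = [fob (from_ps M N ?F) a] \<and> tgt N (?t a) = fob (from_ps M N ?J) a"
      unfolding from_ps_simps(1)[OF a] from_ps_trans_simps(3)[OF a] using n by simp
  next
    fix f assume f: "f \<in> cells1 (timesE M)"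
    note f' = F.M.cells1_timesE[OF f]
    have "src (timesE M) f = map (\<lambda>a. (a, ())) (src M (fst f))" using f by (simp add: zip_units)
    moreover have "map ?t (map (\<lambda>a. (a, ())) (src M (fst f))) = map ?\<theta> (src M (fst f))"
      using F.M.src_in_objs[OF f'(1)] by (simp add: from_ps_trans_simps(3))
    ultimately have m: "map ?t (src (timesE M) f) = map ?\<theta> (src M (fst f))" by simp
    show "gam1 N (fun1 (from_ps M N ?J) f) (map ?t (src (timesE M) f)) =
        gam1 N (?t (tgt (timesE M) f)) [fun1 (from_ps M N ?F) f]"
      unfolding from_ps_simps(2)[OF f] from_ps_trans_simps(3)[OF T.tgt_objs[OF f]] m
      using nat1[OF f'(1,2)] by simp
  next
    fix \<alpha> assume \<alpha>: "\<alpha> \<in> cells2 (timesE M)"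
    note a = F.M.cells2_timesE[OF \<alpha>]
    note d = T.cells.Dom_Ob[OF \<alpha>]
    have "src2 (timesE M) \<alpha> = map (\<lambda>a. (a, ())) (src2 M (fst \<alpha>))" using \<alpha> by (simp add: zip_units)
    moreover have "map (\<lambda>a. ?i (?t a)) (map (\<lambda>a. (a, ())) (src2 M (fst \<alpha>))) = map (\<lambda>a. ?i (?\<theta> a)) (src2 M (fst \<alpha>))"
      using F.M.src_in_objs[OF F.M.cells.Dom_Ob[OF a(1)]] by (simp add: from_ps_trans_simps(3))
    ultimately have m: "map (\<lambda>a. ?i (?t a)) (src2 (timesE M) \<alpha>) = map (\<lambda>a. ?i (?\<theta> a)) (src2 M (fst \<alpha>))" by simp
    show "gam2 N (fun2 (from_ps M N ?J) \<alpha>) (map (\<lambda>a. ?i (?t a)) (src2 (timesE M) \<alpha>)) =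
        gam2 N (?i (?t (tgt2 (timesE M) \<alpha>))) [fun2 (from_ps M N ?F) \<alpha>]"
      unfolding from_ps_simps(3)[OF \<alpha>] from_ps_trans_simps(3)[OF T.tgt_objs[OF d]] m
      using nat2[OF a(1-3)] by simp
  qed
  then show ?thesis
    using F.symmetric_from_ps J.symmetric_from_ps by (simp add: sym_trans_def from_ps_trans_simps(1,2))
qed

section \<open>Transport of structure and the isomorphism\<close>

text \<open>Every category axiom of \<open>D\<close> is the image of one of \<open>C\<close> under
  the bijections. As \<open>iso_functor\<close> contains the statement that its target is a
  category, the hom categories of pseudo symmetric multifunctors are obtained without a direct
  verification.\<close>

lemma iso_functor_transport:
  assumes C: "category C"
    and P1: "bij_betw P1 (Ob C) (Ob D)" and P2: "bij_betw P2 (Ar C) (Ar D)"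
    and Dom: "\<And>f. f \<in> Ar C \<Longrightarrow> Dom D (P2 f) = P1 (Dom C f)"
    and Cod: "\<And>f. f \<in> Ar C \<Longrightarrow> Cod D (P2 f) = P1 (Cod C f)"
    and Idn: "\<And>x. x \<in> Ob C \<Longrightarrow> Idn D (P1 x) = P2 (Idn C x)"
    and Cmp: "\<And>f g. \<lbrakk>f \<in> Ar C; g \<in> Ar C; Dom C g = Cod C f\<rbrakk> \<Longrightarrow> Cmp D (P2 g) (P2 f) = P2 (Cmp C g f)"
  shows "iso_functor C D P1 P2"
proof -
  interpret C: category C by fact
  have Ob: "Ob D = P1 ` Ob C" and Ar: "Ar D = P2 ` Ar C"
    using P1 P2 by (auto simp: bij_betw_def)
  have eq: "P1 x = P1 y \<longleftrightarrow> x = y" if "x \<in> Ob C" "y \<in> Ob C" for x y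
    using P1 that by (auto simp: bij_betw_def inj_on_def)
  note simps = Ob Ar Dom Cod Idn Cmp eq C.Dom_Ob C.Cod_Ob C.Idn_Ar C.Dom_Idn C.Cod_Idn C.Cmp_Ar
    C.Dom_Cmp C.Cod_Cmp C.Cmp_Idn_left C.Cmp_Idn_right C.Cmp_assoc
  have "category D" by unfold_locales (auto simp: simps)
  then show ?thesis
    using P1 P2 C by (intro iso_functor.intro cat_functor.intro cat_functor_axioms.intro
        iso_functor_axioms.intro) (auto simp: simps)
qed

text \<open>The same principle one level up: every 1-cell and 2-cell of \<open>D\<close> is an
  image, so functoriality of composition, associativity and units carry over from
  \<open>C\<close>.\<close>

lemma iso_two_functor_transport:
  assumes C: "two_category C" and Ob0: "Ob0 D = Ob0 C"
    and iso: "\<And>A B. \<lbrakk>A \<in> Ob0 C; B \<in> Ob0 C\<rbrakk> \<Longrightarrow>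
      iso_functor (HomC C A B) (HomC D A B) (P1 A B) (P2 A B)"
    and Id1: "\<And>A. A \<in> Ob0 C \<Longrightarrow> Id1 D A = P1 A A (Id1 C A)"
    and Comp1: "\<And>A B E f g. \<lbrakk>A \<in> Ob0 C; B \<in> Ob0 C; E \<in> Ob0 C;
        f \<in> Ob (HomC C A B); g \<in> Ob (HomC C B E)\<rbrakk> \<Longrightarrow>
      Comp1 D A B E (P1 B E g) (P1 A B f) = P1 A E (Comp1 C A B E g f)"
    and Comp2: "\<And>A B E \<alpha> \<beta>. \<lbrakk>A \<in> Ob0 C; B \<in> Ob0 C; E \<in> Ob0 C;
        \<alpha> \<in> Ar (HomC C A B); \<beta> \<in> Ar (HomC C B E)\<rbrakk> \<Longrightarrow>
      Comp2 D A B E (P2 B E \<beta>) (P2 A B \<alpha>) = P2 A E (Comp2 C A B E \<beta> \<alpha>)"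
  shows "iso_two_functor C D id P1 P2"
proof -
  interpret C: two_category C by fact
  have Ob: "Ob (HomC D A B) = P1 A B ` Ob (HomC C A B)"
    and Ar: "Ar (HomC D A B) = P2 A B ` Ar (HomC C A B)"
    if "A \<in> Ob0 C" "B \<in> Ob0 C" for A B
    using iso_functor.bij_Fo[OF iso[OF that]] iso_functor.bij_Fa[OF iso[OF that]]
    by (auto simp: bij_betw_def)
  have F: "cat_functor (HomC C A B) (HomC D A B) (P1 A B) (P2 A B)" "category (HomC D A B)"
    if "A \<in> Ob0 C" "B \<in> Ob0 C" for A B
    using iso[OF that] by (auto simp: iso_functor_def cat_functor_def)
  have inj: "P1 A B x = P1 A B y \<longleftrightarrow> x = y"
    if "A \<in> Ob0 C" "B \<in> Ob0 C" "x \<in> Ob (HomC C A B)" "y \<in> Ob (HomC C A B)" for A B x y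
    using iso_functor.bij_Fo[OF iso[OF that(1,2)]] that(3,4) by (auto simp: bij_betw_def inj_on_def)
  have c1: "Comp1 C A B E g f \<in> Ob (HomC C A E)"
    if "A \<in> Ob0 C" "B \<in> Ob0 C" "E \<in> Ob0 C" "f \<in> Ob (HomC C A B)" "g \<in> Ob (HomC C B E)" for A B E f g
    using cat_functor.Fo_Ob[OF C.comp_functor[OF that(1-3)], of "(g, f)"] that(4,5) by simp
  have c2: "Comp2 C A B E \<beta> \<alpha> \<in> Ar (HomC C A E) \<and>
      Dom (HomC C A E) (Comp2 C A B E \<beta> \<alpha>) = Comp1 C A B E (Dom (HomC C B E) \<beta>) (Dom (HomC C A B) \<alpha>) \<and>
      Cod (HomC C A E) (Comp2 C A B E \<beta> \<alpha>) = Comp1 C A B E (Cod (HomC C B E) \<beta>) (Cod (HomC C A B) \<alpha>)"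
    if "A \<in> Ob0 C" "B \<in> Ob0 C" "E \<in> Ob0 C" "\<alpha> \<in> Ar (HomC C A B)" "\<beta> \<in> Ar (HomC C B E)" for A B E \<alpha> \<beta>
    using cat_functor.Fa_Ar[OF C.comp_functor[OF that(1-3)], of "(\<beta>, \<alpha>)"]
      cat_functor.Dom_Fa[OF C.comp_functor[OF that(1-3)], of "(\<beta>, \<alpha>)"]
      cat_functor.Cod_Fa[OF C.comp_functor[OF that(1-3)], of "(\<beta>, \<alpha>)"] that(4,5) by simp
  note DCI = cat_functor.Dom_Fa[OF F(1)] cat_functor.Cod_Fa[OF F(1)] cat_functor.Fa_Idn[OF F(1), symmetric]
    cat_functor.Fa_Cmp[OF F(1), symmetric] category.Dom_Ob[OF C.hom_category] category.Cod_Ob[OF C.hom_category]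
    category.Idn_Ar[OF C.hom_category] category.Cmp_Ar[OF C.hom_category]
  have D: "two_category D"
  proof (rule two_category.intro, unfold Ob0)
    fix A B E assume A: "A \<in> Ob0 C" and B: "B \<in> Ob0 C" and E: "E \<in> Ob0 C"
    note o = A B E
    show "cat_functor (prod_cat (HomC D B E) (HomC D A B)) (HomC D A E)
        (\<lambda>(g, f). Comp1 D A B E g f) (\<lambda>(\<beta>, \<alpha>). Comp2 D A B E \<beta> \<alpha>)"
    proof (intro cat_functor.intro cat_functor_axioms.intro category_prod_cat F(2) o)
      fix x assume "x \<in> Ob (prod_cat (HomC D B E) (HomC D A B))"
      then obtain g f where x: "x = (P1 B E g, P1 A B f)" and f: "f \<in> Ob (HomC C A B)"
        and g: "g \<in> Ob (HomC C B E)" using o by (auto simp: Ob)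
      show "(case x of (g, f) \<Rightarrow> Comp1 D A B E g f) \<in> Ob (HomC D A E)"
        using f g o c1 by (simp add: x Comp1 Ob)
      show "(case Idn (prod_cat (HomC D B E) (HomC D A B)) x of (\<beta>, \<alpha>) \<Rightarrow> Comp2 D A B E \<beta> \<alpha>) =
          Idn (HomC D A E) (case x of (g, f) \<Rightarrow> Comp1 D A B E g f)"
        using f g o c1 cat_functor.Fa_Idn[OF C.comp_functor[OF o], of "(g, f)"]
        by (simp add: x Comp1 Comp2 DCI)
    next
      fix x assume "x \<in> Ar (prod_cat (HomC D B E) (HomC D A B))"
      then obtain g f where x: "x = (P2 B E g, P2 A B f)" and f: "f \<in> Ar (HomC C A B)"
        and g: "g \<in> Ar (HomC C B E)" using o by (auto simp: Ar)
      show "(case x of (g, f) \<Rightarrow> Comp2 D A B E g f) \<in> Ar (HomC D A E)"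
        using f g o c2 by (simp add: x Comp2 Ar)
      show "Dom (HomC D A E) (case x of (g, f) \<Rightarrow> Comp2 D A B E g f) =
          (case Dom (prod_cat (HomC D B E) (HomC D A B)) x of (g, f) \<Rightarrow> Comp1 D A B E g f)"
        using f g o c2 by (simp add: x Comp1 Comp2 DCI)
      show "Cod (HomC D A E) (case x of (g, f) \<Rightarrow> Comp2 D A B E g f) =
          (case Cod (prod_cat (HomC D B E) (HomC D A B)) x of (g, f) \<Rightarrow> Comp1 D A B E g f)"
        using f g o c2 by (simp add: x Comp1 Comp2 DCI)
      fix y assume "y \<in> Ar (prod_cat (HomC D B E) (HomC D A B))"
        and d: "Dom (prod_cat (HomC D B E) (HomC D A B)) y = Cod (prod_cat (HomC D B E) (HomC D A B)) x"
      then obtain g' f' where y: "y = (P2 B E g', P2 A B f')" and f': "f' \<in> Ar (HomC C A B)"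
        and g': "g' \<in> Ar (HomC C B E)" using o by (auto simp: Ar)
      have d': "Dom (HomC C B E) g' = Cod (HomC C B E) g" "Dom (HomC C A B) f' = Cod (HomC C A B) f"
        using d f g f' g' o by (simp_all add: x y DCI inj)
      show "(case Cmp (prod_cat (HomC D B E) (HomC D A B)) y x of (\<beta>, \<alpha>) \<Rightarrow> Comp2 D A B E \<beta> \<alpha>) =
          Cmp (HomC D A E) (case y of (\<beta>, \<alpha>) \<Rightarrow> Comp2 D A B E \<beta> \<alpha>) (case x of (\<beta>, \<alpha>) \<Rightarrow> Comp2 D A B E \<beta> \<alpha>)"
        using f g f' g' d' o c2 cat_functor.Fa_Cmp[OF C.comp_functor[OF o], of "(g, f)" "(g', f')"]
        by (simp add: x y Comp2 DCI)
    qed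
  next
    fix A B E H f g h assume o: "A \<in> Ob0 C" "B \<in> Ob0 C" "E \<in> Ob0 C" "H \<in> Ob0 C"
      and "f \<in> Ob (HomC D A B)" "g \<in> Ob (HomC D B E)" "h \<in> Ob (HomC D E H)"
    then show "Comp1 D A E H h (Comp1 D A B E g f) = Comp1 D A B H (Comp1 D B E H h g) f"
      by (auto simp: Ob Comp1 c1 C.Comp1_assoc)
  next
    fix A B E H f g h assume o: "A \<in> Ob0 C" "B \<in> Ob0 C" "E \<in> Ob0 C" "H \<in> Ob0 C"
      and "f \<in> Ar (HomC D A B)" "g \<in> Ar (HomC D B E)" "h \<in> Ar (HomC D E H)"
    then show "Comp2 D A E H h (Comp2 D A B E g f) = Comp2 D A B H (Comp2 D B E H h g) f"
      by (auto simp: Ar Comp2 c2 C.Comp2_assoc)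
  qed (auto simp: F Ob Ar Id1 Comp1 Comp2 DCI C.Id1_Ob C.Comp1_Id1_left C.Comp1_Id1_right
      C.Comp2_Id1_left C.Comp2_Id1_right)
  show ?thesis
    by (intro iso_two_functor.intro two_functor.intro two_functor_axioms.intro
        iso_two_functor_axioms.intro C D)
      (auto simp: Ob0 F iso Id1 Comp1 Comp2 bij_betw_def)
qed

section \<open>Compatibility of the bijections with all compositions\<close>

lemma to_ps_trans_from_ps_trans:
  assumes t: "pseudo_sym_trans M N \<theta>"
  shows "to_ps_trans M (from_ps_trans M N \<theta>) = \<theta>"
proof (rule mtrans_eqI)
  note p = pseudo_sym_transD[OF t]
  show "tcmp \<theta> \<in> extensional (objs M)" by (rule multinaturalD(1)[OF p(3)])
  show "tdom (to_ps_trans M (from_ps_trans M N \<theta>)) = tdom \<theta>"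
    "tcod (to_ps_trans M (from_ps_trans M N \<theta>)) = tcod \<theta>"
    using p(1,2) by (simp_all add: from_ps_trans_simps pseudo_symmetric_multifunctor.to_ps_from_ps)
qed (simp_all add: from_ps_trans_simps)

lemma from_ps_trans_to_ps_trans:
  assumes M: "cat_multicategory M" and t: "sym_trans (timesE M) N \<theta>"
  shows "from_ps_trans M N (to_ps_trans M \<theta>) = \<theta>"
proof (rule mtrans_eqI)
  show "tdom (from_ps_trans M N (to_ps_trans M \<theta>)) = tdom \<theta>"
    "tcod (from_ps_trans M N (to_ps_trans M \<theta>)) = tcod \<theta>"
    using sym_transD(1,2)[OF t] by (simp_all add: from_ps_trans_simps from_ps_to_ps[OF M])
  fix a assume "a \<in> objs (timesE M)"
  then show "tcmp (from_ps_trans M N (to_ps_trans M \<theta>)) a = tcmp \<theta> a"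
    by (cases a) (simp add: from_ps_trans_simps)
qed (fact from_ps_trans_simps sym_trans_ext[OF t])+

lemma multicat_ps_hom_simps:
  "Ob (multicat_ps_hom M N) = {F. pseudo_symmetric_multifunctor M N F}"
  "Ar (multicat_ps_hom M N) = {\<theta>. pseudo_sym_trans M N \<theta>}" "Dom (multicat_ps_hom M N) = tdom"
  "Cod (multicat_ps_hom M N) = tcod" "Idn (multicat_ps_hom M N) = trans_id M N"
  "Cmp (multicat_ps_hom M N) = trans_vcomp M N"
  by (simp_all add: multicat_ps_hom_def)

lemma to_ps_iso_functor:
  assumes M: "cat_multicategory M" and N: "cat_multicategory N"
  shows "iso_functor (multicat_hom (timesE M) N) (multicat_ps_hom M N) (to_ps M) (to_ps_trans M)"
proof (rule iso_functor_transport[OF category_multicat_hom[OF N]])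
  show "bij_betw (to_ps M) (Ob (multicat_hom (timesE M) N)) (Ob (multicat_ps_hom M N))"
    by (rule bij_betw_byWitness[where f' = "from_ps M N"])
      (auto simp: multicat_hom_simps multicat_ps_hom_simps from_ps_to_ps[OF M]
        pseudo_symmetric_to_ps[OF M] pseudo_symmetric_multifunctor.to_ps_from_ps
        pseudo_symmetric_multifunctor.symmetric_from_ps)
  show "bij_betw (to_ps_trans M) (Ar (multicat_hom (timesE M) N)) (Ar (multicat_ps_hom M N))"
    by (rule bij_betw_byWitness[where f' = "from_ps_trans M N"])
      (auto simp: multicat_hom_simps multicat_ps_hom_simps from_ps_trans_to_ps_trans[OF M]
        to_ps_trans_from_ps_trans pseudo_sym_to_ps_trans[OF M] sym_from_ps_trans)
  show "Idn (multicat_ps_hom M N) (to_ps M F) = to_ps_trans M (Idn (multicat_hom (timesE M) N) F)" for F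
    unfolding multicat_ps_hom_simps multicat_hom_simps
    by (rule mtrans_eqI[where A = "objs M"]) simp_all
  show "Cmp (multicat_ps_hom M N) (to_ps_trans M \<zeta>) (to_ps_trans M \<theta>) =
      to_ps_trans M (Cmp (multicat_hom (timesE M) N) \<zeta> \<theta>)" for \<zeta> \<theta>
    unfolding multicat_ps_hom_simps multicat_hom_simps
    by (rule mtrans_eqI[where A = "objs M"]) simp_all
qed (simp_all add: multicat_hom_simps multicat_ps_hom_simps)

lemma psmfun_eqI:
  fixes F G :: "('o, 'f, 'a, 'p, 'g, 'b) psmfun"
  assumes "fob F \<in> extensional A" "fob G \<in> extensional A" "fun1 F \<in> extensional B"
    "fun1 G \<in> extensional B" "fun2 F \<in> extensional E" "fun2 G \<in> extensional E"
    and "\<And>a. a \<in> A \<Longrightarrow> fob F a = fob G a" "\<And>f. f \<in> B \<Longrightarrow> fun1 F f = fun1 G f"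
    and "\<And>\<alpha>. \<alpha> \<in> E \<Longrightarrow> fun2 F \<alpha> = fun2 G \<alpha>" "\<And>\<sigma> f. psym F \<sigma> f = psym G \<sigma> f"
  shows "F = G"
proof (intro psmfun.equality)
  show "psym F = psym G" by (intro ext) (rule assms(10))
qed (use assms in \<open>auto intro: extensionalityI\<close>)

text \<open>The projection sends the 2-cell over \<open>id \<rightarrow> \<sigma>\<close> to its
  first entry, an identity; these identities are the pseudo symmetry of the identity
  multifunctor.\<close>

lemma to_ps_d_id:
  assumes "cat_multicategory M"
  shows "psmfun_id M = to_ps M (d_id M)"
proof -
  interpret cat_multicategory M by fact
  note [simp del] = mprod_simps
  show ?thesis
  proof (rule psmfun_eqI[where A = "objs M" and B = "cells1 M" and E = "cells2 M"])
    have "fst (tcell2 M \<alpha> \<sigma> \<tau>) = \<alpha>" for \<alpha> \<sigma> \<tau> by (simp add: tcell2_def)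
    then show "psym (psmfun_id M) \<sigma> f = psym (to_ps M (d_id M)) \<sigma> f" for \<sigma> f
      by (cases "f \<in> cells1 M \<and> \<sigma> permutes {..<arity M f}")
        (auto simp: psmfun_id_def to_ps_ext act1_cell cells.Idn_Ar cells.Dom_Idn permutes_id)
    show "fun2 (psmfun_id M) \<alpha> = fun2 (to_ps M (d_id M)) \<alpha>" if "\<alpha> \<in> cells2 M" for \<alpha>
      using that by (simp add: psmfun_id_def permutes_id) (simp add: tcell2_def)
    show "fun1 (psmfun_id M) f = fun1 (to_ps M (d_id M)) f" if "f \<in> cells1 M" for f
      using that by (simp add: psmfun_id_def permutes_id) (simp add: tcell1_def)
    show "fob (psmfun_id M) a = fob (to_ps M (d_id M)) a" if "a \<in> objs M" for a
      using that by (simp add: psmfun_id_def mprod_simps(1))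
  qed (simp_all add: psmfun_id_def to_ps_ext)
qed

text \<open>The diagonal explains the composite pseudo symmetry: in \<open>D\<close>,
  \<open>G\<close> is applied to the image under \<open>F\<close> of the 2-cell over
  \<open>id \<rightarrow> \<sigma>\<close>, placed over \<open>id \<rightarrow> \<sigma>\<close>
  once more. Splitting off the second copy of \<open>id \<rightarrow> \<sigma>\<close> gives the two
  factors in \<open>psmfun_comp\<close>.\<close>

lemma to_ps_d_comp1:
  assumes M: "cat_multicategory M" and F: "symmetric_multifunctor (timesE M) N F"
    and G: "symmetric_multifunctor (timesE N) Q G"
  shows "psmfun_comp M Q (to_ps N G) (to_ps M F) = to_ps M (d_comp1 M N Q G F)"
proof -
  interpret M: cat_multicategory M by fact
  interpret F: symmetric_multifunctor "timesE M" N F by fact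
  interpret G: symmetric_multifunctor "timesE N" Q G by fact
  note [simp del] = mprod_simps
  note [simp] = mprod_simps(1) permutes_id M.cells.Idn_Ar M.cells.Dom_Idn M.cells.Cod_Idn M.cells.Dom_Ob
    M.act1_cell M.Dom_tcell2 M.Cod_tcell2 F.fun1_cell
  \<comment> \<open>The permutation is carried along unchanged, and \<open>F\<close> keeps the arity
    that determines its degree.\<close>
  have l1: "fun1 (lift_mfun M F) (tcell1 M f \<sigma>) = tcell1 N (fun1 F (tcell1 M f \<sigma>)) \<sigma>"
    if "f \<in> cells1 M" "\<sigma> permutes {..<arity M f}" for f \<sigma>
    using that by simp (simp add: tcell1_def[of N] F.fun1_cell, simp add: tcell1_def)
  have l2: "fun2 (lift_mfun M F) (tcell2 M \<alpha> \<sigma> \<tau>) = tcell2 N (fun2 F (tcell2 M \<alpha> \<sigma> \<tau>)) \<sigma> \<tau>"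
    if "\<alpha> \<in> cells2 M" "\<sigma> permutes {..<length (src2 M \<alpha>)}" "\<tau> permutes {..<length (src2 M \<alpha>)}" for \<alpha> \<sigma> \<tau>
    using that by simp (simp add: tcell2_def[of N] F.fun2_cell, simp add: tcell2_def)
  show ?thesis
    unfolding d_comp1_eq
  proof (rule psmfun_eqI[where A = "objs M" and B = "cells1 M" and E = "cells2 M"])
    let ?r = "to_ps M (mfun_comp (timesE M) G (lift_mfun M F))"
    show "fob (psmfun_comp M Q (to_ps N G) (to_ps M F)) a = fob ?r a" if "a \<in> objs M" for a
      using that F.fob_objs[of "(a, ())"] by (simp add: psmfun_comp_def compose_def)
    show "fun1 (psmfun_comp M Q (to_ps N G) (to_ps M F)) f = fun1 ?r f" if "f \<in> cells1 M" for f
      using that by (simp add: psmfun_comp_def compose_def l1 del: lift_mfun_simps)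
    show "fun2 (psmfun_comp M Q (to_ps N G) (to_ps M F)) \<alpha> = fun2 ?r \<alpha>" if "\<alpha> \<in> cells2 M" for \<alpha>
      using that by (simp add: psmfun_comp_def compose_def F.fun2_cell l2 del: lift_mfun_simps)
    fix \<sigma> f
    show "psym (psmfun_comp M Q (to_ps N G) (to_ps M F)) \<sigma> f = psym ?r \<sigma> f"
    proof (cases "f \<in> cells1 M \<and> \<sigma> permutes {..<arity M f}")
      case True
      then have f: "f \<in> cells1 M" and \<sigma>: "\<sigma> permutes {..<arity M f}" by auto
      let ?c = "fun2 F (tcell2 M (Idn (cells M) (act1 M f \<sigma>)) id \<sigma>)" and ?f = "fun1 F (tcell1 M f id)"
      have c: "?c \<in> cells2 N" "Cod (cells N) ?c = act1 N ?f \<sigma>" "src2 N ?c = map (fob F) (map (\<lambda>a. (a, ())) (src M (act1 M f \<sigma>)))"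
        using f \<sigma> by (simp_all add: F.fun2_cell F.fun1_act1[symmetric] M.act1_tcell1)
      have f': "?f \<in> cells1 N" "\<sigma> permutes {..<arity N ?f}" using f \<sigma> by simp_all
      have f'': "act1 N ?f \<sigma> \<in> cells1 N" "\<sigma> permutes {..<arity N (act1 N ?f \<sigma>)}"
        using f' by (simp_all add: F.N.act1_cell)
      have "psym (psmfun_comp M Q (to_ps N G) (to_ps M F)) \<sigma> f =
          Cmp (cells Q) (fun2 G (tcell2 N (Idn (cells N) (act1 N ?f \<sigma>)) id \<sigma>)) (fun2 G (tcell2 N ?c id id))"
        using f \<sigma> f' c(1) by (simp add: psmfun_comp_def)
      \<comment> \<open>The two factors compose in the product: in \<open>N\<close> an identity
        follows \<open>?c\<close>, in E\<Sigma> the arrow \<open>id \<rightarrow> \<sigma>\<close>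
        follows an identity.\<close>
      also have "\<dots> = fun2 G (Cmp (cells (timesE N)) (tcell2 N (Idn (cells N) (act1 N ?f \<sigma>)) id \<sigma>) (tcell2 N ?c id id))"
        using c f'' by (intro G.fun2_Cmp[symmetric])
          (simp_all add: F.N.Dom_tcell2 F.N.Cod_tcell2 F.N.cells.Idn_Ar F.N.cells.Dom_Idn)
      also have "\<dots> = fun2 G (tcell2 N ?c id \<sigma>)"
        using c(1,2) f'' F.N.cells.Cmp_Idn_left[OF c(1)] by (simp add: F.N.Cmp_tcell2 F.N.cells.Idn_Ar F.N.cells.Dom_Idn)
      also have "\<dots> = psym ?r \<sigma> f"
        using f \<sigma> by (simp add: l2 del: lift_mfun_simps)
      finally show ?thesis .
    qed (auto simp: psmfun_comp_def to_ps_ext)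
  qed (simp_all add: psmfun_comp_def compose_def to_ps_ext)
qed

text \<open>On 1-cells at the ends this is \<open>to_ps_d_comp1\<close>; on components both sides
  compose the same two 1-cells.\<close>

lemma to_ps_d_comp2:
  assumes M: "cat_multicategory M" and t: "sym_trans (timesE M) N \<theta>" and z: "sym_trans (timesE N) Q \<zeta>"
  shows "pseudo_sym_hcomp M Q (to_ps_trans N \<zeta>) (to_ps_trans M \<theta>) = to_ps_trans M (d_comp2 M N Q \<zeta> \<theta>)"
proof (rule mtrans_eqI[where A = "objs M"])
  note t' = sym_transD[OF t] and z' = sym_transD[OF z]
  interpret J: symmetric_multifunctor "timesE M" N "tcod \<theta>" by (rule t'(2))
  note d = d_comp2_eq[OF M t, of Q \<zeta>]
  show "tdom (pseudo_sym_hcomp M Q (to_ps_trans N \<zeta>) (to_ps_trans M \<theta>)) = tdom (to_ps_trans M (d_comp2 M N Q \<zeta> \<theta>))"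
    using to_ps_d_comp1[OF M t'(1) z'(1)] by (simp add: pseudo_sym_hcomp_def d d_comp1_eq)
  show "tcod (pseudo_sym_hcomp M Q (to_ps_trans N \<zeta>) (to_ps_trans M \<theta>)) = tcod (to_ps_trans M (d_comp2 M N Q \<zeta> \<theta>))"
    using to_ps_d_comp1[OF M t'(2) z'(2)] by (simp add: pseudo_sym_hcomp_def d d_comp1_eq)
  fix a assume a: "a \<in> objs M"
  then have a': "(a, ()) \<in> objs (timesE M)" by simp
  note c = sym_trans_cell[OF t a']
  \<comment> \<open>A component is unary, so the degree supplied by \<open>tcell1\<close> is that of
    the operad unit used in \<open>lift_trans\<close>.\<close>
  have "tcell1 N (tcmp \<theta> (a, ())) id = (tcmp \<theta> (a, ()), (1, id))"
    using c by (simp add: tcell1_def)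
  then show "tcmp (pseudo_sym_hcomp M Q (to_ps_trans N \<zeta>) (to_ps_trans M \<theta>)) a =
      tcmp (to_ps_trans M (d_comp2 M N Q \<zeta> \<theta>)) a"
    using a c(1) J.fob_objs[OF a']
    unfolding d to_ps_trans_simps(3)[OF a] sym_hcomp_simps(3)[OF a'] lift_trans_simps(2)
      lift_trans_simps(3)[OF a'] lift_mfun_simps(1)[OF a']
    by (simp add: pseudo_sym_hcomp_def hcomp_cmp_def)
qed (simp_all add: pseudo_sym_hcomp_def hcomp_cmp_def)

theorem theorem3p9:
  shows "\<exists>I :: ('o, 'f, 'a) mcat \<Rightarrow> ('o, 'f, 'a) d_mfun.
    two_category (d_two_cat I) \<and>
    isomorphic_two_cats (d_two_cat I)
      (multicat_ps :: (('o, 'f, 'a) mcat, ('o, 'f, 'a, 'o, 'f, 'a) psmfun,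
         (('o, 'f, 'a, 'o, 'f, 'a) psmfun, 'o, 'f) mtrans) two_cat)"
proof (intro exI conjI)
  \<comment> \<open>The projections are the only identities that the composition of \<open>D\<close>
    admits.\<close>
  let ?D = "d_two_cat (d_id :: ('o, 'f, 'a) mcat \<Rightarrow> ('o, 'f, 'a) d_mfun)"
  show "two_category ?D" by (rule two_category_D)
  have "iso_two_functor ?D multicat_ps id (\<lambda>M N. to_ps M) (\<lambda>M N. to_ps_trans M)"
    by (rule iso_two_functor_transport[OF two_category_D])
      (simp_all add: d_two_cat_def multicat_ps_def to_ps_iso_functor to_ps_d_id to_ps_d_comp1
        to_ps_d_comp2 multicat_hom_simps)
  then show "isomorphic_two_cats ?D (multicat_ps :: (('o, 'f, 'a) mcat, _, _) two_cat)"
    unfolding isomorphic_two_cats_def by (intro exI)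
qed

end
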